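(* Let $n\ge2$ and let $\Omega=\Omega_0\setminus\overline\Theta$, where $\Omega_0,\Theta\subset\mathbb R^n$ are two open, bounded, connected sets such that $\Omega_0$ has Lipschitz boundary and $\Theta\Subset\Omega_0$. Then $$\lim_{\beta\to+\infty}\lambda(\beta,\Omega)=\lambda_{DD}(\Omega).$$
   Context: $H^1_{\partial\Theta}(\Omega)$ is the closure in $H^1(\Omega)$ of $\{u|_\Omega : u\in C_0^\infty(\mathbb R^n),\ \operatorname{spt}(u)\cap\partial\Theta=\emptyset\}$. For $\beta>0$, $$\lambda(\beta,\Omega)=\inf_{\psi\in H^1_{\partial\Theta}(\Omega),\ \psi\not\equiv0}\frac{\int_\Omega|\nabla\psi|^2dx+\beta\int_{\partial\Omega_0}\psi^2d\mathcal H^{n-1}}{\int_\Omega\psi^2dx},$$ with boundary values on $\partial\Omega_0$ in the trace sense and $\mathcal H^{n-1}$ the $(n-1)$-dimensional Hausdorff measure. $\lambda_{DD}(\Omega)$ is the first Dirichlet eigenvalue of the Laplacian on $\Omega$: $\lambda_{DD}(\Omega)=\min\left\{\int_\Omega|\nabla\psi|^2dx\,/\int_\Omega\psi^2dx : \psi\in H^1_0(\Omega),\ \psi\not\equiv0\right\}$. *)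

theory Defs
  imports "HOL-Analysis.Analysis"
begin

section \<open>Smooth functions with compact support\<close>

definition spt :: "('a::euclidean_space \<Rightarrow> real) \<Rightarrow> 'a set" where
  "spt u = closure {x. u x \<noteq> 0}"

text \<open>For \<open>m \<ge> 1\<close>, a function on a Euclidean space is \<open>C\<^sup>m\<close> iff it is differentiable and all its
  directional derivatives are \<open>C\<^sup>m\<^sup>-\<^sup>1\<close>.\<close>

primrec C_k :: "nat \<Rightarrow> ('a::euclidean_space \<Rightarrow> real) \<Rightarrow> bool" where
  "C_k 0 f \<longleftrightarrow> continuous_on UNIV f"
| "C_k (Suc m) f \<longleftrightarrow>
     (\<forall>x. f differentiable (at x)) \<and> (\<forall>v. C_k m (\<lambda>x. frechet_derivative f (at x) v))"

definition smooth :: "('a::euclidean_space \<Rightarrow> real) \<Rightarrow> bool" where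
  "smooth f \<longleftrightarrow> (\<forall>m. C_k m f)"

text \<open>\<open>C\<^sub>0\<^sup>\<infinity>(D)\<close>, each function being extended by zero to the whole space.\<close>

definition test_functions :: "'a::euclidean_space set \<Rightarrow> ('a \<Rightarrow> real) set" where
  "test_functions D = {u. smooth u \<and> compact (spt u) \<and> spt u \<subseteq> D}"


section \<open>Sobolev spaces\<close>

text \<open>Elements of \<open>L\<^sup>2\<close> and \<open>H\<^sup>1\<close> are represented by functions on the whole space; only their values
  on the domain matter, and those up to null sets.\<close>

definition square_integrable :: "'b measure \<Rightarrow> ('b \<Rightarrow> 'c::euclidean_space) \<Rightarrow> bool" where
  "square_integrable M f \<longleftrightarrow> f \<in> borel_measurable M \<and> integrable M (\<lambda>x. (norm (f x))\<^sup>2)"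

definition has_weak_gradient ::
    "'a::euclidean_space set \<Rightarrow> ('a \<Rightarrow> real) \<Rightarrow> ('a \<Rightarrow> 'a) \<Rightarrow> bool" where
  "has_weak_gradient D u G \<longleftrightarrow> square_integrable (lebesgue_on D) G \<and>
     (\<forall>\<phi>\<in>test_functions D. \<forall>b\<in>Basis.
        (LINT x|lebesgue_on D. u x * frechet_derivative \<phi> (at x) b)
          = - (LINT x|lebesgue_on D. (G x \<bullet> b) * \<phi> x))"

definition H1 :: "'a::euclidean_space set \<Rightarrow> ('a \<Rightarrow> real) set" where
  "H1 D = {u. square_integrable (lebesgue_on D) u \<and> (\<exists>G. has_weak_gradient D u G)}"

text \<open>The weak gradient of \<open>u \<in> H\<^sup>1(D)\<close> is unique up to a null subset of \<open>D\<close>.\<close>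

definition weak_gradient :: "'a::euclidean_space set \<Rightarrow> ('a \<Rightarrow> real) \<Rightarrow> 'a \<Rightarrow> 'a" where
  "weak_gradient D u = (SOME G. has_weak_gradient D u G)"

definition L2_energy :: "'a::euclidean_space set \<Rightarrow> ('a \<Rightarrow> real) \<Rightarrow> real" where
  "L2_energy D u = (LINT x|lebesgue_on D. (u x)\<^sup>2)"

definition Dirichlet_energy :: "'a::euclidean_space set \<Rightarrow> ('a \<Rightarrow> real) \<Rightarrow> real" where
  "Dirichlet_energy D u = (LINT x|lebesgue_on D. (norm (weak_gradient D u x))\<^sup>2)"

definition H1_norm :: "'a::euclidean_space set \<Rightarrow> ('a \<Rightarrow> real) \<Rightarrow> real" where
  "H1_norm D u = sqrt (L2_energy D u + Dirichlet_energy D u)"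

definition H1_closure :: "'a::euclidean_space set \<Rightarrow> ('a \<Rightarrow> real) set \<Rightarrow> ('a \<Rightarrow> real) set" where
  "H1_closure D S = {u \<in> H1 D. \<forall>\<epsilon>>0. \<exists>v\<in>S. H1_norm D (\<lambda>x. u x - v x) < \<epsilon>}"

definition H1_0 :: "'a::euclidean_space set \<Rightarrow> ('a \<Rightarrow> real) set" where
  "H1_0 D = H1_closure D (test_functions D)"

definition test_functions_off :: "'a::euclidean_space set \<Rightarrow> ('a \<Rightarrow> real) set" where
  "test_functions_off \<Theta> = {u \<in> test_functions UNIV. spt u \<inter> frontier \<Theta> = {}}"

definition H1_vanishing :: "'a::euclidean_space set \<Rightarrow> 'a set \<Rightarrow> ('a \<Rightarrow> real) set" where
  "H1_vanishing \<Theta> D = H1_closure D (test_functions_off \<Theta>)"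

definition nonzero_on :: "'a::euclidean_space set \<Rightarrow> ('a \<Rightarrow> real) \<Rightarrow> bool" where
  "nonzero_on D u \<longleftrightarrow> \<not> (AE x in lebesgue_on D. u x = 0)"


section \<open>Hausdorff measure\<close>

text \<open>Normalised so that in dimension \<open>k\<close> it agrees with \<open>k\<close>-dimensional Lebesgue measure on
  \<open>k\<close>-planes. The covering sets must be bounded because \<^const>\<open>diameter\<close> is meaningless for unbounded
  sets; the case distinction on \<open>C = {}\<close> matters only for \<open>k = 0\<close>.\<close>

definition hausdorff_gauge :: "nat \<Rightarrow> 'a::metric_space set \<Rightarrow> ennreal" where
  "hausdorff_gauge k C =
     (if C = {} then 0 else ennreal (unit_ball_vol (real k) * (diameter C / 2) ^ k))"

definition hausdorff_premeasure :: "nat \<Rightarrow> real \<Rightarrow> 'a::metric_space set \<Rightarrow> ennreal" where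
  "hausdorff_premeasure k \<delta> A =
     (INF C\<in>{C :: nat \<Rightarrow> 'a set. A \<subseteq> (\<Union>i. C i) \<and> (\<forall>i. bounded (C i) \<and> diameter (C i) \<le> \<delta>)}.
        (\<Sum>i. hausdorff_gauge k (C i)))"

definition hausdorff_outer_measure :: "nat \<Rightarrow> 'a::metric_space set \<Rightarrow> ennreal" where
  "hausdorff_outer_measure k A = (SUP \<delta>\<in>{0<..}. hausdorff_premeasure k \<delta> A)"

definition hausdorff_measure :: "nat \<Rightarrow> 'a::metric_space measure" where
  "hausdorff_measure k = measure_of UNIV (sets borel) (hausdorff_outer_measure k)"

definition surface_measure :: "'a::euclidean_space set \<Rightarrow> 'a measure" where
  "surface_measure \<Gamma> = restrict_space (hausdorff_measure (DIM('a) - 1)) \<Gamma>"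


section \<open>Lipschitz boundary\<close>

text \<open>Near each boundary point, after a rotation taking the unit vector \<open>e\<close> to the last coordinate
  direction, the set is the region above the graph of a Lipschitz function of the remaining
  \<open>n - 1\<close> coordinates (the hyperplane orthogonal to \<open>e\<close>).\<close>

definition lipschitz_boundary :: "'a::euclidean_space set \<Rightarrow> bool" where
  "lipschitz_boundary D \<longleftrightarrow>
     (\<forall>x0\<in>frontier D. \<exists>r>0. \<exists>e. norm e = 1 \<and>
        (\<exists>\<gamma> L. L-lipschitz_on {y. y \<bullet> e = 0} \<gamma> \<and>
           D \<inter> ball x0 r = {x \<in> ball x0 r. x \<bullet> e > \<gamma> (x - (x \<bullet> e) *\<^sub>R e)}))"


section \<open>Traces and eigenvalues\<close>

text \<open>The trace on \<open>\<partial>\<Omega>\<^sub>0\<close> of a function in \<open>H\<^sup>1\<^bsub>\<partial>\<Theta>\<^esub>(\<Omega>)\<close>, \<open>\<Omega> = \<Omega>\<^sub>0 - closure \<Theta>\<close>, is the continuous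
  extension to the \<open>H\<^sup>1\<close>-closure, with values in \<open>L\<^sup>2(\<partial>\<Omega>\<^sub>0, H\<^sup>n\<^sup>-\<^sup>1)\<close>, of the restriction map
  \<open>u \<mapsto> u|\<partial>\<Omega>\<^sub>0\<close> on the dense class of smooth functions. By the trace theorem each such function has
  exactly one trace up to null sets when \<open>\<Omega>\<^sub>0\<close> is bounded with Lipschitz boundary.\<close>

definition has_trace ::
    "'a::euclidean_space set \<Rightarrow> 'a set \<Rightarrow> ('a \<Rightarrow> real) \<Rightarrow> ('a \<Rightarrow> real) \<Rightarrow> bool" where
  "has_trace \<Omega>0 \<Theta> \<psi> g \<longleftrightarrow>
     square_integrable (surface_measure (frontier \<Omega>0)) g \<and>
     (\<exists>u :: nat \<Rightarrow> 'a \<Rightarrow> real. (\<forall>k. u k \<in> test_functions_off \<Theta>) \<and>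
        (\<lambda>k. H1_norm (\<Omega>0 - closure \<Theta>) (\<lambda>x. \<psi> x - u k x)) \<longlonglongrightarrow> 0 \<and>
        (\<lambda>k. \<integral>\<^sup>+x. ennreal ((g x - u k x)\<^sup>2) \<partial>surface_measure (frontier \<Omega>0)) \<longlonglongrightarrow> 0)"

text \<open>\<open>\<lambda>(\<beta>, \<Omega>)\<close> for \<open>\<Omega> = \<Omega>\<^sub>0 - closure \<Theta>\<close>.\<close>

definition eigenvalue_RD :: "real \<Rightarrow> 'a::euclidean_space set \<Rightarrow> 'a set \<Rightarrow> real" where
  "eigenvalue_RD \<beta> \<Omega>0 \<Theta> =
     Inf {(Dirichlet_energy (\<Omega>0 - closure \<Theta>) \<psi>
             + \<beta> * (LINT x|surface_measure (frontier \<Omega>0). (g x)\<^sup>2))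
           / L2_energy (\<Omega>0 - closure \<Theta>) \<psi>
         | \<psi> g. \<psi> \<in> H1_vanishing \<Theta> (\<Omega>0 - closure \<Theta>) \<and> nonzero_on (\<Omega>0 - closure \<Theta>) \<psi>
               \<and> has_trace \<Omega>0 \<Theta> \<psi> g}"

text \<open>The minimum of a set of reals; \<^const>\<open>Min\<close> is only for finite sets.\<close>

definition eigenvalue_DD :: "'a::euclidean_space set \<Rightarrow> real" where
  "eigenvalue_DD D =
     (LEAST r. \<exists>\<psi>. \<psi> \<in> H1_0 D \<and> nonzero_on D \<psi> \<and> r = Dirichlet_energy D \<psi> / L2_energy D \<psi>)"

end

theory Submission
  imports Defs "HOL-Complex_Analysis.Great_Picard"
begin

text \<open>Since \<open>\<lambda>(\<beta>, \<Omega>)\<close> increases in \<open>\<beta>\<close> and functions in \<open>H\<^sup>1\<^sub>0(\<Omega>)\<close> have trace zero,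
  \<open>\<lambda>(\<beta>, \<Omega>)\<close> converges to some \<open>\<Lambda> \<le> \<lambda>\<^sub>D\<^sub>D(\<Omega>)\<close>. For the converse take smooth normalised quasi-minimisers \<open>u\<^sub>k\<close>
  for \<open>\<beta> = k\<close>; their boundary values tend to zero in \<open>L\<^sup>2\<close>. Integrating along segments that end on the
  Lipschitz graph bounds \<open>u\<^sup>2\<close> on a layer of width \<open>\<delta>\<close> by
  \<open>C \<delta> \<integral>\<^bsub>\<partial>\<Omega>\<^sub>0\<^esub> u\<^sup>2 + C \<delta>\<^sup>2 \<integral>\<^bsub>layer\<^esub> |\<nabla>u|\<^sup>2\<close>. Hence cutting off near \<open>\<partial>\<Omega>\<^sub>0\<close> changes \<open>u\<^sub>k\<close> little
  in \<open>L\<^sup>2\<close>, and Rellich's theorem for compactly supported functions yields an \<open>L\<^sup>2\<close>-Cauchy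
  subsequence, which by the parallelogram law is Cauchy in \<open>H\<^sup>1\<close>. So the gradients do not
  concentrate at the boundary, the cutoff is also harmless for the Dirichlet energy, and the
  truncated functions lie in \<open>C\<^sub>0\<^sup>\<infinity>(\<Omega>)\<close>, whence \<open>\<lambda>\<^sub>D\<^sub>D(\<Omega>) \<le> \<Lambda>\<close>.\<close>

section \<open>Smooth functions\<close>

text \<open>The boundary values are small only in \<open>L2\<close>, while a cutoff at scale
  \<delta> has a gradient of order 1/\<delta>. With b the \<open>L2\<close> norm of the boundary
  values and G the norm of the gradient on the layer, the layer estimate gives mass of order
  sqrt(\<delta>) b + \<delta> G there in norm, so the cutoff costs b / sqrt(\<delta>) + G in the
  gradient. For fixed \<delta> the first term tends to zero with b, but a mere bound on the energies
  does not make G small uniformly along the sequence; this is why the gradients must converge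
  strongly before the final truncation. The mass estimate with G only bounded is what yields
  compactness in the first place, so the argument is not circular. Surface measure enters through
  one inequality: a set whose points project along a fixed direction onto A over a height at most T
  has Lebesgue measure at most c T times the Hausdorff measure of A, and coverings by small sets
  prove this from the definition. A trace is by definition a limit of smooth boundary values, so
  \<lambda>(\<beta>, \<Omega>) can be approached by smooth functions, for which all estimates are
  classical.\<close>

lemma frechet_derivative_eqI: "(f has_derivative f') (at x) \<Longrightarrow> frechet_derivative f (at x) = f'"
  by (rule frechet_derivative_at[symmetric])

lemma C_k_continuous: "C_k m f \<Longrightarrow> continuous_on UNIV f"
  by (cases m) (auto intro!: differentiable_imp_continuous_on simp: differentiable_on_def
      intro: differentiable_at_withinI)

lemma C_k_SucD: "C_k (Suc m) f \<Longrightarrow> C_k m f"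
proof (induction m arbitrary: f)
  case 0
  then show ?case using C_k_continuous by (simp only: C_k.simps(1)) blast
next
  case (Suc m)
  then show ?case by (metis C_k.simps(2))
qed

lemma C_k_const: "C_k m (\<lambda>_. c)"
  by (induction m arbitrary: c) (auto simp: frechet_derivative_const)

lemma C_k_add:
  assumes "C_k m f" "C_k m g" shows "C_k m (\<lambda>x. f x + g x)"
  using assms
proof (induction m arbitrary: f g)
  case 0
  then show ?case by (auto intro: continuous_on_add)
next
  case (Suc m)
  have "((\<lambda>x. f x + g x) has_derivative
      (\<lambda>v. frechet_derivative f (at x) v + frechet_derivative g (at x) v)) (at x)" for x
    using Suc.prems by (intro has_derivative_add) (auto simp: frechet_derivative_works)
  note d = this
  show ?case using Suc d by (auto simp: differentiable_def frechet_derivative_eqI[OF d])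
qed

lemma frechet_derivative_mult_real:
  fixes f g :: "'a::real_normed_vector \<Rightarrow> real"
  assumes "f differentiable (at x)" "g differentiable (at x)"
  shows "frechet_derivative (\<lambda>x. f x * g x) (at x)
    = (\<lambda>v. f x * frechet_derivative g (at x) v + frechet_derivative f (at x) v * g x)"
  using assms unfolding frechet_derivative_works
  by (intro frechet_derivative_eqI has_derivative_mult)

lemma C_k_mult:
  assumes "C_k m f" "C_k m g" shows "C_k m (\<lambda>x. f x * g x)"
  using assms
proof (induction m arbitrary: f g)
  case 0
  then show ?case by (auto intro: continuous_on_mult)
next
  case (Suc m)
  have "C_k m f" "C_k m g" using Suc.prems by (auto dest!: C_k_SucD simp del: C_k.simps)
  then show ?case using Suc
    by (auto simp: frechet_derivative_mult_real intro!: C_k_add)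
qed

lemma C_k_sum: "(\<And>i. i \<in> I \<Longrightarrow> C_k m (f i)) \<Longrightarrow> C_k m (\<lambda>x. \<Sum>i\<in>I. f i x)"
  by (induction I rule: infinite_finite_induct) (auto simp: C_k_const C_k_add)

lemma C_k_inner: "C_k m (\<lambda>x. x \<bullet> b)"
proof (cases m)
  case (Suc n)
  have "((\<lambda>x. x \<bullet> b) has_derivative (\<lambda>v. v \<bullet> b)) (at x)" for x
    by (auto intro!: derivative_eq_intros)
  note d = this
  show ?thesis using Suc d
    by (auto simp: differentiable_def frechet_derivative_eqI[OF d] C_k_const)
qed (auto intro: continuous_intros)

text \<open>Serves to glue: a function given by different smooth formulas on open sets, such as the
  truncation that is set to zero on the hole, is recognised as smooth. In the induction the local
  representative is replaced by its directional derivative.\<close>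

lemma C_k_local:
  assumes "\<And>x. \<exists>U g. open U \<and> x \<in> U \<and> C_k m g \<and> (\<forall>y\<in>U. f y = g y)"
  shows "C_k m f"
  using assms
proof (induction m arbitrary: f)
  case 0
  have "isCont f x" for x
  proof -
    obtain U g where *: "open U" "x \<in> U" "continuous_on UNIV g" "\<forall>y\<in>U. f y = g y"
      using 0[of x] by auto
    then have "continuous_on U f"
      by (metis continuous_on_cong continuous_on_subset subset_UNIV)
    then show ?thesis using * continuous_on_eq_continuous_at by blast
  qed
  then show ?case by (simp add: continuous_at_imp_continuous_on)
next
  case (Suc m)
  have loc: "\<exists>U g. open U \<and> x \<in> U \<and> C_k (Suc m) g \<and> (\<forall>y\<in>U. (f has_derivative frechet_derivative g (at y)) (at y))" for x
  proof -
    obtain U g where *: "open U" "x \<in> U" "C_k (Suc m) g" "\<forall>y\<in>U. f y = g y"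
      using Suc.prems[of x] by blast
    have "(f has_derivative frechet_derivative g (at y)) (at y)" if "y \<in> U" for y
    proof (rule has_derivative_transform_within_open[OF _ \<open>open U\<close> that])
      show "(g has_derivative frechet_derivative g (at y)) (at y)"
        using *(3) by (simp add: frechet_derivative_works)
    qed (use * in auto)
    with * show ?thesis by blast
  qed
  show ?case
  proof (simp only: C_k.simps, intro conjI allI)
    fix x show "f differentiable at x" using loc[of x] by (auto simp: differentiable_def)
  next
    fix v
    show "C_k m (\<lambda>x. frechet_derivative f (at x) v)"
    proof (rule Suc.IH)
      fix x
      obtain U g where *: "open U" "x \<in> U" "C_k (Suc m) g"
        "\<forall>y\<in>U. (f has_derivative frechet_derivative g (at y)) (at y)"
        using loc[of x] by blast
      then show "\<exists>U g. open U \<and> x \<in> U \<and> C_k m g \<and> (\<forall>y\<in>U. frechet_derivative f (at y) v = g y)"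
        by (intro exI[of _ U] exI[of _ "\<lambda>x. frechet_derivative g (at x) v"])
           (auto simp: frechet_derivative_eqI)
    qed
  qed
qed

text \<open>Induction over \<open>h\<close> with \<open>f\<close> fixed: the chain rule leaves the
  derivative of \<open>h\<close> composed with \<open>f\<close>, to which the hypothesis one order
  below applies, times a derivative of \<open>f\<close>.\<close>

lemma C_k_compose:
  fixes h :: "real \<Rightarrow> real" and f :: "'a::euclidean_space \<Rightarrow> real"
  assumes "C_k m h" "C_k m f"
  shows "C_k m (\<lambda>x. h (f x))"
  using assms
proof (induction m arbitrary: h)
  case 0
  then show ?case by (auto intro: continuous_on_compose2)
next
  case (Suc m)
  have d: "((\<lambda>x. h (f x)) has_derivative
      (\<lambda>v. frechet_derivative h (at (f x)) 1 * frechet_derivative f (at x) v)) (at x)" for x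
  proof -
    have h: "(h has_derivative frechet_derivative h (at (f x))) (at (f x))"
      using Suc.prems by (simp add: frechet_derivative_works)
    have f: "(f has_derivative frechet_derivative f (at x)) (at x)"
      using Suc.prems by (simp add: frechet_derivative_works)
    have lin: "frechet_derivative h (at (f x)) t = frechet_derivative h (at (f x)) 1 * t" for t
      using linear_cmul[OF has_derivative_linear[OF h], of t 1] by simp
    show ?thesis using has_derivative_compose[OF f h] by (subst (asm) lin) simp
  qed
  have "C_k m (\<lambda>x. frechet_derivative h (at (f x)) 1)" 
    using Suc.IH[of "\<lambda>y. frechet_derivative h (at y) 1"] Suc.prems C_k_SucD[of m f] by auto
  then have "C_k m (\<lambda>x. frechet_derivative h (at (f x)) 1 * frechet_derivative f (at x) v)" for v
    using Suc.prems by (intro C_k_mult) auto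
  then show ?case using d by (auto simp: differentiable_def frechet_derivative_eqI[OF d])
qed

lemma smooth_const: "smooth (\<lambda>_. c)" by (simp add: smooth_def C_k_const)
lemma smooth_add: "smooth f \<Longrightarrow> smooth g \<Longrightarrow> smooth (\<lambda>x. f x + g x)" by (simp add: smooth_def C_k_add)
lemma smooth_mult: "smooth f \<Longrightarrow> smooth g \<Longrightarrow> smooth (\<lambda>x. f x * g x)" by (simp add: smooth_def C_k_mult)
lemma smooth_diff: "smooth f \<Longrightarrow> smooth g \<Longrightarrow> smooth (\<lambda>x. f x - g x)"
  using smooth_add[of f "\<lambda>x. -1 * g x"] smooth_mult[OF smooth_const, of g "-1"] by simp
lemma smooth_sum: "(\<And>i. i \<in> I \<Longrightarrow> smooth (f i)) \<Longrightarrow> smooth (\<lambda>x. \<Sum>i\<in>I. f i x)"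
  by (simp add: smooth_def C_k_sum)
lemma smooth_inner: "smooth (\<lambda>x. x \<bullet> b)" by (simp add: smooth_def C_k_inner)
lemma smooth_compose:
  fixes h :: "real \<Rightarrow> real" and f :: "'a::euclidean_space \<Rightarrow> real"
  shows "smooth h \<Longrightarrow> smooth f \<Longrightarrow> smooth (\<lambda>x. h (f x))" by (simp add: smooth_def C_k_compose)
lemma smooth_local:
  assumes "\<And>x. \<exists>U g. open U \<and> x \<in> U \<and> smooth g \<and> (\<forall>y\<in>U. f y = g y)"
  shows "smooth f"
  unfolding smooth_def by (intro allI C_k_local) (use assms smooth_def in metis)
lemma smooth_continuous: "smooth f \<Longrightarrow> continuous_on UNIV f"
  unfolding smooth_def using C_k_continuous by blast
lemma smooth_has_derivative: "smooth f \<Longrightarrow> (f has_derivative frechet_derivative f (at x)) (at x)"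
  unfolding smooth_def by (metis C_k.simps(2) frechet_derivative_works)
lemma smooth_frechet_derivative: "smooth f \<Longrightarrow> smooth (\<lambda>x. frechet_derivative f (at x) v)"
  unfolding smooth_def by (metis C_k.simps(2))

text \<open>The factors \<open>t\<^sup>-\<^sup>j\<close> make the family closed under differentiation.\<close>

definition exp_bump :: "nat \<Rightarrow> real \<Rightarrow> real" where
  "exp_bump j t = (if t \<le> 0 then 0 else inverse t ^ j * exp (- inverse t))"

lemma exp_bump_tendsto: "(exp_bump j \<longlongrightarrow> 0) (at 0)"
proof -
  have r: "(exp_bump j \<longlongrightarrow> 0) (at_right 0)"
  proof -
    have "((\<lambda>t. inverse t ^ j * exp (- inverse t)) \<longlongrightarrow> 0) (at_right (0::real))"
    proof -
      \<comment> \<open>The substitution of \<open>inverse t\<close> moves the limit to infinity,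
        where the exponential beats every power.\<close>
      have "(((\<lambda>x::real. x ^ j / exp x) \<circ> inverse) \<longlongrightarrow> 0) (at_right 0)"
        unfolding comp_def
        by (rule filterlim_compose[OF tendsto_power_div_exp_0 filterlim_inverse_at_top_right])
      then show ?thesis by (simp add: comp_def exp_minus divide_inverse)
    qed
    then show ?thesis
      by (rule Lim_transform_eventually)
         (auto simp: eventually_at_right_field exp_bump_def intro!: exI[of _ 1])
  qed
  moreover have "(exp_bump j \<longlongrightarrow> 0) (at_left 0)"
    by (rule Lim_transform_eventually[OF tendsto_const])
       (auto simp: eventually_at_left_field exp_bump_def intro!: exI[of _ "-1"])
  ultimately show ?thesis by (simp add: filterlim_split_at)
qed

lemma exp_bump_deriv:
  "(exp_bump j has_field_derivative (exp_bump (j+2) t - real j * exp_bump (j+1) t)) (at t)"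
proof -
  consider "t < 0" | "t = 0" | "t > 0" by linarith
  then show ?thesis
  proof cases
    case 1
    have "((\<lambda>_. 0) has_field_derivative 0) (at t)" by simp
    then have "(exp_bump j has_field_derivative 0) (at t)"
      by (rule has_field_derivative_transform_within_open[where S="{..<0}"])
         (use 1 in \<open>auto simp: exp_bump_def\<close>)
    then show ?thesis using 1 by (simp add: exp_bump_def)
  next
    case 2
    \<comment> \<open>For \<open>h\<close> different from 0 the difference quotient at 0 is
      \<open>exp_bump (Suc j) h\<close> itself, so its limit is already known.\<close>
    have "((\<lambda>h. (exp_bump j (0 + h) - exp_bump j 0) / h) \<longlongrightarrow> 0) (at 0)"
      by (rule Lim_transform_eventually[OF exp_bump_tendsto[of "Suc j"]])
         (auto simp: exp_bump_def eventually_at_filter divide_inverse)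
    then show ?thesis using 2 by (simp add: DERIV_def exp_bump_def)
  next
    case 3
    have "((\<lambda>t. inverse t ^ j * exp (- inverse t)) has_field_derivative
      (inverse t ^ (j+2) * exp (- inverse t) - real j * (inverse t ^ (j+1) * exp (- inverse t)))) (at t)"
    proof -
      have i: "(inverse has_field_derivative - (inverse t ^ 2)) (at t)"
        using 3 DERIV_inverse[of t] by (simp add: numeral_2_eq_2)
      have "((\<lambda>t. inverse t ^ j * exp (- inverse t)) has_field_derivative
        (real j * (- (inverse t ^ 2) * inverse t ^ (j - 1))) * exp (- inverse t)
          + exp (- inverse t) * (inverse t ^ 2) * inverse t ^ j) (at t)"
        using DERIV_mult[OF DERIV_power[OF i, of j] DERIV_chain2[OF DERIV_exp DERIV_minus[OF i]]]
        by simp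
      then show ?thesis by (cases j) (simp_all add: algebra_simps power2_eq_square)
    qed
    then have "(exp_bump j has_field_derivative
      (inverse t ^ (j+2) * exp (- inverse t) - real j * (inverse t ^ (j+1) * exp (- inverse t)))) (at t)"
      by (rule has_field_derivative_transform_within_open[where S="{0<..}"])
         (use 3 in \<open>auto simp: exp_bump_def\<close>)
    then show ?thesis using 3 by (simp add: exp_bump_def)
  qed
qed

lemma smooth_exp_bump: "smooth (exp_bump j)"
proof -
  have "C_k m (exp_bump j)" for m
  proof (induction m arbitrary: j)
    case 0
    show ?case unfolding C_k.simps
      by (intro continuous_at_imp_continuous_on ballI DERIV_isCont[OF exp_bump_deriv])
  next
    case (Suc m)
    have d: "(exp_bump j has_derivative (*) (exp_bump (j+2) t - real j * exp_bump (j+1) t)) (at t)" for t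
      using exp_bump_deriv[of j t] by (simp add: has_field_derivative_def)
    have "C_k m (\<lambda>t. (exp_bump (j+2) t + (- real j) * exp_bump (j+1) t) * v)" for v
      by (intro C_k_mult C_k_add C_k_const Suc)
    then show ?case using d by (auto simp: differentiable_def frechet_derivative_eqI[OF d])
  qed
  then show ?thesis by (simp add: smooth_def)
qed

text \<open>The standard mollifier \<open>exp (-1 / (1 - |x|^2))\<close>. Writing it with
  \<open>x \<bullet> x\<close>, a polynomial, makes smoothness at the origin immediate.\<close>

definition unit_bump :: "'a::euclidean_space \<Rightarrow> real" where
  "unit_bump x = exp_bump 0 (1 - x \<bullet> x)"

lemma smooth_unit_bump: "smooth unit_bump"
proof -
  have "smooth (\<lambda>x::'a. 1 - (\<Sum>b\<in>Basis. (x \<bullet> b) * (x \<bullet> b)))"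
    by (intro smooth_diff smooth_const smooth_sum smooth_mult smooth_inner)
  then have "smooth (\<lambda>x::'a. exp_bump 0 (1 - (\<Sum>b\<in>Basis. (x \<bullet> b) * (x \<bullet> b))))"
    by (rule smooth_compose[OF smooth_exp_bump])
  then show ?thesis unfolding unit_bump_def[abs_def] by (simp add: euclidean_inner[symmetric])
qed

text \<open>The lower bound on the half ball keeps the mass of the bump scaled to radius \<delta>
  above a fixed multiple of \<delta>^n; the gradient bound of the cutoffs rests on this.\<close>

lemma unit_bump_nonneg: "unit_bump x \<ge> 0" and unit_bump_eq_0: "norm x \<ge> 1 \<Longrightarrow> unit_bump x = 0"
  and unit_bump_ge: "norm x \<le> 1/2 \<Longrightarrow> unit_bump x \<ge> exp (-2)"
proof -
  show "unit_bump x \<ge> 0" by (simp add: unit_bump_def exp_bump_def)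
  show "unit_bump x = 0" if "norm x \<ge> 1"
    using power_mono[OF that, of 2] by (simp add: unit_bump_def exp_bump_def dot_square_norm)
  assume "norm x \<le> 1/2"
  then have "x \<bullet> x \<le> 1/4" using power_mono[of "norm x" "1/2" 2] by (simp add: dot_square_norm power2_eq_square)
  then show "unit_bump x \<ge> exp (-2)"
    by (simp add: unit_bump_def exp_bump_def field_simps)
qed

section \<open>Gradients and cutoff functions\<close>

definition grad :: "('a::euclidean_space \<Rightarrow> real) \<Rightarrow> 'a \<Rightarrow> 'a" where
  "grad u x = (\<Sum>b\<in>Basis. frechet_derivative u (at x) b *\<^sub>R b)"

lemma grad_inner:
  assumes "u differentiable (at x)"
  shows "frechet_derivative u (at x) v = grad u x \<bullet> v"
proof -
  have l: "linear (frechet_derivative u (at x))"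
    using assms by (simp add: linear_frechet_derivative)
  have "frechet_derivative u (at x) v = frechet_derivative u (at x) (\<Sum>b\<in>Basis. (v \<bullet> b) *\<^sub>R b)"
    by (simp add: euclidean_representation)
  also have "\<dots> = (\<Sum>b\<in>Basis. (v \<bullet> b) * frechet_derivative u (at x) b)"
    using l by (simp add: linear_sum linear_cmul)
  finally show ?thesis by (simp add: grad_def inner_sum_right inner_commute mult.commute)
qed

lemma has_derivative_grad:
  assumes "(u has_derivative f') (at x)" and "\<And>v. f' v = g \<bullet> v"
  shows "grad u x = g"
  unfolding grad_def frechet_derivative_eqI[OF assms(1)] using assms(2)
  by (simp add: euclidean_representation)

lemma smooth_has_grad: "smooth u \<Longrightarrow> (u has_derivative (\<lambda>v. grad u x \<bullet> v)) (at x)"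
  using smooth_has_derivative[of u x] grad_inner[of u x]
  by (metis (no_types, lifting) ext differentiable_def)

lemma smooth_grad_inner: "smooth u \<Longrightarrow> frechet_derivative u (at x) v = grad u x \<bullet> v"
  using smooth_has_derivative[of u x] by (intro grad_inner) (auto simp: differentiable_def)

lemma continuous_grad: "smooth u \<Longrightarrow> continuous_on UNIV (grad u)"
  unfolding grad_def[abs_def]
  by (intro continuous_intros smooth_continuous smooth_frechet_derivative)

lemma grad_cong_open:
  assumes "open U" "x \<in> U" "smooth g" "\<And>y. y \<in> U \<Longrightarrow> f y = g y"
  shows "grad f x = grad g x"
  by (rule has_derivative_grad[OF has_derivative_transform_within_open[OF smooth_has_grad[OF assms(3)]
        assms(1,2)]]) (use assms in auto)

lemma grad_mult:
  assumes "smooth u" "smooth v"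
  shows "grad (\<lambda>x. u x * v x) x = u x *\<^sub>R grad v x + v x *\<^sub>R grad u x"
  by (rule has_derivative_grad[OF has_derivative_mult[OF smooth_has_grad smooth_has_grad]])
     (use assms in \<open>auto simp: inner_add_left algebra_simps\<close>)

lemma grad_add:
  assumes "smooth u" "smooth v"
  shows "grad (\<lambda>x. u x + v x) x = grad u x + grad v x"
  by (rule has_derivative_grad[OF has_derivative_add[OF smooth_has_grad smooth_has_grad]])
     (use assms in \<open>auto simp: inner_add_left\<close>)

lemma grad_diff:
  assumes "smooth u" "smooth v"
  shows "grad (\<lambda>x. u x - v x) x = grad u x - grad v x"
  by (rule has_derivative_grad[OF has_derivative_diff[OF smooth_has_grad smooth_has_grad]])
     (use assms in \<open>auto simp: inner_diff_left\<close>)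

lemma grad_cmult:
  assumes "smooth u"
  shows "grad (\<lambda>x. c * u x) x = c *\<^sub>R grad u x"
  by (rule has_derivative_grad[OF has_derivative_mult_right[OF smooth_has_grad]])
     (use assms in auto)

text \<open>Testing the one-sided bound with \<open>grad u x\<close> itself gives the claim; when
  the gradient vanishes, a basis vector shows \<open>0 \<le> K\<close>.\<close>

lemma norm_grad_le:
  assumes "u differentiable (at x)" "\<And>v. frechet_derivative u (at x) v \<le> K * norm v"
  shows "norm (grad u x) \<le> K"
proof (cases "grad u x = 0")
  case True
  obtain b :: 'a where "b \<in> Basis" using nonempty_Basis by blast
  then have "0 \<le> K" using assms(2)[of b] True by (simp add: grad_inner[OF assms(1)])
  then show ?thesis using True by simp
next
  case False
  have "norm (grad u x) * norm (grad u x) \<le> K * norm (grad u x)"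
    using assms(2)[of "grad u x"] by (simp add: grad_inner[OF assms(1)] dot_square_norm power2_eq_square)
  then show ?thesis using False by simp
qed

lemma spt_notin: "x \<notin> spt u \<Longrightarrow> u x = 0"
  using closure_subset[of "{x. u x \<noteq> 0}"] by (auto simp: spt_def)

lemma closed_spt: "closed (spt u)" by (simp add: spt_def)

lemma spt_subset: "closed S \<Longrightarrow> (\<And>x. x \<notin> S \<Longrightarrow> u x = 0) \<Longrightarrow> spt u \<subseteq> S"
  unfolding spt_def by (rule closure_minimal) auto

lemma grad_notin_spt: "x \<notin> spt u \<Longrightarrow> grad u x = 0"
  using grad_cong_open[of "- spt u" x "\<lambda>_. 0" u] closed_spt[of u]
  by (simp add: smooth_const spt_notin open_Compl grad_def)

lemma test_functionsD:
  assumes "u \<in> test_functions D"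
  shows "smooth u" "compact (spt u)" "spt u \<subseteq> D"
  using assms by (auto simp: test_functions_def)

lemma test_functions_mono: "D \<subseteq> D' \<Longrightarrow> u \<in> test_functions D \<Longrightarrow> u \<in> test_functions D'"
  by (auto simp: test_functions_def)

lemma test_functionsI:
  assumes "smooth u" "compact S" "S \<subseteq> D" "\<And>x. x \<notin> S \<Longrightarrow> u x = 0"
  shows "u \<in> test_functions D"
proof -
  have "spt u \<subseteq> S" using assms by (intro spt_subset compact_imp_closed)
  moreover have "compact (spt u)"
    using closed_Int_compact[OF closed_spt assms(2), of u] \<open>spt u \<subseteq> S\<close> by (simp add: inf.absorb1)
  ultimately show ?thesis using assms by (auto simp: test_functions_def)
qed

lemma test_functions_add:
  assumes "u \<in> test_functions D" "v \<in> test_functions D"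
  shows "(\<lambda>x. u x + v x) \<in> test_functions D"
  using assms by (intro test_functionsI[where S="spt u \<union> spt v"])
    (auto simp: test_functions_def smooth_add spt_notin)

lemma test_functions_diff:
  assumes "u \<in> test_functions D" "v \<in> test_functions D"
  shows "(\<lambda>x. u x - v x) \<in> test_functions D"
  using assms by (intro test_functionsI[where S="spt u \<union> spt v"])
    (auto simp: test_functions_def smooth_diff spt_notin)

lemma test_functions_mult:
  assumes "u \<in> test_functions D" "smooth v"
  shows "(\<lambda>x. v x * u x) \<in> test_functions D"
  using assms by (intro test_functionsI[where S="spt u"])
    (auto simp: test_functions_def smooth_mult spt_notin)

lemma test_functions_frechet:
  assumes "u \<in> test_functions D"
  shows "(\<lambda>x. frechet_derivative u (at x) v) \<in> test_functions D"
proof (rule test_functionsI[where S="spt u"])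
  fix x assume "x \<notin> spt u"
  then show "frechet_derivative u (at x) v = 0"
    using test_functionsD[OF assms] by (simp add: smooth_grad_inner grad_notin_spt)
qed (use test_functionsD[OF assms] in \<open>auto intro: smooth_frechet_derivative\<close>)

lemma continuous_bounded_support:
  fixes f :: "'a::euclidean_space \<Rightarrow> 'b::real_normed_vector"
  assumes "continuous_on UNIV f" "compact S" "\<And>x. x \<notin> S \<Longrightarrow> f x = 0"
  obtains B where "B > 0" "\<And>x. norm (f x) \<le> B"
proof -
  have "bounded (f ` S)"
    by (intro compact_imp_bounded compact_continuous_image assms continuous_on_subset[OF assms(1)]) auto
  then obtain B where "B > 0" "\<forall>x\<in>S. norm (f x) \<le> B" by (auto simp: bounded_pos)
  then show ?thesis using assms(3) by (intro that[of B]) (metis norm_zero less_imp_le)+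
qed

lemma test_function_bounded:
  assumes "u \<in> test_functions D" obtains B where "B > 0" "\<And>x. \<bar>u x\<bar> \<le> B"
  using continuous_bounded_support[of u "spt u"] test_functionsD[OF assms]
  by (metis real_norm_def smooth_continuous spt_notin)

lemma grad_bounded:
  assumes "u \<in> test_functions D" obtains B where "B > 0" "\<And>x. norm (grad u x) \<le> B"
  using continuous_bounded_support[of "grad u" "spt u"] test_functionsD[OF assms]
  by (metis continuous_grad grad_notin_spt)

lemma test_function_lipschitz:
  assumes "smooth u" "\<And>x. norm (grad u x) \<le> B"
  shows "\<bar>u x - u y\<bar> \<le> B * norm (x - y)"
proof -
  have "norm (u x - u y) \<le> B * norm (x - y)"
  proof (rule differentiable_bound[of UNIV u "\<lambda>x v. grad u x \<bullet> v" B])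
    show "(u has_derivative (\<lambda>v. grad u z \<bullet> v)) (at z within UNIV)" for z
      using smooth_has_grad[OF assms(1)] by simp
    show "onorm (\<lambda>v. grad u z \<bullet> v) \<le> B" for z
    proof (rule onorm_le)
      fix v show "norm (grad u z \<bullet> v) \<le> B * norm v"
        using Cauchy_Schwarz_ineq2[of "grad u z" v] mult_right_mono[OF assms(2)[of z], of "norm v"] by simp
    qed
  qed auto
  then show ?thesis by simp
qed

lemma borel_test_function: "smooth u \<Longrightarrow> u \<in> borel_measurable borel"
  by (intro borel_measurable_continuous_onI smooth_continuous)

lemma borel_grad: "smooth u \<Longrightarrow> grad u \<in> borel_measurable borel"
  by (intro borel_measurable_continuous_onI continuous_grad)

section \<open>Convolution with indicators, and cutoff functions with controlled gradient\<close>

lemma lborel_integral_translate: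
  fixes f :: "'a::euclidean_space \<Rightarrow> 'b::{banach, second_countable_topology}"
  assumes "f \<in> borel_measurable borel"
  shows "(LINT x|lborel. f (c + x)) = (LINT x|lborel. f x)"
proof -
  have "(LINT x|lborel. f x) = (LINT x|distr lborel borel ((+) c). f x)"
    by (simp add: lborel_distr_plus)
  also have "\<dots> = (LINT x|lborel. f (c + x))"
    using assms by (subst integral_distr) auto
  finally show ?thesis ..
qed

lemma lborel_nn_integral_translate:
  fixes f :: "'a::euclidean_space \<Rightarrow> ennreal"
  assumes "f \<in> borel_measurable borel"
  shows "(\<integral>\<^sup>+x. f (c + x) \<partial>lborel) = (\<integral>\<^sup>+x. f x \<partial>lborel)"
proof -
  have "(\<integral>\<^sup>+x. f x \<partial>lborel) = (\<integral>\<^sup>+x. f x \<partial>distr lborel borel ((+) c))"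
    by (simp add: lborel_distr_plus)
  also have "\<dots> = (\<integral>\<^sup>+x. f (c + x) \<partial>lborel)"
    using assms by (subst nn_integral_distr) auto
  finally show ?thesis ..
qed

definition conv_indicator :: "'a::euclidean_space set \<Rightarrow> ('a \<Rightarrow> real) \<Rightarrow> 'a \<Rightarrow> real" where
  "conv_indicator A u x = (LINT y|lborel. indicator A y * u (x - y))"

lemma integrable_indicator_bounded:
  fixes f :: "'a::euclidean_space \<Rightarrow> real"
  assumes "A \<in> sets borel" "bounded A" "f \<in> borel_measurable borel" "\<And>y. \<bar>f y\<bar> \<le> B"
  shows "integrable lborel (\<lambda>y. indicator A y * f y)"
proof (rule Bochner_Integration.integrable_bound)
  show "integrable lborel (\<lambda>y. B * indicat_real A y)"
    using assms emeasure_bounded_finite[OF assms(2)] by (auto intro!: integrable_real_indicator)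
  show "AE x in lborel. norm (indicator A x * f x) \<le> norm (B * indicat_real A x)"
    using assms(4) by (auto simp: indicator_def abs_mult intro: order_trans[OF _ abs_ge_self])
qed (use assms in measurable)

lemma conv_integrable:
  assumes "A \<in> sets borel" "bounded A" "u \<in> test_functions D"
  shows "integrable lborel (\<lambda>y. indicator A y * u (x - y))"
proof -
  obtain B where "\<And>x. \<bar>u x\<bar> \<le> B" using test_function_bounded[OF assms(3)] by metis
  moreover have [measurable]: "u \<in> borel_measurable borel"
    using test_functionsD[OF assms(3)] borel_test_function by blast
  ultimately show ?thesis by (intro integrable_indicator_bounded[OF assms(1,2)]) auto
qed

text \<open>Differentiation under the integral: the remainder of the first-order expansion, divided
  by the size of the increment, is bounded by \<open>2 * B\<close> on the bounded set
  \<open>A\<close>, with \<open>B\<close> a bound for the gradient, and tends to zero pointwise, so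
  dominated convergence applies along every null sequence of increments.\<close>

lemma conv_has_derivative:
  assumes A: "A \<in> sets borel" "bounded A" and u: "u \<in> test_functions D"
  shows "(conv_indicator A u has_derivative
    (\<lambda>v. conv_indicator A (\<lambda>z. frechet_derivative u (at z) v) x)) (at x)"
proof -
  note sm = test_functionsD(1)[OF u]
  have [measurable]: "u \<in> borel_measurable borel" "grad u \<in> borel_measurable borel"
    using sm borel_test_function borel_grad by blast+
  note [measurable] = A(1)
  obtain B where B: "B > 0" "\<And>x. norm (grad u x) \<le> B" using grad_bounded[OF u] by metis
  have int1: "integrable lborel (\<lambda>y. indicator A y * (grad u (x - y) \<bullet> v))" for x v
    using conv_integrable[OF A test_functions_frechet[OF u, of v], of x]
    by (simp add: smooth_grad_inner[OF sm])
  define D where "D v = (LINT y|lborel. indicator A y * (grad u (x - y) \<bullet> v))" for v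
  have D: "conv_indicator A (\<lambda>z. frechet_derivative u (at z) v) x = D v" for v
    by (simp add: conv_indicator_def D_def smooth_grad_inner[OF sm])
  have "linear D"
    by (rule linearI) (simp_all add: D_def inner_add_right distrib_left mult.left_commute int1)
  then have bl: "bounded_linear D" by (simp add: linear_conv_bounded_linear)
  have "((\<lambda>h. norm (conv_indicator A u (x + h) - conv_indicator A u x - D h) / norm h) \<longlongrightarrow> 0) (at 0)"
    unfolding tendsto_at_iff_sequentially comp_def
  proof (intro allI impI)
    fix X :: "nat \<Rightarrow> 'a" assume X: "\<forall>i. X i \<in> UNIV - {0}" "X \<longlonglongrightarrow> 0"
    define R where "R i y = indicator A y * ((u (x - y + X i) - u (x - y) - grad u (x - y) \<bullet> X i) / norm (X i))" for i y
    have lim: "(\<lambda>i. LINT y|lborel. R i y) \<longlonglongrightarrow> (LINT y::'a|lborel. 0::real)"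
    proof (rule integral_dominated_convergence[where w="\<lambda>y. 2 * B * indicator A y"])
      show "integrable lborel (\<lambda>y. 2 * B * indicat_real A y)"
        using A emeasure_bounded_finite[OF A(2)] by (auto intro!: integrable_real_indicator)
      show "R i \<in> borel_measurable lborel" for i unfolding R_def by measurable
      show "AE y in lborel. norm (R i y) \<le> 2 * B * indicat_real A y" for i
      proof (rule AE_I2)
        fix y
        have "\<bar>u (x - y + X i) - u (x - y)\<bar> \<le> B * norm (X i)"
          using test_function_lipschitz[OF sm B(2), of "x - y + X i" "x - y"] by simp
        moreover have "\<bar>grad u (x - y) \<bullet> X i\<bar> \<le> B * norm (X i)"
          using Cauchy_Schwarz_ineq2[of "grad u (x-y)" "X i"] mult_right_mono[OF B(2)[of "x-y"], of "norm (X i)"] by simp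
        ultimately have "\<bar>u (x - y + X i) - u (x - y) - grad u (x - y) \<bullet> X i\<bar> \<le> 2 * B * norm (X i)" by linarith
        then show "norm (R i y) \<le> 2 * B * indicat_real A y"
          using X(1)[rule_format, of i] by (auto simp: R_def indicator_def abs_mult divide_le_eq)
      qed
      show "AE y in lborel. (\<lambda>i. R i y) \<longlonglongrightarrow> 0"
      proof (rule AE_I2)
        fix y
        have "((\<lambda>h. norm (u (x - y + h) - u (x - y) - grad u (x - y) \<bullet> h) / norm h) \<longlongrightarrow> 0) (at 0)"
          using smooth_has_grad[OF sm, of "x - y"] by (simp add: has_derivative_at)
        then have "(\<lambda>i. norm (u (x - y + X i) - u (x - y) - grad u (x - y) \<bullet> X i) / norm (X i)) \<longlonglongrightarrow> 0"
          using X unfolding tendsto_at_iff_sequentially comp_def by blast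
        then have "(\<lambda>i. (u (x - y + X i) - u (x - y) - grad u (x - y) \<bullet> X i) / norm (X i)) \<longlonglongrightarrow> 0"
          by (subst tendsto_norm_zero_iff[symmetric]) simp
        then show "(\<lambda>i. R i y) \<longlonglongrightarrow> 0" unfolding R_def by (rule tendsto_mult_right_zero)
      qed
    qed simp
    have "norm (conv_indicator A u (x + X i) - conv_indicator A u x - D (X i)) / norm (X i)
      = norm (LINT y|lborel. R i y)" for i
    proof -
      have "(LINT y|lborel. R i y) = (conv_indicator A u (x + X i) - conv_indicator A u x - D (X i)) / norm (X i)"
        using conv_integrable[OF A u, of x] conv_integrable[OF A u, of "x + X i"] int1[of x "X i"]
        by (simp add: R_def conv_indicator_def D_def right_diff_distrib algebra_simps
            flip: Bochner_Integration.integral_diff)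
      then show ?thesis by simp
    qed
    then show "(\<lambda>i. norm (conv_indicator A u (x + X i) - conv_indicator A u x - D (X i)) / norm (X i)) \<longlonglongrightarrow> 0"
      using tendsto_norm[OF lim] by simp
  qed
  then have "(conv_indicator A u has_derivative D) (at x)" using bl by (simp add: has_derivative_at)
  then show ?thesis by (simp add: D)
qed

text \<open>A derivative of the convolution is again a convolution of \<open>A\<close> with a test
  function, so the induction reproduces itself for all \<open>u\<close> at once.\<close>

lemma smooth_conv:
  assumes A: "A \<in> sets borel" "bounded A" and u: "u \<in> test_functions D"
  shows "smooth (conv_indicator A u)"
proof -
  have "C_k m (conv_indicator A u)" for m
    using u
  proof (induction m arbitrary: u)
    case 0
    show ?case unfolding C_k.simps
      by (intro continuous_at_imp_continuous_on ballI has_derivative_continuous[OF conv_has_derivative[OF A 0]])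
  next
    case (Suc m)
    then show ?case using conv_has_derivative[OF A Suc.prems] test_functions_frechet[OF Suc.prems]
      by (auto simp: differentiable_def frechet_derivative_eqI[OF conv_has_derivative[OF A Suc.prems]])
  qed
  then show ?thesis by (simp add: smooth_def)
qed

lemma unit_bump_scaled_smooth: "smooth (\<lambda>x. unit_bump (c *\<^sub>R x :: 'a::euclidean_space))"
proof -
  have "smooth (\<lambda>x::'a. 1 - c^2 * (\<Sum>b\<in>Basis. (x \<bullet> b) * (x \<bullet> b)))"
    by (intro smooth_diff smooth_const smooth_sum smooth_mult smooth_inner)
  then have "smooth (\<lambda>x::'a. exp_bump 0 (1 - c^2 * (\<Sum>b\<in>Basis. (x \<bullet> b) * (x \<bullet> b))))"
    by (rule smooth_compose[OF smooth_exp_bump])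
  then show ?thesis unfolding unit_bump_def[abs_def]
    by (simp add: euclidean_inner[symmetric] power2_eq_square mult.assoc)
qed

lemma unit_bump_scaled_test:
  assumes "\<delta> > 0" shows "(\<lambda>x. unit_bump (inverse \<delta> *\<^sub>R x :: 'a::euclidean_space)) \<in> test_functions UNIV"
proof (rule test_functionsI[OF unit_bump_scaled_smooth compact_cball[of 0 \<delta>]])
  show "unit_bump (inverse \<delta> *\<^sub>R x) = 0" if "x \<notin> cball 0 \<delta>" for x :: 'a
    using that assms by (intro unit_bump_eq_0) (simp add: field_simps)
qed auto

text \<open>The two ball conditions are what results from averaging the indicator of
  \<open>A\<close> over balls of radius \<delta>. The constant \<open>C\<close> is a parameter so
  that one value can serve all sets and scales.\<close>

definition cutoff :: "real \<Rightarrow> 'a::euclidean_space set \<Rightarrow> real \<Rightarrow> ('a \<Rightarrow> real) \<Rightarrow> bool" where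
  "cutoff C A \<delta> \<eta> \<longleftrightarrow> smooth \<eta> \<and> (\<forall>x. 0 \<le> \<eta> x \<and> \<eta> x \<le> 1) \<and> (\<forall>x. ball x \<delta> \<subseteq> A \<longrightarrow> \<eta> x = 1) \<and>
     (\<forall>x. ball x \<delta> \<inter> A = {} \<longrightarrow> \<eta> x = 0) \<and> (\<forall>x. norm (grad \<eta> x) \<le> C / \<delta>)"

text \<open>The cutoff is the indicator of \<open>A\<close> convolved with the scaled bump, divided
  by its mass \<open>I\<close>. The gradient of this kernel is at most
  \<open>K / (\<delta> * I)\<close> and lives on a ball of volume \<open>V * \<delta> ^ n\<close>,
  which is comparable to \<open>I\<close>; the powers of \<delta> cancel except for one, and the
  constant depends neither on \<open>A\<close> nor on \<delta>.\<close>

lemma cutoff_exists: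
  obtains C where "C > 0"
    "\<And>(A::'a::euclidean_space set) \<delta>. A \<in> sets borel \<Longrightarrow> bounded A \<Longrightarrow> \<delta> > 0 \<Longrightarrow> \<exists>\<eta>. cutoff C A \<delta> \<eta>"
proof -
  have t1: "(unit_bump :: 'a \<Rightarrow> real) \<in> test_functions UNIV" using unit_bump_scaled_test[of 1] by simp
  obtain K where K: "K > 0" "\<And>x::'a. norm (grad unit_bump x) \<le> K" using grad_bounded[OF t1] by metis
  define n where "n = DIM('a)"
  define V where "V = unit_ball_vol (real n)"
  have V: "V > 0" by (simp add: V_def unit_ball_vol_pos)
  \<comment> \<open>\<open>2 ^ n * exp 2\<close> is the ratio of \<open>V * \<delta> ^ n\<close> to
    the lower bound \<open>exp (-2) * (V * (\<delta>/2) ^ n)\<close> for the mass of the scaled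
    bump.\<close>
  define C where "C = K * 2 ^ n * exp 2"
  have C: "C > 0" using K by (simp add: C_def)
  show ?thesis
  proof (rule that[of C, OF C])
    fix A :: "'a set" and \<delta> :: real assume A: "A \<in> sets borel" "bounded A" and \<delta>: "\<delta> > 0"
    define \<rho> where "\<rho> x = unit_bump (inverse \<delta> *\<^sub>R x :: 'a)" for x
    have t: "\<rho> \<in> test_functions UNIV" unfolding \<rho>_def[abs_def] by (rule unit_bump_scaled_test[OF \<delta>])
    have [measurable]: "\<rho> \<in> borel_measurable borel" using test_functionsD(1)[OF t] borel_test_function by blast
    note [measurable] = A(1)
    obtain B where B: "\<And>x. \<bar>\<rho> x\<bar> \<le> B" using test_function_bounded[OF t] by metis
    have nonneg: "\<rho> x \<ge> 0" for x by (simp add: \<rho>_def unit_bump_nonneg)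
    have zero: "\<rho> x = 0" if "norm x \<ge> \<delta>" for x
      using that \<delta> unfolding \<rho>_def by (intro unit_bump_eq_0) (simp add: field_simps)
    have int: "integrable lborel \<rho>"
    proof -
      have "integrable lborel (\<lambda>y. indicator (cball 0 \<delta>) y * \<rho> y)"
        by (rule integrable_indicator_bounded[OF _ _ _ B]) auto
      moreover have "(\<lambda>y. indicator (cball 0 \<delta>) y * \<rho> y) = \<rho>"
        using zero by (auto simp: fun_eq_iff indicator_def)
      ultimately show ?thesis by simp
    qed
    define I where "I = (LINT y|lborel. \<rho> y)"
    have I: "I \<ge> exp (-2) * (V * (\<delta>/2) ^ n)"
    proof -
      have "(LINT y|lborel. exp (-2) * indicat_real (cball (0::'a) (\<delta>/2)) y) \<le> I"
        unfolding I_def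
      proof (rule integral_mono[OF _ int])
        show "integrable lborel (\<lambda>y. exp (- 2) * indicat_real (cball 0 (\<delta> / 2)) (y::'a))"
          using emeasure_bounded_finite[of "cball (0::'a) (\<delta>/2)"] by (auto intro!: integrable_real_indicator)
        fix x :: 'a
        show "exp (- 2) * indicat_real (cball 0 (\<delta> / 2)) x \<le> \<rho> x"
          using nonneg[of x] \<delta> unit_bump_ge[of "inverse \<delta> *\<^sub>R x"] unfolding \<rho>_def
          by (auto simp: indicator_def field_simps)
      qed
      moreover have "measure lborel (cball (0::'a) (\<delta>/2)) = V * (\<delta>/2) ^ n"
        using content_cball[of "\<delta>/2" "0::'a"] \<delta> by (simp add: V_def n_def)
      ultimately show ?thesis by simp
    qed
    then have Ipos: "I > 0" using V \<delta> by (smt (verit) divide_pos_pos exp_gt_zero mult_pos_pos zero_less_power)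
    define \<eta> where "\<eta> = conv_indicator A (\<lambda>z. inverse I * \<rho> z)"
    have t': "(\<lambda>z. inverse I * \<rho> z) \<in> test_functions UNIV"
      by (intro test_functions_mult t smooth_const)
    have \<eta>: "\<eta> x = inverse I * (LINT y|lborel. indicator A y * \<rho> (x - y))" for x
      by (simp add: \<eta>_def conv_indicator_def mult.left_commute)
    have tr: "integrable lborel (\<lambda>y. \<rho> (x - y))" "(LINT y|lborel. \<rho> (x - y)) = I" for x
    proof -
      \<comment> \<open>The kernel is even, so its reflection is a plain translate and translation
        invariance suffices.\<close>
      have e: "\<rho> (x - y) = \<rho> (- x + y)" for y
        by (simp add: \<rho>_def unit_bump_def algebra_simps inner_commute)
      show "(LINT y|lborel. \<rho> (x - y)) = I"
        unfolding e I_def by (rule lborel_integral_translate) simp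
      show "integrable lborel (\<lambda>y. \<rho> (x - y))"
        using integrable_distr_eq[of "(+) (-x)" lborel borel \<rho>] int unfolding e by (simp add: lborel_distr_plus)
    qed
    have le1: "(LINT y|lborel. indicator A y * \<rho> (x - y)) \<le> I" for x
      unfolding tr(2)[of x, symmetric]
      by (rule integral_mono[OF conv_integrable[OF A t] tr(1)]) (use nonneg in \<open>auto simp: indicator_def\<close>)
    have sm: "smooth \<eta>" unfolding \<eta>_def by (rule smooth_conv[OF A t'])
    show "\<exists>\<eta>. cutoff C A \<delta> \<eta>"
      unfolding cutoff_def
    proof (intro exI[of _ \<eta>] conjI sm allI impI)
      fix x
      show "0 \<le> \<eta> x" unfolding \<eta> using Ipos nonneg
        by (intro mult_nonneg_nonneg integral_nonneg_AE AE_I2) auto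
      show "\<eta> x \<le> 1" unfolding \<eta> using Ipos le1[of x] by (simp add: field_simps)
    next
      fix x assume s: "ball x \<delta> \<subseteq> A"
      have "indicator A y * \<rho> (x - y) = \<rho> (x - y)" for y
        using zero[of "x - y"] s by (cases "norm (x - y) < \<delta>") (auto simp: indicator_def subset_iff dist_norm)
      then show "\<eta> x = 1" unfolding \<eta> using Ipos tr(2)[of x] by (simp only:) simp
    next
      fix x assume s: "ball x \<delta> \<inter> A = {}"
      have "indicator A y * \<rho> (x - y) = 0" for y
        using zero[of "x - y"] s by (cases "norm (x - y) < \<delta>") (auto simp: indicator_def disjoint_iff dist_norm)
      then show "\<eta> x = 0" unfolding \<eta> by (simp only:) simp
    next
      fix x
      show "norm (grad \<eta> x) \<le> C / \<delta>"
      proof (rule norm_grad_le)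
        show "\<eta> differentiable at x" using smooth_has_grad[OF sm] by (auto simp: differentiable_def)
        fix v
        have g: "grad \<rho> z = inverse \<delta> *\<^sub>R grad unit_bump (inverse \<delta> *\<^sub>R z)" for z
        proof (rule has_derivative_grad)
          show "(\<rho> has_derivative (\<lambda>v. grad unit_bump (inverse \<delta> *\<^sub>R z) \<bullet> (inverse \<delta> *\<^sub>R v))) (at z)"
            unfolding \<rho>_def[abs_def]
            by (rule has_derivative_compose[OF _ smooth_has_grad[OF smooth_unit_bump], of "\<lambda>x. inverse \<delta> *\<^sub>R x"])
               (auto intro!: derivative_eq_intros)
        qed auto
        have gb: "norm (grad \<rho> z) \<le> K / \<delta>" for z
          using K(2)[of "inverse \<delta> *\<^sub>R z"] \<delta> by (simp add: g field_simps)
        have gz: "grad \<rho> z = 0" if "norm z > \<delta>" for z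
        proof (rule grad_notin_spt)
          have "spt \<rho> \<subseteq> cball 0 \<delta>" by (rule spt_subset) (auto intro: zero)
          then show "z \<notin> spt \<rho>" using that by auto
        qed
        have sr: "smooth \<rho>" using test_functionsD(1)[OF t] .
        have "frechet_derivative \<eta> (at x) v
          = conv_indicator A (\<lambda>z. frechet_derivative (\<lambda>z. inverse I * \<rho> z) (at z) v) x"
          unfolding \<eta>_def by (simp add: frechet_derivative_eqI[OF conv_has_derivative[OF A t']])
        also have "\<dots> = (LINT y|lborel. indicator A y * (inverse I * (grad \<rho> (x - y) \<bullet> v)))"
          by (simp add: conv_indicator_def smooth_grad_inner[OF test_functionsD(1)[OF t']] grad_cmult[OF sr])
        also have "\<dots> \<le> (LINT y|lborel. (inverse I * (K / \<delta>) * norm v) * indicat_real (cball x \<delta>) y)"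
        proof (rule integral_mono)
          show "integrable lborel (\<lambda>y. indicat_real A y * (inverse I * (grad \<rho> (x - y) \<bullet> v)))"
            using conv_integrable[OF A test_functions_frechet[OF t', of v], of x]
            by (simp add: smooth_grad_inner[OF test_functionsD(1)[OF t']] grad_cmult[OF sr])
          show "integrable lborel (\<lambda>y. inverse I * (K / \<delta>) * norm v * indicat_real (cball x \<delta>) y)"
            using emeasure_bounded_finite[of "cball x \<delta>"] by (auto intro!: integrable_real_indicator)
          fix y
          have "grad \<rho> (x - y) \<bullet> v \<le> K / \<delta> * norm v"
            using norm_cauchy_schwarz[of "grad \<rho> (x - y)" v] mult_right_mono[OF gb[of "x - y"], of "norm v"] by simp
          then have "inverse I * (grad \<rho> (x - y) \<bullet> v) \<le> inverse I * (K / \<delta> * norm v)"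
            using Ipos by (intro mult_left_mono) auto
          moreover have "0 \<le> inverse I * (K / \<delta> * norm v)" using Ipos K \<delta> by auto
          ultimately show "indicat_real A y * (inverse I * (grad \<rho> (x - y) \<bullet> v)) \<le> inverse I * (K / \<delta>) * norm v * indicat_real (cball x \<delta>) y"
            using gz[of "x - y"] by (auto simp: indicator_def dist_norm mult.assoc)
        qed
        also have "\<dots> = inverse I * (K / \<delta>) * norm v * (V * \<delta> ^ n)"
          using content_cball[of \<delta> x] \<delta> by (simp add: V_def n_def)
        also have "\<dots> \<le> C / \<delta> * norm v"
        proof -
          have "V * \<delta> ^ n \<le> 2 ^ n * exp 2 * I"
            using I by (simp add: power_divide exp_minus field_simps)
          then have "inverse I * (V * \<delta> ^ n) \<le> 2 ^ n * exp 2" using Ipos by (simp add: field_simps)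
          then have "(K / \<delta> * norm v) * (inverse I * (V * \<delta> ^ n)) \<le> (K / \<delta> * norm v) * (2 ^ n * exp 2)"
            using K \<delta> by (intro mult_left_mono) auto
          then show ?thesis by (simp add: C_def mult_ac)
        qed
        finally show "frechet_derivative \<eta> (at x) v \<le> C / \<delta> * norm v" .
      qed
    qed
  qed
qed

section \<open>Square-integrable functions and weak gradients\<close>

text \<open>The Bochner integral of a non-integrable function is 0, so this is the \<open>L2\<close>
  norm only together with \<open>square_integrable\<close>.\<close>

definition l2 :: "'b measure \<Rightarrow> ('b \<Rightarrow> 'c::euclidean_space) \<Rightarrow> real" where
  "l2 M f = sqrt (LINT x|M. (norm (f x))\<^sup>2)"

lemma l2_nonneg: "0 \<le> l2 M f"
  by (simp add: l2_def)

lemma l2_square: "(l2 M f)\<^sup>2 = (LINT x|M. (norm (f x))\<^sup>2)"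
  by (simp add: l2_def)

lemma square_integrable_measurable: "square_integrable M f \<Longrightarrow> f \<in> borel_measurable M"
  by (simp add: square_integrable_def)

lemma square_integrable_iff_nn:
  "square_integrable M f \<longleftrightarrow> f \<in> borel_measurable M \<and> (\<integral>\<^sup>+x. ennreal ((norm (f x))\<^sup>2) \<partial>M) < \<infinity>"
  unfolding square_integrable_def integrable_iff_bounded by (auto simp: )

lemma l2_eq_nn:
  "square_integrable M f \<Longrightarrow> (\<integral>\<^sup>+x. ennreal ((norm (f x))\<^sup>2) \<partial>M) = ennreal ((l2 M f)\<^sup>2)"
  unfolding l2_square square_integrable_def by (intro nn_integral_eq_integral) auto

lemma square_integrable_norm: "square_integrable M f \<Longrightarrow> square_integrable M (\<lambda>x. norm (f x))"
  by (auto simp: square_integrable_def)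

lemma l2_norm: "l2 M (\<lambda>x. norm (f x)) = l2 M f"
  by (simp add: l2_def)

lemma square_integrable_mono:
  assumes "square_integrable M g" "f \<in> borel_measurable M" "AE x in M. norm (f x) \<le> norm (g x)"
  shows "square_integrable M f" and "l2 M f \<le> l2 M g"
proof -
  have le: "AE x in M. (norm (f x))\<^sup>2 \<le> (norm (g x))\<^sup>2"
    using assms(3) by eventually_elim (auto intro: power_mono)
  show "square_integrable M f"
    unfolding square_integrable_def
    using assms(1,2) le by (auto simp: square_integrable_def intro: Bochner_Integration.integrable_bound)
  then show "l2 M f \<le> l2 M g"
    using assms(1) le by (auto simp: l2_def square_integrable_def intro!: integral_mono_AE)
qed

lemma square_integrable_scale: "square_integrable M f \<Longrightarrow> square_integrable M (\<lambda>x. c *\<^sub>R f x)"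
  by (auto simp: square_integrable_def power_mult_distrib)

lemma l2_scale: "l2 M (\<lambda>x. c *\<^sub>R f x) = \<bar>c\<bar> * l2 M f"
  by (simp add: l2_def power_mult_distrib real_sqrt_mult)

lemma square_integrable_add:
  assumes "square_integrable M f" "square_integrable M g"
  shows "square_integrable M (\<lambda>x. f x + g x)"
  unfolding square_integrable_def
proof
  show m: "(\<lambda>x. f x + g x) \<in> borel_measurable M"
    using assms by (auto simp: square_integrable_def)
  show "integrable M (\<lambda>x. (norm (f x + g x))\<^sup>2)"
  proof (rule Bochner_Integration.integrable_bound)
    show "integrable M (\<lambda>x. 2 * (norm (f x))\<^sup>2 + 2 * (norm (g x))\<^sup>2)"
      using assms by (auto simp: square_integrable_def)
    have "(norm (f x + g x))\<^sup>2 \<le> 2 * (norm (f x))\<^sup>2 + 2 * (norm (g x))\<^sup>2" for x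
    proof -
      have "(norm (f x + g x))\<^sup>2 \<le> (norm (f x) + norm (g x))\<^sup>2"
        by (intro power_mono norm_triangle_ineq) auto
      also have "\<dots> \<le> 2 * (norm (f x))\<^sup>2 + 2 * (norm (g x))\<^sup>2"
        using sum_squares_bound[of "norm (f x)" "norm (g x)"] by (simp add: power2_sum)
      finally show ?thesis .
    qed
    then show "AE x in M. norm ((norm (f x + g x))\<^sup>2) \<le> norm (2 * (norm (f x))\<^sup>2 + 2 * (norm (g x))\<^sup>2)"
      by (intro AE_I2) (auto intro: order_trans[OF _ abs_ge_self])
  qed (use m in measurable)
qed

lemma square_integrable_diff:
  assumes "square_integrable M f" "square_integrable M g"
  shows "square_integrable M (\<lambda>x. f x - g x)"
  using square_integrable_add[OF assms(1) square_integrable_scale[OF assms(2), of "-1"]] by simp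

lemma square_integrable_mult_integrable:
  fixes f g :: "'b \<Rightarrow> real"
  assumes "square_integrable M f" "square_integrable M g"
  shows "integrable M (\<lambda>x. f x * g x)"
proof (rule Bochner_Integration.integrable_bound)
  show "integrable M (\<lambda>x. (f x)\<^sup>2 + (g x)\<^sup>2)"
    using assms by (auto simp: square_integrable_def)
  show "(\<lambda>x. f x * g x) \<in> borel_measurable M" using assms by (auto simp: square_integrable_def)
  have "\<bar>f x * g x\<bar> \<le> (f x)\<^sup>2 + (g x)\<^sup>2" for x
    using sum_squares_bound[of "\<bar>f x\<bar>" "\<bar>g x\<bar>"] mult_nonneg_nonneg[of "\<bar>f x\<bar>" "\<bar>g x\<bar>"]
    unfolding power2_abs abs_mult by linarith
  then show "AE x in M. norm (f x * g x) \<le> norm ((f x)\<^sup>2 + (g x)\<^sup>2)" by simp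
qed

lemma l2_Cauchy_Schwarz:
  fixes f g :: "'b \<Rightarrow> real"
  assumes "square_integrable M f" "square_integrable M g"
  shows "\<bar>LINT x|M. f x * g x\<bar> \<le> l2 M f * l2 M g"
proof -
  have [measurable]: "f \<in> borel_measurable M" "g \<in> borel_measurable M"
    using assms by (auto simp: square_integrable_def)
  note i = square_integrable_mult_integrable[OF assms]
  have "(\<integral>\<^sup>+x. ennreal \<bar>f x * g x\<bar> \<partial>M) = ennreal (LINT x|M. \<bar>f x * g x\<bar>)"
    using i by (intro nn_integral_eq_integral) auto
  then have "ennreal ((LINT x|M. \<bar>f x * g x\<bar>)\<^sup>2) = (\<integral>\<^sup>+x. ennreal \<bar>f x\<bar> * ennreal \<bar>g x\<bar> \<partial>M)\<^sup>2"
    by (simp add: abs_mult ennreal_mult ennreal_power)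
  also have "\<dots> \<le> (\<integral>\<^sup>+x. ennreal \<bar>f x\<bar> ^ 2 \<partial>M) * (\<integral>\<^sup>+x. ennreal \<bar>g x\<bar> ^ 2 \<partial>M)"
    by (rule Cauchy_Schwarz_nn_integral) auto
  also have "\<dots> = ennreal ((l2 M f * l2 M g)\<^sup>2)"
    using l2_eq_nn[OF assms(1)] l2_eq_nn[OF assms(2)]
    by (simp add: ennreal_power power_mult_distrib ennreal_mult)
  finally have "(LINT x|M. \<bar>f x * g x\<bar>)\<^sup>2 \<le> (l2 M f * l2 M g)\<^sup>2"
    by simp
  then have "(LINT x|M. \<bar>f x * g x\<bar>) \<le> l2 M f * l2 M g"
    by (rule power2_le_imp_le) (simp add: l2_nonneg)
  then show ?thesis using integral_abs_bound[of M "\<lambda>x. f x * g x"] by linarith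
qed

lemma l2_triangle:
  assumes "square_integrable M f" "square_integrable M g"
  shows "l2 M (\<lambda>x. f x + g x) \<le> l2 M f + l2 M g"
proof (rule power2_le_imp_le)
  note fg = square_integrable_norm[OF assms(1)] square_integrable_norm[OF assms(2)]
  note i = square_integrable_mult_integrable[OF fg]
  have "(LINT x|M. (norm (f x + g x))\<^sup>2) \<le> (LINT x|M. (norm (f x))\<^sup>2 + 2 * (norm (f x) * norm (g x)) + (norm (g x))\<^sup>2)"
  proof (rule integral_mono)
    show "integrable M (\<lambda>x. (norm (f x + g x))\<^sup>2)"
      using square_integrable_add[OF assms] by (simp add: square_integrable_def)
    show "integrable M (\<lambda>x. (norm (f x))\<^sup>2 + 2 * (norm (f x) * norm (g x)) + (norm (g x))\<^sup>2)"
      using assms i by (auto simp: square_integrable_def)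
    fix x
    have "(norm (f x + g x))\<^sup>2 \<le> (norm (f x) + norm (g x))\<^sup>2"
      by (intro power_mono norm_triangle_ineq) auto
    then show "(norm (f x + g x))\<^sup>2 \<le> (norm (f x))\<^sup>2 + 2 * (norm (f x) * norm (g x)) + (norm (g x))\<^sup>2"
      by (simp add: power2_sum algebra_simps)
  qed
  also have "\<dots> = (l2 M f)\<^sup>2 + 2 * (LINT x|M. norm (f x) * norm (g x)) + (l2 M g)\<^sup>2"
    using assms i by (simp add: square_integrable_def l2_square)
  also have "\<dots> \<le> (l2 M f)\<^sup>2 + 2 * (l2 M f * l2 M g) + (l2 M g)\<^sup>2"
    using l2_Cauchy_Schwarz[OF fg] by (simp add: l2_norm)
  finally show "(l2 M (\<lambda>x. f x + g x))\<^sup>2 \<le> (l2 M f + l2 M g)\<^sup>2"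
    by (simp add: l2_square power2_sum)
qed (simp add: l2_nonneg)

lemma l2_minus_commute: "l2 M (\<lambda>x. f x - g x) = l2 M (\<lambda>x. g x - f x)"
  by (simp add: l2_def norm_minus_commute)

lemma l2_diff_triangle:
  assumes "square_integrable M f" "square_integrable M g" "square_integrable M h"
  shows "l2 M (\<lambda>x. f x - h x) \<le> l2 M (\<lambda>x. f x - g x) + l2 M (\<lambda>x. g x - h x)"
  using l2_triangle[OF square_integrable_diff[OF assms(1,2)] square_integrable_diff[OF assms(2,3)]]
  by simp

lemma l2_abs_diff:
  assumes "square_integrable M f" "square_integrable M g"
  shows "\<bar>l2 M f - l2 M g\<bar> \<le> l2 M (\<lambda>x. f x - g x)"
  using l2_triangle[OF square_integrable_diff[OF assms] assms(2)]
    l2_triangle[OF square_integrable_diff[OF assms(2,1)] assms(1)]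
  by (simp add: l2_minus_commute[of M g f])

lemma l2_tendsto:
  assumes "\<And>k. square_integrable M (f k)" "square_integrable M g"
    and "(\<lambda>k. l2 M (\<lambda>x. g x - f k x)) \<longlonglongrightarrow> 0"
  shows "(\<lambda>k. l2 M (f k)) \<longlonglongrightarrow> l2 M g"
proof -
  have "(\<lambda>k. l2 M (f k) - l2 M g) \<longlonglongrightarrow> 0"
    by (rule Lim_null_comparison[OF _ assms(3)])
       (use l2_abs_diff[OF assms(1,2)] in \<open>auto simp: l2_minus_commute[of M g]\<close>)
  then show ?thesis by (simp add: LIM_zero_iff)
qed

text \<open>Riesz-Fischer: a fast subsequence converges almost everywhere, and Fatou's lemma carries
  the Cauchy estimate over to the pointwise limit.\<close>

lemma l2_complete:
  fixes f :: "nat \<Rightarrow> 'b \<Rightarrow> 'c::euclidean_space"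
  assumes sq: "\<And>k. square_integrable M (f k)"
    and cau: "\<And>\<epsilon>. \<epsilon> > 0 \<Longrightarrow> \<exists>K. \<forall>k\<ge>K. \<forall>l\<ge>K. l2 M (\<lambda>x. f k x - f l x) < \<epsilon>"
  obtains g where "square_integrable M g" "(\<lambda>k. l2 M (\<lambda>x. g x - f k x)) \<longlonglongrightarrow> 0"
proof -
  have [measurable]: "f k \<in> borel_measurable M" for k using sq by (simp add: square_integrable_def)
  note sqd = square_integrable_diff[OF sq sq]
  define K where "K j = (SOME K. \<forall>k\<ge>K. \<forall>l\<ge>K. l2 M (\<lambda>x. f k x - f l x) < (1/8) ^ j)" for j :: nat
  have K: "l2 M (\<lambda>x. f k x - f l x) < (1/8) ^ j" if "k \<ge> K j" "l \<ge> K j" for j k l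
    using someI_ex[OF cau[of "(1/8) ^ j"]] that unfolding K_def[symmetric] by simp
  \<comment> \<open>Summing the thresholds makes \<open>r i\<close> at least every
    \<open>K j\<close> with \<open>j \<le> i\<close>.\<close>
  define r where "r j = (\<Sum>i\<le>j. K i)" for j
  have r: "r i \<ge> K j" if "j \<le> i" for i j
    unfolding r_def by (rule member_le_sum) (use that in auto)
  define d where "d j x = norm (f (r (Suc j)) x - f (r j) x)" for j x
  have [measurable]: "d j \<in> borel_measurable M" for j unfolding d_def by measurable
  have dn: "(\<integral>\<^sup>+x. ennreal ((d j x)\<^sup>2) \<partial>M) \<le> ennreal ((1/8) ^ j)" for j
  proof -
    have "(\<integral>\<^sup>+x. ennreal ((d j x)\<^sup>2) \<partial>M) = ennreal ((l2 M (\<lambda>x. f (r (Suc j)) x - f (r j) x))\<^sup>2)"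
      using l2_eq_nn[OF sqd] by (simp add: d_def)
    also have "\<dots> \<le> ennreal (((1/8) ^ j)\<^sup>2)"
      using K[of j "r (Suc j)" "r j"] r[of j "Suc j"] r[of j j]
      by (intro ennreal_leI power_mono) (simp_all add: l2_nonneg)
    also have "\<dots> \<le> ennreal ((1/8) ^ j)"
      by (intro ennreal_leI) (simp add: power2_eq_square mult_le_cancel_right1 power_le_one)
    finally show ?thesis .
  qed
  \<comment> \<open>The weights \<open>4 ^ j\<close> still leave a convergent series of integrals,
    since these are at most \<open>(1/8) ^ j\<close>; finiteness at a point then forces
    \<open>d j x\<close> to decay like \<open>(1/2) ^ j\<close>, which is summable.\<close>
  have "(\<integral>\<^sup>+x. (\<Sum>j. ennreal (4 ^ j * (d j x)\<^sup>2)) \<partial>M) = (\<Sum>j. ennreal (4 ^ j) * (\<integral>\<^sup>+x. ennreal ((d j x)\<^sup>2) \<partial>M))"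
    by (simp add: nn_integral_suminf ennreal_mult nn_integral_cmult)
  also have "\<dots> \<le> (\<Sum>j. ennreal ((1/2) ^ j))"
  proof (intro suminf_le summableI)
    fix j :: nat
    have "ennreal (4 ^ j) * (\<integral>\<^sup>+x. ennreal ((d j x)\<^sup>2) \<partial>M) \<le> ennreal (4 ^ j) * ennreal ((1/8) ^ j)"
      by (intro mult_left_mono dn) auto
    also have "\<dots> = ennreal (4 ^ j * (1/8) ^ j)" by (rule ennreal_mult[symmetric]) auto
    also have "(4::real) ^ j * (1/8) ^ j = (1/2) ^ j" by (simp only: power_mult_distrib[symmetric]) simp
    finally show "ennreal (4 ^ j) * (\<integral>\<^sup>+x. ennreal ((d j x)\<^sup>2) \<partial>M) \<le> ennreal ((1/2) ^ j)" .
  qed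
  also have "\<dots> = ennreal 2"
    by (subst suminf_ennreal2) (auto simp: suminf_geometric)
  also have "\<dots> < \<infinity>" by simp
  finally have fin: "(\<integral>\<^sup>+x. (\<Sum>j. ennreal (4 ^ j * (d j x)\<^sup>2)) \<partial>M) < \<infinity>" .
  have "AE x in M. (\<Sum>j. ennreal (4 ^ j * (d j x)\<^sup>2)) \<noteq> \<infinity>"
  proof (rule nn_integral_noteq_infinite)
    show "(\<lambda>x. \<Sum>j. ennreal (4 ^ j * (d j x)\<^sup>2)) \<in> borel_measurable M" by measurable
    show "(\<integral>\<^sup>+x. (\<Sum>j. ennreal (4 ^ j * (d j x)\<^sup>2)) \<partial>M) \<noteq> \<infinity>" by (rule less_imp_neq[OF fin])
  qed
  then have conv: "AE x in M. convergent (\<lambda>j. f (r j) x)"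
  proof eventually_elim
    case (elim x)
    define S where "S = (\<Sum>j. ennreal (4 ^ j * (d j x)\<^sup>2))"
    have "S \<noteq> top" using elim by (simp only: S_def infinity_ennreal_def) simp
    then obtain C where C: "C \<ge> 0" "(\<Sum>j. ennreal (4 ^ j * (d j x)\<^sup>2)) = ennreal C"
      unfolding S_def[symmetric] by (metis ennreal_cases)
    have "d j x \<le> sqrt C * (1/2) ^ j" for j
    proof -
      have "sum (\<lambda>j. ennreal (4 ^ j * (d j x)\<^sup>2)) {j} \<le> (\<Sum>j. ennreal (4 ^ j * (d j x)\<^sup>2))"
        by (rule sum_le_suminf) auto
      then have "ennreal (4 ^ j * (d j x)\<^sup>2) \<le> ennreal C" unfolding C(2) by simp
      then have "4 ^ j * (d j x)\<^sup>2 \<le> C" by (subst (asm) ennreal_le_iff[OF C(1)])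
      moreover have "((2::real) ^ j)\<^sup>2 = 4 ^ j"
        unfolding power_mult[symmetric] mult.commute[of j] by (simp add: power_mult)
      ultimately have "(2 ^ j * d j x)\<^sup>2 \<le> C"
        unfolding power_mult_distrib by (simp only:)
      then have "2 ^ j * d j x \<le> sqrt C" by (rule real_le_rsqrt)
      then have "d j x \<le> sqrt C / 2 ^ j" by (simp add: pos_le_divide_eq mult.commute)
      then show ?thesis by (simp only: power_one_over) (simp only: divide_inverse mult_1)
    qed
    then have b: "norm (norm (f (r (Suc j)) x - f (r j) x)) \<le> sqrt C * (1/2) ^ j" for j
      by (simp add: d_def)
    have "summable (\<lambda>j. sqrt C * (1/2) ^ j)" by (intro summable_mult summable_geometric) simp
    then have "summable (\<lambda>j. norm (f (r (Suc j)) x - f (r j) x))"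
      by (rule summable_comparison_test'[where N=0]) (rule b)
    then have "summable (\<lambda>j. f (r (Suc j)) x - f (r j) x)" by (rule summable_norm_cancel)
    then have "convergent (\<lambda>n. \<Sum>j<n. f (r (Suc j)) x - f (r j) x)"
      by (simp add: summable_iff_convergent)
    then have "convergent (\<lambda>n. (f (r n) x - f (r 0) x) + f (r 0) x)"
      using sum_lessThan_telescope[of "\<lambda>j. f (r j) x"] by (intro convergent_add convergent_const) simp
    then show ?case by simp
  qed
  define g where "g x = lim (\<lambda>j. f (r j) x)" for x
  have [measurable]: "g \<in> borel_measurable M" unfolding g_def by measurable
  have le: "(\<integral>\<^sup>+x. ennreal ((norm (g x - f k x))\<^sup>2) \<partial>M) \<le> ennreal (((1/8) ^ j)\<^sup>2)" if k: "k \<ge> K j" for k j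
  proof -
    have "(\<integral>\<^sup>+x. ennreal ((norm (g x - f k x))\<^sup>2) \<partial>M)
      = (\<integral>\<^sup>+x. liminf (\<lambda>i. ennreal ((norm (f (r i) x - f k x))\<^sup>2)) \<partial>M)"
    proof (rule nn_integral_cong_AE)
      show "AE x in M. ennreal ((norm (g x - f k x))\<^sup>2) = liminf (\<lambda>i. ennreal ((norm (f (r i) x - f k x))\<^sup>2))"
        using conv
      proof eventually_elim
        case (elim x)
        then have "(\<lambda>i. f (r i) x) \<longlonglongrightarrow> g x" unfolding g_def by (simp add: convergent_LIMSEQ_iff)
        then have "(\<lambda>i. ennreal ((norm (f (r i) x - f k x))\<^sup>2)) \<longlonglongrightarrow> ennreal ((norm (g x - f k x))\<^sup>2)"
          by (intro tendsto_intros)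
        then show ?case by (rule lim_imp_Liminf[OF trivial_limit_sequentially, symmetric])
      qed
    qed
    also have "\<dots> \<le> liminf (\<lambda>i. \<integral>\<^sup>+x. ennreal ((norm (f (r i) x - f k x))\<^sup>2) \<partial>M)"
      by (rule nn_integral_liminf) auto
    also have "\<dots> \<le> ennreal (((1/8) ^ j)\<^sup>2)"
    proof (rule Liminf_le)
      show "\<forall>\<^sub>F i in sequentially. (\<integral>\<^sup>+x. ennreal ((norm (f (r i) x - f k x))\<^sup>2) \<partial>M) \<le> ennreal (((1/8) ^ j)\<^sup>2)"
        unfolding eventually_sequentially
      proof (intro exI[of _ j] allI impI)
        fix i assume "j \<le> i"
        then have "r i \<ge> K j" by (rule r)
        then show "(\<integral>\<^sup>+x. ennreal ((norm (f (r i) x - f k x))\<^sup>2) \<partial>M) \<le> ennreal (((1/8) ^ j)\<^sup>2)"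
          unfolding l2_eq_nn[OF sqd] using K[of j "r i" k] k
          by (intro ennreal_leI power_mono) (auto simp: l2_nonneg less_imp_le)
      qed
    qed simp
    finally show ?thesis .
  qed
  have sqgd: "square_integrable M (\<lambda>x. g x - f k x)" if "k \<ge> K j" for k j
    unfolding square_integrable_iff_nn using le[OF that] by (auto intro: le_less_trans)
  have sqg: "square_integrable M g"
    using square_integrable_add[OF sqgd[of 0 "K 0"] sq[of "K 0"]] by simp
  have "l2 M (\<lambda>x. g x - f k x) \<le> (1/8) ^ j" if "k \<ge> K j" for k j
  proof (rule power2_le_imp_le)
    show "(l2 M (\<lambda>x. g x - f k x))\<^sup>2 \<le> ((1/8) ^ j)\<^sup>2"
      using le[OF that] l2_eq_nn[OF sqgd[OF that]] by simp
  qed simp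
  note fin = this
  have "(\<lambda>k. l2 M (\<lambda>x. g x - f k x)) \<longlonglongrightarrow> 0"
  proof (rule LIMSEQ_I)
    fix e :: real assume "e > 0"
    then obtain j where "(1/8) ^ j < e" using real_arch_pow_inv[of e "1/8"] by auto
    then show "\<exists>no. \<forall>n\<ge>no. norm (l2 M (\<lambda>x. g x - f n x) - 0) < e"
      using fin[of j] by (intro exI[of _ "K j"]) (auto simp: l2_nonneg intro: le_less_trans)
  qed
  then show ?thesis using sqg that by blast
qed

section \<open>Test functions in \<open>L2\<close> and their weak gradients\<close>

lemma borel_measurable_lebesgue_on:
  "f \<in> borel_measurable borel \<Longrightarrow> f \<in> borel_measurable (lebesgue_on D)"
  by (rule measurable_restrict_space1, rule measurable_completion) simp

lemma nn_integral_lebesgue_on: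
  assumes "D \<in> sets lebesgue"
  shows "(\<integral>\<^sup>+x. f x \<partial>lebesgue_on D) = (\<integral>\<^sup>+x. f x * indicator D x \<partial>lborel)"
  using assms by (subst nn_integral_restrict_space) (auto simp: nn_integral_completion)

lemma square_integrable_continuous_support:
  fixes f :: "'a::euclidean_space \<Rightarrow> 'b::euclidean_space"
  assumes "continuous_on UNIV f" "compact S" "\<And>x. x \<notin> S \<Longrightarrow> f x = 0" "D \<in> sets lebesgue"
  shows "square_integrable (lebesgue_on D) f"
proof -
  have f[measurable]: "f \<in> borel_measurable borel" by (rule borel_measurable_continuous_onI[OF assms(1)])
  obtain B where B: "\<And>x. norm (f x) \<le> B" using continuous_bounded_support[OF assms(1-3)] by metis
  have "(\<integral>\<^sup>+x. ennreal ((norm (f x))\<^sup>2) * indicator D x \<partial>lborel) \<le> (\<integral>\<^sup>+x. ennreal (B\<^sup>2) * indicator S x \<partial>lborel)"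
    by (intro nn_integral_mono) (use assms(3) B in \<open>auto simp: indicator_def intro!: ennreal_leI power_mono\<close>)
  also have "\<dots> = ennreal (B\<^sup>2) * emeasure lborel S"
    using assms(2) by (intro nn_integral_cmult_indicator) (auto intro: borel_compact)
  also have "\<dots> < \<infinity>"
    using emeasure_compact_finite[OF assms(2)] by (simp add: ennreal_mult_less_top)
  finally show ?thesis
    using borel_measurable_lebesgue_on[OF f] nn_integral_lebesgue_on[OF assms(4)]
    by (simp add: square_integrable_iff_nn)
qed

lemma square_integrable_test:
  assumes "u \<in> test_functions D'" "D \<in> sets lebesgue"
  shows "square_integrable (lebesgue_on D) u" "square_integrable (lebesgue_on D) (grad u)"
proof -
  note u = test_functionsD[OF assms(1)]
  show "square_integrable (lebesgue_on D) u"
    by (rule square_integrable_continuous_support[OF smooth_continuous[OF u(1)] u(2) _ assms(2)])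
       (rule spt_notin)
  show "square_integrable (lebesgue_on D) (grad u)"
    by (rule square_integrable_continuous_support[OF continuous_grad[OF u(1)] u(2) _ assms(2)])
       (rule grad_notin_spt)
qed

lemma square_integrable_frechet:
  assumes "u \<in> test_functions D'" "D \<in> sets lebesgue"
  shows "square_integrable (lebesgue_on D) (\<lambda>x. frechet_derivative u (at x) v)"
  using square_integrable_test(1)[OF test_functions_frechet[OF assms(1)] assms(2)] .

lemma square_integrable_component:
  assumes "square_integrable M f"
  shows "square_integrable M (\<lambda>x. f x \<bullet> b)"
proof (rule square_integrable_mono(1)[OF square_integrable_scale[OF assms, of "norm b"]])
  show "(\<lambda>x. f x \<bullet> b) \<in> borel_measurable M"
    using square_integrable_measurable[OF assms] by measurable
  have "norm (f x \<bullet> b) \<le> norm (norm b *\<^sub>R f x)" for x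
    using Cauchy_Schwarz_ineq2[of "f x" b] by (simp add: mult.commute)
  then show "AE x in M. norm (f x \<bullet> b) \<le> norm (norm b *\<^sub>R f x)" by (intro AE_I2)
qed

text \<open>Difference quotients of \<open>w\<close> have integral zero by translation invariance.
  They are bounded and, as the steps are at most 1, supported in one fixed ball, so they converge
  dominatedly to the directional derivative.\<close>

lemma integral_directional_derivative_eq_0:
  assumes w: "w \<in> test_functions D'"
  shows "(LINT x|lborel. grad w x \<bullet> v) = 0"
proof -
  note sm = test_functionsD(1)[OF w]
  have [measurable]: "w \<in> borel_measurable borel" "grad w \<in> borel_measurable borel"
    using sm borel_test_function borel_grad by blast+
  obtain B where B: "B > 0" "\<And>x. norm (grad w x) \<le> B" using grad_bounded[OF w] by metis
  obtain R where R: "\<And>x. x \<in> spt w \<Longrightarrow> norm x \<le> R"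
    using compact_imp_bounded[OF test_functionsD(2)[OF w]] by (auto simp: bounded_iff)
  have w0: "w x = 0" if "norm x > R" for x using R[of x] that spt_notin[of x w] by force
  define h where "h i = inverse (real (Suc i))" for i
  have h: "h i > 0" "h i \<le> 1" for i by (auto simp: h_def inverse_le_1_iff)
  have hlim: "h \<longlonglongrightarrow> 0" unfolding h_def by (rule LIMSEQ_inverse_real_of_nat)
  have intw: "integrable lborel w"
  proof -
    obtain C where "\<And>x. \<bar>w x\<bar> \<le> C" using test_function_bounded[OF w] by metis
    then have "integrable lborel (\<lambda>y. indicator (cball 0 R) y * w y)"
      by (intro integrable_indicator_bounded) auto
    moreover have "(\<lambda>y. indicator (cball 0 R) y * w y) = w"
      using w0 by (fastforce simp: indicator_def)
    ultimately show ?thesis by simp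
  qed
  have z: "(LINT x|lborel. (w (h i *\<^sub>R v + x) - w x) / h i) = 0" for i
  proof -
    have "integrable lborel (\<lambda>x. w (h i *\<^sub>R v + x))"
      using integrable_distr_eq[of "(+) (h i *\<^sub>R v)" lborel borel w] intw by (simp add: lborel_distr_plus)
    then show ?thesis using intw by (simp add: lborel_integral_translate)
  qed
  have "(\<lambda>i. LINT x|lborel. (w (h i *\<^sub>R v + x) - w x) / h i) \<longlonglongrightarrow> (LINT x|lborel. grad w x \<bullet> v)"
  proof (rule integral_dominated_convergence[where w="\<lambda>x. B * norm v * indicator (cball 0 (R + norm v)) x"])
    show "integrable lborel (\<lambda>x. B * norm v * indicat_real (cball 0 (R + norm v)) (x::'a))"
      using emeasure_bounded_finite[of "cball (0::'a) (R + norm v)"] by (auto intro!: integrable_real_indicator)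
    show "AE x in lborel. (\<lambda>i. (w (h i *\<^sub>R v + x) - w x) / h i) \<longlonglongrightarrow> grad w x \<bullet> v"
    proof (rule AE_I2)
      fix x
      have "((\<lambda>t. w (t *\<^sub>R v + x)) has_derivative (\<lambda>t. grad w (0 *\<^sub>R v + x) \<bullet> (t *\<^sub>R v))) (at 0)"
        by (rule has_derivative_compose[OF _ smooth_has_grad[OF sm]]) (auto intro!: derivative_eq_intros)
      then have "((\<lambda>t. w (t *\<^sub>R v + x)) has_field_derivative grad w x \<bullet> v) (at 0)"
        by (simp add: has_field_derivative_def mult.commute[of _ "grad w x \<bullet> v"])
      then have "((\<lambda>t. (w (t *\<^sub>R v + x) - w x) / t) \<longlongrightarrow> grad w x \<bullet> v) (at 0)"
        by (simp add: DERIV_def)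
      then show "(\<lambda>i. (w (h i *\<^sub>R v + x) - w x) / h i) \<longlonglongrightarrow> grad w x \<bullet> v"
        unfolding tendsto_at_iff_sequentially comp_def using hlim h(1) by (auto simp: less_imp_neq[symmetric])
    qed
    show "AE x in lborel. norm ((w (h i *\<^sub>R v + x) - w x) / h i) \<le> B * norm v * indicat_real (cball 0 (R + norm v)) x" for i
    proof (rule AE_I2)
      fix x
      have "\<bar>w (h i *\<^sub>R v + x) - w x\<bar> \<le> h i * (B * norm v)"
        using test_function_lipschitz[OF sm B(2), of "h i *\<^sub>R v + x" x] h(1)[of i] by (simp add: mult_ac)
      moreover have "w (h i *\<^sub>R v + x) = 0" "w x = 0" if "norm x > R + norm v"
      proof -
        have "norm (h i *\<^sub>R v) \<le> norm v" using h[of i] by (simp add: mult_left_le_one_le)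
        then show "w (h i *\<^sub>R v + x) = 0"
          using that norm_diff_ineq[of x "h i *\<^sub>R v"] by (intro w0) (simp add: add.commute)
        show "w x = 0" using that norm_ge_zero[of v] by (intro w0) linarith
      qed
      ultimately show "norm ((w (h i *\<^sub>R v + x) - w x) / h i) \<le> B * norm v * indicat_real (cball 0 (R + norm v)) x"
        using h(1)[of i] by (auto simp: indicator_def field_simps)
    qed
  qed auto
  then have "(\<lambda>i. 0) \<longlonglongrightarrow> (LINT x|lborel. grad w x \<bullet> v)" unfolding z .
  then show ?thesis by (rule LIMSEQ_unique[OF _ tendsto_const])
qed

lemma integral_lebesgue_on_supported:
  fixes f :: "'a::euclidean_space \<Rightarrow> real"
  assumes "f \<in> borel_measurable borel" "\<And>x. x \<notin> D \<Longrightarrow> f x = 0" "D \<in> sets lebesgue"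
  shows "(LINT x|lebesgue_on D. f x) = (LINT x|lborel. f x)"
proof -
  have "(\<lambda>x. indicator D x *\<^sub>R f x) = f" using assms(2) by (auto simp: indicator_def fun_eq_iff)
  then show ?thesis using assms by (subst integral_restrict_space) (auto simp: integral_completion)
qed

text \<open>Integration by parts: the product of \<open>u\<close> with a test function of
  \<open>D\<close> is again one, so its directional derivatives integrate to zero, and the product
  rule splits them.\<close>

lemma has_weak_gradient_smooth:
  assumes D: "open D" and u: "u \<in> test_functions D'"
  shows "has_weak_gradient D u (grad u)"
  unfolding has_weak_gradient_def
proof (intro conjI ballI)
  have Dl: "D \<in> sets lebesgue" using D by auto
  show "square_integrable (lebesgue_on D) (grad u)" by (rule square_integrable_test[OF u Dl])
  fix \<phi> b assume \<phi>: "\<phi> \<in> test_functions D" and "b \<in> (Basis :: 'a set)"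
  note su = test_functionsD(1)[OF u] and s\<phi> = test_functionsD(1)[OF \<phi>]
  have p: "(\<lambda>x. u x * \<phi> x) \<in> test_functions D" by (rule test_functions_mult[OF \<phi> su])
  have i1: "integrable (lebesgue_on D) (\<lambda>x. u x * (grad \<phi> x \<bullet> b))"
    by (intro square_integrable_mult_integrable square_integrable_component square_integrable_test[OF u Dl] square_integrable_test[OF \<phi> Dl])
  have i2: "integrable (lebesgue_on D) (\<lambda>x. (grad u x \<bullet> b) * \<phi> x)"
    by (intro square_integrable_mult_integrable square_integrable_component square_integrable_test[OF u Dl] square_integrable_test[OF \<phi> Dl])
  have "0 = (LINT x|lborel. grad (\<lambda>x. u x * \<phi> x) x \<bullet> b)"
    using integral_directional_derivative_eq_0[OF p] by simp
  also have "\<dots> = (LINT x|lebesgue_on D. grad (\<lambda>x. u x * \<phi> x) x \<bullet> b)"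
  proof (rule integral_lebesgue_on_supported[symmetric])
    show "(\<lambda>x. grad (\<lambda>x. u x * \<phi> x) x \<bullet> b) \<in> borel_measurable borel"
      using borel_grad[OF test_functionsD(1)[OF p]] by measurable
    show "grad (\<lambda>x. u x * \<phi> x) x \<bullet> b = 0" if "x \<notin> D" for x
      using that test_functionsD(3)[OF p] by (subst grad_notin_spt) auto
  qed (rule Dl)
  also have "\<dots> = (LINT x|lebesgue_on D. u x * (grad \<phi> x \<bullet> b) + (grad u x \<bullet> b) * \<phi> x)"
    by (simp add: grad_mult[OF su s\<phi>] inner_add_left mult.commute[of "\<phi> _"])
  also have "\<dots> = (LINT x|lebesgue_on D. u x * (grad \<phi> x \<bullet> b)) + (LINT x|lebesgue_on D. (grad u x \<bullet> b) * \<phi> x)"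
    by (rule Bochner_Integration.integral_add[OF i1 i2])
  finally show "(LINT x|lebesgue_on D. u x * frechet_derivative \<phi> (at x) b) = - (LINT x|lebesgue_on D. (grad u x \<bullet> b) * \<phi> x)"
    by (simp add: smooth_grad_inner[OF s\<phi>])
qed

lemma has_weak_gradient_diff:
  assumes "open D" "has_weak_gradient D \<psi> G" "square_integrable (lebesgue_on D) \<psi>"
    and "has_weak_gradient D u H" "square_integrable (lebesgue_on D) u"
  shows "has_weak_gradient D (\<lambda>x. \<psi> x - u x) (\<lambda>x. G x - H x)"
  unfolding has_weak_gradient_def
proof (intro conjI ballI)
  have Dl: "D \<in> sets lebesgue" using assms(1) by auto
  have G: "square_integrable (lebesgue_on D) G" "square_integrable (lebesgue_on D) H"
    using assms(2,4) by (auto simp: has_weak_gradient_def)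
  show "square_integrable (lebesgue_on D) (\<lambda>x. G x - H x)"
    using G by (rule square_integrable_diff)
  fix \<phi> b assume \<phi>: "\<phi> \<in> test_functions D" and b: "b \<in> (Basis :: 'a set)"
  note i = square_integrable_mult_integrable
  note f = square_integrable_frechet[OF \<phi> Dl, of b] square_integrable_test(1)[OF \<phi> Dl]
  show "(LINT x|lebesgue_on D. (\<psi> x - u x) * frechet_derivative \<phi> (at x) b) =
         - (LINT x|lebesgue_on D. (G x - H x) \<bullet> b * \<phi> x)"
    using assms(2,4) \<phi> b i[OF assms(3) f(1)] i[OF assms(5) f(1)]
      i[OF square_integrable_component[OF G(1)] f(2)] i[OF square_integrable_component[OF G(2)] f(2)]
    by (simp add: left_diff_distrib inner_diff_left has_weak_gradient_def)
qed

section \<open>The fundamental lemma of the calculus of variations and uniqueness of weak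
  gradients\<close>

text \<open>Cutoffs of the neighbourhoods \<open>A j\<close> at their own radius
  \<open>\<delta> j\<close> equal 1 on \<open>K\<close> and vanish at distance more than
  \<open>2 * \<delta> j\<close>. Being bounded by 1, they allow an identity against test functions
  to pass to indicators of compact sets.\<close>

lemma test_functions_approximate_indicator:
  fixes K D :: "'a::euclidean_space set"
  assumes K: "compact K" "K \<subseteq> D" "open D" "K \<noteq> {}"
  obtains \<phi> :: "nat \<Rightarrow> 'a \<Rightarrow> real" where "\<And>j. \<phi> j \<in> test_functions D"
    "\<And>j x. 0 \<le> \<phi> j x" "\<And>j x. \<phi> j x \<le> 1" "\<And>x. (\<lambda>j. \<phi> j x) \<longlonglongrightarrow> indicator K x"
proof -
  obtain C :: real where C: "\<And>(A::'a set) \<delta>. A \<in> sets borel \<Longrightarrow> bounded A \<Longrightarrow> \<delta> > 0 \<Longrightarrow> \<exists>\<eta>. cutoff C A \<delta> \<eta>"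
    by (rule cutoff_exists) blast
  obtain e where e: "e > 0" "(\<Union>x\<in>K. cball x e) \<subseteq> D"
    using compact_subset_open_imp_cball_epsilon_subset[OF K(1,3,2)] by metis
  \<comment> \<open>The largest radius is \<open>e / 2\<close>, so that supports of width
    \<open>2 * \<delta> j\<close> stay in the \<open>e\<close>-neighbourhood of \<open>K\<close>,
    which lies in \<open>D\<close>.\<close>
  define \<delta> where "\<delta> j = e / 2 * inverse (real (Suc j))" for j
  have \<delta>: "\<delta> j > 0" "2 * \<delta> j \<le> e" for j using e(1) by (auto simp: \<delta>_def field_simps)
  define A where "A j = (\<Union>x\<in>K. ball x (\<delta> j))" for j
  have A: "A j \<in> sets borel" "bounded (A j)" for j
  proof -
    have "open (A j)" unfolding A_def by auto
    then show "A j \<in> sets borel" by auto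
    obtain B where B: "\<And>k. k \<in> K \<Longrightarrow> norm k \<le> B"
      using compact_imp_bounded[OF K(1)] by (auto simp: bounded_iff)
    have "norm x \<le> B + \<delta> j" if "x \<in> A j" for x
    proof -
      obtain k where "k \<in> K" "dist k x < \<delta> j" using \<open>x \<in> A j\<close> by (auto simp: A_def)
      then show ?thesis using B[of k] norm_triangle_sub[of x k] by (simp add: dist_norm norm_minus_commute)
    qed
    then show "bounded (A j)" by (auto simp: bounded_iff)
  qed
  define \<phi> where "\<phi> j = (SOME \<eta>. cutoff C (A j) (\<delta> j) \<eta>)" for j
  have c\<phi>: "cutoff C (A j) (\<delta> j) (\<phi> j)" for j
    unfolding \<phi>_def by (rule someI_ex[OF C[OF A[of j] \<delta>(1)[of j]]])
  have \<phi>: "smooth (\<phi> j)" "\<forall>x. 0 \<le> \<phi> j x \<and> \<phi> j x \<le> 1" "\<forall>x. ball x (\<delta> j) \<subseteq> A j \<longrightarrow> \<phi> j x = 1"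
       "\<forall>x. ball x (\<delta> j) \<inter> A j = {} \<longrightarrow> \<phi> j x = 0" for j
    using c\<phi>[of j] unfolding cutoff_def by blast+
  have far: "\<phi> j x = 0" if "infdist x K > 2 * \<delta> j" for j x
  proof -
    have "ball x (\<delta> j) \<inter> A j = {}"
    proof (rule ccontr)
      assume "ball x (\<delta> j) \<inter> A j \<noteq> {}"
      then obtain y k where "dist x y < \<delta> j" "k \<in> K" "dist k y < \<delta> j" by (auto simp: A_def)
      then have "dist x k < 2 * \<delta> j" using dist_triangle[of x k y] by (simp add: dist_commute)
      then show False using infdist_le[OF \<open>k \<in> K\<close>, of x] that by linarith
    qed
    then show ?thesis using \<phi>(4) by blast
  qed
  show ?thesis
  proof (rule that[of \<phi>])
    show "0 \<le> \<phi> j x" "\<phi> j x \<le> 1" for j x using \<phi>(2) by auto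
    show "\<phi> j \<in> test_functions D" for j
    proof (rule test_functionsI[OF \<phi>(1)])
      show "compact {x. infdist x K \<le> 2 * \<delta> j}"
        by (rule compact_infdist_le) (use K \<delta>(1)[of j] in auto)
      show "{x. infdist x K \<le> 2 * \<delta> j} \<subseteq> D"
      proof
        fix x assume x: "x \<in> {x. infdist x K \<le> 2 * \<delta> j}"
        obtain k where "k \<in> K" "infdist x K = dist x k"
          using infdist_attains_inf[OF compact_imp_closed[OF K(1)] K(4)] by metis
        then have "x \<in> cball k e" using x \<delta>(2)[of j] by (simp add: dist_commute)
        then show "x \<in> D" using e(2) \<open>k \<in> K\<close> by blast
      qed
      show "\<phi> j x = 0" if "x \<notin> {x. infdist x K \<le> 2 * \<delta> j}" for x using far that by auto
    qed
    show "(\<lambda>j. \<phi> j x) \<longlonglongrightarrow> indicator K x" for x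
    proof (cases "x \<in> K")
      case True
      then have "ball x (\<delta> j) \<subseteq> A j" for j by (auto simp: A_def)
      then show ?thesis using \<phi>(3) True by simp
    next
      case False
      then have pos: "infdist x K > 0"
        using infdist_pos_not_in_closed[OF compact_imp_closed[OF K(1)] K(4)] by simp
      have "(\<lambda>j. 2 * \<delta> j) \<longlonglongrightarrow> 2 * (e / 2 * 0)"
        unfolding \<delta>_def by (intro tendsto_intros LIMSEQ_inverse_real_of_nat)
      then have "\<forall>\<^sub>F j in sequentially. 2 * \<delta> j < infdist x K"
        using pos by (intro order_tendstoD(2)) auto
      then have "\<forall>\<^sub>F j in sequentially. 0 = \<phi> j x" by eventually_elim (simp add: far)
      then show ?thesis using False by (auto intro: Lim_transform_eventually[OF tendsto_const])
    qed
  qed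
qed

lemma integral_compact_eq_0:
  fixes g :: "'a::euclidean_space \<Rightarrow> real"
  assumes D: "open D" "integrable (lebesgue_on D) g"
    and ort: "\<And>\<phi>. \<phi> \<in> test_functions D \<Longrightarrow> (LINT x|lebesgue_on D. g x * \<phi> x) = 0"
    and K: "compact K" "K \<subseteq> D"
  shows "(LINT x|lebesgue_on D. g x * indicator K x) = 0"
proof (cases "K = {}")
  case False
  obtain \<phi> where \<phi>: "\<And>j. \<phi> j \<in> test_functions D"
    "\<And>j x. 0 \<le> \<phi> j x" "\<And>j x. \<phi> j x \<le> 1" "\<And>x. (\<lambda>j. \<phi> j x) \<longlonglongrightarrow> indicator K x"
    using test_functions_approximate_indicator[OF K D(1) False] by metis
  have [measurable]: "g \<in> borel_measurable (lebesgue_on D)" using D(2) by auto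
  have [measurable]: "\<phi> j \<in> borel_measurable (lebesgue_on D)" for j
    by (intro borel_measurable_lebesgue_on borel_test_function test_functionsD(1)[OF \<phi>(1)])
  have [measurable]: "(indicator K :: _ \<Rightarrow> real) \<in> borel_measurable (lebesgue_on D)"
    using K by (intro borel_measurable_lebesgue_on borel_measurable_indicator borel_compact)
  have "(\<lambda>j. LINT x|lebesgue_on D. g x * \<phi> j x) \<longlonglongrightarrow> (LINT x|lebesgue_on D. g x * indicator K x)"
  proof (rule integral_dominated_convergence[where w="\<lambda>x. \<bar>g x\<bar>"])
    show "AE x in lebesgue_on D. (\<lambda>j. g x * \<phi> j x) \<longlonglongrightarrow> g x * indicator K x"
      by (intro AE_I2 tendsto_intros \<phi>)
    show "AE x in lebesgue_on D. norm (g x * \<phi> j x) \<le> \<bar>g x\<bar>" for j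
      using \<phi>(2,3)[of j] by (intro AE_I2) (auto simp: abs_mult mult_left_le)
  qed (use D in auto)
  then have "(\<lambda>j. 0) \<longlonglongrightarrow> (LINT x|lebesgue_on D. g x * indicator K x)" unfolding ort[OF \<phi>(1)] .
  then show ?thesis by (rule LIMSEQ_unique[OF _ tendsto_const])
qed simp

text \<open>Up to a null set, a Lebesgue measurable set is an F-sigma and hence a countable union of
  compact sets.\<close>

lemma null_if_compact_null:
  assumes "A \<in> sets lebesgue" "\<And>K. compact K \<Longrightarrow> K \<subseteq> A \<Longrightarrow> K \<in> null_sets lebesgue"
  shows "A \<in> null_sets lebesgue"
proof -
  obtain C T where CT: "fsigma C" "T \<in> null_sets lebesgue" "C \<union> T = A"
    using lebesgue_set_almost_fsigma[OF assms(1)] by metis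
  obtain F :: "nat \<Rightarrow> 'a set" where F: "range F \<subseteq> Collect compact" "C = \<Union>(range F)"
    using fsigma_Union_compact[of C] CT(1) by metis
  have "F i \<in> null_sets lebesgue" for i
    using F CT(3) by (intro assms(2)) auto
  then have "C \<in> null_sets lebesgue" unfolding F(2) by (intro null_sets_UN) auto
  then show ?thesis using CT by auto
qed

text \<open>Over a compact subset of the set where \<open>g > 0\<close> the integral of
  \<open>g\<close> vanishes although \<open>g\<close> is positive there; so every such compact set
  is null, and with it the whole set.\<close>

lemma fundamental_lemma_positive_part:
  fixes g :: "'a::euclidean_space \<Rightarrow> real"
  assumes D: "open D" "integrable (lebesgue_on D) g"
    and ort: "\<And>\<phi>. \<phi> \<in> test_functions D \<Longrightarrow> (LINT x|lebesgue_on D. g x * \<phi> x) = 0"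
  shows "AE x in lebesgue_on D. g x \<le> 0"
proof -
  have Dl: "D \<in> sets lebesgue" using D(1) by auto
  have gm: "g \<in> borel_measurable (lebesgue_on D)" using D(2) by auto
  define A where "A = {x \<in> D. g x > 0}"
  have "{x \<in> space (lebesgue_on D). g x > 0} \<in> sets (lebesgue_on D)" using gm by measurable
  then have Al: "A \<in> sets lebesgue" using Dl by (auto simp: A_def sets_restrict_space_iff)
  have "A \<in> null_sets lebesgue"
  proof (rule null_if_compact_null[OF Al])
    fix K assume K: "compact K" "K \<subseteq> A"
    then have KD: "K \<subseteq> D" by (auto simp: A_def)
    have KM: "K \<in> sets (lebesgue_on D)" using K KD Dl by (auto simp: sets_restrict_space_iff lmeasurable_compact fmeasurableD)
    have i: "integrable (lebesgue_on D) (\<lambda>x. g x * indicator K x)"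
      using integrable_mult_indicator[OF KM D(2)] by (simp add: mult.commute)
    have nn: "0 \<le> g x * indicator K x" for x using K(2) by (auto simp: indicator_def A_def)
    have "AE x in lebesgue_on D. g x * indicator K x = 0"
      using integral_nonneg_eq_0_iff_AE[OF i] nn integral_compact_eq_0[OF D ort K(1) KD] by simp
    then have "AE x in lebesgue. x \<notin> K"
      using Dl KD K(2) by (simp add: AE_restrict_space_iff) (auto elim!: eventually_mono simp: A_def indicator_def split: if_splits)
    then show "K \<in> null_sets lebesgue"
      using K(1) by (subst AE_iff_null_sets) (auto simp: lmeasurable_compact fmeasurableD)
  qed
  then have "AE x in lebesgue. x \<notin> A" using AE_not_in by blast
  then show ?thesis using Dl by (auto simp: AE_restrict_space_iff A_def elim!: eventually_mono)
qed

lemma fundamental_lemma: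
  fixes g :: "'a::euclidean_space \<Rightarrow> real"
  assumes D: "open D" "integrable (lebesgue_on D) g"
    and ort: "\<And>\<phi>. \<phi> \<in> test_functions D \<Longrightarrow> (LINT x|lebesgue_on D. g x * \<phi> x) = 0"
  shows "AE x in lebesgue_on D. g x = 0"
proof -
  have "AE x in lebesgue_on D. g x \<le> 0" by (rule fundamental_lemma_positive_part[OF assms])
  moreover have "AE x in lebesgue_on D. - g x \<le> 0"
    by (rule fundamental_lemma_positive_part) (use assms in auto)
  ultimately show ?thesis by eventually_elim auto
qed

lemma weak_gradient_unique:
  fixes u :: "'a::euclidean_space \<Rightarrow> real"
  assumes D: "open D" "bounded D" and G: "has_weak_gradient D u G" "has_weak_gradient D u H"
  shows "AE x in lebesgue_on D. G x = H x"
proof -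
  have Dl: "D \<in> sets lebesgue" using D(1) by auto
  have sq: "square_integrable (lebesgue_on D) G" "square_integrable (lebesgue_on D) H"
    using G by (auto simp: has_weak_gradient_def)
  \<comment> \<open>Boundedness of \<open>D\<close> puts constants into \<open>L2\<close>, which
    turns the square-integrable components into integrable ones, as the fundamental lemma
    asks.\<close>
  have one: "square_integrable (lebesgue_on D) (\<lambda>x. 1::real)"
    using emeasure_bounded_finite[OF D(2)] nn_integral_lebesgue_on[OF Dl, of "\<lambda>_. 1"] D(1)
    by (simp add: square_integrable_iff_nn)
  have "AE x in lebesgue_on D. (G x - H x) \<bullet> b = 0" if b: "b \<in> Basis" for b
  proof (rule fundamental_lemma[OF D(1)])
    note c = square_integrable_component[OF square_integrable_diff[OF sq], of b]
    show "integrable (lebesgue_on D) (\<lambda>x. (G x - H x) \<bullet> b)"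
      using square_integrable_mult_integrable[OF c one] by simp
    fix \<phi> assume \<phi>: "\<phi> \<in> test_functions D"
    note f = square_integrable_test(1)[OF \<phi> Dl]
    note i = square_integrable_mult_integrable[OF square_integrable_component[OF sq(1), of b] f]
      square_integrable_mult_integrable[OF square_integrable_component[OF sq(2), of b] f]
    have "(LINT x|lebesgue_on D. (G x \<bullet> b) * \<phi> x) = (LINT x|lebesgue_on D. (H x \<bullet> b) * \<phi> x)"
      using G \<phi> b by (auto simp: has_weak_gradient_def)
    then show "(LINT x|lebesgue_on D. (G x - H x) \<bullet> b * \<phi> x) = 0"
      using i by (simp add: inner_diff_left left_diff_distrib)
  qed
  then have "AE x in lebesgue_on D. \<forall>b\<in>Basis. (G x - H x) \<bullet> b = 0"
    by (subst AE_finite_all) auto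
  then show ?thesis by eventually_elim (auto simp: inner_diff_left intro: euclidean_eqI)
qed

text \<open>Frees the energy from the choice operator inside \<open>weak_gradient\<close>:
  uniqueness almost everywhere allows any weak gradient to be inserted.\<close>

lemma Dirichlet_energy_eq:
  fixes u :: "'a::euclidean_space \<Rightarrow> real"
  assumes D: "open D" "bounded D" and G: "has_weak_gradient D u G"
  shows "Dirichlet_energy D u = (l2 (lebesgue_on D) G)\<^sup>2"
proof -
  have w: "has_weak_gradient D u (weak_gradient D u)"
    unfolding weak_gradient_def using G by (rule someI[of "has_weak_gradient D u"])
  have "AE x in lebesgue_on D. weak_gradient D u x = G x" by (rule weak_gradient_unique[OF D w G])
  then show ?thesis unfolding Dirichlet_energy_def l2_square
    using w G by (intro integral_cong_AE) (auto simp: has_weak_gradient_def square_integrable_def)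
qed

lemma L2_energy_eq: "L2_energy D u = (l2 (lebesgue_on D) u)\<^sup>2"
  by (simp add: L2_energy_def l2_square)

lemma H1_norm_diff:
  assumes D: "open D" "bounded D"
    and "has_weak_gradient D \<psi> G" "square_integrable (lebesgue_on D) \<psi>"
    and u: "u \<in> test_functions D'"
  shows "(H1_norm D (\<lambda>x. \<psi> x - u x))\<^sup>2
    = (l2 (lebesgue_on D) (\<lambda>x. \<psi> x - u x))\<^sup>2 + (l2 (lebesgue_on D) (\<lambda>x. G x - grad u x))\<^sup>2"
proof -
  have Dl: "D \<in> sets lebesgue" using D(1) by auto
  have "has_weak_gradient D (\<lambda>x. \<psi> x - u x) (\<lambda>x. G x - grad u x)"
    by (rule has_weak_gradient_diff[OF D(1) assms(3,4) has_weak_gradient_smooth[OF D(1) u]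
          square_integrable_test(1)[OF u Dl]])
  then show ?thesis
    using Dirichlet_energy_eq[OF D] by (simp add: H1_norm_def L2_energy_eq)
qed

section \<open>Compactness of bounded sets of test functions\<close>

lemma power2_le_of_abs_le: "\<bar>a\<bar> \<le> b \<Longrightarrow> a\<^sup>2 \<le> (b::real)\<^sup>2"
  using power_mono[of "\<bar>a\<bar>" b 2] by simp

text \<open>The diagonal argument. Division by \<open>\<bar>M x\<bar> + 1\<close> turns bounds that
  depend on the point into the common bound 1 and is undone in the limit.\<close>

lemma pointwise_bounded_convergent_subsequence:
  fixes f :: "nat \<Rightarrow> 'a \<Rightarrow> real"
  assumes "countable S" and M: "\<And>x. x \<in> S \<Longrightarrow> \<exists>M. \<forall>n. \<bar>f n x\<bar> \<le> M"
  obtains r where "strict_mono (r::nat\<Rightarrow>nat)" "\<And>x. x \<in> S \<Longrightarrow> convergent (\<lambda>n. f (r n) x)"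
proof -
  obtain M where M: "\<And>x n. x \<in> S \<Longrightarrow> \<bar>f n x\<bar> \<le> M x" using assms(2) by metis
  have pos: "\<bar>M x\<bar> + 1 > 0" for x by linarith
  obtain r where r: "strict_mono (r::nat\<Rightarrow>nat)"
    "\<And>x. x \<in> S \<Longrightarrow> \<exists>l. (\<lambda>n. f (r n) x / (\<bar>M x\<bar> + 1)) \<longlonglongrightarrow> l"
  proof (rule function_convergent_subsequence[OF assms(1), of "\<lambda>n x. f n x / (\<bar>M x\<bar> + 1)" 1])
    show "norm (f n x / (\<bar>M x\<bar> + 1)) \<le> 1" if "x \<in> S" for n x
      using M[OF that, of n] pos[of x] by (simp add: divide_le_eq)
  qed blast
  have "convergent (\<lambda>n. f (r n) x)" if "x \<in> S" for x
  proof -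
    obtain l where "(\<lambda>n. f (r n) x / (\<bar>M x\<bar> + 1)) \<longlonglongrightarrow> l" using r(2)[OF \<open>x \<in> S\<close>] by blast
    then have "(\<lambda>n. f (r n) x / (\<bar>M x\<bar> + 1) * (\<bar>M x\<bar> + 1)) \<longlonglongrightarrow> l * (\<bar>M x\<bar> + 1)"
      by (rule tendsto_mult_right)
    then show ?thesis using pos[of x] by (auto simp: convergent_def)
  qed
  then show ?thesis using r(1) that by blast
qed

section \<open>Increments along segments and under translations\<close>

text \<open>Cauchy-Schwarz on the segment: with \<open>D\<close> the increment and \<open>f\<close>
  the derivative along \<open>e\<close>, integrating \<open>(t * f s - D)^2 \<ge> 0\<close> over
  \<open>[0, t]\<close> gives \<open>t * (t * J - D^2) \<ge> 0\<close>, where \<open>J\<close> is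
  the integral of \<open>f^2\<close>.\<close>

lemma segment_estimate:
  fixes u :: "'a::euclidean_space \<Rightarrow> real"
  assumes u: "smooth u" and e: "norm e = 1" and t: "0 \<le> t"
  shows "ennreal ((u (x + t *\<^sub>R e) - u x)\<^sup>2)
    \<le> ennreal t * (\<integral>\<^sup>+s. ennreal ((norm (grad u (x + s *\<^sub>R e)))\<^sup>2) * indicator {0..t} s \<partial>lborel)"
proof -
  define f where "f s = grad u (x + s *\<^sub>R e) \<bullet> e" for s
  define D where "D = u (x + t *\<^sub>R e) - u x"
  have cf: "continuous_on A f" for A
    unfolding f_def by (intro continuous_intros continuous_on_compose2[OF continuous_grad[OF u]]) auto
  have "((\<lambda>s. u (x + s *\<^sub>R e)) has_vector_derivative f s) (at s within {0..t})" for s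
  proof -
    have "((\<lambda>s. u (x + s *\<^sub>R e)) has_derivative (\<lambda>r. grad u (x + s *\<^sub>R e) \<bullet> (r *\<^sub>R e))) (at s)"
      by (rule has_derivative_compose[OF _ smooth_has_grad[OF u]]) (auto intro!: derivative_eq_intros)
    then show ?thesis unfolding has_vector_derivative_def f_def
      by (auto intro: has_derivative_at_withinI)
  qed
  then have I1: "(f has_integral D) {0..t}"
    using fundamental_theorem_of_calculus[OF t, of "\<lambda>s. u (x + s *\<^sub>R e)" f] by (simp add: D_def)
  define J where "J = integral {0..t} (\<lambda>s. (f s)\<^sup>2)"
  have I2: "((\<lambda>s. (f s)\<^sup>2) has_integral J) {0..t}"
    unfolding J_def by (intro integrable_integral integrable_continuous_real continuous_intros cf)
  have I3: "((\<lambda>s. D\<^sup>2) has_integral t * D\<^sup>2) {0..t}"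
    using has_integral_const_real[of "D\<^sup>2" 0 t] t by simp
  have "((\<lambda>s. t\<^sup>2 * (f s)\<^sup>2 - 2 * t * D * f s + D\<^sup>2) has_integral t\<^sup>2 * J - 2 * t * D * D + t * D\<^sup>2) {0..t}"
    by (intro has_integral_add has_integral_diff has_integral_mult_right I1 I2 I3)
  moreover have "0 \<le> t\<^sup>2 * (f s)\<^sup>2 - 2 * t * D * f s + D\<^sup>2" for s
  proof -
    have "t\<^sup>2 * (f s)\<^sup>2 - 2 * t * D * f s + D\<^sup>2 = (t * f s - D)\<^sup>2" by (simp add: power2_eq_square algebra_simps)
    then show ?thesis by simp
  qed
  ultimately have "0 \<le> t\<^sup>2 * J - 2 * t * D * D + t * D\<^sup>2" by (rule has_integral_nonneg)
  then have "0 \<le> t * (t * J - D\<^sup>2)" by (simp add: power2_eq_square algebra_simps)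
  then have le: "D\<^sup>2 \<le> t * J"
  proof (cases "t = 0")
    case False
    then show ?thesis using \<open>0 \<le> t * (t * J - D\<^sup>2)\<close> t by (simp add: zero_le_mult_iff)
  qed (simp add: D_def)
  have "J \<ge> 0" unfolding J_def by (intro integral_nonneg has_integral_integrable[OF I2]) auto
  then have "ennreal (D\<^sup>2) \<le> ennreal t * ennreal J" using le t by (simp add: ennreal_mult[symmetric] ennreal_leI)
  also have "ennreal J = (\<integral>\<^sup>+s. ennreal (indicator {0..t} s * (f s)\<^sup>2) \<partial>lborel)"
    by (rule nn_integral_has_integral_lebesgue[OF _ I2, symmetric]) auto
  also have "\<dots> \<le> (\<integral>\<^sup>+s. ennreal ((norm (grad u (x + s *\<^sub>R e)))\<^sup>2) * indicator {0..t} s \<partial>lborel)"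
  proof (rule nn_integral_mono)
    fix s
    have "\<bar>f s\<bar> \<le> norm (grad u (x + s *\<^sub>R e))"
      using Cauchy_Schwarz_ineq2[of "grad u (x + s *\<^sub>R e)" e] e by (simp add: f_def)
    then have "(f s)\<^sup>2 \<le> (norm (grad u (x + s *\<^sub>R e)))\<^sup>2" by (rule power2_le_of_abs_le)
    then show "ennreal (indicator {0..t} s * (f s)\<^sup>2) \<le> ennreal ((norm (grad u (x + s *\<^sub>R e)))\<^sup>2) * indicator {0..t} s"
      by (auto simp: indicator_def intro: ennreal_leI)
  qed
  finally show ?thesis by (simp add: D_def mult_left_mono)
qed

text \<open>The squared increment is at most \<open>t\<close> times an integral over a segment of
  length \<open>t = norm h\<close>. After Tonelli each slice is a translate of the whole energy,
  which supplies the second factor \<open>t\<close>.\<close>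

lemma translation_estimate:
  fixes w :: "'a::euclidean_space \<Rightarrow> real"
  assumes w: "smooth w"
  shows "(\<integral>\<^sup>+x. ennreal ((w (x + h) - w x)\<^sup>2) \<partial>lborel)
    \<le> ennreal ((norm h)\<^sup>2) * (\<integral>\<^sup>+x. ennreal ((norm (grad w x))\<^sup>2) \<partial>lborel)"
proof (cases "h = 0")
  case False
  define t e where "t = norm h" and "e = h /\<^sub>R norm h"
  have te: "t \<ge> 0" "norm e = 1" "h = t *\<^sub>R e" using False by (auto simp: t_def e_def)
  have [measurable]: "grad w \<in> borel_measurable borel" by (rule borel_grad[OF w])
  define g where "g x = ennreal ((norm (grad w x))\<^sup>2)" for x
  have [measurable]: "g \<in> borel_measurable borel" unfolding g_def by measurable
  have "(\<integral>\<^sup>+x. ennreal ((w (x + h) - w x)\<^sup>2) \<partial>lborel)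
    \<le> (\<integral>\<^sup>+x. ennreal t * (\<integral>\<^sup>+s. g (x + s *\<^sub>R e) * indicator {0..t} s \<partial>lborel) \<partial>lborel)"
    using segment_estimate[OF w te(2,1)] by (intro nn_integral_mono) (simp add: te(3) g_def)
  also have "\<dots> = ennreal t * (\<integral>\<^sup>+x. (\<integral>\<^sup>+s. g (x + s *\<^sub>R e) * indicator {0..t} s \<partial>lborel) \<partial>lborel)"
    by (rule nn_integral_cmult) measurable
  also have "(\<integral>\<^sup>+x. (\<integral>\<^sup>+s. g (x + s *\<^sub>R e) * indicator {0..t} s \<partial>lborel) \<partial>lborel)
    = (\<integral>\<^sup>+s. (\<integral>\<^sup>+x. g (x + s *\<^sub>R e) * indicator {0..t} s \<partial>lborel) \<partial>lborel)"
    by (rule lborel_pair.Fubini') measurable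
  also have "\<dots> = (\<integral>\<^sup>+s. (\<integral>\<^sup>+x. g x \<partial>lborel) * indicator {0..t} s \<partial>lborel)"
  proof (rule nn_integral_cong)
    fix s
    have "(\<integral>\<^sup>+x. g (x + s *\<^sub>R e) * indicator {0..t} s \<partial>lborel) = (\<integral>\<^sup>+x. g (s *\<^sub>R e + x) \<partial>lborel) * indicator {0..t} s"
      by (subst nn_integral_multc) (auto simp: add.commute)
    then show "(\<integral>\<^sup>+x. g (x + s *\<^sub>R e) * indicator {0..t} s \<partial>lborel) = (\<integral>\<^sup>+x. g x \<partial>lborel) * indicator {0..t} s"
      by (simp add: lborel_nn_integral_translate)
  qed
  also have "\<dots> = (\<integral>\<^sup>+x. g x \<partial>lborel) * ennreal t"
    using te(1) by (simp add: nn_integral_cmult_indicator)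
  finally show ?thesis
    using te(1) by (simp add: g_def t_def power2_eq_square ennreal_mult mult_ac)
qed simp

section \<open>Lattice cells and an inequality of Rellich type\<close>

text \<open>Labels the half-open cube of side \<open>s\<close> that contains \<open>x\<close> by
  integer coordinates; the corner of the cube is
  \<open>s *\<^sub>R lattice_point s x\<close>.\<close>

definition lattice_point :: "real \<Rightarrow> 'a::euclidean_space \<Rightarrow> 'a" where
  "lattice_point s x = (\<Sum>b\<in>Basis. real_of_int \<lfloor>(x \<bullet> b) / s\<rfloor> *\<^sub>R b)"

definition lattice_cell :: "real \<Rightarrow> 'a::euclidean_space \<Rightarrow> 'a set" where
  "lattice_cell s z = {x. lattice_point s x = z}"

lemma lattice_point_inner: "b \<in> Basis \<Longrightarrow> lattice_point s x \<bullet> b = real_of_int \<lfloor>(x \<bullet> b) / s\<rfloor>"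
  by (simp add: lattice_point_def inner_sum_left_Basis)

lemma measurable_lattice_point[measurable]: "lattice_point s \<in> borel_measurable borel"
  unfolding lattice_point_def[abs_def] by measurable

lemma borel_lattice_cell[measurable]: "lattice_cell s z \<in> sets borel"
proof -
  have "lattice_point s -` {z} \<inter> space borel \<in> sets borel"
    by (rule measurable_sets[OF measurable_lattice_point]) auto
  then show ?thesis by (simp add: lattice_cell_def vimage_def)
qed

lemma lattice_point_dist:
  fixes x y :: "'a::euclidean_space"
  assumes "s > 0" "lattice_point s x = lattice_point s y"
  shows "norm (x - y) \<le> s * real DIM('a)"
proof -
  have "\<bar>(x - y) \<bullet> b\<bar> \<le> s" if "b \<in> Basis" for b
  proof -
    have eq: "\<lfloor>(x \<bullet> b) / s\<rfloor> = \<lfloor>(y \<bullet> b) / s\<rfloor>"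
      using lattice_point_inner[OF that, of s x] lattice_point_inner[OF that, of s y] assms(2) by simp
    have "\<bar>(x \<bullet> b) / s - (y \<bullet> b) / s\<bar> \<le> 1"
      using eq floor_correct[of "(x \<bullet> b) / s"] floor_correct[of "(y \<bullet> b) / s"] by linarith
    then show ?thesis using assms(1) by (simp add: inner_diff_left diff_divide_distrib[symmetric] abs_divide)
  qed
  then have "(\<Sum>b\<in>Basis. \<bar>(x - y) \<bullet> b\<bar>) \<le> (\<Sum>b\<in>(Basis::'a set). s)" by (intro sum_mono)
  then show ?thesis using norm_le_l1[of "x - y"] by (simp add: mult.commute)
qed

lemma finite_lattice_points:
  assumes "bounded B" shows "finite (lattice_point s ` (B :: 'a::euclidean_space set))"
proof -
  obtain R where R: "\<And>x. x \<in> B \<Longrightarrow> norm x \<le> R" using assms by (auto simp: bounded_iff)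
  define N where "N = \<lceil>\<bar>R\<bar> / \<bar>s\<bar>\<rceil> + 1"
  define G where "G k = (\<Sum>b\<in>(Basis::'a set). real_of_int (k b) *\<^sub>R b)" for k :: "'a \<Rightarrow> int"
  have "lattice_point s x \<in> G ` (PiE Basis (\<lambda>_. {-N..N}))" if "x \<in> B" for x
  proof (rule image_eqI[where x="restrict (\<lambda>b. \<lfloor>(x \<bullet> b) / s\<rfloor>) Basis"])
    show "lattice_point s x = G (restrict (\<lambda>b. \<lfloor>(x \<bullet> b) / s\<rfloor>) Basis)"
      by (simp add: G_def lattice_point_def)
    have "\<lfloor>(x \<bullet> b) / s\<rfloor> \<in> {-N..N}" if b: "b \<in> Basis" for b
    proof -
      have "\<bar>x \<bullet> b\<bar> \<le> \<bar>R\<bar>" using Basis_le_norm[OF b, of x] R[OF \<open>x \<in> B\<close>] by linarith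
      then have "\<bar>(x \<bullet> b) / s\<bar> \<le> \<bar>R\<bar> / \<bar>s\<bar>" by (simp add: abs_divide divide_right_mono)
      then show ?thesis unfolding N_def by (simp, linarith)
    qed
    then show "restrict (\<lambda>b. \<lfloor>(x \<bullet> b) / s\<rfloor>) Basis \<in> PiE Basis (\<lambda>_. {-N..N})" by auto
  qed
  then have "lattice_point s ` B \<subseteq> G ` (PiE Basis (\<lambda>_. {-N..N}))" by auto
  then show ?thesis by (rule finite_subset) (intro finite_imageI finite_PiE, auto)
qed

lemma bounded_lattice_cell: "s > 0 \<Longrightarrow> bounded (lattice_cell s (z::'a::euclidean_space))"
proof (cases "lattice_cell s z = {}")
  case False
  assume s: "s > 0"
  obtain y where y: "lattice_point s y = z" using False by (auto simp: lattice_cell_def)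
  have "lattice_cell s z \<subseteq> cball y (s * real DIM('a))"
    using lattice_point_dist[OF s, of y] y by (auto simp: lattice_cell_def dist_norm)
  then show ?thesis by (rule bounded_subset[OF bounded_cball])
qed auto

text \<open>The open box with the same corner lies in the cell. A lower bound is the direction in
  which the cell volume is divided out later.\<close>

lemma measure_lattice_cell_ge:
  fixes y :: "'a::euclidean_space"
  assumes s: "s > 0"
  shows "s ^ DIM('a) \<le> measure lborel (lattice_cell s (lattice_point s y))"
proof -
  define z where "z = lattice_point s y"
  have "x \<in> lattice_cell s z" if x: "x \<in> box (s *\<^sub>R z) (s *\<^sub>R z + s *\<^sub>R One)" for x
  proof -
    have "\<lfloor>(x \<bullet> b) / s\<rfloor> = \<lfloor>(y \<bullet> b) / s\<rfloor>" if b: "b \<in> Basis" for b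
    proof -
      have "s * real_of_int \<lfloor>(y \<bullet> b) / s\<rfloor> < x \<bullet> b" "x \<bullet> b < s * real_of_int \<lfloor>(y \<bullet> b) / s\<rfloor> + s"
        using x b by (auto simp: mem_box inner_add_left z_def lattice_point_inner)
      then show ?thesis using s by (intro floor_unique) (auto simp: field_simps)
    qed
    then show ?thesis by (simp add: lattice_cell_def z_def lattice_point_def)
  qed
  then have "box (s *\<^sub>R z) (s *\<^sub>R z + s *\<^sub>R One) \<subseteq> lattice_cell s z" by auto
  then have "measure lborel (box (s *\<^sub>R z) (s *\<^sub>R z + s *\<^sub>R One)) \<le> measure lborel (lattice_cell s z)"
    using emeasure_bounded_finite[OF bounded_lattice_cell[OF s, of z]]
    by (intro measure_mono_fmeasurable) (auto simp: fmeasurable_def)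
  moreover have "measure lborel (box (s *\<^sub>R z) (s *\<^sub>R z + s *\<^sub>R One)) = s ^ DIM('a)"
    using s by (subst measure_lborel_box) (auto simp: inner_add_left)
  ultimately show ?thesis by (simp add: z_def)
qed

lemma square_integrable_lborel:
  fixes f :: "'a::euclidean_space \<Rightarrow> 'b::euclidean_space"
  assumes "continuous_on UNIV f" "compact S" "\<And>x. x \<notin> S \<Longrightarrow> f x = 0"
  shows "square_integrable lborel f"
proof -
  have f: "f \<in> borel_measurable borel" by (rule borel_measurable_continuous_onI[OF assms(1)])
  have "(\<integral>\<^sup>+x. ennreal ((norm (f x))\<^sup>2) \<partial>lborel) < \<infinity>"
    using square_integrable_continuous_support[OF assms, of UNIV]
    by (simp add: square_integrable_iff_nn nn_integral_lebesgue_on)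
  then show ?thesis using f by (simp add: square_integrable_iff_nn)
qed

lemma square_integrable_lborel_test:
  assumes "u \<in> test_functions D'"
  shows "square_integrable lborel u" "square_integrable lborel (grad u)"
proof -
  note u = test_functionsD[OF assms(1)]
  show "square_integrable lborel u"
    by (rule square_integrable_lborel[OF smooth_continuous[OF u(1)] u(2)]) (rule spt_notin)
  show "square_integrable lborel (grad u)"
    by (rule square_integrable_lborel[OF continuous_grad[OF u(1)] u(2)]) (rule grad_notin_spt)
qed

lemma l2_lebesgue_on_supported:
  fixes f :: "'a::euclidean_space \<Rightarrow> 'b::euclidean_space"
  assumes "f \<in> borel_measurable borel" "\<And>x. x \<notin> D \<Longrightarrow> f x = 0" "D \<in> sets lebesgue"
  shows "l2 (lebesgue_on D) f = l2 lborel f"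
  unfolding l2_def using assms by (subst integral_lebesgue_on_supported) auto

lemma l2_test_functions_lborel:
  assumes "u \<in> test_functions D" "D \<in> sets lebesgue"
  shows "l2 (lebesgue_on D) u = l2 lborel u" "l2 (lebesgue_on D) (grad u) = l2 lborel (grad u)"
proof -
  note u = test_functionsD[OF assms(1)]
  have o: "x \<notin> spt u" if "x \<notin> D" for x using u(3) that by blast
  show "l2 (lebesgue_on D) u = l2 lborel u"
    by (rule l2_lebesgue_on_supported[OF borel_test_function[OF u(1)] _ assms(2)]) (use o spt_notin in blast)
  show "l2 (lebesgue_on D) (grad u) = l2 lborel (grad u)"
    by (rule l2_lebesgue_on_supported[OF borel_grad[OF u(1)] _ assms(2)]) (use o grad_notin_spt in blast)
qed

text \<open>The variance identity on a cell: the two pure squares contribute \<open>V * K\<close>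
  each and the mixed term \<open>2 * J^2\<close>. It trades the deviation from the mean for
  differences of values, which translations control.\<close>

lemma cell_double_integral:
  fixes w :: "'a::euclidean_space \<Rightarrow> real"
  assumes w: "square_integrable lborel w" and Q: "Q \<in> sets borel" "bounded Q"
  defines "J \<equiv> (LINT x|lborel. indicator Q x * w x)" and "K \<equiv> (LINT x|lborel. indicator Q x * (w x)\<^sup>2)"
    and "V \<equiv> measure lborel Q"
  shows "(\<integral>\<^sup>+x. (\<integral>\<^sup>+y. ennreal (indicator Q x * (indicator Q y * (w x - w y)\<^sup>2)) \<partial>lborel) \<partial>lborel)
    = ennreal (2 * V * K - 2 * J\<^sup>2)"
proof -
  have [measurable]: "w \<in> borel_measurable borel" using square_integrable_measurable[OF w] by simp
  note [measurable] = Q(1)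
  have i0: "integrable lborel (indicat_real Q)"
    using emeasure_bounded_finite[OF Q(2)] Q(1) by (auto intro!: integrable_real_indicator)
  have sqI: "square_integrable lborel (indicat_real Q)"
  proof -
    have "(\<lambda>x. (norm (indicat_real Q x))\<^sup>2) = indicat_real Q" by (auto simp: indicator_def)
    then show ?thesis using i0 by (simp add: square_integrable_def)
  qed
  have i1: "integrable lborel (\<lambda>x. indicator Q x * w x)"
    by (rule square_integrable_mult_integrable[OF sqI w])
  have i2: "integrable lborel (\<lambda>x. indicator Q x * (w x)\<^sup>2)"
    using integrable_mult_indicator[of Q lborel "\<lambda>x. (w x)\<^sup>2"] w Q(1) by (simp add: square_integrable_def)
  have V: "(LINT x|lborel. indicat_real Q x) = V" by (simp add: V_def)
  have e: "indicator Q y * (w x - w y)\<^sup>2 = (w x)\<^sup>2 * indicator Q y - 2 * w x * (indicator Q y * w y) + indicator Q y * (w y)\<^sup>2" for x y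
    by (simp add: power2_eq_square algebra_simps)
  have iy: "integrable lborel (\<lambda>y. indicator Q y * (w x - w y)\<^sup>2)" for x
    unfolding e by (intro Bochner_Integration.integrable_add Bochner_Integration.integrable_diff integrable_mult_right i0 i1 i2)
  have inner: "(LINT y|lborel. indicator Q y * (w x - w y)\<^sup>2) = (w x)\<^sup>2 * V - 2 * w x * J + K" for x
    unfolding e using i0 i1 i2 by (simp add: V_def J_def K_def)
  have step: "(\<integral>\<^sup>+y. ennreal (indicator Q x * (indicator Q y * (w x - w y)\<^sup>2)) \<partial>lborel)
    = ennreal (indicator Q x * ((w x)\<^sup>2 * V - 2 * w x * J + K))" for x
    unfolding inner[symmetric]
    using iy[of x] by (subst nn_integral_eq_integral) (auto intro: integrable_mult_right)
  have e2: "indicator Q x * ((w x)\<^sup>2 * V - 2 * w x * J + K)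
      = V * (indicator Q x * (w x)\<^sup>2) - 2 * J * (indicator Q x * w x) + K * indicator Q x" for x
    by (simp add: algebra_simps)
  have ix: "integrable lborel (\<lambda>x. indicator Q x * ((w x)\<^sup>2 * V - 2 * w x * J + K))"
    unfolding e2 by (intro Bochner_Integration.integrable_add Bochner_Integration.integrable_diff integrable_mult_right i0 i1 i2)
  have "(\<integral>\<^sup>+x. ennreal (indicator Q x * ((w x)\<^sup>2 * V - 2 * w x * J + K)) \<partial>lborel)
    = ennreal (LINT x|lborel. indicator Q x * ((w x)\<^sup>2 * V - 2 * w x * J + K))"
  proof (rule nn_integral_eq_integral[OF ix], intro AE_I2)
    fix x
    have "0 \<le> (LINT y|lborel. indicator Q y * (w x - w y)\<^sup>2)" by (intro integral_nonneg_AE AE_I2) auto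
    then show "0 \<le> indicator Q x * ((w x)\<^sup>2 * V - 2 * w x * J + K)" by (simp add: inner)
  qed
  also have "(LINT x|lborel. indicator Q x * ((w x)\<^sup>2 * V - 2 * w x * J + K)) = V * K - 2 * J * J + K * V"
    unfolding e2 using i0 i1 i2 by (simp add: V_def J_def K_def)
  finally show ?thesis unfolding step by (simp add: power2_eq_square algebra_simps)
qed

text \<open>A Poincare inequality summed over the cells. Up to the squared cell integrals, the mass
  of \<open>w\<close> is a double integral of \<open>(w x - w y)^2\<close> over pairs in a common
  cell. Such pairs are at most \<open>R = s * n\<close> apart; admitting all pairs within that
  distance and applying the translation estimate to every \<open>h\<close> in the ball gives
  \<open>R^2\<close> times the energy times the volume of the ball.\<close>

lemma rellich_inequality:
  obtains C where "C > 0" "\<And>s (B::'a::euclidean_space set) w. s > 0 \<Longrightarrow> bounded B \<Longrightarrow> w \<in> test_functions B \<Longrightarrow>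
    (l2 lborel w)\<^sup>2 \<le> (1 / s ^ DIM('a)) * (\<Sum>z\<in>lattice_point s ` B. (LINT x|lborel. indicator (lattice_cell s z) x * w x)\<^sup>2)
      + C * s\<^sup>2 * (l2 lborel (grad w))\<^sup>2"
proof -
  define n where "n = DIM('a)"
  \<comment> \<open>This is \<open>R^2\<close> times the volume of a ball of radius
    \<open>R\<close>, for \<open>R = s * n\<close>, divided by \<open>s ^ n * s^2\<close>.\<close>
  define C where "C = unit_ball_vol (real n) * real n ^ n * (real n)\<^sup>2"
  have n: "n > 0" by (simp add: n_def)
  have C: "C > 0" using n by (simp add: C_def unit_ball_vol_pos)
  show ?thesis
  proof (rule that[of C, OF C])
    fix s :: real and B :: "'a set" and w assume s: "s > 0" and B: "bounded B" and w: "w \<in> test_functions B"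
    define Z where "Z = lattice_point s ` B"
    define R where "R = s * real n"
    have R: "R > 0" using s n by (simp add: R_def)
    have finZ: "finite Z" unfolding Z_def by (rule finite_lattice_points[OF B])
    define Q :: "'a \<Rightarrow> 'a set" where "Q = lattice_cell s"
    note sm = test_functionsD(1)[OF w]
    have [measurable]: "w \<in> borel_measurable borel" "grad w \<in> borel_measurable borel"
      by (rule borel_test_function[OF sm], rule borel_grad[OF sm])
    note sqw = square_integrable_lborel_test[OF w]
    have [measurable]: "cball x R \<in> sets borel" for x :: 'a by simp
    define J where "J z = (LINT x|lborel. indicator (Q z) x * w x)" for z
    define K where "K z = (LINT x|lborel. indicator (Q z) x * (w x)\<^sup>2)" for z
    define V where "V z = measure lborel (Q z)" for z
    have Qm[measurable]: "Q z \<in> sets borel" and Qb: "bounded (Q z)" for z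
      unfolding Q_def using bounded_lattice_cell[OF s] by auto
    define A where "A = (l2 lborel (grad w))\<^sup>2"
    have cell: "(\<integral>\<^sup>+x. (\<integral>\<^sup>+y. ennreal (indicator (Q z) x * (indicator (Q z) y * (w x - w y)\<^sup>2)) \<partial>lborel) \<partial>lborel)
      = ennreal (2 * V z * K z - 2 * (J z)\<^sup>2)" for z
      using cell_double_integral[OF sqw(1) Qm Qb, of z] by (simp add: J_def K_def V_def)
    \<comment> \<open>The cell quantities are differences; only their nonnegativity allows the sum
      over the cells to be moved into \<open>ennreal\<close>.\<close>
    have cell_nonneg: "0 \<le> V z * K z - (J z)\<^sup>2" for z
    proof -
      have sqI: "square_integrable lborel (indicat_real (Q z))"
      proof -
        have "(\<lambda>x. (norm (indicat_real (Q z) x))\<^sup>2) = indicat_real (Q z)" by (auto simp: indicator_def)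
        then show ?thesis using emeasure_bounded_finite[OF Qb, of z]
          by (auto simp: square_integrable_def intro!: integrable_real_indicator)
      qed
      have sqIw: "square_integrable lborel (\<lambda>x. indicator (Q z) x * w x)"
        by (rule square_integrable_mono(1)[OF sqw(1)]) (auto simp: indicator_def)
      have "\<bar>LINT x|lborel. indicator (Q z) x * (indicator (Q z) x * w x)\<bar> \<le> l2 lborel (indicat_real (Q z)) * l2 lborel (\<lambda>x. indicator (Q z) x * w x)"
        by (rule l2_Cauchy_Schwarz[OF sqI sqIw])
      moreover have "(LINT x|lborel. indicator (Q z) x * (indicator (Q z) x * w x)) = J z"
        unfolding J_def by (rule Bochner_Integration.integral_cong) (auto simp: indicator_def)
      ultimately have "(J z)\<^sup>2 \<le> (l2 lborel (indicat_real (Q z)) * l2 lborel (\<lambda>x. indicator (Q z) x * w x))\<^sup>2"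
        by (simp only: power2_le_of_abs_le)
      also have "\<dots> = V z * K z"
      proof -
        have "(l2 lborel (indicat_real (Q z)))\<^sup>2 = V z"
        proof -
          have "(\<lambda>x. (norm (indicat_real (Q z) x))\<^sup>2) = indicat_real (Q z)" by (auto simp: indicator_def)
          then show ?thesis by (simp add: l2_square V_def)
        qed
        moreover have "(l2 lborel (\<lambda>x. indicator (Q z) x * w x))\<^sup>2 = K z"
          unfolding l2_square K_def by (rule Bochner_Integration.integral_cong) (auto simp: indicator_def)
        ultimately show ?thesis by (simp add: power_mult_distrib)
      qed
      finally show ?thesis by simp
    qed
    have "ennreal (\<Sum>z\<in>Z. 2 * V z * K z - 2 * (J z)\<^sup>2) = (\<Sum>z\<in>Z. ennreal (2 * V z * K z - 2 * (J z)\<^sup>2))"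
      using cell_nonneg by (intro sum_ennreal[symmetric]) (simp add: mult.assoc)
    also have "\<dots> = (\<integral>\<^sup>+x. (\<Sum>z\<in>Z. \<integral>\<^sup>+y. ennreal (indicator (Q z) x * (indicator (Q z) y * (w x - w y)\<^sup>2)) \<partial>lborel) \<partial>lborel)"
      unfolding cell[symmetric] by (rule nn_integral_sum[symmetric]) measurable
    also have "\<dots> = (\<integral>\<^sup>+x. (\<integral>\<^sup>+y. (\<Sum>z\<in>Z. ennreal (indicator (Q z) x * (indicator (Q z) y * (w x - w y)\<^sup>2))) \<partial>lborel) \<partial>lborel)"
      by (intro nn_integral_cong nn_integral_sum[symmetric]) measurable
    also have "\<dots> \<le> (\<integral>\<^sup>+x. (\<integral>\<^sup>+y. ennreal (indicator (cball x R) y * (w x - w y)\<^sup>2) \<partial>lborel) \<partial>lborel)"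
    proof (intro nn_integral_mono)
      fix x y :: 'a
      \<comment> \<open>The cells are disjoint, so for a given \<open>x\<close> at most the cell
        with label \<open>lattice_point s x\<close> contributes.\<close>
      have "(\<Sum>z\<in>Z. ennreal (indicator (Q z) x * (indicator (Q z) y * (w x - w y)\<^sup>2)))
        = (\<Sum>z\<in>Z. if z = lattice_point s x then ennreal (indicator (Q z) y * (w x - w y)\<^sup>2) else 0)"
        by (rule sum.cong) (auto simp: Q_def lattice_cell_def indicator_def)
      also have "\<dots> \<le> ennreal (indicator (Q (lattice_point s x)) y * (w x - w y)\<^sup>2)"
        using finZ by (simp add: sum.delta)
      also have "\<dots> \<le> ennreal (indicator (cball x R) y * (w x - w y)\<^sup>2)"
        using lattice_point_dist[OF s, of x y]
        by (auto simp: Q_def lattice_cell_def indicator_def R_def n_def dist_norm)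
      finally show "(\<Sum>z\<in>Z. ennreal (indicator (Q z) x * (indicator (Q z) y * (w x - w y)\<^sup>2)))
        \<le> ennreal (indicator (cball x R) y * (w x - w y)\<^sup>2)" .
    qed
    also have "\<dots> = (\<integral>\<^sup>+x. (\<integral>\<^sup>+h. ennreal (indicator (cball 0 R) h * (w (x + h) - w x)\<^sup>2) \<partial>lborel) \<partial>lborel)"
    proof (rule nn_integral_cong)
      fix x :: 'a
      have "(\<integral>\<^sup>+y. ennreal (indicator (cball x R) y * (w x - w y)\<^sup>2) \<partial>lborel)
        = (\<integral>\<^sup>+h. ennreal (indicator (cball x R) (x + h) * (w x - w (x + h))\<^sup>2) \<partial>lborel)"
        by (rule lborel_nn_integral_translate[symmetric]) measurable
      also have "\<dots> = (\<integral>\<^sup>+h. ennreal (indicator (cball 0 R) h * (w (x + h) - w x)\<^sup>2) \<partial>lborel)"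
        by (rule nn_integral_cong) (auto simp: indicator_def dist_norm power2_commute)
      finally show "(\<integral>\<^sup>+y. ennreal (indicator (cball x R) y * (w x - w y)\<^sup>2) \<partial>lborel)
        = (\<integral>\<^sup>+h. ennreal (indicator (cball 0 R) h * (w (x + h) - w x)\<^sup>2) \<partial>lborel)" .
    qed
    also have "\<dots> = (\<integral>\<^sup>+h. (\<integral>\<^sup>+x. ennreal (indicator (cball 0 R) h * (w (x + h) - w x)\<^sup>2) \<partial>lborel) \<partial>lborel)"
      by (rule lborel_pair.Fubini') measurable
    also have "\<dots> \<le> (\<integral>\<^sup>+h. ennreal (R\<^sup>2 * A) * indicator (cball 0 R) (h::'a) \<partial>lborel)"
    proof (rule nn_integral_mono)
      fix h :: 'a
      show "(\<integral>\<^sup>+x. ennreal (indicator (cball 0 R) h * (w (x + h) - w x)\<^sup>2) \<partial>lborel)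
        \<le> ennreal (R\<^sup>2 * A) * indicator (cball 0 R) h"
      proof (cases "h \<in> cball 0 R")
        case True
        have "(\<integral>\<^sup>+x. ennreal ((w (x + h) - w x)\<^sup>2) \<partial>lborel) \<le> ennreal ((norm h)\<^sup>2) * ennreal A"
          using translation_estimate[OF sm, of h] l2_eq_nn[OF sqw(2)] by (simp add: A_def)
        also have "\<dots> \<le> ennreal (R\<^sup>2 * A)"
          using True by (simp add: A_def ennreal_mult[symmetric] ennreal_leI mult_right_mono power_mono)
        finally show ?thesis using True by simp
      qed simp
    qed
    also have "\<dots> = ennreal (R\<^sup>2 * A) * emeasure lborel (cball (0::'a) R)"
      by (rule nn_integral_cmult_indicator) auto
    also have "\<dots> = ennreal (R\<^sup>2 * A * (unit_ball_vol (real n) * R ^ n))"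
      using emeasure_cball[of R "0::'a"] R by (simp add: n_def A_def ennreal_mult)
    finally have sum: "(\<Sum>z\<in>Z. 2 * V z * K z - 2 * (J z)\<^sup>2) \<le> R\<^sup>2 * A * (unit_ball_vol (real n) * R ^ n)"
      using R by (subst (asm) ennreal_le_iff) (auto simp: A_def)
    have m: "(l2 lborel w)\<^sup>2 = (\<Sum>z\<in>Z. K z)"
    proof -
      have "(\<Sum>z\<in>Z. K z) = (LINT x|lborel. (\<Sum>z\<in>Z. indicator (Q z) x * (w x)\<^sup>2))"
        unfolding K_def
      proof (rule Bochner_Integration.integral_sum[symmetric])
        show "integrable lborel (\<lambda>x. indicator (Q z) x * (w x)\<^sup>2)" for z
          using integrable_mult_indicator[of "Q z" lborel "\<lambda>x. (w x)\<^sup>2"] sqw(1)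
          by (simp add: square_integrable_def)
      qed
      also have "\<dots> = (LINT x|lborel. (norm (w x))\<^sup>2)"
      proof (rule Bochner_Integration.integral_cong)
        fix x
        show "(\<Sum>z\<in>Z. indicator (Q z) x * (w x)\<^sup>2) = (norm (w x))\<^sup>2"
        proof (cases "x \<in> B")
          case True
          have "(\<Sum>z\<in>Z. indicator (Q z) x * (w x)\<^sup>2) = (\<Sum>z\<in>Z. if z = lattice_point s x then (w x)\<^sup>2 else 0)"
            by (rule sum.cong) (auto simp: Q_def lattice_cell_def indicator_def)
          also have "\<dots> = (w x)\<^sup>2" using finZ True by (simp add: sum.delta Z_def)
          finally show ?thesis by simp
        next
          case False
          then have "w x = 0" using test_functionsD(3)[OF w] spt_notin[of x w] by blast
          then show ?thesis by simp
        qed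
      qed simp
      finally show ?thesis by (simp add: l2_square)
    qed
    have "s ^ n * (l2 lborel w)\<^sup>2 \<le> (\<Sum>z\<in>Z. V z * K z)"
      unfolding m sum_distrib_left
    proof (rule sum_mono)
      fix z assume "z \<in> Z"
      then have "s ^ n \<le> V z" unfolding V_def Q_def Z_def n_def using measure_lattice_cell_ge[OF s] by auto
      moreover have "0 \<le> K z" unfolding K_def by (intro integral_nonneg_AE AE_I2) auto
      ultimately show "s ^ n * K z \<le> V z * K z" by (rule mult_right_mono)
    qed
    also have "\<dots> = (\<Sum>z\<in>Z. (2 * V z * K z - 2 * (J z)\<^sup>2) / 2) + (\<Sum>z\<in>Z. (J z)\<^sup>2)"
      unfolding sum.distrib[symmetric] by (rule sum.cong) (auto simp: field_simps)
    also have "(\<Sum>z\<in>Z. (2 * V z * K z - 2 * (J z)\<^sup>2) / 2) = (\<Sum>z\<in>Z. 2 * V z * K z - 2 * (J z)\<^sup>2) / 2"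
      by (simp add: sum_divide_distrib)
    also have "\<dots> \<le> R\<^sup>2 * A * (unit_ball_vol (real n) * R ^ n)"
    proof -
      have "0 \<le> R\<^sup>2 * A * (unit_ball_vol (real n) * R ^ n)" using R by (simp add: A_def)
      then show ?thesis using sum by linarith
    qed
    also have "\<dots> = s ^ n * (C * s\<^sup>2 * A)"
      by (simp add: R_def C_def power_mult_distrib mult_ac)
    finally have "s ^ n * (l2 lborel w)\<^sup>2 \<le> s ^ n * (C * s\<^sup>2 * A + (\<Sum>z\<in>Z. (J z)\<^sup>2) / s ^ n)"
      using s by (simp add: distrib_left)
    then have "(l2 lborel w)\<^sup>2 \<le> C * s\<^sup>2 * A + (\<Sum>z\<in>Z. (J z)\<^sup>2) / s ^ n" using s by simp
    then show "(l2 lborel w)\<^sup>2 \<le> (1 / s ^ DIM('a)) * (\<Sum>z\<in>lattice_point s ` B. (LINT x|lborel. indicator (lattice_cell s z) x * w x)\<^sup>2)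
      + C * s\<^sup>2 * (l2 lborel (grad w))\<^sup>2"
      by (simp add: J_def Q_def Z_def A_def n_def)
  qed
qed

section \<open>Cell integrals and compactness in \<open>L2\<close>\<close>

text \<open>Pairs of a mesh size and a cell label. Restricting to the meshes
  \<open>1 / (j + 1)\<close> keeps the set countable, so that one diagonal subsequence makes all
  cell integrals converge.\<close>

definition cell_index :: "'a::euclidean_space set \<Rightarrow> (real \<times> 'a) set" where
  "cell_index B = (\<Union>j. (\<lambda>z. (inverse (real (Suc j)), z)) ` lattice_point (inverse (real (Suc j))) ` B)"

definition cell_integral :: "('a::euclidean_space \<Rightarrow> real) \<Rightarrow> real \<times> 'a \<Rightarrow> real" where
  "cell_integral w i = (LINT x|lborel. indicator (lattice_cell (fst i) (snd i)) x * w x)"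

lemma countable_cell_index: "bounded B \<Longrightarrow> countable (cell_index B)"
  unfolding cell_index_def
  by (rule countable_UN, simp) (rule countable_finite, rule finite_imageI, rule finite_lattice_points)

lemma cell_index_pos: "i \<in> cell_index B \<Longrightarrow> fst i > 0"
  by (auto simp: cell_index_def)

lemma square_integrable_cell: "s > 0 \<Longrightarrow> square_integrable lborel (indicat_real (lattice_cell s z))"
proof -
  assume s: "s > 0"
  have "(\<lambda>x. (norm (indicat_real (lattice_cell s z) x))\<^sup>2) = indicat_real (lattice_cell s z)"
    by (auto simp: indicator_def)
  then show ?thesis using emeasure_bounded_finite[OF bounded_lattice_cell[OF s, of z]]
    by (auto simp: square_integrable_def intro!: integrable_real_indicator)
qed

lemma cell_integral_diff:
  assumes "fst i > 0" "square_integrable lborel v" "square_integrable lborel w"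
  shows "cell_integral (\<lambda>x. v x - w x) i = cell_integral v i - cell_integral w i"
  unfolding cell_integral_def right_diff_distrib
  by (intro Bochner_Integration.integral_diff square_integrable_mult_integrable square_integrable_cell assms)

lemma cell_integral_bound:
  assumes "fst i > 0" "square_integrable lborel w"
  shows "\<bar>cell_integral w i\<bar> \<le> l2 lborel (indicat_real (lattice_cell (fst i) (snd i))) * l2 lborel w"
  unfolding cell_integral_def by (intro l2_Cauchy_Schwarz square_integrable_cell assms)

text \<open>In the inequality for \<open>w k - w l\<close> the gradient term is made small by the
  choice of the mesh, uniformly in \<open>k\<close> and \<open>l\<close>. For that mesh only
  finitely many cell integrals remain, and each of them converges.\<close>

lemma rellich_Cauchy:
  fixes w :: "nat \<Rightarrow> 'a::euclidean_space \<Rightarrow> real"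
  assumes B: "bounded B" and w: "\<And>k. w k \<in> test_functions B"
    and A: "\<And>k. l2 lborel (grad (w k)) \<le> A"
    and conv: "\<And>i. i \<in> cell_index B \<Longrightarrow> convergent (\<lambda>k. cell_integral (w k) i)"
    and \<epsilon>: "\<epsilon> > 0"
  shows "\<exists>K. \<forall>k\<ge>K. \<forall>l\<ge>K. l2 lborel (\<lambda>x. w k x - w l x) < \<epsilon>"
proof -
  obtain C where C: "C > 0" "\<And>s (B::'a set) w. s > 0 \<Longrightarrow> bounded B \<Longrightarrow> w \<in> test_functions B \<Longrightarrow>
    (l2 lborel w)\<^sup>2 \<le> (1 / s ^ DIM('a)) * (\<Sum>z\<in>lattice_point s ` B. (LINT x|lborel. indicator (lattice_cell s z) x * w x)\<^sup>2)
      + C * s\<^sup>2 * (l2 lborel (grad w))\<^sup>2"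
    by (rule rellich_inequality) blast
  note sq = square_integrable_lborel_test[OF w]
  have A0: "0 \<le> A" using A[of 0] l2_nonneg order_trans by blast
  have gradd: "(l2 lborel (grad (\<lambda>x. w k x - w l x)))\<^sup>2 \<le> (2 * A)\<^sup>2" for k l
  proof (rule power_mono[OF _ l2_nonneg])
    have "l2 lborel (\<lambda>x. grad (w k) x + -1 *\<^sub>R grad (w l) x) \<le> l2 lborel (grad (w k)) + l2 lborel (\<lambda>x. -1 *\<^sub>R grad (w l) x)"
      by (intro l2_triangle square_integrable_scale sq)
    also have "l2 lborel (\<lambda>x. -1 *\<^sub>R grad (w l) x) = l2 lborel (grad (w l))"
      using l2_scale[of lborel "-1" "grad (w l)"] by simp
    also have "l2 lborel (grad (w k)) + l2 lborel (grad (w l)) \<le> 2 * A" using A[of k] A[of l] by simp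
    finally show "l2 lborel (grad (\<lambda>x. w k x - w l x)) \<le> 2 * A"
      by (simp add: grad_diff[OF test_functionsD(1)[OF w] test_functionsD(1)[OF w], abs_def])
  qed
  have "(\<lambda>j. C * (inverse (real (Suc j)))\<^sup>2 * (2 * A)\<^sup>2) \<longlonglongrightarrow> C * 0\<^sup>2 * (2 * A)\<^sup>2"
    by (intro tendsto_intros LIMSEQ_inverse_real_of_nat)
  then have "\<forall>\<^sub>F j in sequentially. C * (inverse (real (Suc j)))\<^sup>2 * (2 * A)\<^sup>2 < \<epsilon>\<^sup>2 / 2"
    using \<epsilon> by (intro order_tendstoD(2)) auto
  then obtain j where j: "C * (inverse (real (Suc j)))\<^sup>2 * (2 * A)\<^sup>2 < \<epsilon>\<^sup>2 / 2"
    by (auto simp: eventually_sequentially)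
  define s where "s = inverse (real (Suc j))"
  have s: "s > 0" by (simp add: s_def)
  define Z where "Z = lattice_point s ` B"
  have finZ: "finite Z" unfolding Z_def by (rule finite_lattice_points[OF B])
  have idx: "(s, z) \<in> cell_index B" if "z \<in> Z" for z
    using that unfolding cell_index_def Z_def s_def by blast
  \<comment> \<open>At most \<open>N\<close> squares of size \<open>\<eta>^2\<close>, divided by
    \<open>s ^ n\<close>, add up to half of \<open>\<epsilon>^2\<close>; the other half is left to
    the gradient. The added 1 avoids division by zero when there are no cells.\<close>
  define N where "N = real (card Z) + 1"
  have N: "N > 0" by (simp add: N_def add_nonneg_pos)
  define \<eta> where "\<eta> = sqrt (s ^ DIM('a) * (\<epsilon>\<^sup>2 / 2) / N)"
  have \<eta>: "\<eta> > 0" "\<eta>\<^sup>2 = s ^ DIM('a) * (\<epsilon>\<^sup>2 / 2) / N" using s \<epsilon> N by (auto simp: \<eta>_def)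
  have "\<forall>z\<in>Z. \<exists>K. \<forall>k\<ge>K. \<forall>l\<ge>K. \<bar>cell_integral (w k) (s, z) - cell_integral (w l) (s, z)\<bar> < \<eta>"
    using CauchyD[OF convergent_Cauchy[OF conv[OF idx]] \<eta>(1)] by simp
  then obtain Kz where "\<forall>z\<in>Z. \<forall>k\<ge>Kz z. \<forall>l\<ge>Kz z. \<bar>cell_integral (w k) (s, z) - cell_integral (w l) (s, z)\<bar> < \<eta>"
    by (rule bchoice[THEN exE])
  then have Kz: "\<And>z k l. z \<in> Z \<Longrightarrow> k \<ge> Kz z \<Longrightarrow> l \<ge> Kz z \<Longrightarrow> \<bar>cell_integral (w k) (s, z) - cell_integral (w l) (s, z)\<bar> < \<eta>"
    by blast
  define K where "K = (\<Sum>z\<in>Z. Kz z)"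
  have KK: "Kz z \<le> K" if "z \<in> Z" for z unfolding K_def using finZ that by (intro member_le_sum) auto
  have "l2 lborel (\<lambda>x. w k x - w l x) < \<epsilon>" if kl: "k \<ge> K" "l \<ge> K" for k l
  proof (rule power2_less_imp_less)
    have d: "(\<lambda>x. w k x - w l x) \<in> test_functions B" by (rule test_functions_diff[OF w w])
    have "(\<Sum>z\<in>Z. (LINT x|lborel. indicator (lattice_cell s z) x * (w k x - w l x))\<^sup>2) \<le> (\<Sum>z\<in>Z. \<eta>\<^sup>2)"
    proof (rule sum_mono)
      fix z assume z: "z \<in> Z"
      have "(LINT x|lborel. indicator (lattice_cell s z) x * (w k x - w l x)) = cell_integral (w k) (s, z) - cell_integral (w l) (s, z)"
        using cell_integral_diff[of "(s, z)" "w k" "w l"] s sq by (simp add: cell_integral_def)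
      moreover have "\<bar>cell_integral (w k) (s, z) - cell_integral (w l) (s, z)\<bar> \<le> \<eta>"
        using Kz[OF z, of k l] KK[OF z] kl by simp
      ultimately show "(LINT x|lborel. indicator (lattice_cell s z) x * (w k x - w l x))\<^sup>2 \<le> \<eta>\<^sup>2"
        by (simp only: power2_le_of_abs_le)
    qed
    also have "\<dots> = real (card Z) * \<eta>\<^sup>2" by simp
    also have "\<dots> \<le> N * \<eta>\<^sup>2" by (intro mult_right_mono) (auto simp: N_def)
    also have "\<dots> = s ^ DIM('a) * (\<epsilon>\<^sup>2 / 2)" using N by (simp add: \<eta>(2))
    finally have 1: "(1 / s ^ DIM('a)) * (\<Sum>z\<in>Z. (LINT x|lborel. indicator (lattice_cell s z) x * (w k x - w l x))\<^sup>2) \<le> \<epsilon>\<^sup>2 / 2"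
      using s by (simp add: field_simps)
    have "(l2 lborel (\<lambda>x. w k x - w l x))\<^sup>2 \<le> (1 / s ^ DIM('a)) * (\<Sum>z\<in>Z. (LINT x|lborel. indicator (lattice_cell s z) x * (w k x - w l x))\<^sup>2)
      + C * s\<^sup>2 * (l2 lborel (grad (\<lambda>x. w k x - w l x)))\<^sup>2"
      unfolding Z_def by (rule C(2)[OF s B d])
    also have "\<dots> \<le> \<epsilon>\<^sup>2 / 2 + C * s\<^sup>2 * (2 * A)\<^sup>2"
      using C(1) by (intro add_mono 1 mult_left_mono gradd) auto
    also have "\<dots> < \<epsilon>\<^sup>2" using j by (simp add: s_def)
    finally show "(l2 lborel (\<lambda>x. w k x - w l x))\<^sup>2 < \<epsilon>\<^sup>2" .
  qed (use \<epsilon> in simp)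
  then show ?thesis by blast
qed

section \<open>Hausdorff measure\<close>

lemma hausdorff_premeasure_le:
  assumes "A \<subseteq> (\<Union>i. C i)" "\<And>i. bounded (C i)" "\<And>i. diameter (C i) \<le> \<delta>"
  shows "hausdorff_premeasure k \<delta> A \<le> (\<Sum>i. hausdorff_gauge k (C i))"
  unfolding hausdorff_premeasure_def using assms by (intro INF_lower) auto

lemma hausdorff_premeasure_greatest:
  assumes "\<And>C. A \<subseteq> (\<Union>i. C i) \<Longrightarrow> (\<And>i. bounded (C i)) \<Longrightarrow> (\<And>i. diameter (C i) \<le> \<delta>)
    \<Longrightarrow> x \<le> (\<Sum>i. hausdorff_gauge k (C i))"
  shows "x \<le> hausdorff_premeasure k \<delta> A"
  unfolding hausdorff_premeasure_def by (intro INF_greatest) (auto intro: assms)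

lemma hausdorff_premeasure_mono:
  "A \<subseteq> B \<Longrightarrow> hausdorff_premeasure k \<delta> A \<le> hausdorff_premeasure k \<delta> B"
  by (rule hausdorff_premeasure_greatest, rule hausdorff_premeasure_le) auto

lemma hausdorff_premeasure_antimono:
  assumes "\<delta> \<le> \<delta>'" shows "hausdorff_premeasure k \<delta>' A \<le> hausdorff_premeasure k \<delta> A"
proof (rule hausdorff_premeasure_greatest)
  fix C :: "nat \<Rightarrow> 'a set"
  assume "A \<subseteq> (\<Union>i. C i)" "\<And>i. bounded (C i)" and d: "\<And>i. diameter (C i) \<le> \<delta>"
  then show "hausdorff_premeasure k \<delta>' A \<le> (\<Sum>i. hausdorff_gauge k (C i))"
    by (intro hausdorff_premeasure_le) (auto intro: order_trans[OF d assms])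
qed

lemma hausdorff_premeasure_empty: "\<delta> > 0 \<Longrightarrow> hausdorff_premeasure k \<delta> {} = 0"
  using hausdorff_premeasure_le[of "{}" "\<lambda>_. {}" \<delta> k] by (simp add: hausdorff_gauge_def)

text \<open>The usual argument with an error \<open>e / 2 ^ (i + 1)\<close> for the
  \<open>i\<close>-th set; \<open>prod_decode\<close> merges the countably many covers into a single
  sequence.\<close>

lemma hausdorff_premeasure_countably_subadditive:
  fixes A :: "nat \<Rightarrow> 'a::metric_space set"
  shows "hausdorff_premeasure k \<delta> (\<Union>i. A i) \<le> (\<Sum>i. hausdorff_premeasure k \<delta> (A i))"
proof (rule ennreal_le_epsilon)
  fix e :: real assume fin: "(\<Sum>i. hausdorff_premeasure k \<delta> (A i)) < top" and e: "e > 0"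
  have "\<exists>C. A i \<subseteq> (\<Union>j. C j) \<and> (\<forall>j. bounded (C j) \<and> diameter (C j) \<le> \<delta>)
      \<and> (\<Sum>j. hausdorff_gauge k (C j)) \<le> hausdorff_premeasure k \<delta> (A i) + ennreal (e * (1/2) ^ Suc i)" for i
  proof -
    have "hausdorff_premeasure k \<delta> (A i) < top"
      using sum_le_suminf[OF summableI, of "{i}" "\<lambda>i. hausdorff_premeasure k \<delta> (A i)"] fin
      by (auto intro: le_less_trans)
    then have "hausdorff_premeasure k \<delta> (A i) < hausdorff_premeasure k \<delta> (A i) + ennreal (e * (1/2) ^ Suc i)"
      using e by (simp add: ennreal_add_left_cancel_less[of _ 0, simplified])
    then show ?thesis
      unfolding hausdorff_premeasure_def[of k \<delta> "A i"] INF_less_iff by (auto intro: less_imp_le)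
  qed
  then have "\<forall>i. \<exists>C. A i \<subseteq> (\<Union>j. C j) \<and> (\<forall>j. bounded (C j) \<and> diameter (C j) \<le> \<delta>)
      \<and> (\<Sum>j. hausdorff_gauge k (C j)) \<le> hausdorff_premeasure k \<delta> (A i) + ennreal (e * (1/2) ^ Suc i)" ..
  from choice[OF this] obtain C where C: "\<And>i. A i \<subseteq> (\<Union>j. C i j)" "\<And>i j. bounded (C i j)" "\<And>i j. diameter (C i j) \<le> \<delta>"
      "\<And>i. (\<Sum>j. hausdorff_gauge k (C i j)) \<le> hausdorff_premeasure k \<delta> (A i) + ennreal (e * (1/2) ^ Suc i)"
    by blast
  define D where "D m = C (fst (prod_decode m)) (snd (prod_decode m))" for m
  have "hausdorff_premeasure k \<delta> (\<Union>i. A i) \<le> (\<Sum>m. hausdorff_gauge k (D m))"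
  proof (rule hausdorff_premeasure_le)
    show "(\<Union>i. A i) \<subseteq> (\<Union>m. D m)"
    proof
      fix x assume "x \<in> (\<Union>i. A i)"
      then obtain i j where "x \<in> C i j" using C(1) by blast
      then have "x \<in> D (prod_encode (i, j))" by (simp add: D_def)
      then show "x \<in> (\<Union>m. D m)" by blast
    qed
  qed (auto simp: D_def C)
  also have "\<dots> = (\<Sum>i. \<Sum>j. hausdorff_gauge k (C i j))"
    using suminf_ennreal_2dimen[of "\<lambda>i. \<Sum>j. hausdorff_gauge k (C i j)" "\<lambda>(i,j). hausdorff_gauge k (C i j)"]
    by (simp add: D_def case_prod_beta)
  also have "\<dots> \<le> (\<Sum>i. hausdorff_premeasure k \<delta> (A i) + ennreal (e * (1/2) ^ Suc i))"
    by (intro suminf_le C summableI)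
  also have "\<dots> = (\<Sum>i. hausdorff_premeasure k \<delta> (A i)) + (\<Sum>i. ennreal (e * (1/2) ^ Suc i))"
    by (rule suminf_add[symmetric]) auto
  also have "(\<Sum>i. ennreal (e * (1/2) ^ Suc i)) = ennreal e"
  proof -
    have "(\<lambda>i. e * (1/2) ^ Suc i) sums (e * 1)" by (intro sums_mult power_half_series)
    then show ?thesis using e by (intro sums_unique[symmetric]) (simp add: sums_ennreal del: power_Suc)
  qed
  finally show "hausdorff_premeasure k \<delta> (\<Union>i. A i) \<le> (\<Sum>i. hausdorff_premeasure k \<delta> (A i)) + ennreal e" .
qed

lemma hausdorff_premeasure_le_outer:
  "\<delta> > 0 \<Longrightarrow> hausdorff_premeasure k \<delta> A \<le> hausdorff_outer_measure k A"
  unfolding hausdorff_outer_measure_def by (rule SUP_upper) auto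

lemma hausdorff_outer_mono:
  "A \<subseteq> B \<Longrightarrow> hausdorff_outer_measure k A \<le> hausdorff_outer_measure k B"
  unfolding hausdorff_outer_measure_def by (intro SUP_mono) (auto intro: hausdorff_premeasure_mono)

lemma hausdorff_outer_empty: "hausdorff_outer_measure k ({} :: 'a::metric_space set) = 0"
proof -
  have "hausdorff_outer_measure k ({} :: 'a set) \<le> 0"
    unfolding hausdorff_outer_measure_def by (rule SUP_least) (auto simp: hausdorff_premeasure_empty)
  then show ?thesis by simp
qed

lemma hausdorff_outer_countably_subadditive:
  "hausdorff_outer_measure k (\<Union>i. A i) \<le> (\<Sum>i. hausdorff_outer_measure k (A i))"
  unfolding hausdorff_outer_measure_def[of k "\<Union>i. A i"]
proof (rule SUP_least)
  fix \<delta> :: real assume "\<delta> \<in> {0<..}"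
  then show "hausdorff_premeasure k \<delta> (\<Union>i. A i) \<le> (\<Sum>i. hausdorff_outer_measure k (A i))"
    by (intro order_trans[OF hausdorff_premeasure_countably_subadditive] suminf_le
        hausdorff_premeasure_le_outer summableI) auto
qed

lemma hausdorff_outer_space: "outer_measure_space (Pow UNIV) (hausdorff_outer_measure k)"
  by (auto simp: outer_measure_space_def positive_def increasing_def countably_subadditive_def
      hausdorff_outer_empty intro: hausdorff_outer_mono hausdorff_outer_countably_subadditive)

lemma hausdorff_outer_subadditive:
  "hausdorff_outer_measure k (A \<union> B) \<le> hausdorff_outer_measure k A + hausdorff_outer_measure k B"
proof -
  have "hausdorff_outer_measure k (\<Union>i. binaryset A B i) \<le> (\<Sum>i. hausdorff_outer_measure k (binaryset A B i))"
    by (rule hausdorff_outer_countably_subadditive)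
  then show ?thesis
    by (simp add: UN_binaryset_eq suminf_binaryset_eq[of "hausdorff_outer_measure k", OF hausdorff_outer_empty])
qed

section \<open>Additivity on separated sets and measurability of Borel sets\<close>

text \<open>No set of diameter below \<open>d\<close> meets both \<open>A\<close> and
  \<open>B\<close>, so a fine cover of the union splits into a cover of \<open>A\<close> and a cover
  of \<open>B\<close> without using any set twice.\<close>

lemma hausdorff_outer_separated:
  fixes A B :: "'a::metric_space set"
  assumes d: "d > 0" "\<And>x y. x \<in> A \<Longrightarrow> y \<in> B \<Longrightarrow> d \<le> dist x y"
  shows "hausdorff_outer_measure k A + hausdorff_outer_measure k B \<le> hausdorff_outer_measure k (A \<union> B)"
proof -
  have small: "hausdorff_premeasure k \<delta> A + hausdorff_premeasure k \<delta> B \<le> hausdorff_premeasure k \<delta> (A \<union> B)"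
    if \<delta>: "\<delta> > 0" "\<delta> < d" for \<delta>
  proof (rule hausdorff_premeasure_greatest)
    fix C :: "nat \<Rightarrow> 'a set"
    assume C: "A \<union> B \<subseteq> (\<Union>i. C i)" "\<And>i. bounded (C i)" "\<And>i. diameter (C i) \<le> \<delta>"
    define CA where "CA i = (if C i \<inter> A \<noteq> {} then C i else {})" for i
    define CB where "CB i = (if C i \<inter> B \<noteq> {} then C i else {})" for i
    have "hausdorff_premeasure k \<delta> A \<le> (\<Sum>i. hausdorff_gauge k (CA i))"
      using C \<delta>(1) by (intro hausdorff_premeasure_le) (auto simp: CA_def, blast)
    moreover have "hausdorff_premeasure k \<delta> B \<le> (\<Sum>i. hausdorff_gauge k (CB i))"
      using C \<delta>(1) by (intro hausdorff_premeasure_le) (auto simp: CB_def, blast)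
    ultimately have "hausdorff_premeasure k \<delta> A + hausdorff_premeasure k \<delta> B
      \<le> (\<Sum>i. hausdorff_gauge k (CA i)) + (\<Sum>i. hausdorff_gauge k (CB i))" by (rule add_mono)
    also have "\<dots> = (\<Sum>i. hausdorff_gauge k (CA i) + hausdorff_gauge k (CB i))"
      by (rule suminf_add) auto
    also have "\<dots> \<le> (\<Sum>i. hausdorff_gauge k (C i))"
    proof (intro suminf_le summableI)
      fix i
      have "\<not> (C i \<inter> A \<noteq> {} \<and> C i \<inter> B \<noteq> {})"
      proof
        assume "C i \<inter> A \<noteq> {} \<and> C i \<inter> B \<noteq> {}"
        then obtain x y where xy: "x \<in> C i" "x \<in> A" "y \<in> C i" "y \<in> B" by blast
        then have "dist x y \<le> \<delta>" using diameter_bounded_bound[OF C(2) xy(1,3)] C(3)[of i] by linarith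
        then show False using d(2)[OF xy(2,4)] \<delta>(2) by linarith
      qed
      then show "hausdorff_gauge k (CA i) + hausdorff_gauge k (CB i) \<le> hausdorff_gauge k (C i)"
        by (auto simp: CA_def CB_def hausdorff_gauge_def)
    qed
    finally show "hausdorff_premeasure k \<delta> A + hausdorff_premeasure k \<delta> B \<le> (\<Sum>i. hausdorff_gauge k (C i))" .
  qed
  \<comment> \<open>Independent scales for \<open>A\<close> and \<open>B\<close> allow the two
    suprema to be taken one after the other.\<close>
  have two: "hausdorff_premeasure k \<delta>1 A + hausdorff_premeasure k \<delta>2 B \<le> hausdorff_outer_measure k (A \<union> B)"
    if "\<delta>1 > 0" "\<delta>2 > 0" for \<delta>1 \<delta>2
  proof -
    define \<delta> where "\<delta> = min (min \<delta>1 \<delta>2) (d/2)"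
    have \<delta>: "\<delta> > 0" "\<delta> < d" "\<delta> \<le> \<delta>1" "\<delta> \<le> \<delta>2" using that d(1) by (auto simp: \<delta>_def)
    have "hausdorff_premeasure k \<delta>1 A + hausdorff_premeasure k \<delta>2 B \<le> hausdorff_premeasure k \<delta> A + hausdorff_premeasure k \<delta> B"
      by (intro add_mono hausdorff_premeasure_antimono \<delta>)
    also have "\<dots> \<le> hausdorff_outer_measure k (A \<union> B)"
      using small[OF \<delta>(1,2)] hausdorff_premeasure_le_outer[OF \<delta>(1)] order_trans by blast
    finally show ?thesis .
  qed
  have "hausdorff_premeasure k \<delta>1 A + hausdorff_outer_measure k B \<le> hausdorff_outer_measure k (A \<union> B)" if "\<delta>1 > 0" for \<delta>1
    unfolding hausdorff_outer_measure_def[of k B] add.commute[of "hausdorff_premeasure k \<delta>1 A"]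
    using two[OF that] by (subst ennreal_SUP_add_left[symmetric]) (auto intro!: SUP_least simp: add.commute)
  then show ?thesis
    unfolding hausdorff_outer_measure_def[of k A]
    by (subst ennreal_SUP_add_left[symmetric]) (auto intro!: SUP_least)
qed

text \<open>The shells \<open>R j\<close> of a set around a closed set \<open>F\<close> are pairwise far apart when
  their indices are not adjacent, so both the even and the odd shells have summable outer measure.\<close>

lemma hausdorff_outer_closed_superadditive:
  fixes F E :: "'a::metric_space set"
  assumes F: "closed F" "F \<noteq> {}" and fin: "hausdorff_outer_measure k E < top"
  shows "hausdorff_outer_measure k (E \<inter> F) + hausdorff_outer_measure k (E - F) \<le> hausdorff_outer_measure k E"
proof -
  define \<mu> :: "'a set \<Rightarrow> ennreal" where "\<mu> = hausdorff_outer_measure k"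
  have mono: "A \<subseteq> B \<Longrightarrow> \<mu> A \<le> \<mu> B" for A B unfolding \<mu>_def by (rule hausdorff_outer_mono)
  define a where "a j = 1 / real (Suc j)" for j
  have a: "a j > 0" "i < j \<Longrightarrow> a j < a i" for i j by (auto simp: a_def frac_less2)
  define G where "G j = {x \<in> E - F. infdist x F \<ge> a j}" for j
  define R where "R j = G (Suc j) - G j" for j
  have Rsep: "a (Suc i) - a j \<le> dist x y" if "x \<in> R i" "y \<in> R j" for i j x y
    using that infdist_triangle[of x F y] by (auto simp: R_def G_def)
  have parity: "(\<Sum>i<n. \<mu> (R (2 * i + c))) \<le> \<mu> (\<Union>i<n. R (2 * i + c))" for n c
  proof (induction n)
    case 0
    show ?case by (simp add: \<mu>_def hausdorff_outer_empty)
  next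
    case (Suc n)
    have "(\<Sum>i<Suc n. \<mu> (R (2 * i + c))) \<le> \<mu> (\<Union>i<n. R (2 * i + c)) + \<mu> (R (2 * n + c))"
      using Suc by (simp add: add_right_mono)
    also have "\<dots> \<le> \<mu> ((\<Union>i<n. R (2 * i + c)) \<union> R (2 * n + c))"
      unfolding \<mu>_def
    \<comment> \<open>For \<open>n = 0\<close> the union is empty and any positive distance serves;
      the separate value also avoids the truncated subtraction \<open>2 * n + c - 1\<close>.\<close>
    proof (rule hausdorff_outer_separated[where d="if n = 0 then 1 else a (2 * n + c - 1) - a (2 * n + c)"])
      show "0 < (if n = 0 then 1 else a (2 * n + c - 1) - a (2 * n + c))" using a(2)[of "2 * n + c - 1" "2 * n + c"] by auto
      fix x y assume "x \<in> (\<Union>i<n. R (2 * i + c))" and y: "y \<in> R (2 * n + c)"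
      then obtain i where i: "i < n" "x \<in> R (2 * i + c)" by auto
      have "a (2 * n + c - 1) \<le> a (Suc (2 * i + c))"
      proof -
        have "Suc (2 * i + c) \<le> 2 * n + c - 1" using i(1) by arith
        then show ?thesis using a(2)[of "Suc (2 * i + c)" "2 * n + c - 1"] by (auto simp: le_less)
      qed
      then show "(if n = 0 then 1 else a (2 * n + c - 1) - a (2 * n + c)) \<le> dist x y"
        using Rsep[OF i(2) y] i(1) by auto
    qed
    also have "(\<Union>i<n. R (2 * i + c)) \<union> R (2 * n + c) = (\<Union>i<Suc n. R (2 * i + c))"
      by (auto simp: lessThan_Suc)
    finally show ?case .
  qed
  have RE: "(\<Union>i<n. R (2 * i + c)) \<subseteq> E" for n c by (auto simp: R_def G_def)
  have sums: "(\<Sum>i<n. \<mu> (R i)) \<le> \<mu> E + \<mu> E" for n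
  proof -
    have "(\<Sum>i<n. \<mu> (R i)) \<le> (\<Sum>i<2*n. \<mu> (R i))" by (rule sum_mono2) auto
    also have "\<dots> = (\<Sum>i<n. \<mu> (R (2 * i + 0))) + (\<Sum>i<n. \<mu> (R (2 * i + 1)))"
      by (induction n) (auto simp: algebra_simps)
    also have "\<dots> \<le> \<mu> E + \<mu> E"
      by (intro add_mono order_trans[OF parity] mono RE)
    finally show ?thesis .
  qed
  have "(\<Sum>i. \<mu> (R i)) \<le> \<mu> E + \<mu> E" by (rule suminf_le_const[OF summableI sums])
  also have "\<dots> < top" using fin by (simp add: \<mu>_def)
  finally have sfin: "(\<Sum>i. \<mu> (R i)) < top" .
  define r where "r i = enn2real (\<mu> (R i))" for i
  have r: "\<mu> (R i) = ennreal (r i)" "r i \<ge> 0" for i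
  proof -
    have "\<mu> (R i) \<le> (\<Sum>i. \<mu> (R i))" using sum_le_suminf[OF summableI, of "{i}" "\<lambda>i. \<mu> (R i)"] by simp
    then show "\<mu> (R i) = ennreal (r i)" using sfin by (simp add: r_def le_less_trans)
  qed (simp add: r_def)
  have summ: "summable r"
    using sfin r(2) unfolding r(1) by (intro summable_suminf_not_top) auto
  \<comment> \<open>A point outside the closed set \<open>F\<close> has positive distance from it
    and thus belongs to some \<open>G m\<close>. If the least such index exceeds \<open>n\<close>,
    it picks out the shell that contains the point.\<close>
  have tail: "\<mu> (E - F) \<le> \<mu> (G n) + ennreal (\<Sum>i. r (i + n))" for n
  proof -
    have "E - F \<subseteq> G n \<union> (\<Union>i. R (i + n))"
    proof
      fix x assume x: "x \<in> E - F"
      then have "infdist x F > 0" using infdist_pos_not_in_closed[OF F] by auto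
      then obtain m where "a m < infdist x F" using reals_Archimedean by (auto simp: a_def divide_inverse)
      then have ex: "x \<in> G m" using x by (auto simp: G_def)
      define j where "j = (LEAST j. x \<in> G j)"
      have j: "x \<in> G j" "\<And>i. i < j \<Longrightarrow> x \<notin> G i"
        unfolding j_def using LeastI[of "\<lambda>j. x \<in> G j", OF ex] not_less_Least by auto
      show "x \<in> G n \<union> (\<Union>i. R (i + n))"
      proof (cases "j \<le> n")
        case True
        have "a n \<le> a j" using True a(2)[of j n] by (cases "j = n") auto
        then show ?thesis using j(1) by (auto simp: G_def)
      next
        case False
        then obtain i where i: "j = Suc (i + n)" using less_imp_Suc_add[of n j] by (auto simp: add.commute)
        then have "x \<in> R (i + n)" using j by (auto simp: R_def)
        then show ?thesis by blast
      qed
    qed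
    then have "\<mu> (E - F) \<le> \<mu> (G n \<union> (\<Union>i. R (i + n)))" by (rule mono)
    also have "\<dots> \<le> \<mu> (G n) + \<mu> (\<Union>i. R (i + n))"
      unfolding \<mu>_def by (rule hausdorff_outer_subadditive)
    also have "\<mu> (\<Union>i. R (i + n)) \<le> (\<Sum>i. \<mu> (R (i + n)))"
      unfolding \<mu>_def by (rule hausdorff_outer_countably_subadditive)
    also have "(\<Sum>i. \<mu> (R (i + n))) = ennreal (\<Sum>i. r (i + n))"
      unfolding r(1) using summ r(2) by (intro suminf_ennreal2) (auto simp: summable_iff_shift)
    finally show ?thesis by (simp add: add_left_mono)
  qed
  have near: "\<mu> (E \<inter> F) + \<mu> (G n) \<le> \<mu> E" for n
  proof -
    have "\<mu> (E \<inter> F) + \<mu> (G n) \<le> \<mu> (E \<inter> F \<union> G n)"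
      unfolding \<mu>_def
    proof (rule hausdorff_outer_separated[OF a(1)[of n]])
      fix x y assume "x \<in> E \<inter> F" "y \<in> G n"
      then show "a n \<le> dist x y" using infdist_le[of x F y] by (auto simp: G_def dist_commute)
    qed
    also have "\<dots> \<le> \<mu> E" by (rule mono) (auto simp: G_def)
    finally show ?thesis .
  qed
  show ?thesis
  proof (rule ennreal_le_epsilon)
    fix e :: real assume "0 < e"
    then obtain n where "\<bar>\<Sum>i. r (i + n)\<bar> < e"
      using suminf_exist_split[OF \<open>0 < e\<close> summ] by auto
    then have n: "ennreal (\<Sum>i. r (i + n)) \<le> ennreal e" by (intro ennreal_leI) simp
    have "\<mu> (E \<inter> F) + \<mu> (E - F) \<le> \<mu> (E \<inter> F) + (\<mu> (G n) + ennreal e)"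
      by (intro add_left_mono order_trans[OF tail[of n]] n)
    also have "\<dots> \<le> \<mu> E + ennreal e" unfolding add.assoc[symmetric] by (intro add_right_mono near)
    finally show "hausdorff_outer_measure k (E \<inter> F) + hausdorff_outer_measure k (E - F)
      \<le> hausdorff_outer_measure k E + ennreal e" by (simp add: \<mu>_def)
  qed
qed

text \<open>Without countable additivity, \<^const>\<open>measure_of\<close> would return the zero measure.\<close>

lemma hausdorff_measure_space:
  "measure_space UNIV (sets borel) (hausdorff_outer_measure k :: 'a::metric_space set \<Rightarrow> ennreal)"
proof -
  interpret P: sigma_algebra "UNIV :: 'a set" "Pow UNIV" by (rule sigma_algebra_Pow)
  let ?L = "lambda_system UNIV (Pow UNIV) (hausdorff_outer_measure k :: 'a set \<Rightarrow> ennreal)"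
  have ms: "measure_space UNIV ?L (hausdorff_outer_measure k)"
    by (rule P.caratheodory_lemma[OF hausdorff_outer_space])
  then have sa: "sigma_algebra UNIV ?L" by (simp add: measure_space_def)
  have cl: "F \<in> ?L" if F: "closed F" for F :: "'a set"
  proof -
    have "hausdorff_outer_measure k (E \<inter> F) + hausdorff_outer_measure k (E - F) = hausdorff_outer_measure k E" for E
    proof (rule antisym)
      show "hausdorff_outer_measure k E \<le> hausdorff_outer_measure k (E \<inter> F) + hausdorff_outer_measure k (E - F)"
        using hausdorff_outer_subadditive[of k "E \<inter> F" "E - F"] by (simp add: Int_Diff_Un)
      show "hausdorff_outer_measure k (E \<inter> F) + hausdorff_outer_measure k (E - F) \<le> hausdorff_outer_measure k E"
      proof (cases "F = {} \<or> hausdorff_outer_measure k E = top")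
        case False
        then show ?thesis using F by (intro hausdorff_outer_closed_superadditive) (auto simp: top.not_eq_extremum)
      qed (auto simp: hausdorff_outer_empty)
    qed
    then show ?thesis unfolding P.lambda_system_eq by simp
  qed
  have "sigma_sets UNIV (Collect closed) \<subseteq> ?L"
    by (rule sigma_algebra.sigma_sets_subset[OF sa]) (use cl in blast)
  then have "sets borel \<subseteq> ?L" by (simp add: borel_eq_closed)
  then show ?thesis
    using measure_down[OF ms _ \<open>sets borel \<subseteq> ?L\<close>] sets.sigma_algebra_axioms[of borel] by simp
qed

lemma sets_hausdorff_measure[simp, measurable_cong]: "sets (hausdorff_measure k) = sets borel"
  using sets.sigma_sets_eq[of borel] by (simp add: hausdorff_measure_def)

lemma space_hausdorff_measure[simp]: "space (hausdorff_measure k) = UNIV"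
  by (simp add: hausdorff_measure_def)

lemma emeasure_hausdorff_measure:
  "A \<in> sets borel \<Longrightarrow> emeasure (hausdorff_measure k) A = hausdorff_outer_measure k A"
  unfolding hausdorff_measure_def using hausdorff_measure_space[of k]
  by (intro emeasure_measure_of_sigma) (auto simp: measure_space_def)

section \<open>Tubes: Lebesgue measure dominated by Hausdorff measure\<close>

definition tube :: "'a::euclidean_space \<Rightarrow> real \<Rightarrow> 'a set \<Rightarrow> 'a set" where
  "tube e T C = (\<lambda>(y, s). y + s *\<^sub>R e) ` (C \<times> {0..T})"

lemma compact_tube: "compact C \<Longrightarrow> compact (tube e T C)"
  unfolding tube_def
  by (intro compact_continuous_image compact_Times) (auto intro!: continuous_intros simp: case_prod_beta)

text \<open>Balls of radius \<open>2 * d\<close>, centred at steps of length \<open>d\<close> along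
  the segment that starts at one point of \<open>C\<close>, cover the tube. Their number is at most
  \<open>2 * T / d\<close> since \<open>d \<le> T\<close>, so the volume is of order
  \<open>T * d ^ (n - 1)\<close>. The bound \<open>d\<close> is separate from the diameter because
  that may be zero.\<close>

lemma emeasure_tube_le:
  fixes e :: "'a::euclidean_space"
  assumes e: "norm e = 1" and C: "compact C" "diameter C \<le> d" and d: "0 < d" "d \<le> T"
  shows "emeasure lborel (tube e T C) \<le> ennreal (2 ^ Suc DIM('a) * unit_ball_vol (real DIM('a)) * T * d ^ (DIM('a) - 1))"
proof (cases "C = {}")
  case False
  define n where "n = DIM('a)"
  have n: "n \<ge> 1" by (simp add: n_def DIM_positive Suc_leI)
  define ub where "ub = unit_ball_vol (real n)"
  have ub: "ub > 0" by (simp add: ub_def unit_ball_vol_pos)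
  obtain c where c: "c \<in> C" using False by blast
  define N where "N = nat \<lfloor>T / d\<rfloor>"
  have sub: "tube e T C \<subseteq> (\<Union>i\<in>{..N}. cball (c + (real i * d) *\<^sub>R e) (2 * d))"
  proof
    fix x assume "x \<in> tube e T C"
    then obtain y s where ys: "y \<in> C" "0 \<le> s" "s \<le> T" "x = y + s *\<^sub>R e" by (auto simp: tube_def)
    define i where "i = nat \<lfloor>s / d\<rfloor>"
    have "\<lfloor>s / d\<rfloor> \<ge> 0" using ys d by simp
    then have ri: "real i = real_of_int \<lfloor>s / d\<rfloor>" by (simp add: i_def)
    have "i \<le> N" unfolding i_def N_def using ys d by (intro nat_mono floor_mono divide_right_mono) auto
    moreover have "norm (x - (c + (real i * d) *\<^sub>R e)) \<le> 2 * d"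
    proof -
      have "x - (c + (real i * d) *\<^sub>R e) = (y - c) + (s - real i * d) *\<^sub>R e"
        by (simp add: ys(4) algebra_simps)
      note eq = this
      have "norm (x - (c + (real i * d) *\<^sub>R e)) \<le> norm (y - c) + \<bar>s - real i * d\<bar>"
        unfolding eq using norm_triangle_ineq[of "y - c" "(s - real i * d) *\<^sub>R e"] e by simp
      moreover have "norm (y - c) \<le> d"
        using diameter_bounded_bound[OF compact_imp_bounded[OF C(1)] ys(1) c] C(2) by (simp add: dist_norm)
      moreover have "\<bar>s - real i * d\<bar> \<le> d"
      proof -
        have "real i \<le> s / d" "s / d \<le> real i + 1" unfolding ri by linarith+
        then have "real i * d \<le> s" "s \<le> (real i + 1) * d" using d(1) by (simp_all add: pos_le_divide_eq pos_divide_le_eq)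
        then show ?thesis by (simp add: algebra_simps)
      qed
      ultimately show ?thesis by linarith
    qed
    ultimately show "x \<in> (\<Union>i\<in>{..N}. cball (c + (real i * d) *\<^sub>R e) (2 * d))"
      by (auto simp: dist_norm norm_minus_commute intro!: bexI[of _ i])
  qed
  have "emeasure lborel (tube e T C) \<le> emeasure lborel (\<Union>i\<in>{..N}. cball (c + (real i * d) *\<^sub>R e) (2 * d))"
    by (rule emeasure_mono[OF sub]) auto
  also have "\<dots> \<le> (\<Sum>i\<in>{..N}. emeasure lborel (cball (c + (real i * d) *\<^sub>R e) (2 * d)))"
    by (rule emeasure_subadditive_finite) auto
  also have "\<dots> = (\<Sum>i\<in>{..N}. ennreal (ub * (2 * d) ^ n))"
    using d(1) by (intro sum.cong) (auto simp: emeasure_cball ub_def n_def)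
  also have "\<dots> = ennreal ((real N + 1) * (ub * (2 * d) ^ n))"
    using ub d(1) by (subst sum_ennreal) (auto simp: algebra_simps)
  also have "\<dots> \<le> ennreal (2 * T / d * (ub * (2 * d) ^ n))"
  proof (intro ennreal_leI mult_right_mono)
    have "real N \<le> T / d" using d by (simp add: N_def)
    moreover have "1 \<le> T / d" using d by simp
    ultimately have "real N + 1 \<le> 2 * (T / d)" by linarith
    then show "real N + 1 \<le> 2 * T / d" by simp
  qed (use ub d in auto)
  also have "2 * T / d * (ub * (2 * d) ^ n) = 2 ^ Suc n * ub * T * d ^ (n - 1)"
    using d(1) n by (cases n) (auto simp: power_mult_distrib)
  finally show ?thesis by (simp add: n_def ub_def)
qed (simp add: tube_def)

text \<open>A set of diameter zero admits every small \<open>d\<close> in the preceding bound, and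
  \<open>T * d ^ (n - 1)\<close> tends to zero because \<open>n - 1 \<ge> 1\<close>.\<close>

lemma emeasure_tube_diameter:
  fixes e :: "'a::euclidean_space"
  assumes dim: "DIM('a) \<ge> 2" and e: "norm e = 1" and C: "compact C" "diameter C \<le> T" and T: "T > 0"
  shows "emeasure lborel (tube e T C) \<le> ennreal (2 ^ Suc DIM('a) * unit_ball_vol (real DIM('a)) * T * diameter C ^ (DIM('a) - 1))"
proof (cases "diameter C = 0")
  case False
  then have "diameter C > 0" using diameter_ge_0[OF compact_imp_bounded[OF C(1)]] by linarith
  then show ?thesis by (rule emeasure_tube_le[OF e C(1) order_refl _ C(2)])
next
  case True
  define c where "c = 2 ^ Suc DIM('a) * unit_ball_vol (real DIM('a)) * T"
  have c: "c > 0" using T unit_ball_vol_pos[of "real DIM('a)"] by (simp add: c_def)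
  have "emeasure lborel (tube e T C) \<le> 0 + ennreal r" if r: "r > 0" for r
  proof -
    define d where "d = min 1 (min T (r / c))"
    have d: "0 < d" "d \<le> T" "d \<le> 1" "d \<le> r / c" using T r c by (simp_all add: d_def)
    then have cd: "c * d \<le> r" using c by (simp add: pos_le_divide_eq mult.commute)
    have "emeasure lborel (tube e T C) \<le> ennreal (c * d ^ (DIM('a) - 1))"
      unfolding c_def using True d by (intro emeasure_tube_le e C) auto
    also have "\<dots> \<le> ennreal (c * d)"
      using power_decreasing[of 1 "DIM('a) - 1" d] d dim c by (intro ennreal_leI mult_left_mono) auto
    also have "\<dots> \<le> ennreal r" using cd by (intro ennreal_leI)
    finally show ?thesis by simp
  qed
  then have "emeasure lborel (tube e T C) \<le> 0" by (rule ennreal_le_epsilon)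
  then show ?thesis by simp
qed

text \<open>The ratio of the volume bound for tubes to the gauge: \<open>2 ^ (n - 1)\<close> and the
  volume of the \<open>(n - 1)\<close>-dimensional unit ball undo the normalisation in
  \<open>hausdorff_gauge\<close>.\<close>

definition tube_const :: "nat \<Rightarrow> real" where
  "tube_const n = 2 ^ Suc n * unit_ball_vol (real n) * 2 ^ (n - 1) / unit_ball_vol (real (n - 1))"

lemma tube_const_pos: "tube_const n > 0"
  by (simp add: tube_const_def unit_ball_vol_pos)

text \<open>A cover of \<open>A\<close> yields a cover of \<open>S\<close> by tubes over the
  closures of its members, each of Lebesgue measure at most a constant times \<open>T\<close> times
  its gauge. This uses sets of diameter up to \<open>T\<close>, so the premeasure at scale
  \<open>T\<close> already dominates.\<close>

lemma emeasure_projection_le: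
  fixes e :: "'a::euclidean_space"
  assumes dim: "DIM('a) \<ge> 2" and e: "norm e = 1" and T: "T > 0"
    and S: "\<And>x. x \<in> S \<Longrightarrow> \<exists>y\<in>A. \<exists>s\<in>{0..T}. x = y + s *\<^sub>R e"
  shows "emeasure lborel S \<le> ennreal (tube_const DIM('a) * T) * hausdorff_outer_measure (DIM('a) - 1) A"
proof -
  define k where "k = DIM('a) - 1"
  define c where "c = tube_const DIM('a) * T"
  have c: "c > 0" using T tube_const_pos by (simp add: c_def)
  have ub0: "unit_ball_vol (real DIM('a) - 1) \<noteq> 0"
  proof -
    have "real (DIM('a) - 1) = real DIM('a) - 1" using dim by simp
    moreover have "unit_ball_vol (real (DIM('a) - 1)) > 0" by (rule unit_ball_vol_pos) simp
    ultimately show ?thesis by (simp only: less_irrefl)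
  qed
  \<comment> \<open>With the constant moved to the left, the bound for each single cover passes to
    the infimum over covers.\<close>
  have "emeasure lborel S * ennreal (1 / c) \<le> hausdorff_premeasure k T A"
  proof (rule hausdorff_premeasure_greatest)
    fix C :: "nat \<Rightarrow> 'a set"
    assume C: "A \<subseteq> (\<Union>i. C i)" "\<And>i. bounded (C i)" "\<And>i. diameter (C i) \<le> T"
    have cc: "compact (closure (C i))" for i using C(2) by (simp add: compact_closure)
    have tm: "tube e T (closure (C i)) \<in> sets borel" for i by (rule borel_compact[OF compact_tube[OF cc]])
    have "emeasure lborel S \<le> emeasure lborel (\<Union>i. tube e T (closure (C i)))"
    proof (rule emeasure_mono)
      show "S \<subseteq> (\<Union>i. tube e T (closure (C i)))"
      proof
        fix x assume "x \<in> S"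
        then obtain y s where "y \<in> A" "s \<in> {0..T}" "x = y + s *\<^sub>R e" using S by blast
        moreover then obtain i where "y \<in> C i" using C(1) by blast
        ultimately show "x \<in> (\<Union>i. tube e T (closure (C i)))"
          using closure_subset[of "C i"] by (force simp: tube_def)
      qed
      show "(\<Union>i. tube e T (closure (C i))) \<in> sets lborel"
        using tm by auto
    qed
    also have "\<dots> \<le> (\<Sum>i. emeasure lborel (tube e T (closure (C i))))"
      using tm by (intro emeasure_subadditive_countably) auto
    also have "\<dots> \<le> (\<Sum>i. ennreal c * hausdorff_gauge k (C i))"
    proof (intro suminf_le summableI)
      fix i
      show "emeasure lborel (tube e T (closure (C i))) \<le> ennreal c * hausdorff_gauge k (C i)"
      proof (cases "C i = {}")
        case False
        have "emeasure lborel (tube e T (closure (C i)))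
          \<le> ennreal (2 ^ Suc DIM('a) * unit_ball_vol (real DIM('a)) * T * diameter (closure (C i)) ^ (DIM('a) - 1))"
          using C(3)[of i] by (intro emeasure_tube_diameter dim e cc T) (simp add: diameter_closure[OF C(2)])
        also have "\<dots> = ennreal (c * (unit_ball_vol (real k) * (diameter (C i) / 2) ^ k))"
          using ub0 dim
          by (simp add: diameter_closure[OF C(2)] c_def tube_const_def k_def power_divide field_simps)
        also have "\<dots> = ennreal c * hausdorff_gauge k (C i)"
          using False c diameter_ge_0[OF C(2), of i] by (simp add: hausdorff_gauge_def ennreal_mult)
        finally show ?thesis .
      qed (simp add: tube_def)
    qed
    also have "\<dots> = ennreal c * (\<Sum>i. hausdorff_gauge k (C i))" by simp
    finally have "emeasure lborel S * ennreal (1 / c) \<le> ennreal c * (\<Sum>i. hausdorff_gauge k (C i)) * ennreal (1 / c)"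
      by (rule mult_right_mono) simp
    also have "\<dots> = ennreal (c * (1 / c)) * (\<Sum>i. hausdorff_gauge k (C i))"
      using c by (simp only: ennreal_mult mult_ac less_imp_le zero_le_divide_1_iff)
    also have "c * (1 / c) = 1" using c by simp
    finally show "emeasure lborel S * ennreal (1 / c) \<le> (\<Sum>i. hausdorff_gauge k (C i))" by simp
  qed
  also have "\<dots> \<le> hausdorff_outer_measure k A" by (rule hausdorff_premeasure_le_outer[OF T])
  finally have "ennreal c * (emeasure lborel S * ennreal (1 / c)) \<le> ennreal c * hausdorff_outer_measure k A"
    by (rule mult_left_mono) simp
  moreover have "ennreal c * (emeasure lborel S * ennreal (1 / c)) = ennreal (c * (1 / c)) * emeasure lborel S"
    using c by (simp only: ennreal_mult mult_ac less_imp_le zero_le_divide_1_iff)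
  moreover have "c * (1 / c) = 1" using c by simp
  ultimately show ?thesis by (simp add: c_def k_def)
qed

lemma sets_surface_measure: "\<Gamma> \<in> sets borel \<Longrightarrow> A \<in> sets (surface_measure \<Gamma>) \<longleftrightarrow> A \<in> sets borel \<and> A \<subseteq> \<Gamma>"
  unfolding surface_measure_def by (subst sets_restrict_space_iff) auto

lemma space_surface_measure[simp]: "space (surface_measure \<Gamma>) = \<Gamma>"
  by (simp add: surface_measure_def space_restrict_space)

lemma borel_measurable_surface: "f \<in> borel_measurable borel \<Longrightarrow> f \<in> borel_measurable (surface_measure \<Gamma>)"
  unfolding surface_measure_def
  by (rule measurable_restrict_space1) (simp add: measurable_cong_sets[OF sets_hausdorff_measure refl])

text \<open>Applied to preimages under \<open>q\<close>, the measure inequality says that the image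
  of Lebesgue measure on \<open>S\<close> is at most a multiple of surface measure; the integral of
  \<open>f\<close> is monotone in the measure.\<close>

lemma nn_integral_projection_le:
  fixes e :: "'a::euclidean_space"
  assumes dim: "DIM('a) \<ge> 2" and e: "norm e = 1" and T: "T > 0"
    and \<Gamma>: "\<Gamma> \<in> sets borel" and S: "S \<in> sets borel"
    and q: "q \<in> borel_measurable (restrict_space borel S)"
    and qS: "\<And>x. x \<in> S \<Longrightarrow> q x \<in> \<Gamma> \<and> (\<exists>s\<in>{0..T}. x = q x + s *\<^sub>R e)"
    and f: "f \<in> borel_measurable borel"
  shows "(\<integral>\<^sup>+x. f (q x) * indicator S x \<partial>lborel)
    \<le> ennreal (tube_const DIM('a) * T) * (\<integral>\<^sup>+x. f x \<partial>surface_measure \<Gamma>)"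
proof -
  define c where "c = ennreal (tube_const DIM('a) * T)"
  define M where "M = restrict_space lborel S"
  define \<sigma> where "\<sigma> = surface_measure \<Gamma>"
  have spM: "space M = S" by (simp add: M_def space_restrict_space)
  have qm: "q \<in> borel_measurable M"
  proof -
    have "sets M = sets (restrict_space borel S)" unfolding M_def by (rule sets_restrict_space_cong) simp
    then show ?thesis using q measurable_cong_sets[OF _ refl, of M "restrict_space borel S" borel] by simp
  qed
  have qm2: "q \<in> measurable M \<sigma>"
  proof (rule measurableI)
    show "q x \<in> space \<sigma>" if "x \<in> space M" for x using qS that by (simp add: spM \<sigma>_def)
    fix A assume "A \<in> sets \<sigma>"
    then have "A \<in> sets borel" by (simp add: \<sigma>_def sets_surface_measure[OF \<Gamma>])
    then show "q -` A \<inter> space M \<in> sets M" by (rule measurable_sets[OF qm])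
  qed
  have le: "distr M \<sigma> q \<le> scale_measure c \<sigma>"
  proof -
    have "\<forall>A\<in>sets (distr M \<sigma> q). emeasure (distr M \<sigma> q) A \<le> emeasure (scale_measure c \<sigma>) A"
    proof
      fix A assume "A \<in> sets (distr M \<sigma> q)"
      then have A: "A \<in> sets \<sigma>" by simp
      then have Ab: "A \<in> sets borel" "A \<subseteq> \<Gamma>" by (auto simp: \<sigma>_def sets_surface_measure[OF \<Gamma>])
      have "emeasure (distr M \<sigma> q) A = emeasure M (q -` A \<inter> S)" by (simp add: emeasure_distr[OF qm2 A] spM)
      also have "\<dots> = emeasure lborel (q -` A \<inter> S)"
        unfolding M_def using S by (intro emeasure_restrict_space) auto
      also have "\<dots> \<le> c * hausdorff_outer_measure (DIM('a) - 1) A"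
        unfolding c_def by (rule emeasure_projection_le[OF dim e T]) (use qS in blast)
      also have "hausdorff_outer_measure (DIM('a) - 1) A = emeasure \<sigma> A"
        unfolding \<sigma>_def surface_measure_def using \<Gamma> Ab
        by (subst emeasure_restrict_space) (auto simp: emeasure_hausdorff_measure)
      finally show "emeasure (distr M \<sigma> q) A \<le> emeasure (scale_measure c \<sigma>) A" by simp
    qed
    then show ?thesis by (subst le_measure) simp_all
  qed
  have f\<sigma>: "f \<in> borel_measurable \<sigma>" unfolding \<sigma>_def by (rule borel_measurable_surface[OF f])
  have "(\<integral>\<^sup>+x. f (q x) * indicator S x \<partial>lborel) = (\<integral>\<^sup>+x. f (q x) \<partial>M)"
    unfolding M_def by (rule nn_integral_restrict_space[symmetric]) (simp add: S)
  also have "\<dots> = (\<integral>\<^sup>+x. f x \<partial>distr M \<sigma> q)"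
    by (rule nn_integral_distr[OF qm2, symmetric]) (simp add: f\<sigma>)
  also have "(\<integral>\<^sup>+x. f x \<partial>distr M \<sigma> q) \<le> (\<integral>\<^sup>+x. f x \<partial>scale_measure c \<sigma>)"
  proof (rule nn_integral_mono_measure)
    show "sets (distr M \<sigma> q) = sets (scale_measure c \<sigma>)" by simp
  qed (rule le)
  also have "(\<integral>\<^sup>+x. f x \<partial>scale_measure c \<sigma>) = c * (\<integral>\<^sup>+x. f x \<partial>\<sigma>)"
    by (rule nn_integral_scale_measure[OF f\<sigma>])
  finally show ?thesis unfolding c_def \<sigma>_def .
qed

section \<open>Boundary layers\<close>

text \<open>\<open>t\<close> is the height of \<open>x\<close> above the graph in direction
  \<open>e\<close>. A nearest boundary point \<open>p\<close> lies on the graph, and the height is a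
  Lipschitz function with constant \<open>1 + L\<close>, whence the bound on \<open>t\<close>. The
  quarter radius keeps \<open>p\<close> and the vertical segment inside the ball in which the graph
  describes \<open>D\<close>.\<close>

lemma lipschitz_graph_projection:
  fixes D :: "'a::euclidean_space set"
  assumes D: "open D" and e: "norm e = 1" and lip: "L-lipschitz_on {y. y \<bullet> e = 0} \<gamma>"
    and loc: "D \<inter> ball x0 r = {x \<in> ball x0 r. x \<bullet> e > \<gamma> (x - (x \<bullet> e) *\<^sub>R e)}"
    and \<delta>: "\<delta> > 0" "(1 + L) * \<delta> < r / 4"
    and x: "x \<in> D" "x \<in> ball x0 (r / 4)" "infdist x (frontier D) < \<delta>" "frontier D \<noteq> {}"
  defines "t \<equiv> x \<bullet> e - \<gamma> (x - (x \<bullet> e) *\<^sub>R e)"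
  shows "0 < t" "t < (1 + L) * \<delta>"
    "x - t *\<^sub>R e \<in> frontier D"
    "\<And>s. 0 \<le> s \<Longrightarrow> s < t \<Longrightarrow> x - s *\<^sub>R e \<in> D \<and> infdist (x - s *\<^sub>R e) (frontier D) < (1 + L) * \<delta>"
proof -
  define P where "P y = y - (y \<bullet> e) *\<^sub>R e" for y :: 'a
  have L: "L \<ge> 0" using lip by (auto simp: lipschitz_on_def)
  have ee: "e \<bullet> e = 1" using e by (simp add: dot_square_norm)
  have Pe: "P y \<bullet> e = 0" for y by (simp add: P_def inner_diff_left ee)
  have Pse: "P (y - s *\<^sub>R e) = P y" for y s by (simp add: P_def inner_diff_left ee algebra_simps)
  \<comment> \<open>Orthogonal projection to the hyperplane does not increase distances, by
    Pythagoras, so the Lipschitz bound extends to arbitrary points.\<close>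
  have Plip: "\<bar>\<gamma> (P y) - \<gamma> (P z)\<bar> \<le> L * norm (y - z)" for y z
  proof -
    have "\<bar>\<gamma> (P y) - \<gamma> (P z)\<bar> \<le> L * norm (P y - P z)"
      using lipschitz_onD[OF lip, of "P y" "P z"] Pe by (simp add: dist_norm)
    moreover have "norm (P y - P z) \<le> norm (y - z)"
    proof -
      have pyth: "(norm (a - (a \<bullet> e) *\<^sub>R e))\<^sup>2 = (norm a)\<^sup>2 - (a \<bullet> e)\<^sup>2" for a
      proof -
        have "(a - c *\<^sub>R e) \<bullet> (a - c *\<^sub>R e) = a \<bullet> a - 2 * c * (a \<bullet> e) + c * c * (e \<bullet> e)" for c
          by (simp add: algebra_simps inner_commute)
        then show ?thesis unfolding power2_norm_eq_inner ee by (simp add: power2_eq_square)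
      qed
      have "P y - P z = (y - z) - ((y - z) \<bullet> e) *\<^sub>R e" by (simp add: P_def inner_diff_left algebra_simps)
      then have "(norm (P y - P z))\<^sup>2 = (norm (y - z))\<^sup>2 - ((y - z) \<bullet> e)\<^sup>2"
        using pyth[of "y - z"] by simp
      then have "(norm (P y - P z))\<^sup>2 \<le> (norm (y - z))\<^sup>2" by simp
      then show ?thesis by (rule power2_le_imp_le) simp
    qed
    ultimately show ?thesis using L mult_left_mono order_trans by blast
  qed
  have inD: "y \<in> D \<longleftrightarrow> y \<bullet> e > \<gamma> (P y)" if "y \<in> ball x0 r" for y
    using loc that unfolding P_def by blast
  have dr: "\<delta> < r / 4"
  proof -
    have "\<delta> \<le> (1 + L) * \<delta>" using L \<delta>(1) by (simp add: algebra_simps)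
    then show ?thesis using \<delta>(2) by simp
  qed
  have r: "r > 0" using dr \<delta>(1) by linarith
  have xr: "x \<in> ball x0 r" using x(2) r by auto
  have tP: "t = x \<bullet> e - \<gamma> (P x)" by (simp add: t_def P_def)
  show t0: "0 < t" using inD[OF xr] x(1) by (simp add: tP)
  obtain p where p: "p \<in> frontier D" "dist x p < \<delta>"
  proof -
    obtain p where "p \<in> frontier D" "infdist x (frontier D) = dist x p"
      using infdist_attains_inf[OF frontier_closed x(4)] by blast
    then show ?thesis using x(3) that by simp
  qed
  have pr: "p \<in> ball x0 r"
  proof -
    have "dist x0 p < r / 4 + \<delta>" using x(2) p(2) dist_triangle[of x0 p x] by simp
    then show ?thesis using dr r by simp
  qed
  have pD: "p \<notin> D" using p(1) D frontier_disjoint_eq[of D] by blast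
  \<comment> \<open>\<open>p\<close> is a limit of points of \<open>D\<close>, which lie above the
    graph, so it cannot lie strictly below; the chosen \<open>\<epsilon>\<close> makes
    \<open>(1 + L) * \<epsilon>\<close> equal to the supposed gap. With \<open>p \<notin> D\<close>
    this places \<open>p\<close> on the graph.\<close>
  have peq: "\<gamma> (P p) \<le> p \<bullet> e"
  proof (rule ccontr)
    assume "\<not> \<gamma> (P p) \<le> p \<bullet> e"
    define \<epsilon> where "\<epsilon> = (\<gamma> (P p) - p \<bullet> e) / (1 + L)"
    have \<epsilon>: "\<epsilon> > 0" using \<open>\<not> \<gamma> (P p) \<le> p \<bullet> e\<close> L by (simp add: \<epsilon>_def)
    obtain \<rho> where \<rho>: "\<rho> > 0" "ball p \<rho> \<subseteq> ball x0 r"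
      using openE[OF open_ball pr] by blast
    have "p \<in> closure D" using p(1) by (simp add: frontier_def)
    then obtain y where y: "y \<in> D" "dist y p < min \<epsilon> \<rho>"
      using closure_approachable[of p D] \<epsilon> \<rho>(1) by (metis min_less_iff_conj)
    have "y \<in> ball x0 r" using y(2) \<rho>(2) by (auto simp: dist_commute)
    then have "\<gamma> (P y) < y \<bullet> e" using inD y(1) by blast
    moreover have "\<gamma> (P p) - \<gamma> (P y) \<le> L * norm (p - y)" using Plip[of p y] by linarith
    moreover have "y \<bullet> e - p \<bullet> e \<le> norm (p - y)"
      using norm_cauchy_schwarz[of "y - p" e] e by (simp add: inner_diff_left norm_minus_commute)
    ultimately have "\<gamma> (P p) - p \<bullet> e < (1 + L) * norm (p - y)" by (simp add: algebra_simps)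
    also have "\<dots> < (1 + L) * \<epsilon>" using y(2) L by (intro mult_strict_left_mono) (auto simp: dist_norm norm_minus_commute)
    also have "\<dots> = \<gamma> (P p) - p \<bullet> e" using L by (simp add: \<epsilon>_def)
    finally show False by simp
  qed
  show tT: "t < (1 + L) * \<delta>"
  proof -
    have "x \<bullet> e - p \<bullet> e \<le> norm (x - p)"
      using norm_cauchy_schwarz[of "x - p" e] e by (simp add: inner_diff_left)
    moreover have "\<gamma> (P p) - \<gamma> (P x) \<le> L * norm (x - p)" using Plip[of p x] by (simp add: norm_minus_commute)
    moreover have "p \<bullet> e = \<gamma> (P p)" using peq inD[OF pr] pD by linarith
    ultimately have "t \<le> (1 + L) * norm (x - p)" by (simp add: tP algebra_simps)
    also have "\<dots> < (1 + L) * \<delta>" using p(2) L by (intro mult_strict_left_mono) (auto simp: dist_norm)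
    finally show ?thesis .
  qed
  have ballr: "x - s *\<^sub>R e \<in> ball x0 r" if "0 \<le> s" "s \<le> t" for s
  proof -
    have "dist x0 (x - s *\<^sub>R e) \<le> dist x0 x + dist x (x - s *\<^sub>R e)" by (rule dist_triangle)
    also have "dist x (x - s *\<^sub>R e) = s" using e that by (simp add: dist_norm)
    also have "dist x0 x + s < r / 4 + r / 4" using x(2) that tT \<delta>(2) by simp
    finally show ?thesis using r by simp
  qed
  have segD: "x - s *\<^sub>R e \<in> D" if "0 \<le> s" "s < t" for s
    using inD[OF ballr[of s]] that by (simp add: Pse inner_diff_left ee tP)
  show qF: "x - t *\<^sub>R e \<in> frontier D"
  proof -
    have "x - t *\<^sub>R e \<notin> D" using inD[OF ballr[of t]] t0 by (simp add: Pse inner_diff_left ee tP)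
    moreover have "x - t *\<^sub>R e \<in> closure D"
      unfolding closure_approachable
    proof (intro allI impI)
      fix \<epsilon> :: real assume \<epsilon>: "\<epsilon> > 0"
      define s where "s = max 0 (t - \<epsilon> / 2)"
      have s: "0 \<le> s" "s < t" "t - s < \<epsilon>" using \<epsilon> t0 by (auto simp: s_def)
      have "x - s *\<^sub>R e - (x - t *\<^sub>R e) = (t - s) *\<^sub>R e" by (simp add: algebra_simps)
      then have "dist (x - s *\<^sub>R e) (x - t *\<^sub>R e) < \<epsilon>" using s e by (simp add: dist_norm)
      then show "\<exists>y\<in>D. dist y (x - t *\<^sub>R e) < \<epsilon>" using segD[OF s(1,2)] by blast
    qed
    ultimately show ?thesis using D by (simp add: frontier_def interior_open)
  qed
  fix s assume s: "0 \<le> s" "s < t"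
  have "infdist (x - s *\<^sub>R e) (frontier D) \<le> dist (x - s *\<^sub>R e) (x - t *\<^sub>R e)" by (rule infdist_le[OF qF])
  also have "x - s *\<^sub>R e - (x - t *\<^sub>R e) = (t - s) *\<^sub>R e" by (simp add: algebra_simps)
  then have "dist (x - s *\<^sub>R e) (x - t *\<^sub>R e) = t - s" using s e by (simp add: dist_norm)
  finally show "x - s *\<^sub>R e \<in> D \<and> infdist (x - s *\<^sub>R e) (frontier D) < (1 + L) * \<delta>"
    using segD[OF s] s tT by simp
qed

lemma open_infdist_less: "open {x. infdist x A < d}"
  by (intro open_Collect_less continuous_intros)

text \<open>On the segment from \<open>x\<close> down to its projection \<open>q x\<close> on the graph,
  \<open>u(x)\<^sup>2 \<le> 2 u(q x)\<^sup>2 + 2 t \<integral>|\<nabla>u|\<^sup>2\<close>; the first term is integrated by means of the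
  comparison of Lebesgue and Hausdorff measure, the second by Tonelli and translation invariance.\<close>

lemma boundary_layer_local:
  fixes D :: "'a::euclidean_space set"
  assumes dim: "DIM('a) \<ge> 2" and D: "open D" and e: "norm e = 1"
    and lip: "L-lipschitz_on {y. y \<bullet> e = 0} \<gamma>"
    and loc: "D \<inter> ball x0 r = {x \<in> ball x0 r. x \<bullet> e > \<gamma> (x - (x \<bullet> e) *\<^sub>R e)}"
    and \<delta>: "\<delta> > 0" "(1 + L) * \<delta> < r / 4" and ne: "frontier D \<noteq> {}" and u: "smooth u"
  defines "T \<equiv> (1 + L) * \<delta>"
  shows "(\<integral>\<^sup>+x. ennreal ((u x)\<^sup>2) * indicator (D \<inter> ball x0 (r / 4) \<inter> {x. infdist x (frontier D) < \<delta>}) x \<partial>lborel)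
    \<le> ennreal (2 * tube_const DIM('a) * T) * (\<integral>\<^sup>+x. ennreal ((u x)\<^sup>2) \<partial>surface_measure (frontier D))
      + ennreal (2 * T\<^sup>2) * (\<integral>\<^sup>+x. ennreal ((norm (grad u x))\<^sup>2) * indicator (D \<inter> {x. infdist x (frontier D) < T}) x \<partial>lborel)"
proof -
  define S where "S = D \<inter> ball x0 (r / 4) \<inter> {x. infdist x (frontier D) < \<delta>}"
  define t where "t x = x \<bullet> e - \<gamma> (x - (x \<bullet> e) *\<^sub>R e)" for x
  define q where "q x = x - t x *\<^sub>R e" for x
  define h where "h x = ennreal ((norm (grad u x))\<^sup>2) * indicator (D \<inter> {x. infdist x (frontier D) < T}) x" for x
  have L: "L \<ge> 0" using lip by (auto simp: lipschitz_on_def)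
  have ee: "e \<bullet> e = 1" using e by (simp add: dot_square_norm)
  have T: "T > 0" using L \<delta>(1) by (simp add: T_def)
  have "open S" unfolding S_def by (intro open_Int D open_ball open_infdist_less)
  then have S[measurable]: "S \<in> sets borel" by auto
  have [measurable]: "u \<in> borel_measurable borel" "grad u \<in> borel_measurable borel"
    by (rule borel_test_function[OF u], rule borel_grad[OF u])
  have [measurable]: "D \<inter> {x. infdist x (frontier D) < T} \<in> sets borel"
    by (rule borel_open[OF open_Int[OF D open_infdist_less]])
  have [measurable]: "h \<in> borel_measurable borel" unfolding h_def by measurable
  have "continuous_on UNIV (\<lambda>x. \<gamma> (x - (x \<bullet> e) *\<^sub>R e))"
    by (rule continuous_on_compose2[OF lipschitz_on_continuous_on[OF lip]])
       (auto intro!: continuous_intros simp: inner_diff_left ee)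
  then have "continuous_on UNIV q" unfolding q_def t_def by (intro continuous_intros)
  then have [measurable]: "q \<in> borel_measurable borel" by (rule borel_measurable_continuous_onI)
  have geo: "0 < t x" "t x < T" "q x \<in> frontier D"
    "\<And>s. 0 \<le> s \<Longrightarrow> s < t x \<Longrightarrow> x - s *\<^sub>R e \<in> D \<inter> {x. infdist x (frontier D) < T}" if "x \<in> S" for x
    using lipschitz_graph_projection[OF D e lip loc \<delta>, of x] that ne
    unfolding S_def t_def q_def T_def by auto
  have pw: "ennreal ((u x)\<^sup>2) * indicator S x
    \<le> ennreal 2 * (ennreal ((u (q x))\<^sup>2) * indicator S x) + ennreal (2 * T) * (\<integral>\<^sup>+s. h (x + s *\<^sub>R (- e)) * indicator {0..T} s \<partial>lborel)" for x
  proof (cases "x \<in> S")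
    case True
    note g = geo[OF True]
    have "ennreal ((u (x + t x *\<^sub>R (- e)) - u x)\<^sup>2)
      \<le> ennreal (t x) * (\<integral>\<^sup>+s. ennreal ((norm (grad u (x + s *\<^sub>R (- e))))\<^sup>2) * indicator {0..t x} s \<partial>lborel)"
      using g(1) e by (intro segment_estimate[OF u]) auto
    also have "\<dots> \<le> ennreal T * (\<integral>\<^sup>+s. h (x + s *\<^sub>R (- e)) * indicator {0..T} s \<partial>lborel)"
    proof (rule mult_mono)
      show "ennreal (t x) \<le> ennreal T" using g(2) by (intro ennreal_leI) simp
      show "(\<integral>\<^sup>+s. ennreal ((norm (grad u (x + s *\<^sub>R (- e))))\<^sup>2) * indicator {0..t x} s \<partial>lborel)
        \<le> (\<integral>\<^sup>+s. h (x + s *\<^sub>R (- e)) * indicator {0..T} s \<partial>lborel)"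
      proof (rule nn_integral_mono_AE)
        \<comment> \<open>At \<open>s = t x\<close> the segment has reached the frontier, outside
          \<open>D\<close>, where \<open>h\<close> vanishes; this single parameter is discarded as a
          null set.\<close>
        show "AE s in lborel. ennreal ((norm (grad u (x + s *\<^sub>R (- e))))\<^sup>2) * indicator {0..t x} s
          \<le> h (x + s *\<^sub>R (- e)) * indicator {0..T} s"
          using AE_lborel_singleton[of "t x"]
        proof eventually_elim
          case (elim s)
          show ?case
          proof (cases "s \<in> {0..t x}")
            case True
            then have "0 \<le> s" "s < t x" using elim by auto
            then show ?thesis using g(4)[of s] g(2) by (simp add: h_def)
          qed simp
        qed
      qed
    qed auto
    finally have "ennreal ((u (q x) - u x)\<^sup>2) \<le> ennreal T * (\<integral>\<^sup>+s. h (x + s *\<^sub>R (- e)) * indicator {0..T} s \<partial>lborel)"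
      by (simp add: q_def)
    then have "ennreal 2 * ennreal ((u (q x) - u x)\<^sup>2) \<le> ennreal 2 * (ennreal T * (\<integral>\<^sup>+s. h (x + s *\<^sub>R (- e)) * indicator {0..T} s \<partial>lborel))"
      by (rule mult_left_mono) simp
    moreover have "ennreal 2 * ennreal T = ennreal (2 * T)" using T by (subst ennreal_mult[symmetric]) auto
    moreover have "ennreal ((u x)\<^sup>2) \<le> ennreal 2 * ennreal ((u (q x))\<^sup>2) + ennreal 2 * ennreal ((u (q x) - u x)\<^sup>2)"
    proof -
      \<comment> \<open>With \<open>a = u x\<close> and \<open>b = u (q x)\<close>, this square is
        exactly \<open>2 * b^2 + 2 * (b - a)^2 - a^2\<close>.\<close>
      have "0 \<le> (u x - 2 * u (q x))\<^sup>2" by simp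
      then have "(u x)\<^sup>2 \<le> 2 * (u (q x))\<^sup>2 + 2 * (u (q x) - u x)\<^sup>2" by (simp add: power2_eq_square algebra_simps)
      then have "ennreal ((u x)\<^sup>2) \<le> ennreal (2 * (u (q x))\<^sup>2 + 2 * (u (q x) - u x)\<^sup>2)" by (rule ennreal_leI)
      also have "\<dots> = ennreal 2 * ennreal ((u (q x))\<^sup>2) + ennreal 2 * ennreal ((u (q x) - u x)\<^sup>2)"
        by (subst ennreal_plus) (auto simp: ennreal_mult)
      finally show ?thesis .
    qed
    ultimately show ?thesis using True
      by (simp only: indicator_simps mult_1_right mult.assoc[symmetric]) (meson add_left_mono order_trans)
  qed simp
  have "(\<integral>\<^sup>+x. ennreal ((u x)\<^sup>2) * indicator S x \<partial>lborel)
    \<le> (\<integral>\<^sup>+x. ennreal 2 * (ennreal ((u (q x))\<^sup>2) * indicator S x) + ennreal (2 * T) * (\<integral>\<^sup>+s. h (x + s *\<^sub>R (- e)) * indicator {0..T} s \<partial>lborel) \<partial>lborel)"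
    by (rule nn_integral_mono) (rule pw)
  also have "\<dots> = ennreal 2 * (\<integral>\<^sup>+x. ennreal ((u (q x))\<^sup>2) * indicator S x \<partial>lborel)
    + ennreal (2 * T) * (\<integral>\<^sup>+x. (\<integral>\<^sup>+s. h (x + s *\<^sub>R (- e)) * indicator {0..T} s \<partial>lborel) \<partial>lborel)"
    by (subst nn_integral_add, measurable, subst nn_integral_cmult, measurable, subst nn_integral_cmult, measurable)
  also have "(\<integral>\<^sup>+x. (\<integral>\<^sup>+s. h (x + s *\<^sub>R (- e)) * indicator {0..T} s \<partial>lborel) \<partial>lborel)
    = (\<integral>\<^sup>+s. (\<integral>\<^sup>+x. h (x + s *\<^sub>R (- e)) * indicator {0..T} s \<partial>lborel) \<partial>lborel)"
    by (rule lborel_pair.Fubini') measurable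
  also have "\<dots> = (\<integral>\<^sup>+s. (\<integral>\<^sup>+x. h x \<partial>lborel) * indicator {0..T} s \<partial>lborel)"
  proof (rule nn_integral_cong)
    fix s
    have "(\<integral>\<^sup>+x. h (x + s *\<^sub>R (- e)) * indicator {0..T} s \<partial>lborel) = (\<integral>\<^sup>+x. h (s *\<^sub>R (- e) + x) \<partial>lborel) * indicator {0..T} s"
      unfolding add.commute[of _ "s *\<^sub>R (- e)"] by (rule nn_integral_multc) measurable
    then show "(\<integral>\<^sup>+x. h (x + s *\<^sub>R (- e)) * indicator {0..T} s \<partial>lborel) = (\<integral>\<^sup>+x. h x \<partial>lborel) * indicator {0..T} s"
      by (subst (asm) lborel_nn_integral_translate) auto
  qed
  also have "\<dots> = (\<integral>\<^sup>+x. h x \<partial>lborel) * ennreal T"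
    using T by (simp add: nn_integral_cmult_indicator)
  also have "(\<integral>\<^sup>+x. ennreal ((u (q x))\<^sup>2) * indicator S x \<partial>lborel)
    \<le> ennreal (tube_const DIM('a) * T) * (\<integral>\<^sup>+x. ennreal ((u x)\<^sup>2) \<partial>surface_measure (frontier D))"
  proof (rule nn_integral_projection_le[OF dim e T _ S])
    show "q \<in> borel_measurable (restrict_space borel S)" by (rule measurable_restrict_space1) measurable
    fix x assume "x \<in> S"
    then show "q x \<in> frontier D \<and> (\<exists>s\<in>{0..T}. x = q x + s *\<^sub>R e)"
      using geo[of x] by (auto simp: q_def intro!: bexI[of _ "t x"])
  qed (auto intro: borel_closed)
  finally have "(\<integral>\<^sup>+x. ennreal ((u x)\<^sup>2) * indicator S x \<partial>lborel)
    \<le> ennreal 2 * (ennreal (tube_const DIM('a) * T) * (\<integral>\<^sup>+x. ennreal ((u x)\<^sup>2) \<partial>surface_measure (frontier D)))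
      + ennreal (2 * T) * ((\<integral>\<^sup>+x. h x \<partial>lborel) * ennreal T)"
    by (simp add: add_right_mono mult_left_mono)
  moreover have "ennreal 2 * (ennreal (tube_const DIM('a) * T) * X) = ennreal (2 * tube_const DIM('a) * T) * X" for X
    using T tube_const_pos[of "DIM('a)"] by (simp add: ennreal_mult mult.assoc)
  moreover have "ennreal (2 * T) * (X * ennreal T) = ennreal (2 * T\<^sup>2) * X" for X
    using T by (simp add: power2_eq_square ennreal_mult mult_ac)
  ultimately show ?thesis unfolding S_def h_def by simp
qed

text \<open>Compactness of the boundary: finitely many local estimates are added. The balls of half
  radius cover the boundary, so a point closer to it than half of every radius lies in one of the
  full balls. The gradient is integrated over a layer thicker by the factor \<open>M\<close>,
  because heights above the graph may exceed distances to the boundary.\<close>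

lemma boundary_layer:
  fixes D :: "'a::euclidean_space set"
  assumes dim: "DIM('a) \<ge> 2" and D: "open D" "bounded D" "D \<noteq> {}" "lipschitz_boundary D"
  obtains K M \<delta>0 where "K > 0" "M > 0" "\<delta>0 > 0"
    "\<And>\<delta> u. 0 < \<delta> \<Longrightarrow> \<delta> < \<delta>0 \<Longrightarrow> smooth u \<Longrightarrow>
      (\<integral>\<^sup>+x. ennreal ((u x)\<^sup>2) * indicator (D \<inter> {x. infdist x (frontier D) < \<delta>}) x \<partial>lborel)
      \<le> ennreal (K * \<delta>) * (\<integral>\<^sup>+x. ennreal ((u x)\<^sup>2) \<partial>surface_measure (frontier D))
        + ennreal (K * \<delta>\<^sup>2) * (\<integral>\<^sup>+x. ennreal ((norm (grad u x))\<^sup>2) * indicator (D \<inter> {x. infdist x (frontier D) < M * \<delta>}) x \<partial>lborel)"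
proof -
  define \<Gamma> where "\<Gamma> = frontier D"
  have ne: "\<Gamma> \<noteq> {}" unfolding \<Gamma>_def using D frontier_eq_empty[of D] not_bounded_UNIV by auto
  have cpt: "compact \<Gamma>" unfolding \<Gamma>_def by (rule compact_frontier_bounded[OF D(2)])
  define I where "I u = (\<integral>\<^sup>+x. ennreal ((u x)\<^sup>2) \<partial>surface_measure \<Gamma>)" for u
  define J where "J u d = (\<integral>\<^sup>+x. ennreal ((norm (grad u x))\<^sup>2) * indicator (D \<inter> {x. infdist x \<Gamma> < d}) x \<partial>lborel)" for u d
  have Jmono: "J u d \<le> J u d'" if "d \<le> d'" for u d d'
    unfolding J_def by (rule nn_integral_mono) (use that in \<open>auto simp: indicator_def\<close>)
  define P where "P p \<rho> K M d \<longleftrightarrow> (\<forall>\<delta> u. 0 < \<delta> \<longrightarrow> \<delta> < d \<longrightarrow> smooth u \<longrightarrow>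
     (\<integral>\<^sup>+x. ennreal ((u x)\<^sup>2) * indicator (D \<inter> ball p \<rho> \<inter> {x. infdist x \<Gamma> < \<delta>}) x \<partial>lborel)
      \<le> ennreal (K * \<delta>) * I u + ennreal (K * \<delta>\<^sup>2) * J u (M * \<delta>))" for p \<rho> K M d
  have ex: "\<exists>\<rho> K M d. \<rho> > 0 \<and> K > 0 \<and> M > 0 \<and> d > 0 \<and> P p \<rho> K M d" if p: "p \<in> \<Gamma>" for p
  proof -
    obtain r e \<gamma> L where loc: "r > 0" "norm e = 1" "L-lipschitz_on {y. y \<bullet> e = 0} \<gamma>"
      "D \<inter> ball p r = {x \<in> ball p r. x \<bullet> e > \<gamma> (x - (x \<bullet> e) *\<^sub>R e)}"
      using D(4) p unfolding lipschitz_boundary_def \<Gamma>_def by blast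
    have L: "L \<ge> 0" using loc(3) by (auto simp: lipschitz_on_def)
    define c where "c = tube_const DIM('a)"
    have c: "c > 0" by (simp add: c_def tube_const_pos)
    define K where "K = 2 * c * (1 + L) + 2 * (1 + L)\<^sup>2"
    have pos: "0 < 2 * c * (1 + L)" "0 < 2 * (1 + L)\<^sup>2" using c L by (auto intro!: mult_pos_pos)
    have K: "2 * c * (1 + L) \<le> K" "2 * (1 + L)\<^sup>2 \<le> K" "K > 0"
      unfolding K_def using pos by (simp_all only: le_add_same_cancel1 le_add_same_cancel2 less_imp_le add_pos_pos)
    define d where "d = r / 4 / (1 + L)"
    have "P p (r / 4) K (1 + L) d"
      unfolding P_def
    proof (intro allI impI)
      fix \<delta> :: real and u :: "'a \<Rightarrow> real" assume \<delta>: "0 < \<delta>" "\<delta> < d" and u: "smooth u"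
      have T: "(1 + L) * \<delta> < r / 4" 
      proof -
        have L1: "1 + L > 0" using L by simp
        show ?thesis using \<delta>(2)[unfolded d_def pos_less_divide_eq[OF L1]] by (simp only: mult.commute)
      qed
      have "(\<integral>\<^sup>+x. ennreal ((u x)\<^sup>2) * indicator (D \<inter> ball p (r / 4) \<inter> {x. infdist x \<Gamma> < \<delta>}) x \<partial>lborel)
        \<le> ennreal (2 * c * ((1 + L) * \<delta>)) * I u + ennreal (2 * ((1 + L) * \<delta>)\<^sup>2) * J u ((1 + L) * \<delta>)"
        unfolding \<Gamma>_def I_def J_def c_def
        by (rule boundary_layer_local[OF dim D(1) loc(2,3,4) \<delta>(1) T _ u]) (use ne \<Gamma>_def in simp)
      also have "\<dots> \<le> ennreal (K * \<delta>) * I u + ennreal (K * \<delta>\<^sup>2) * J u ((1 + L) * \<delta>)"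
      proof (intro add_mono mult_right_mono ennreal_leI)
        show "2 * c * ((1 + L) * \<delta>) \<le> K * \<delta>" using mult_right_mono[OF K(1), of \<delta>] \<delta>(1) by (simp add: mult.assoc)
        show "2 * ((1 + L) * \<delta>)\<^sup>2 \<le> K * \<delta>\<^sup>2" using mult_right_mono[OF K(2), of "\<delta>\<^sup>2"] by (simp add: power_mult_distrib mult.assoc)
      qed auto
      finally show "(\<integral>\<^sup>+x. ennreal ((u x)\<^sup>2) * indicator (D \<inter> ball p (r / 4) \<inter> {x. infdist x \<Gamma> < \<delta>}) x \<partial>lborel)
        \<le> ennreal (K * \<delta>) * I u + ennreal (K * \<delta>\<^sup>2) * J u ((1 + L) * \<delta>)" .
    qed
    moreover have "d > 0" "r / 4 > 0" "1 + L > 0" using loc(1) L by (auto simp: d_def)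
    ultimately show ?thesis using K(3) by blast
  qed
  define Q where "Q p z \<longleftrightarrow> (case z of (\<rho>, K, M, d) \<Rightarrow> \<rho> > 0 \<and> K > 0 \<and> M > 0 \<and> d > 0 \<and> P p \<rho> K M d)" for p z
  have "\<forall>p\<in>\<Gamma>. \<exists>z. Q p z"
  proof
    fix p assume "p \<in> \<Gamma>"
    then obtain \<rho> K M d where "\<rho> > 0 \<and> K > 0 \<and> M > 0 \<and> d > 0 \<and> P p \<rho> K M d" using ex by blast
    then have "Q p (\<rho>, K, M, d)" by (simp add: Q_def)
    then show "\<exists>z. Q p z" ..
  qed
  from bchoice[OF this] obtain f where f: "\<forall>p\<in>\<Gamma>. Q p (f p)" by blast
  define \<rho> K M d where "\<rho> p = fst (f p)" and "K p = fst (snd (f p))"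
    and "M p = fst (snd (snd (f p)))" and "d p = snd (snd (snd (f p)))" for p
  have loc: "\<rho> p > 0 \<and> K p > 0 \<and> M p > 0 \<and> d p > 0 \<and> P p (\<rho> p) (K p) (M p) (d p)" if "p \<in> \<Gamma>" for p
    using bspec[OF f that] by (simp add: Q_def case_prod_beta \<rho>_def K_def M_def d_def)
  have "\<Gamma> \<subseteq> (\<Union>p\<in>\<Gamma>. ball p (\<rho> p / 2))" using loc by force
  then obtain F where F: "F \<subseteq> \<Gamma>" "finite F" "\<Gamma> \<subseteq> (\<Union>p\<in>F. ball p (\<rho> p / 2))"
    by (rule compactE_image[OF cpt, of \<Gamma> "\<lambda>p. ball p (\<rho> p / 2)", OF open_ball])
  have Fne: "F \<noteq> {}" using F(3) ne by auto
  have Kpos: "K p > 0" "M p > 0" "d p > 0" "\<rho> p > 0" if "p \<in> F" for p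
    using loc[OF subsetD[OF F(1) that]] by simp_all
  define \<delta>0 where "\<delta>0 = Min ((\<lambda>p. min (d p) (\<rho> p / 2)) ` F)"
  have \<delta>0: "\<delta>0 > 0" unfolding \<delta>0_def using F(2) Fne Kpos(3,4) by (subst Min_gr_iff) auto
  have \<delta>0le: "\<delta>0 \<le> d p" "\<delta>0 \<le> \<rho> p / 2" if "p \<in> F" for p
    using Min_le[of "(\<lambda>p. min (d p) (\<rho> p / 2)) ` F" "min (d p) (\<rho> p / 2)"] F(2) that unfolding \<delta>0_def by auto
  define Ks Ms where "Ks = sum K F" and "Ms = sum M F"
  have "Ks > 0" "Ms > 0" unfolding Ks_def Ms_def by (rule sum_pos[OF F(2) Fne], rule Kpos, assumption)+
  moreover have "(\<integral>\<^sup>+x. ennreal ((u x)\<^sup>2) * indicator (D \<inter> {x. infdist x \<Gamma> < \<delta>}) x \<partial>lborel)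
      \<le> ennreal (Ks * \<delta>) * I u + ennreal (Ks * \<delta>\<^sup>2) * J u (Ms * \<delta>)"
    if \<delta>: "0 < \<delta>" "\<delta> < \<delta>0" and u: "smooth u" for \<delta> u
  proof -
    have [measurable]: "u \<in> borel_measurable borel" by (rule borel_test_function[OF u])
    have m: "D \<inter> ball p (\<rho> p) \<inter> {x. infdist x \<Gamma> < \<delta>} \<in> sets borel" for p
    proof -
      have "open (D \<inter> ball p (\<rho> p) \<inter> {x. infdist x \<Gamma> < \<delta>})" by (intro open_Int D open_ball open_infdist_less)
      then show ?thesis by auto
    qed
    note [measurable] = m
    have "(\<integral>\<^sup>+x. ennreal ((u x)\<^sup>2) * indicator (D \<inter> {x. infdist x \<Gamma> < \<delta>}) x \<partial>lborel)
      \<le> (\<integral>\<^sup>+x. (\<Sum>p\<in>F. ennreal ((u x)\<^sup>2) * indicator (D \<inter> ball p (\<rho> p) \<inter> {x. infdist x \<Gamma> < \<delta>}) x) \<partial>lborel)"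
    proof (rule nn_integral_mono)
      fix x
      show "ennreal ((u x)\<^sup>2) * indicator (D \<inter> {x. infdist x \<Gamma> < \<delta>}) x
        \<le> (\<Sum>p\<in>F. ennreal ((u x)\<^sup>2) * indicator (D \<inter> ball p (\<rho> p) \<inter> {x. infdist x \<Gamma> < \<delta>}) x)"
      proof (cases "x \<in> D \<inter> {x. infdist x \<Gamma> < \<delta>}")
        case True
        obtain y where y: "y \<in> \<Gamma>" "infdist x \<Gamma> = dist x y"
          using infdist_attains_inf[OF compact_imp_closed[OF cpt] ne] by blast
        obtain p where p: "p \<in> F" "y \<in> ball p (\<rho> p / 2)" using F(3) y(1) by blast
        have "dist p x \<le> dist p y + dist x y" using dist_triangle[of p x y] by (simp add: dist_commute)
        also have "\<dots> < \<rho> p / 2 + \<rho> p / 2" using p True y(2) \<delta>(2) \<delta>0le(2)[OF p(1)] by simp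
        finally have "x \<in> ball p (\<rho> p)" by simp
        then have "ennreal ((u x)\<^sup>2) * indicator (D \<inter> {x. infdist x \<Gamma> < \<delta>}) x
          = ennreal ((u x)\<^sup>2) * indicator (D \<inter> ball p (\<rho> p) \<inter> {x. infdist x \<Gamma> < \<delta>}) x"
          using True by simp
        also have "\<dots> \<le> (\<Sum>p\<in>F. ennreal ((u x)\<^sup>2) * indicator (D \<inter> ball p (\<rho> p) \<inter> {x. infdist x \<Gamma> < \<delta>}) x)"
          using p(1) F(2) by (intro member_le_sum) auto
        finally show ?thesis .
      qed simp
    qed
    also have "\<dots> = (\<Sum>p\<in>F. \<integral>\<^sup>+x. ennreal ((u x)\<^sup>2) * indicator (D \<inter> ball p (\<rho> p) \<inter> {x. infdist x \<Gamma> < \<delta>}) x \<partial>lborel)"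
      by (rule nn_integral_sum) measurable
    also have "\<dots> \<le> (\<Sum>p\<in>F. ennreal (K p * \<delta>) * I u + ennreal (K p * \<delta>\<^sup>2) * J u (Ms * \<delta>))"
    proof (rule sum_mono)
      fix p assume p: "p \<in> F"
      have "P p (\<rho> p) (K p) (M p) (d p)" using loc[OF subsetD[OF F(1) p]] by simp
      then have "(\<integral>\<^sup>+x. ennreal ((u x)\<^sup>2) * indicator (D \<inter> ball p (\<rho> p) \<inter> {x. infdist x \<Gamma> < \<delta>}) x \<partial>lborel)
        \<le> ennreal (K p * \<delta>) * I u + ennreal (K p * \<delta>\<^sup>2) * J u (M p * \<delta>)"
        using less_le_trans[OF \<delta>(2) \<delta>0le(1)[OF p]] \<delta>(1) u unfolding P_def by blast
      also have "\<dots> \<le> ennreal (K p * \<delta>) * I u + ennreal (K p * \<delta>\<^sup>2) * J u (Ms * \<delta>)"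
      proof (intro add_left_mono mult_left_mono Jmono mult_right_mono)
        show "M p \<le> Ms" unfolding Ms_def using p F(2) Kpos by (intro member_le_sum) (auto intro: less_imp_le)
      qed (use \<delta> in auto)
      finally show "(\<integral>\<^sup>+x. ennreal ((u x)\<^sup>2) * indicator (D \<inter> ball p (\<rho> p) \<inter> {x. infdist x \<Gamma> < \<delta>}) x \<partial>lborel)
        \<le> ennreal (K p * \<delta>) * I u + ennreal (K p * \<delta>\<^sup>2) * J u (Ms * \<delta>)" .
    qed
    also have "\<dots> = (\<Sum>p\<in>F. ennreal (K p * \<delta>)) * I u + (\<Sum>p\<in>F. ennreal (K p * \<delta>\<^sup>2)) * J u (Ms * \<delta>)"
      by (simp add: sum.distrib sum_distrib_right)
    also have "(\<Sum>p\<in>F. ennreal (K p * \<delta>)) = ennreal (Ks * \<delta>)"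
      unfolding Ks_def sum_distrib_right using Kpos \<delta>(1) by (intro sum_ennreal) (simp add: less_imp_le)
    also have "(\<Sum>p\<in>F. ennreal (K p * \<delta>\<^sup>2)) = ennreal (Ks * \<delta>\<^sup>2)"
      unfolding Ks_def sum_distrib_right using Kpos by (intro sum_ennreal) (simp add: less_imp_le)
    finally show ?thesis .
  qed
  ultimately show ?thesis using \<delta>0 that[of Ks Ms \<delta>0] unfolding I_def J_def \<Gamma>_def by blast
qed

section \<open>The Dirichlet eigenvalue\<close>

lemma l2_parallelogram:
  fixes f g :: "'b \<Rightarrow> 'c::euclidean_space"
  assumes "square_integrable M f" "square_integrable M g"
  shows "(l2 M (\<lambda>x. f x + g x))\<^sup>2 + (l2 M (\<lambda>x. f x - g x))\<^sup>2 = 2 * (l2 M f)\<^sup>2 + 2 * (l2 M g)\<^sup>2"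
proof -
  have i: "integrable M (\<lambda>x. (norm (f x + g x))\<^sup>2)" "integrable M (\<lambda>x. (norm (f x - g x))\<^sup>2)"
    "integrable M (\<lambda>x. (norm (f x))\<^sup>2)" "integrable M (\<lambda>x. (norm (g x))\<^sup>2)"
    using assms square_integrable_add[OF assms] square_integrable_diff[OF assms]
    by (simp_all add: square_integrable_def)
  have "(l2 M (\<lambda>x. f x + g x))\<^sup>2 + (l2 M (\<lambda>x. f x - g x))\<^sup>2
    = (LINT x|M. (norm (f x + g x))\<^sup>2 + (norm (f x - g x))\<^sup>2)"
    unfolding l2_square using i by simp
  also have "\<dots> = (LINT x|M. 2 * (norm (f x))\<^sup>2 + 2 * (norm (g x))\<^sup>2)"
    by (rule Bochner_Integration.integral_cong)
       (auto simp: power2_norm_eq_inner inner_add_left inner_add_right inner_diff_left inner_diff_right)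
  also have "\<dots> = 2 * (l2 M f)\<^sup>2 + 2 * (l2 M g)\<^sup>2"
    unfolding l2_square using i by simp
  finally show ?thesis .
qed

lemma l2_eq_0_iff:
  assumes "square_integrable M f"
  shows "l2 M f = 0 \<longleftrightarrow> (AE x in M. f x = 0)"
proof -
  have "l2 M f = 0 \<longleftrightarrow> (LINT x|M. (norm (f x))\<^sup>2) = 0" by (simp add: l2_def)
  also have "\<dots> \<longleftrightarrow> (AE x in M. (norm (f x))\<^sup>2 = 0)"
    using assms by (intro integral_nonneg_eq_0_iff_AE) (auto simp: square_integrable_def)
  finally show ?thesis by simp
qed

lemma nonzero_on_iff:
  assumes "square_integrable (lebesgue_on D) u"
  shows "nonzero_on D u \<longleftrightarrow> l2 (lebesgue_on D) u > 0"
  unfolding nonzero_on_def l2_eq_0_iff[OF assms, symmetric] using l2_nonneg[of "lebesgue_on D" u] by linarith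

section \<open>Limits in \<open>H1\<close> of test functions\<close>

lemma H1_tendsto:
  fixes \<psi> :: "'a::euclidean_space \<Rightarrow> real"
  assumes D: "open D" "bounded D" and \<psi>: "has_weak_gradient D \<psi> G" "square_integrable (lebesgue_on D) \<psi>"
    and u: "\<And>k. u k \<in> test_functions UNIV"
  shows "((\<lambda>k. H1_norm D (\<lambda>x. \<psi> x - u k x)) \<longlonglongrightarrow> 0) \<longleftrightarrow>
    ((\<lambda>k. l2 (lebesgue_on D) (\<lambda>x. \<psi> x - u k x)) \<longlonglongrightarrow> 0) \<and>
    ((\<lambda>k. l2 (lebesgue_on D) (\<lambda>x. G x - grad (u k) x)) \<longlonglongrightarrow> 0)" (is "?h \<longleftrightarrow> ?a \<and> ?b")
proof -
  define a where "a k = l2 (lebesgue_on D) (\<lambda>x. \<psi> x - u k x)" for k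
  define b where "b k = l2 (lebesgue_on D) (\<lambda>x. G x - grad (u k) x)" for k
  define h where "h k = H1_norm D (\<lambda>x. \<psi> x - u k x)" for k
  have hab: "(h k)\<^sup>2 = (a k)\<^sup>2 + (b k)\<^sup>2" for k
    unfolding h_def a_def b_def by (rule H1_norm_diff[OF D \<psi> u])
  have nn: "a k \<ge> 0" "b k \<ge> 0" for k by (auto simp: a_def b_def l2_nonneg)
  have h0: "h k \<ge> 0" for k
    by (auto simp: h_def H1_norm_def L2_energy_def Dirichlet_energy_def intro!: add_nonneg_nonneg integral_nonneg_AE)
  have ah: "a k \<le> h k" and bh: "b k \<le> h k" for k
    by (rule power2_le_imp_le; use hab[of k] h0 in simp)+
  have hs: "h k \<le> a k + b k" for k
    by (rule power2_le_imp_le) (use hab[of k] nn[of k] in \<open>auto simp: power2_sum\<close>)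
  have "h \<longlonglongrightarrow> 0 \<longleftrightarrow> a \<longlonglongrightarrow> 0 \<and> b \<longlonglongrightarrow> 0"
  proof safe
    assume h: "h \<longlonglongrightarrow> 0"
    show "a \<longlonglongrightarrow> 0" by (rule tendsto_sandwich[OF _ _ tendsto_const h]) (use nn ah in auto)
    show "b \<longlonglongrightarrow> 0" by (rule tendsto_sandwich[OF _ _ tendsto_const h]) (use nn bh in auto)
  next
    assume "a \<longlonglongrightarrow> 0" "b \<longlonglongrightarrow> 0"
    then have ab: "(\<lambda>k. a k + b k) \<longlonglongrightarrow> 0" using tendsto_add[of a 0 _ b 0] by simp
    show "h \<longlonglongrightarrow> 0" by (rule tendsto_sandwich[OF _ _ tendsto_const ab]) (use h0 hs in auto)
  qed
  then show ?thesis unfolding a_def b_def h_def .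
qed

lemma H1_closure_sequence:
  assumes "\<psi> \<in> H1_closure D S"
  shows "\<exists>u. (\<forall>k::nat. u k \<in> S) \<and> (\<lambda>k. H1_norm D (\<lambda>x. \<psi> x - u k x)) \<longlonglongrightarrow> 0"
proof -
  have "\<forall>k::nat. \<exists>v. v \<in> S \<and> H1_norm D (\<lambda>x. \<psi> x - v x) < inverse (real (Suc k))"
  proof
    fix k :: nat
    have "inverse (real (Suc k)) > 0" by simp
    then show "\<exists>v. v \<in> S \<and> H1_norm D (\<lambda>x. \<psi> x - v x) < inverse (real (Suc k))"
      using assms unfolding H1_closure_def by blast
  qed
  from choice[OF this] obtain u where u: "\<And>k. u k \<in> S" "\<And>k. H1_norm D (\<lambda>x. \<psi> x - u k x) < inverse (real (Suc k))"
    by blast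
  have "(\<lambda>k. H1_norm D (\<lambda>x. \<psi> x - u k x)) \<longlonglongrightarrow> 0"
  proof (rule tendsto_sandwich[OF _ _ tendsto_const LIMSEQ_inverse_real_of_nat])
    show "\<forall>\<^sub>F k in sequentially. 0 \<le> H1_norm D (\<lambda>x. \<psi> x - u k x)"
      by (auto simp: H1_norm_def L2_energy_def Dirichlet_energy_def intro!: add_nonneg_nonneg integral_nonneg_AE)
    show "\<forall>\<^sub>F k in sequentially. H1_norm D (\<lambda>x. \<psi> x - u k x) \<le> inverse (real (Suc k))"
      using u(2) by (intro always_eventually allI less_imp_le)
  qed
  then show ?thesis using u(1) by blast
qed

lemma H1_closureD:
  fixes \<psi> :: "'a::euclidean_space \<Rightarrow> real"
  assumes "\<psi> \<in> H1_closure D S"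
  obtains G where "has_weak_gradient D \<psi> G" "square_integrable (lebesgue_on D) \<psi>"
  using assms unfolding H1_closure_def H1_def by blast

text \<open>Through this, inequalities between the energies of smooth functions pass to their limits
  in \<open>H1\<close>.\<close>

lemma energies_tendsto:
  fixes \<psi> :: "'a::euclidean_space \<Rightarrow> real"
  assumes D: "open D" "bounded D" and \<psi>: "has_weak_gradient D \<psi> G" "square_integrable (lebesgue_on D) \<psi>"
    and u: "\<And>k. u k \<in> test_functions UNIV" and lim: "(\<lambda>k. H1_norm D (\<lambda>x. \<psi> x - u k x)) \<longlonglongrightarrow> 0"
  shows "(\<lambda>k. (l2 (lebesgue_on D) (u k))\<^sup>2) \<longlonglongrightarrow> L2_energy D \<psi>"
    "(\<lambda>k. (l2 (lebesgue_on D) (grad (u k)))\<^sup>2) \<longlonglongrightarrow> Dirichlet_energy D \<psi>"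
proof -
  have Dl: "D \<in> sets lebesgue" using D(1) by auto
  note l = lim[unfolded H1_tendsto[OF D \<psi> u]]
  have G: "square_integrable (lebesgue_on D) G" using \<psi>(1) by (simp add: has_weak_gradient_def)
  show "(\<lambda>k. (l2 (lebesgue_on D) (u k))\<^sup>2) \<longlonglongrightarrow> L2_energy D \<psi>"
    unfolding L2_energy_eq
    by (intro tendsto_power l2_tendsto square_integrable_test[OF u Dl] \<psi>(2) conjunct1[OF l])
  show "(\<lambda>k. (l2 (lebesgue_on D) (grad (u k)))\<^sup>2) \<longlonglongrightarrow> Dirichlet_energy D \<psi>"
    unfolding Dirichlet_energy_eq[OF D \<psi>(1)]
    by (intro tendsto_power l2_tendsto square_integrable_test[OF u Dl] G conjunct2[OF l])
qed

text \<open>Keeps the set of Dirichlet quotients nonempty; the \<open>Inf\<close> of the empty set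
  would be an arbitrary value.\<close>

lemma test_function_nonzero_exists:
  fixes D :: "'a::euclidean_space set"
  assumes "open D" "D \<noteq> {}"
  obtains w where "w \<in> test_functions D" "l2 lborel w > 0"
proof -
  obtain p r where p: "r > 0" "cball p r \<subseteq> D" using assms(2) open_contains_cball[THEN iffD1, OF assms(1)] by blast
  define \<delta> where "\<delta> = r / 4"
  have \<delta>: "\<delta> > 0" "3 * \<delta> \<le> r" using p by (auto simp: \<delta>_def)
  obtain C :: real where C: "\<And>(A::'a set) \<delta>. A \<in> sets borel \<Longrightarrow> bounded A \<Longrightarrow> \<delta> > 0 \<Longrightarrow> \<exists>\<eta>. cutoff C A \<delta> \<eta>"
    by (rule cutoff_exists) blast
  have b: "ball p (2 * \<delta>) \<in> sets borel" by auto
  obtain w where cw: "cutoff C (ball p (2 * \<delta>)) \<delta> w"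
    using C[OF b bounded_ball \<delta>(1)] by (rule exE)
  have w: "smooth w" "\<And>x. ball x \<delta> \<subseteq> ball p (2 * \<delta>) \<Longrightarrow> w x = 1"
    "\<And>x. ball x \<delta> \<inter> ball p (2 * \<delta>) = {} \<Longrightarrow> w x = 0"
    using cw by (simp_all add: cutoff_def)
  have wt: "w \<in> test_functions D"
  proof (rule test_functionsI[OF w(1) compact_cball[of p "3 * \<delta>"]])
    show "cball p (3 * \<delta>) \<subseteq> D" using p(2) \<delta>(2) by auto
    fix x assume x: "x \<notin> cball p (3 * \<delta>)"
    have "ball x \<delta> \<inter> ball p (2 * \<delta>) = {}"
    proof (rule ccontr)
      assume "ball x \<delta> \<inter> ball p (2 * \<delta>) \<noteq> {}"
      then obtain y where "dist x y < \<delta>" "dist p y < 2 * \<delta>" by auto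
      then show False using x dist_triangle[of p x y] by (simp add: dist_commute)
    qed
    then show "w x = 0" by (rule w(3))
  qed
  have "w x = 1" if "x \<in> ball p \<delta>" for x
  proof (rule w(2), rule subsetI)
    fix y assume "y \<in> ball x \<delta>"
    then show "y \<in> ball p (2 * \<delta>)" using that dist_triangle[of p y x] by simp
  qed
  then have "(LINT x|lborel. indicat_real (ball p \<delta>) x) \<le> (LINT x|lborel. (norm (w x))\<^sup>2)"
  proof (intro integral_mono)
    show "integrable lborel (indicat_real (ball p \<delta>))"
      using emeasure_bounded_finite[of "ball p \<delta>"] by (intro integrable_real_indicator) auto
    show "integrable lborel (\<lambda>x. (norm (w x))\<^sup>2)"
      using square_integrable_lborel_test(1)[OF wt] by (simp add: square_integrable_def)
  qed (auto simp: indicator_def)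
  moreover have "(LINT x|lborel. indicat_real (ball p \<delta>) x) > 0"
    using content_ball_pos[OF \<delta>(1), of p] by simp
  ultimately have "0 < (l2 lborel w)\<^sup>2" unfolding l2_square by linarith
  then have "l2 lborel w > 0" using l2_nonneg[of lborel w] by (simp add: zero_less_power2)
  then show ?thesis using wt that by blast
qed

section \<open>Minimisation of the Dirichlet quotient\<close>

text \<open>Restricted to test functions, which vanish outside \<open>D\<close>, so that integrals
  over the whole space and classical gradients replace those of \<open>eigenvalue_DD\<close>; the
  two numbers agree once a minimiser in \<open>H1_0 D\<close> is found.\<close>

definition rayleigh_inf :: "'a::euclidean_space set \<Rightarrow> real" where
  "rayleigh_inf D = Inf {(l2 lborel (grad w))\<^sup>2 / (l2 lborel w)\<^sup>2 | w. w \<in> test_functions D \<and> l2 lborel w > 0}"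

lemma rayleigh_inf_le:
  fixes D :: "'a::euclidean_space set"
  assumes "w \<in> test_functions D"
  shows "rayleigh_inf D * (l2 lborel w)\<^sup>2 \<le> (l2 lborel (grad w))\<^sup>2"
proof (cases "l2 lborel w > 0")
  case True
  have "rayleigh_inf D \<le> (l2 lborel (grad w))\<^sup>2 / (l2 lborel w)\<^sup>2"
    unfolding rayleigh_inf_def
  proof (rule cInf_lower)
    show "bdd_below {(l2 lborel (grad w))\<^sup>2 / (l2 lborel w)\<^sup>2 | w::'a \<Rightarrow> real. w \<in> test_functions D \<and> l2 lborel w > 0}"
      by (rule bdd_belowI[of _ 0]) auto
  qed (use True assms in blast)
  then show ?thesis using True by (simp add: pos_le_divide_eq)
next
  case False
  then have "l2 lborel w = 0" using l2_nonneg[of lborel w] by linarith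
  then show ?thesis by simp
qed

lemma rayleigh_inf_nonneg:
  fixes D :: "'a::euclidean_space set"
  assumes "open D" "D \<noteq> {}" shows "rayleigh_inf D \<ge> 0"
proof -
  obtain w where w: "w \<in> test_functions D" "l2 lborel w > 0" using test_function_nonzero_exists[OF assms] .
  have "{(l2 lborel (grad w))\<^sup>2 / (l2 lborel w)\<^sup>2 | w::'a \<Rightarrow> real. w \<in> test_functions D \<and> l2 lborel w > 0} \<noteq> {}"
    using w by blast
  then show ?thesis unfolding rayleigh_inf_def by (rule cInf_greatest) auto
qed

lemma test_functions_normalize:
  assumes w: "w \<in> test_functions D" and c: "c > 0"
  shows "(\<lambda>x. (1 / c) * w x) \<in> test_functions D" "l2 M (\<lambda>x. (1 / c) * w x) = l2 M w / c"
    "l2 N (grad (\<lambda>x. (1 / c) * w x)) = l2 N (grad w) / c"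
proof -
  show "(\<lambda>x. (1 / c) * w x) \<in> test_functions D" by (rule test_functions_mult[OF w smooth_const])
  show "l2 M (\<lambda>x. (1 / c) * w x) = l2 M w / c" using l2_scale[of M "1 / c" w] c by simp
  have "grad (\<lambda>x. (1 / c) * w x) = (\<lambda>x. (1 / c) *\<^sub>R grad w x)"
    by (rule ext) (rule grad_cmult[OF test_functionsD(1)[OF w]])
  then show "l2 N (grad (\<lambda>x. (1 / c) * w x)) = l2 N (grad w) / c"
    using l2_scale[of N "1 / c" "grad w"] c by simp
qed

lemma rayleigh_minimizing:
  fixes D :: "'a::euclidean_space set"
  assumes D: "open D" "D \<noteq> {}" and e: "e > 0"
  obtains w where "w \<in> test_functions D" "l2 lborel w = 1" "(l2 lborel (grad w))\<^sup>2 \<le> rayleigh_inf D + e"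
proof -
  define X where "X = {(l2 lborel (grad w))\<^sup>2 / (l2 lborel w)\<^sup>2 | w::'a \<Rightarrow> real. w \<in> test_functions D \<and> l2 lborel w > 0}"
  obtain w0 where "w0 \<in> test_functions D" "l2 lborel w0 > 0" using test_function_nonzero_exists[OF D] .
  then have "X \<noteq> {}" by (auto simp: X_def)
  moreover have "Inf X < rayleigh_inf D + e" using e by (simp add: rayleigh_inf_def X_def)
  ultimately obtain q where "q \<in> X" "q < rayleigh_inf D + e" using cInf_lessD by blast
  then obtain w where w: "w \<in> test_functions D" "l2 lborel w > 0"
    "(l2 lborel (grad w))\<^sup>2 / (l2 lborel w)\<^sup>2 < rayleigh_inf D + e" by (auto simp: X_def)
  note n = test_functions_normalize[OF w(1,2)]
  show ?thesis
    by (rule that[OF n(1)]) (use w in \<open>simp_all only: n(2,3) power_divide, auto\<close>)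
qed

text \<open>A quasi-minimizing sequence of a quadratic form that is Cauchy in \<open>L\<^sup>2\<close> is Cauchy in the
  form norm: the parallelogram law gives \<open>a(f - g) \<le> 2(a(f) - \<lambda>) + 2(a(g) - \<lambda>) + \<lambda> \<parallel>f - g\<parallel>\<^sup>2\<close>.\<close>

lemma dirichlet_minimizer:
  fixes D :: "'a::euclidean_space set"
  assumes D: "open D" "bounded D" "D \<noteq> {}"
  obtains \<psi> where "\<psi> \<in> H1_0 D" "L2_energy D \<psi> = 1" "Dirichlet_energy D \<psi> = rayleigh_inf D"
    "nonzero_on D \<psi>"
proof -
  define \<Lambda> where "\<Lambda> = rayleigh_inf D"
  have \<Lambda>0: "\<Lambda> \<ge> 0" unfolding \<Lambda>_def by (rule rayleigh_inf_nonneg[OF D(1,3)])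
  have Dl: "D \<in> sets lebesgue" using D(1) by auto
  have "\<forall>k::nat. \<exists>w. w \<in> test_functions D \<and> l2 lborel w = 1 \<and> (l2 lborel (grad w))\<^sup>2 \<le> \<Lambda> + inverse (real (Suc k))"
  proof
    fix k :: nat
    have "inverse (real (Suc k)) > 0" by simp
    then obtain w where "w \<in> test_functions D" "l2 lborel w = 1" "(l2 lborel (grad w))\<^sup>2 \<le> \<Lambda> + inverse (real (Suc k))"
      using rayleigh_minimizing[OF D(1,3) \<open>inverse (real (Suc k)) > 0\<close>] unfolding \<Lambda>_def by blast
    then show "\<exists>w. w \<in> test_functions D \<and> l2 lborel w = 1 \<and> (l2 lborel (grad w))\<^sup>2 \<le> \<Lambda> + inverse (real (Suc k))" by blast
  qed
  from choice[OF this] obtain v where v: "\<And>k. v k \<in> test_functions D" "\<And>k. l2 lborel (v k) = 1"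
    "\<And>k. (l2 lborel (grad (v k)))\<^sup>2 \<le> \<Lambda> + inverse (real (Suc k))" by blast
  \<comment> \<open>One subsequence for all cells of all meshes; the normalisation bounds each cell
    integral by the norm of the indicator of the cell.\<close>
  obtain r where r: "strict_mono (r::nat\<Rightarrow>nat)" "\<And>i. i \<in> cell_index D \<Longrightarrow> convergent (\<lambda>n. cell_integral (v (r n)) i)"
  proof (rule pointwise_bounded_convergent_subsequence[OF countable_cell_index[OF D(2)], of "\<lambda>n i. cell_integral (v n) i"])
    fix i :: "real \<times> 'a" assume "i \<in> cell_index D"
    then have "\<bar>cell_integral (v n) i\<bar> \<le> l2 lborel (indicat_real (lattice_cell (fst i) (snd i)))" for n
      using cell_integral_bound[OF cell_index_pos square_integrable_lborel_test(1)[OF v(1)], of i D n] v(2)[of n] by simp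
    then show "\<exists>M. \<forall>n. \<bar>cell_integral (v n) i\<bar> \<le> M" by blast
  qed blast
  define w where "w k = v (r k)" for k
  have w: "w k \<in> test_functions D" "l2 lborel (w k) = 1" for k by (auto simp: w_def v)
  have wg: "(l2 lborel (grad (w k)))\<^sup>2 \<le> \<Lambda> + inverse (real (Suc k))" for k
  proof -
    have "inverse (real (Suc (r k))) \<le> inverse (real (Suc k))"
      using seq_suble[OF r(1), of k] by (intro le_imp_inverse_le) auto
    then show ?thesis using v(3)[of "r k"] unfolding w_def by linarith
  qed
  have wb: "l2 lborel (grad (w k)) \<le> sqrt (\<Lambda> + 1)" for k
  proof (rule real_le_rsqrt)
    have "inverse (real (Suc k)) \<le> 1" by (simp add: inverse_le_1_iff)
    then show "(l2 lborel (grad (w k)))\<^sup>2 \<le> \<Lambda> + 1" using wg[of k] by linarith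
  qed
  note sq = square_integrable_lborel_test[OF w(1)]
  have cau: "\<exists>K. \<forall>k\<ge>K. \<forall>l\<ge>K. l2 lborel (\<lambda>x. w k x - w l x) < \<epsilon>" if "\<epsilon> > 0" for \<epsilon>
    by (rule rellich_Cauchy[OF D(2) w(1) wb _ that]) (use r(2) in \<open>simp add: w_def\<close>)
  have gdiff: "(l2 lborel (\<lambda>x. grad (w k) x - grad (w l) x))\<^sup>2
    \<le> 2 * inverse (real (Suc k)) + 2 * inverse (real (Suc l)) + \<Lambda> * (l2 lborel (\<lambda>x. w k x - w l x))\<^sup>2" for k l
  proof -
    have s: "(\<lambda>x. w k x + w l x) \<in> test_functions D" by (rule test_functions_add[OF w(1) w(1)])
    have "\<Lambda> * (l2 lborel (\<lambda>x. w k x + w l x))\<^sup>2 \<le> (l2 lborel (\<lambda>x. grad (w k) x + grad (w l) x))\<^sup>2"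
      using rayleigh_inf_le[OF s] by (simp add: \<Lambda>_def grad_add[OF test_functionsD(1)[OF w(1)] test_functionsD(1)[OF w(1)], abs_def])
    moreover have "(l2 lborel (\<lambda>x. w k x + w l x))\<^sup>2 = 4 - (l2 lborel (\<lambda>x. w k x - w l x))\<^sup>2"
      using l2_parallelogram[OF sq(1)[of k] sq(1)[of l]] w(2) by simp
    moreover have "(l2 lborel (\<lambda>x. grad (w k) x + grad (w l) x))\<^sup>2 + (l2 lborel (\<lambda>x. grad (w k) x - grad (w l) x))\<^sup>2
      = 2 * (l2 lborel (grad (w k)))\<^sup>2 + 2 * (l2 lborel (grad (w l)))\<^sup>2"
      by (rule l2_parallelogram[OF sq(2)[of k] sq(2)[of l]])
    ultimately show ?thesis using wg[of k] wg[of l] by (simp add: right_diff_distrib)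
  qed
  have gcau: "\<exists>K. \<forall>k\<ge>K. \<forall>l\<ge>K. l2 lborel (\<lambda>x. grad (w k) x - grad (w l) x) < \<epsilon>" if \<epsilon>: "\<epsilon> > 0" for \<epsilon>
  proof -
    \<comment> \<open>Chosen so that \<open>\<Lambda> * \<eta>^2\<close> is at most
      \<open>\<epsilon>^2 / 4\<close>; the added 1 admits \<open>\<Lambda> = 0\<close>.\<close>
    define \<eta> where "\<eta> = sqrt (\<epsilon>\<^sup>2 / (4 * (\<Lambda> + 1)))"
    have \<eta>: "\<eta> > 0" "\<eta>\<^sup>2 = \<epsilon>\<^sup>2 / (4 * (\<Lambda> + 1))" using \<epsilon> \<Lambda>0 by (auto simp: \<eta>_def)
    obtain K1 where K1: "\<forall>k\<ge>K1. \<forall>l\<ge>K1. l2 lborel (\<lambda>x. w k x - w l x) < \<eta>" using cau[OF \<eta>(1)] by blast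
    obtain K2 where K2: "inverse (real (Suc K2)) < \<epsilon>\<^sup>2 / 8" using reals_Archimedean[of "\<epsilon>\<^sup>2 / 8"] \<epsilon> by auto
    have "l2 lborel (\<lambda>x. grad (w k) x - grad (w l) x) < \<epsilon>" if kl: "k \<ge> max K1 K2" "l \<ge> max K1 K2" for k l
    proof (rule power2_less_imp_less)
      have inv: "inverse (real (Suc k)) < \<epsilon>\<^sup>2 / 8" if "k \<ge> K2" for k
        by (rule le_less_trans[OF _ K2]) (use that in \<open>intro le_imp_inverse_le, auto\<close>)
      have "(l2 lborel (\<lambda>x. w k x - w l x))\<^sup>2 \<le> \<eta>\<^sup>2"
        using K1 kl by (intro power_mono l2_nonneg less_imp_le) auto
      then have "\<Lambda> * (l2 lborel (\<lambda>x. w k x - w l x))\<^sup>2 \<le> \<Lambda> * (\<epsilon>\<^sup>2 / (4 * (\<Lambda> + 1)))"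
        unfolding \<eta>(2) using \<Lambda>0 by (rule mult_left_mono)
      also have "\<dots> \<le> \<epsilon>\<^sup>2 / 4" using \<Lambda>0 by (simp add: divide_simps) (simp add: algebra_simps)
      finally have "\<Lambda> * (l2 lborel (\<lambda>x. w k x - w l x))\<^sup>2 \<le> \<epsilon>\<^sup>2 / 4" .
      moreover have "inverse (real (Suc k)) < \<epsilon>\<^sup>2 / 8" "inverse (real (Suc l)) < \<epsilon>\<^sup>2 / 8"
        by (rule inv, use kl in simp)+
      moreover have "\<epsilon>\<^sup>2 > 0" using \<epsilon> by simp
      ultimately show "(l2 lborel (\<lambda>x. grad (w k) x - grad (w l) x))\<^sup>2 < \<epsilon>\<^sup>2"
        using gdiff[of k l] by linarith
    qed (use \<epsilon> in simp)
    then show ?thesis by blast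
  qed
  define M where "M = lebesgue_on D"
  have sqM: "square_integrable M (w k)" "square_integrable M (grad (w k))" for k
    unfolding M_def by (rule square_integrable_test[OF w(1) Dl])+
  have lM: "l2 M (\<lambda>x. w k x - w l x) = l2 lborel (\<lambda>x. w k x - w l x)" for k l
    unfolding M_def by (rule l2_test_functions_lborel(1)[OF test_functions_diff[OF w(1) w(1)] Dl])
  have lMg: "l2 M (\<lambda>x. grad (w k) x - grad (w l) x) = l2 lborel (\<lambda>x. grad (w k) x - grad (w l) x)" for k l
    using l2_test_functions_lborel(2)[OF test_functions_diff[OF w(1)[of k] w(1)[of l]] Dl]
    by (simp add: M_def grad_diff[OF test_functionsD(1)[OF w(1)] test_functionsD(1)[OF w(1)], abs_def])
  obtain \<psi> where \<psi>: "square_integrable M \<psi>" "(\<lambda>k. l2 M (\<lambda>x. \<psi> x - w k x)) \<longlonglongrightarrow> 0"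
    using l2_complete[of M w, OF sqM(1)] cau unfolding lM by blast
  obtain G where G: "square_integrable M G" "(\<lambda>k. l2 M (\<lambda>x. G x - grad (w k) x)) \<longlonglongrightarrow> 0"
    using l2_complete[of M "\<lambda>k. grad (w k)", OF sqM(2)] gcau unfolding lMg by blast
  \<comment> \<open>Functions and gradients converge separately in \<open>L2\<close>; both sides of
    the integration by parts are continuous for this convergence by Cauchy-Schwarz, which identifies
    \<open>G\<close> as the weak gradient of \<open>\<psi>\<close>.\<close>
  have wG: "has_weak_gradient D \<psi> G"
    unfolding has_weak_gradient_def
  proof (intro conjI ballI)
    show "square_integrable (lebesgue_on D) G" using G(1) by (simp add: M_def)
    fix \<phi> b assume \<phi>: "\<phi> \<in> test_functions D" and b: "b \<in> (Basis :: 'a set)"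
    have f: "square_integrable M (\<lambda>x. frechet_derivative \<phi> (at x) b)" "square_integrable M \<phi>"
      unfolding M_def by (rule square_integrable_frechet[OF \<phi> Dl], rule square_integrable_test(1)[OF \<phi> Dl])
    have l1: "(\<lambda>k. LINT x|M. w k x * frechet_derivative \<phi> (at x) b) \<longlonglongrightarrow> (LINT x|M. \<psi> x * frechet_derivative \<phi> (at x) b)"
    proof (rule LIM_zero_cancel, rule Lim_null_comparison)
      show "\<forall>\<^sub>F k in sequentially. norm ((LINT x|M. w k x * frechet_derivative \<phi> (at x) b) - (LINT x|M. \<psi> x * frechet_derivative \<phi> (at x) b))
        \<le> l2 M (\<lambda>x. \<psi> x - w k x) * l2 M (\<lambda>x. frechet_derivative \<phi> (at x) b)"
      proof (rule always_eventually, rule allI)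
        fix k
        have "(LINT x|M. (w k x - \<psi> x) * frechet_derivative \<phi> (at x) b)
          = (LINT x|M. w k x * frechet_derivative \<phi> (at x) b) - (LINT x|M. \<psi> x * frechet_derivative \<phi> (at x) b)"
          unfolding left_diff_distrib
          by (intro Bochner_Integration.integral_diff square_integrable_mult_integrable sqM \<psi> f)
        then show "norm ((LINT x|M. w k x * frechet_derivative \<phi> (at x) b) - (LINT x|M. \<psi> x * frechet_derivative \<phi> (at x) b))
          \<le> l2 M (\<lambda>x. \<psi> x - w k x) * l2 M (\<lambda>x. frechet_derivative \<phi> (at x) b)"
          using l2_Cauchy_Schwarz[OF square_integrable_diff[OF sqM(1) \<psi>(1)] f(1), of k]
          by (simp add: l2_minus_commute[of M \<psi>])
      qed
      show "(\<lambda>k. l2 M (\<lambda>x. \<psi> x - w k x) * l2 M (\<lambda>x. frechet_derivative \<phi> (at x) b)) \<longlonglongrightarrow> 0"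
        using tendsto_mult_right[OF \<psi>(2), of "l2 M (\<lambda>x. frechet_derivative \<phi> (at x) b)"] by simp
    qed
    have l2': "(\<lambda>k. LINT x|M. (grad (w k) x \<bullet> b) * \<phi> x) \<longlonglongrightarrow> (LINT x|M. (G x \<bullet> b) * \<phi> x)"
    proof (rule LIM_zero_cancel, rule Lim_null_comparison)
      show "\<forall>\<^sub>F k in sequentially. norm ((LINT x|M. (grad (w k) x \<bullet> b) * \<phi> x) - (LINT x|M. (G x \<bullet> b) * \<phi> x))
        \<le> l2 M (\<lambda>x. G x - grad (w k) x) * l2 M \<phi>"
      proof (rule always_eventually, rule allI)
        fix k
        have d: "square_integrable M (\<lambda>x. grad (w k) x - G x)" by (rule square_integrable_diff[OF sqM(2) G(1)])
        have "(LINT x|M. ((grad (w k) x - G x) \<bullet> b) * \<phi> x)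
          = (LINT x|M. (grad (w k) x \<bullet> b) * \<phi> x) - (LINT x|M. (G x \<bullet> b) * \<phi> x)"
          unfolding left_diff_distrib inner_diff_left
          by (intro Bochner_Integration.integral_diff square_integrable_mult_integrable square_integrable_component sqM G f)
        moreover have "l2 M (\<lambda>x. (grad (w k) x - G x) \<bullet> b) \<le> l2 M (\<lambda>x. grad (w k) x - G x)"
        proof (rule square_integrable_mono(2)[OF d])
          show "(\<lambda>x. (grad (w k) x - G x) \<bullet> b) \<in> borel_measurable M"
            by (rule square_integrable_measurable[OF square_integrable_component[OF d]])
          show "AE x in M. norm ((grad (w k) x - G x) \<bullet> b) \<le> norm (grad (w k) x - G x)"
            using Basis_le_norm[OF b] by (intro AE_I2) simp
        qed
        ultimately show "norm ((LINT x|M. (grad (w k) x \<bullet> b) * \<phi> x) - (LINT x|M. (G x \<bullet> b) * \<phi> x))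
          \<le> l2 M (\<lambda>x. G x - grad (w k) x) * l2 M \<phi>"
          using l2_Cauchy_Schwarz[OF square_integrable_component[OF d, of b] f(2)]
            mult_right_mono[OF _ l2_nonneg[of M \<phi>], of "l2 M (\<lambda>x. (grad (w k) x - G x) \<bullet> b)"]
          by (simp add: l2_minus_commute[of M G]) (meson order_trans)
      qed
      show "(\<lambda>k. l2 M (\<lambda>x. G x - grad (w k) x) * l2 M \<phi>) \<longlonglongrightarrow> 0"
        using tendsto_mult_right[OF G(2), of "l2 M \<phi>"] by simp
    qed
    have "(LINT x|M. w k x * frechet_derivative \<phi> (at x) b) = - (LINT x|M. (grad (w k) x \<bullet> b) * \<phi> x)" for k
      using has_weak_gradient_smooth[OF D(1) w(1), of k] \<phi> b by (simp add: has_weak_gradient_def M_def)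
    then have "(\<lambda>k. LINT x|M. w k x * frechet_derivative \<phi> (at x) b) \<longlonglongrightarrow> - (LINT x|M. (G x \<bullet> b) * \<phi> x)"
      using tendsto_minus[OF l2'] by simp
    then show "(LINT x|lebesgue_on D. \<psi> x * frechet_derivative \<phi> (at x) b) = - (LINT x|lebesgue_on D. (G x \<bullet> b) * \<phi> x)"
      using LIMSEQ_unique[OF l1] by (simp add: M_def)
  qed
  have wU: "w k \<in> test_functions UNIV" for k by (rule test_functions_mono[OF _ w(1)]) auto
  have lim: "(\<lambda>k. H1_norm D (\<lambda>x. \<psi> x - w k x)) \<longlonglongrightarrow> 0"
    using H1_tendsto[OF D(1,2) wG \<psi>(1)[unfolded M_def], of w, OF wU] \<psi>(2) G(2) by (simp add: M_def)
  have H: "\<psi> \<in> H1_0 D"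
    unfolding H1_0_def H1_closure_def H1_def
  proof (intro CollectI conjI allI impI)
    show "square_integrable (lebesgue_on D) \<psi>" using \<psi>(1) by (simp add: M_def)
    show "\<exists>G. has_weak_gradient D \<psi> G" using wG by blast
    fix \<epsilon> :: real assume "\<epsilon> > 0"
    then have "\<forall>\<^sub>F k in sequentially. H1_norm D (\<lambda>x. \<psi> x - w k x) < \<epsilon>"
      using lim by (rule order_tendstoD(2)[rotated])
    then obtain k where "H1_norm D (\<lambda>x. \<psi> x - w k x) < \<epsilon>" by (auto simp: eventually_sequentially)
    then show "\<exists>v\<in>test_functions D. H1_norm D (\<lambda>x. \<psi> x - v x) < \<epsilon>" using w(1) by blast
  qed
  note en = energies_tendsto[OF D(1,2) wG \<psi>(1)[unfolded M_def], of w, OF wU lim]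
  have wl: "l2 (lebesgue_on D) (w k) = 1" "l2 (lebesgue_on D) (grad (w k)) = l2 lborel (grad (w k))" for k
    using l2_test_functions_lborel[OF w(1) Dl] w(2) by auto
  have E1: "L2_energy D \<psi> = 1"
    using LIMSEQ_unique[OF en(1)[unfolded wl] tendsto_const] by simp
  have E2: "Dirichlet_energy D \<psi> = \<Lambda>"
  proof (rule LIMSEQ_unique[OF en(2)[unfolded wl]])
    show "(\<lambda>k. (l2 lborel (grad (w k)))\<^sup>2) \<longlonglongrightarrow> \<Lambda>"
    proof (rule tendsto_sandwich[OF _ _ tendsto_const])
      show "\<forall>\<^sub>F k in sequentially. \<Lambda> \<le> (l2 lborel (grad (w k)))\<^sup>2"
        using rayleigh_inf_le[OF w(1)] w(2) by (simp add: \<Lambda>_def)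
      show "\<forall>\<^sub>F k in sequentially. (l2 lborel (grad (w k)))\<^sup>2 \<le> \<Lambda> + inverse (real (Suc k))"
        using wg by simp
      show "(\<lambda>k. \<Lambda> + inverse (real (Suc k))) \<longlonglongrightarrow> \<Lambda>"
        using tendsto_add[OF tendsto_const[of \<Lambda>] LIMSEQ_inverse_real_of_nat] by simp
    qed
  qed
  have "nonzero_on D \<psi>"
    using nonzero_on_iff[OF \<psi>(1)[unfolded M_def]] E1 l2_nonneg[of "lebesgue_on D" \<psi>]
    by (auto simp: L2_energy_eq less_le)
  then show ?thesis using that H E1 E2 by (simp add: \<Lambda>_def)
qed

lemma rayleigh_inf_le_H1_0:
  fixes D :: "'a::euclidean_space set"
  assumes D: "open D" "bounded D" and \<psi>: "\<psi> \<in> H1_0 D" "nonzero_on D \<psi>"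
  shows "rayleigh_inf D \<le> Dirichlet_energy D \<psi> / L2_energy D \<psi>"
proof -
  have Dl: "D \<in> sets lebesgue" using D(1) by auto
  obtain G where G: "has_weak_gradient D \<psi> G" "square_integrable (lebesgue_on D) \<psi>"
    using \<psi>(1) unfolding H1_0_def by (rule H1_closureD)
  obtain w where w: "\<And>k::nat. w k \<in> test_functions D" "(\<lambda>k. H1_norm D (\<lambda>x. \<psi> x - w k x)) \<longlonglongrightarrow> 0"
    using H1_closure_sequence[OF \<psi>(1)[unfolded H1_0_def]] by blast
  have wU: "w k \<in> test_functions UNIV" for k by (rule test_functions_mono[OF _ w(1)]) auto
  note en = energies_tendsto[OF D G, of w, OF wU w(2)]
  have "rayleigh_inf D * L2_energy D \<psi> \<le> Dirichlet_energy D \<psi>"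
  proof (rule LIMSEQ_le[OF tendsto_mult_left[OF en(1)] en(2)], intro exI allI impI)
    show "rayleigh_inf D * (l2 (lebesgue_on D) (w k))\<^sup>2 \<le> (l2 (lebesgue_on D) (grad (w k)))\<^sup>2" for k
      unfolding l2_test_functions_lborel[OF w(1) Dl] by (rule rayleigh_inf_le[OF w(1)])
  qed
  moreover have "L2_energy D \<psi> > 0"
    using \<psi>(2) nonzero_on_iff[OF G(2)] by (simp add: L2_energy_eq)
  ultimately show ?thesis by (simp add: pos_le_divide_eq)
qed

text \<open>\<open>LEAST\<close> over the reals is meaningful only when the minimum is attained, and
  the minimiser supplies this; density of test functions gives minimality.\<close>

lemma eigenvalue_DD_eq_rayleigh_inf:
  fixes D :: "'a::euclidean_space set"
  assumes D: "open D" "bounded D" "D \<noteq> {}"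
  shows "eigenvalue_DD D = rayleigh_inf D"
  unfolding eigenvalue_DD_def
proof (rule Least_equality)
  obtain \<psi> where "\<psi> \<in> H1_0 D" "L2_energy D \<psi> = 1" "Dirichlet_energy D \<psi> = rayleigh_inf D" "nonzero_on D \<psi>"
    using dirichlet_minimizer[OF D] .
  then show "\<exists>\<psi>. \<psi> \<in> H1_0 D \<and> nonzero_on D \<psi> \<and> rayleigh_inf D = Dirichlet_energy D \<psi> / L2_energy D \<psi>"
    by (intro exI[of _ \<psi>]) simp
qed (use rayleigh_inf_le_H1_0[OF D(1,2)] in blast)

section \<open>The Robin-Dirichlet eigenvalue\<close>

lemma test_functions_offD:
  assumes "u \<in> test_functions_off \<Theta>"
  shows "u \<in> test_functions UNIV" "smooth u" "spt u \<inter> frontier \<Theta> = {}"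
  using assms by (auto simp: test_functions_off_def test_functions_def)

lemma test_functions_off_add:
  assumes "u \<in> test_functions_off \<Theta>" "v \<in> test_functions_off \<Theta>"
  shows "(\<lambda>x. u x + v x) \<in> test_functions_off \<Theta>"
proof -
  have "spt (\<lambda>x. u x + v x) \<subseteq> spt u \<union> spt v"
    by (rule spt_subset) (auto simp: closed_spt spt_notin)
  then show ?thesis using assms unfolding test_functions_off_def by (auto intro: test_functions_add)
qed

lemma test_functions_off_cmult:
  assumes "u \<in> test_functions_off \<Theta>"
  shows "(\<lambda>x. c * u x) \<in> test_functions_off \<Theta>"
proof -
  have "spt (\<lambda>x. c * u x) \<subseteq> spt u"
    by (rule spt_subset) (auto simp: closed_spt spt_notin)
  then show ?thesis using assms test_functions_mult[OF _ smooth_const, of u UNIV c]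
    unfolding test_functions_off_def by auto
qed

locale robin_domain =
  fixes \<Omega>0 \<Theta> :: "'a::euclidean_space set"
  assumes dim: "DIM('a) \<ge> 2"
    and open0: "open \<Omega>0" and bounded0: "bounded \<Omega>0" and nonempty0: "\<Omega>0 \<noteq> {}"
    and lipschitz0: "lipschitz_boundary \<Omega>0"
    and open\<Theta>: "open \<Theta>" and \<Theta>_subset: "closure \<Theta> \<subseteq> \<Omega>0"
begin

definition \<Omega> :: "'a set" where "\<Omega> = \<Omega>0 - closure \<Theta>"
definition \<sigma> :: "'a measure" where "\<sigma> = surface_measure (frontier \<Omega>0)"
definition M :: "'a measure" where "M = lebesgue_on \<Omega>"
text \<open>Square integrability on the outer boundary is part of the class because
  \<open>has_trace\<close> delivers it: functions whose boundary values converge in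
  \<open>L2\<close> to a square-integrable trace have it from some index on.\<close>

definition V :: "('a \<Rightarrow> real) set" where
  "V = {u \<in> test_functions_off \<Theta>. square_integrable \<sigma> u}"

lemma open\<Omega>: "open \<Omega>" and bounded\<Omega>: "bounded \<Omega>"
  using open0 bounded0 by (auto simp: \<Omega>_def open_Diff intro: bounded_subset)

lemma lebesgue\<Omega>: "\<Omega> \<in> sets lebesgue"
  using open\<Omega> by auto

text \<open>Otherwise \<open>\<Omega>0 = closure \<Theta>\<close> would be open and closed, hence
  the whole space, which is unbounded.\<close>

lemma nonempty\<Omega>: "\<Omega> \<noteq> {}"
proof
  assume "\<Omega> = {}"
  then have "\<Omega>0 = closure \<Theta>" using \<Theta>_subset by (auto simp: \<Omega>_def)
  then have "closed \<Omega>0" by simp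
  then have "\<Omega>0 = UNIV" using open0 nonempty0 clopen[of \<Omega>0] by blast
  then show False using bounded0 not_bounded_UNIV by simp
qed

lemma frontier_nonempty: "frontier \<Omega>0 \<noteq> {}"
  using nonempty0 bounded0 frontier_eq_empty[of \<Omega>0] not_bounded_UNIV by auto

lemma space_M[simp]: "space M = \<Omega>" by (simp add: M_def)

lemma AE_M_I: "(\<And>x. x \<in> \<Omega> \<Longrightarrow> P x) \<Longrightarrow> AE x in M. P x"
  by (intro AE_I2) simp

lemma VD:
  assumes "u \<in> V"
  shows "u \<in> test_functions_off \<Theta>" "u \<in> test_functions UNIV" "smooth u" "square_integrable \<sigma> u"
  using assms test_functions_offD[of u \<Theta>] by (auto simp: V_def)

lemma square_integrable_M:
  assumes "u \<in> test_functions UNIV"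
  shows "square_integrable M u" "square_integrable M (grad u)"
  unfolding M_def by (rule square_integrable_test[OF assms lebesgue\<Omega>])+

lemma V_add: "u \<in> V \<Longrightarrow> v \<in> V \<Longrightarrow> (\<lambda>x. u x + v x) \<in> V"
  by (simp add: V_def test_functions_off_add square_integrable_add)

lemma test_functions_subset_off: "test_functions \<Omega> \<subseteq> test_functions_off \<Theta>"
proof
  fix u assume u: "u \<in> test_functions \<Omega>"
  have "frontier \<Theta> \<subseteq> closure \<Theta>" by (simp add: frontier_def)
  then have "spt u \<inter> frontier \<Theta> = {}" using test_functionsD(3)[OF u] by (auto simp: \<Omega>_def)
  then show "u \<in> test_functions_off \<Theta>"
    using test_functions_mono[OF _ u, of UNIV] by (simp add: test_functions_off_def)
qed

section \<open>Robin quotients and their approximation by smooth functions\<close>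

definition robin_quotients :: "real \<Rightarrow> real set" where
  "robin_quotients \<beta> = {(Dirichlet_energy \<Omega> \<psi> + \<beta> * (LINT x|\<sigma>. (g x)\<^sup>2)) / L2_energy \<Omega> \<psi>
    | \<psi> g. \<psi> \<in> H1_vanishing \<Theta> \<Omega> \<and> nonzero_on \<Omega> \<psi> \<and> has_trace \<Omega>0 \<Theta> \<psi> g}"

lemma eigenvalue_RD_eq: "eigenvalue_RD \<beta> \<Omega>0 \<Theta> = Inf (robin_quotients \<beta>)"
  by (simp add: eigenvalue_RD_def robin_quotients_def \<Omega>_def \<sigma>_def)

lemma robin_quotients_nonneg: "\<beta> \<ge> 0 \<Longrightarrow> q \<in> robin_quotients \<beta> \<Longrightarrow> q \<ge> 0"
  by (auto simp: robin_quotients_def Dirichlet_energy_def L2_energy_def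
      intro!: divide_nonneg_nonneg add_nonneg_nonneg mult_nonneg_nonneg integral_nonneg_AE)

lemma eigenvalue_RD_le: "\<beta> \<ge> 0 \<Longrightarrow> q \<in> robin_quotients \<beta> \<Longrightarrow> eigenvalue_RD \<beta> \<Omega>0 \<Theta> \<le> q"
  unfolding eigenvalue_RD_eq using robin_quotients_nonneg by (intro cInf_lower bdd_belowI[of _ 0]) auto

text \<open>A function of \<open>V\<close> is its own trace, by the constant approximating sequence,
  so it competes in the infimum. The multiplied form also covers functions of zero mass.\<close>

lemma eigenvalue_RD_le_smooth:
  assumes \<beta>: "\<beta> \<ge> 0" and u: "u \<in> V"
  shows "eigenvalue_RD \<beta> \<Omega>0 \<Theta> * (l2 M u)\<^sup>2 \<le> (l2 M (grad u))\<^sup>2 + \<beta> * (l2 \<sigma> u)\<^sup>2"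
proof (cases "l2 M u > 0")
  case True
  note u' = VD[OF u]
  have wg: "has_weak_gradient \<Omega> u (grad u)" by (rule has_weak_gradient_smooth[OF open\<Omega> u'(2)])
  note sq = square_integrable_M[OF u'(2)]
  have H0: "H1_norm \<Omega> (\<lambda>x. u x - u x) = 0"
    using H1_norm_diff[OF open\<Omega> bounded\<Omega> wg _ u'(2)] sq(1) by (simp add: M_def l2_def)
  have "u \<in> H1_vanishing \<Theta> \<Omega>"
    unfolding H1_vanishing_def H1_closure_def H1_def
    using sq(1) wg u'(1) H0 by (auto simp: M_def intro!: bexI[of _ u])
  moreover have "nonzero_on \<Omega> u" using nonzero_on_iff[OF sq(1)[unfolded M_def]] True by (simp add: M_def)
  moreover have "has_trace \<Omega>0 \<Theta> u u"
    unfolding has_trace_def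
  proof (intro conjI exI[of _ "\<lambda>_. u"] allI)
    show "square_integrable (surface_measure (frontier \<Omega>0)) u" using u'(4) by (simp add: \<sigma>_def)
    show "(\<lambda>k. H1_norm (\<Omega>0 - closure \<Theta>) (\<lambda>x. u x - u x)) \<longlonglongrightarrow> 0"
      using H0 by (simp add: \<Omega>_def)
  qed (use u' in auto)
  ultimately have "(Dirichlet_energy \<Omega> u + \<beta> * (LINT x|\<sigma>. (u x)\<^sup>2)) / L2_energy \<Omega> u \<in> robin_quotients \<beta>"
    unfolding robin_quotients_def by blast
  then have "eigenvalue_RD \<beta> \<Omega>0 \<Theta> \<le> (Dirichlet_energy \<Omega> u + \<beta> * (LINT x|\<sigma>. (u x)\<^sup>2)) / L2_energy \<Omega> u"
    by (rule eigenvalue_RD_le[OF \<beta>])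
  moreover have "(LINT x|\<sigma>. (u x)\<^sup>2) = (l2 \<sigma> u)\<^sup>2" by (simp add: l2_square)
  moreover have "Dirichlet_energy \<Omega> u = (l2 M (grad u))\<^sup>2"
    unfolding M_def by (rule Dirichlet_energy_eq[OF open\<Omega> bounded\<Omega> wg])
  moreover have "L2_energy \<Omega> u = (l2 M u)\<^sup>2" by (simp add: L2_energy_eq M_def)
  ultimately show ?thesis using True by (simp add: pos_le_divide_eq)
next
  case False
  then have "l2 M u = 0" using l2_nonneg[of M u] by linarith
  then show ?thesis using \<beta> by simp
qed

text \<open>The approximating test functions of \<open>\<Omega>\<close> vanish on the outer
  boundary, so zero is a trace of \<open>\<psi>\<close> and the boundary term disappears for every
  \<open>\<beta>\<close>.\<close>

lemma H1_0_quotient: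
  assumes \<psi>: "\<psi> \<in> H1_0 \<Omega>" "nonzero_on \<Omega> \<psi>"
  shows "Dirichlet_energy \<Omega> \<psi> / L2_energy \<Omega> \<psi> \<in> robin_quotients \<beta>"
proof -
  obtain u where u: "\<And>k::nat. u k \<in> test_functions \<Omega>" "(\<lambda>k. H1_norm \<Omega> (\<lambda>x. \<psi> x - u k x)) \<longlonglongrightarrow> 0"
    using H1_closure_sequence[OF \<psi>(1)[unfolded H1_0_def]] by blast
  have "\<psi> \<in> H1_vanishing \<Theta> \<Omega>"
    using \<psi>(1) test_functions_subset_off unfolding H1_0_def H1_vanishing_def H1_closure_def by blast
  moreover have "has_trace \<Omega>0 \<Theta> \<psi> (\<lambda>_. 0)"
    unfolding has_trace_def
  proof (intro conjI exI[of _ u] allI)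
    show "u k \<in> test_functions_off \<Theta>" for k using u(1) test_functions_subset_off by blast
    show "(\<lambda>k. H1_norm (\<Omega>0 - closure \<Theta>) (\<lambda>x. \<psi> x - u k x)) \<longlonglongrightarrow> 0"
      using u(2) by (simp add: \<Omega>_def)
    have "u k x = 0" if "x \<in> frontier \<Omega>0" for k x
    proof -
      have "x \<notin> \<Omega>0" using that open0 frontier_disjoint_eq[of \<Omega>0] by blast
      then have "x \<notin> spt (u k)" using test_functionsD(3)[OF u(1)[of k]] by (auto simp: \<Omega>_def)
      then show ?thesis by (rule spt_notin)
    qed
    then have "(\<integral>\<^sup>+x. ennreal ((0 - u k x)\<^sup>2) \<partial>surface_measure (frontier \<Omega>0)) = (\<integral>\<^sup>+x. 0 \<partial>surface_measure (frontier \<Omega>0))" for k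
      by (intro nn_integral_cong) simp
    then show "(\<lambda>k. \<integral>\<^sup>+x. ennreal ((0 - u k x)\<^sup>2) \<partial>surface_measure (frontier \<Omega>0)) \<longlonglongrightarrow> 0" by simp
  qed (simp add: square_integrable_def)
  ultimately have "(Dirichlet_energy \<Omega> \<psi> + \<beta> * (LINT x|\<sigma>. 0\<^sup>2)) / L2_energy \<Omega> \<psi> \<in> robin_quotients \<beta>"
    unfolding robin_quotients_def using \<psi>(2)
    by (intro CollectI exI[of _ \<psi>] exI[of _ "\<lambda>_::'a. 0::real"]) simp
  then show ?thesis by simp
qed

lemma eigenvalue_RD_le_Dirichlet:
  assumes "\<beta> \<ge> 0" shows "eigenvalue_RD \<beta> \<Omega>0 \<Theta> \<le> rayleigh_inf \<Omega>"
proof -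
  obtain \<psi> where \<psi>: "\<psi> \<in> H1_0 \<Omega>" "L2_energy \<Omega> \<psi> = 1" "Dirichlet_energy \<Omega> \<psi> = rayleigh_inf \<Omega>" "nonzero_on \<Omega> \<psi>"
    using dirichlet_minimizer[OF open\<Omega> bounded\<Omega> nonempty\<Omega>] .
  then show ?thesis using eigenvalue_RD_le[OF assms H1_0_quotient[OF \<psi>(1,4)]] by simp
qed

lemma robin_quotients_nonempty: "robin_quotients \<beta> \<noteq> {}"
proof -
  obtain \<psi> where "\<psi> \<in> H1_0 \<Omega>" "L2_energy \<Omega> \<psi> = 1" "Dirichlet_energy \<Omega> \<psi> = rayleigh_inf \<Omega>" "nonzero_on \<Omega> \<psi>"
    using dirichlet_minimizer[OF open\<Omega> bounded\<Omega> nonempty\<Omega>] .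
  then show ?thesis using H1_0_quotient by blast
qed

lemma eigenvalue_RD_nonneg: "\<beta> \<ge> 0 \<Longrightarrow> eigenvalue_RD \<beta> \<Omega>0 \<Theta> \<ge> 0"
  unfolding eigenvalue_RD_eq using robin_quotients_nonneg robin_quotients_nonempty by (intro cInf_greatest) auto

text \<open>The boundary convergence in \<open>has_trace\<close> concerns an extended integral. Once
  this falls below 1 it is finite, so the difference and hence \<open>u k\<close> are square
  integrable on the boundary, and all three terms of the quotient converge as real numbers.\<close>

lemma trace_approximation:
  assumes tr: "has_trace \<Omega>0 \<Theta> \<psi> g" and \<psi>: "\<psi> \<in> H1_vanishing \<Theta> \<Omega>"
  shows "\<exists>u. (\<forall>k::nat. u k \<in> test_functions_off \<Theta>) \<and> (\<forall>\<^sub>F k in sequentially. u k \<in> V)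
    \<and> (\<lambda>k. (l2 M (u k))\<^sup>2) \<longlonglongrightarrow> L2_energy \<Omega> \<psi>
    \<and> (\<lambda>k. (l2 M (grad (u k)))\<^sup>2) \<longlonglongrightarrow> Dirichlet_energy \<Omega> \<psi>
    \<and> (\<lambda>k. (l2 \<sigma> (u k))\<^sup>2) \<longlonglongrightarrow> (LINT x|\<sigma>. (g x)\<^sup>2)"
proof -
  obtain u where u: "\<forall>k. u k \<in> test_functions_off \<Theta>"
    "(\<lambda>k. H1_norm (\<Omega>0 - closure \<Theta>) (\<lambda>x. \<psi> x - u k x)) \<longlonglongrightarrow> 0"
    "(\<lambda>k. \<integral>\<^sup>+x. ennreal ((g x - u k x)\<^sup>2) \<partial>surface_measure (frontier \<Omega>0)) \<longlonglongrightarrow> 0"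
    and g0: "square_integrable (surface_measure (frontier \<Omega>0)) g"
    using tr unfolding has_trace_def by blast
  have g: "square_integrable \<sigma> g" using g0 by (simp add: \<sigma>_def)
  have uU: "u k \<in> test_functions UNIV" for k using test_functions_offD(1)[OF u(1)[rule_format]] .
  obtain G where G: "has_weak_gradient \<Omega> \<psi> G" "square_integrable (lebesgue_on \<Omega>) \<psi>"
    using \<psi> unfolding H1_vanishing_def by (rule H1_closureD)
  note en = energies_tendsto[OF open\<Omega> bounded\<Omega> G, of u, OF uU u(2)[folded \<Omega>_def], folded M_def]
  define d where "d k = (\<integral>\<^sup>+x. ennreal ((g x - u k x)\<^sup>2) \<partial>\<sigma>)" for k
  have d0: "d \<longlonglongrightarrow> 0" using u(3) unfolding \<sigma>_def[symmetric] d_def[symmetric] by simp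
  have um: "u k \<in> borel_measurable \<sigma>" for k
    unfolding \<sigma>_def by (rule borel_measurable_surface[OF borel_test_function[OF test_functionsD(1)[OF uU]]])
  have gm: "g \<in> borel_measurable \<sigma>" by (rule square_integrable_measurable[OF g])
  have dm: "(\<lambda>x. g x - u k x) \<in> borel_measurable \<sigma>" for k using um gm by measurable
  have sqd: "square_integrable \<sigma> (\<lambda>x. g x - u k x)" if "d k < 1" for k
    unfolding square_integrable_iff_nn using dm[of k] that
    by (auto simp: d_def intro: less_trans[OF _ ennreal_one_less_top])
  have ev: "\<forall>\<^sub>F k in sequentially. d k < 1" using d0 by (rule order_tendstoD) simp
  have sqk: "square_integrable \<sigma> (u k)" if "d k < 1" for k
    using square_integrable_diff[OF g sqd[OF that]] by simp
  have evV: "\<forall>\<^sub>F k in sequentially. u k \<in> V"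
    using ev by eventually_elim (use sqk u(1) in \<open>auto simp: V_def\<close>)
  have "(\<lambda>k. ennreal ((l2 \<sigma> (\<lambda>x. g x - u k x))\<^sup>2)) \<longlonglongrightarrow> 0"
  proof (rule Lim_transform_eventually[OF d0])
    show "\<forall>\<^sub>F k in sequentially. d k = ennreal ((l2 \<sigma> (\<lambda>x. g x - u k x))\<^sup>2)"
      using ev by eventually_elim (use l2_eq_nn[OF sqd] in \<open>simp add: d_def\<close>)
  qed
  then have "(\<lambda>k. (l2 \<sigma> (\<lambda>x. g x - u k x))\<^sup>2) \<longlonglongrightarrow> 0"
    by (subst (asm) ennreal_tendsto_0_iff) auto
  then have "(\<lambda>k. sqrt ((l2 \<sigma> (\<lambda>x. g x - u k x))\<^sup>2)) \<longlonglongrightarrow> sqrt 0" by (rule tendsto_real_sqrt)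
  then have l0: "(\<lambda>k. l2 \<sigma> (\<lambda>x. g x - u k x)) \<longlonglongrightarrow> 0" by (simp add: l2_nonneg)
  have "(\<lambda>k. l2 \<sigma> (u k)) \<longlonglongrightarrow> l2 \<sigma> g"
  proof (rule LIM_zero_cancel, rule Lim_null_comparison[OF _ l0])
    show "\<forall>\<^sub>F k in sequentially. norm (l2 \<sigma> (u k) - l2 \<sigma> g) \<le> l2 \<sigma> (\<lambda>x. g x - u k x)"
      using ev
    proof eventually_elim
      case (elim k)
      show ?case using l2_abs_diff[OF g sqk[OF elim]] by (simp add: abs_minus_commute)
    qed
  qed
  then have "(\<lambda>k. (l2 \<sigma> (u k))\<^sup>2) \<longlonglongrightarrow> (l2 \<sigma> g)\<^sup>2" by (rule tendsto_power)
  then have "(\<lambda>k. (l2 \<sigma> (u k))\<^sup>2) \<longlonglongrightarrow> (LINT x|\<sigma>. (g x)\<^sup>2)" by (simp add: l2_square)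
  then show ?thesis using u(1) evV en by blast
qed

text \<open>The quotient is continuous along a smooth approximation, the limit of the denominators
  being positive, so the infimum is approached within \<open>V\<close>; scaling normalises the
  mass.\<close>

lemma robin_minimizing:
  assumes \<beta>: "\<beta> \<ge> 0" and e: "e > 0"
  obtains u where "u \<in> V" "l2 M u = 1" "(l2 M (grad u))\<^sup>2 + \<beta> * (l2 \<sigma> u)\<^sup>2 \<le> eigenvalue_RD \<beta> \<Omega>0 \<Theta> + e"
proof -
  define R where "R = eigenvalue_RD \<beta> \<Omega>0 \<Theta> + e"
  have "Inf (robin_quotients \<beta>) < R" using e by (simp add: R_def eigenvalue_RD_eq)
  then obtain q where "q \<in> robin_quotients \<beta>" "q < R"
    using cInf_lessD[OF robin_quotients_nonempty] by blast
  then obtain \<psi> g where \<psi>: "\<psi> \<in> H1_vanishing \<Theta> \<Omega>" "nonzero_on \<Omega> \<psi>" "has_trace \<Omega>0 \<Theta> \<psi> g"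
    and qR: "(Dirichlet_energy \<Omega> \<psi> + \<beta> * (LINT x|\<sigma>. (g x)\<^sup>2)) / L2_energy \<Omega> \<psi> < R"
    unfolding robin_quotients_def by blast
  obtain G where G: "square_integrable (lebesgue_on \<Omega>) \<psi>"
    using \<psi>(1) unfolding H1_vanishing_def H1_closure_def H1_def by blast
  have pos: "L2_energy \<Omega> \<psi> > 0" using nonzero_on_iff[OF G] \<psi>(2) by (simp add: L2_energy_eq)
  obtain u where u: "\<forall>\<^sub>F k in sequentially. u (k::nat) \<in> V"
    "(\<lambda>k. (l2 M (u k))\<^sup>2) \<longlonglongrightarrow> L2_energy \<Omega> \<psi>"
    "(\<lambda>k. (l2 M (grad (u k)))\<^sup>2) \<longlonglongrightarrow> Dirichlet_energy \<Omega> \<psi>"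
    "(\<lambda>k. (l2 \<sigma> (u k))\<^sup>2) \<longlonglongrightarrow> (LINT x|\<sigma>. (g x)\<^sup>2)"
    using trace_approximation[OF \<psi>(3,1)] by blast
  have "(\<lambda>k. ((l2 M (grad (u k)))\<^sup>2 + \<beta> * (l2 \<sigma> (u k))\<^sup>2) / (l2 M (u k))\<^sup>2)
    \<longlonglongrightarrow> (Dirichlet_energy \<Omega> \<psi> + \<beta> * (LINT x|\<sigma>. (g x)\<^sup>2)) / L2_energy \<Omega> \<psi>"
    using pos by (intro tendsto_divide tendsto_add tendsto_mult tendsto_const u) auto
  then have "\<forall>\<^sub>F k in sequentially. ((l2 M (grad (u k)))\<^sup>2 + \<beta> * (l2 \<sigma> (u k))\<^sup>2) / (l2 M (u k))\<^sup>2 < R"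
    using qR by (rule order_tendstoD)
  moreover have "\<forall>\<^sub>F k in sequentially. 0 < (l2 M (u k))\<^sup>2" using u(2) pos by (rule order_tendstoD)
  ultimately have "\<forall>\<^sub>F k in sequentially. u k \<in> V \<and> 0 < (l2 M (u k))\<^sup>2
      \<and> ((l2 M (grad (u k)))\<^sup>2 + \<beta> * (l2 \<sigma> (u k))\<^sup>2) / (l2 M (u k))\<^sup>2 < R"
    using u(1) by eventually_elim blast
  then obtain k where k: "u k \<in> V" "0 < (l2 M (u k))\<^sup>2"
    "((l2 M (grad (u k)))\<^sup>2 + \<beta> * (l2 \<sigma> (u k))\<^sup>2) / (l2 M (u k))\<^sup>2 < R"
    by (auto simp: eventually_sequentially)
  define c where "c = l2 M (u k)"
  have c: "c > 0" using k(2) l2_nonneg[of M "u k"] by (simp add: c_def zero_less_power2 less_le)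
  define w where "w = (\<lambda>x. (1 / c) * u k x)"
  note n = test_functions_normalize[OF VD(2)[OF k(1)] c]
  have w\<sigma>: "square_integrable \<sigma> w"
    using square_integrable_scale[OF VD(4)[OF k(1)], of "1 / c"] by (simp add: w_def)
  have "w \<in> V" unfolding V_def using w\<sigma> test_functions_off_cmult[OF VD(1)[OF k(1)], of "1 / c"] by (simp add: w_def)
  moreover have "l2 M w = 1" using n(2)[of M] c by (simp add: w_def c_def)
  moreover have "(l2 M (grad w))\<^sup>2 + \<beta> * (l2 \<sigma> w)\<^sup>2 = ((l2 M (grad (u k)))\<^sup>2 + \<beta> * (l2 \<sigma> (u k))\<^sup>2) / c\<^sup>2"
    unfolding w_def n(2)[of \<sigma>] n(3)[of M] by (simp add: power_divide add_divide_distrib)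
  ultimately show ?thesis using that[of w] k(3) by (simp add: R_def c_def)
qed

text \<open>A quasi-minimiser for \<open>\<beta>2\<close> competes for \<open>\<beta>1\<close>,
  where its boundary term is no larger.\<close>

lemma eigenvalue_RD_mono:
  assumes "0 \<le> \<beta>1" "\<beta>1 \<le> \<beta>2"
  shows "eigenvalue_RD \<beta>1 \<Omega>0 \<Theta> \<le> eigenvalue_RD \<beta>2 \<Omega>0 \<Theta>"
proof (rule field_le_epsilon)
  fix e :: real assume "e > 0"
  have \<beta>2: "0 \<le> \<beta>2" using assms by simp
  obtain u where u: "u \<in> V" "l2 M u = 1" "(l2 M (grad u))\<^sup>2 + \<beta>2 * (l2 \<sigma> u)\<^sup>2 \<le> eigenvalue_RD \<beta>2 \<Omega>0 \<Theta> + e"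
    using robin_minimizing[OF \<beta>2 \<open>e > 0\<close>] .
  have "eigenvalue_RD \<beta>1 \<Omega>0 \<Theta> \<le> (l2 M (grad u))\<^sup>2 + \<beta>1 * (l2 \<sigma> u)\<^sup>2"
    using eigenvalue_RD_le_smooth[OF assms(1) u(1)] u(2) by simp
  also have "\<dots> \<le> (l2 M (grad u))\<^sup>2 + \<beta>2 * (l2 \<sigma> u)\<^sup>2"
    using assms(2) by (intro add_left_mono mult_right_mono) auto
  finally show "eigenvalue_RD \<beta>1 \<Omega>0 \<Theta> \<le> eigenvalue_RD \<beta>2 \<Omega>0 \<Theta> + e" using u(3) by linarith
qed

section \<open>Layers at the outer boundary and truncation\<close>

definition layer :: "real \<Rightarrow> 'a set" where "layer d = {x. infdist x (frontier \<Omega>0) < d}"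

lemma borel_layer[measurable]: "layer d \<in> sets borel"
  unfolding layer_def by (rule borel_open[OF open_infdist_less])

text \<open>A norm rather than its square, so that the estimates below are linear in it and obey a
  triangle inequality.\<close>

definition layer_energy :: "real \<Rightarrow> ('a \<Rightarrow> real) \<Rightarrow> real" where
  "layer_energy d u = l2 M (\<lambda>x. indicator (layer d) x *\<^sub>R grad u x)"

lemma square_integrable_indicator:
  fixes f :: "'a \<Rightarrow> 'c::euclidean_space"
  assumes "square_integrable M f"
  shows "square_integrable M (\<lambda>x. indicat_real (layer d) x *\<^sub>R f x)" "l2 M (\<lambda>x. indicat_real (layer d) x *\<^sub>R f x) \<le> l2 M f"
proof -
  have m: "(\<lambda>x. indicat_real (layer d) x *\<^sub>R f x) \<in> borel_measurable M"
  proof (rule borel_measurable_scaleR)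
    show "indicat_real (layer d) \<in> borel_measurable M"
      unfolding M_def by (rule borel_measurable_lebesgue_on) measurable
  qed (rule square_integrable_measurable[OF assms])
  have ae: "AE x in M. norm (indicat_real (layer d) x *\<^sub>R f x) \<le> norm (f x)"
    by (intro AE_I2) (auto simp: indicator_def)
  show "square_integrable M (\<lambda>x. indicat_real (layer d) x *\<^sub>R f x)" by (rule square_integrable_mono(1)[OF assms m ae])
  show "l2 M (\<lambda>x. indicat_real (layer d) x *\<^sub>R f x) \<le> l2 M f" by (rule square_integrable_mono(2)[OF assms m ae])
qed

text \<open>The compact set \<open>closure \<Theta>\<close> has positive distance from the outer
  boundary, so thin layers of \<open>\<Omega>0\<close> lie in \<open>\<Omega>\<close> and boundary
  estimates for \<open>\<Omega>0\<close> can be read on \<open>\<Omega>\<close>.\<close>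

lemma layer_distance:
  obtains \<rho> where "\<rho> > 0" "\<Omega>0 \<inter> layer \<rho> \<subseteq> \<Omega>"
proof -
  have "compact (closure \<Theta>)"
    using bounded_subset[OF bounded0 \<Theta>_subset] by (simp add: compact_eq_bounded_closed)
  moreover have "closure \<Theta> \<inter> frontier \<Omega>0 = {}"
    using \<Theta>_subset open0 frontier_disjoint_eq[of \<Omega>0] by blast
  ultimately obtain \<rho> where \<rho>: "\<rho> > 0" "\<forall>x\<in>closure \<Theta>. \<forall>y\<in>frontier \<Omega>0. \<rho> \<le> dist x y"
    using separate_compact_closed[of "closure \<Theta>" "frontier \<Omega>0"] by auto
  have "\<Omega>0 \<inter> layer \<rho> \<subseteq> \<Omega>"
  proof
    fix x assume x: "x \<in> \<Omega>0 \<inter> layer \<rho>"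
    obtain y where y: "y \<in> frontier \<Omega>0" "infdist x (frontier \<Omega>0) = dist x y"
      using infdist_attains_inf[OF frontier_closed frontier_nonempty] by blast
    have "x \<notin> closure \<Theta>"
    proof
      assume "x \<in> closure \<Theta>"
      then have "\<rho> \<le> dist x y" using \<rho>(2) y(1) by blast
      then show False using x y(2) by (simp add: layer_def)
    qed
    then show "x \<in> \<Omega>" using x by (simp add: \<Omega>_def)
  qed
  then show ?thesis using \<rho>(1) that by blast
qed

text \<open>The square root of the boundary layer estimate. The width is restricted so that even the
  thicker layer carrying the gradient stays away from the hole.\<close>

lemma layer_estimate:
  obtains K m \<delta>0 where "K > 0" "m \<ge> 1" "\<delta>0 > 0"
    "\<And>\<delta> u. 0 < \<delta> \<Longrightarrow> \<delta> < \<delta>0 \<Longrightarrow> u \<in> V \<Longrightarrow>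
      l2 M (\<lambda>x. indicat_real (layer \<delta>) x *\<^sub>R u x) \<le> K * (sqrt \<delta> * l2 \<sigma> u + \<delta> * layer_energy (m * \<delta>) u)"
proof -
  obtain K0 m0 \<delta>0 where K0: "K0 > 0" "m0 > 0" "\<delta>0 > 0"
    "\<And>\<delta> u. 0 < \<delta> \<Longrightarrow> \<delta> < \<delta>0 \<Longrightarrow> smooth u \<Longrightarrow>
      (\<integral>\<^sup>+x. ennreal ((u x)\<^sup>2) * indicator (\<Omega>0 \<inter> {x. infdist x (frontier \<Omega>0) < \<delta>}) x \<partial>lborel)
      \<le> ennreal (K0 * \<delta>) * (\<integral>\<^sup>+x. ennreal ((u x)\<^sup>2) \<partial>surface_measure (frontier \<Omega>0))
        + ennreal (K0 * \<delta>\<^sup>2) * (\<integral>\<^sup>+x. ennreal ((norm (grad u x))\<^sup>2) * indicator (\<Omega>0 \<inter> {x. infdist x (frontier \<Omega>0) < m0 * \<delta>}) x \<partial>lborel)"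
    using boundary_layer[OF dim open0 bounded0 nonempty0 lipschitz0] by blast
  obtain \<rho> where \<rho>: "\<rho> > 0" "\<Omega>0 \<inter> layer \<rho> \<subseteq> \<Omega>" using layer_distance .
  \<comment> \<open>The maximum with 1 makes the layer of width \<open>m * \<delta>\<close> contain
    the one of width \<open>\<delta>\<close>, which is used when gradients are compared
    later.\<close>
  define m where "m = max m0 1"
  define d0 where "d0 = min \<delta>0 (\<rho> / m)"
  define K where "K = sqrt K0"
  have m: "m \<ge> 1" "m0 \<le> m" by (auto simp: m_def)
  have "K > 0" "d0 > 0" using K0 \<rho>(1) m by (auto simp: K_def d0_def)
  moreover have "l2 M (\<lambda>x. indicat_real (layer \<delta>) x *\<^sub>R u x) \<le> K * (sqrt \<delta> * l2 \<sigma> u + \<delta> * layer_energy (m * \<delta>) u)"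
    if \<delta>: "0 < \<delta>" "\<delta> < d0" and u: "u \<in> V" for \<delta> u
  proof -
    note u' = VD[OF u]
    note sq = square_integrable_M[OF u'(2)]
    define S where "S = l2 M (\<lambda>x. indicat_real (layer \<delta>) x *\<^sub>R u x)"
    define G where "G = layer_energy (m * \<delta>) u"
    define b where "b = l2 \<sigma> u"
    have nn: "G \<ge> 0" "b \<ge> 0" "S \<ge> 0" by (auto simp: G_def b_def S_def layer_energy_def l2_nonneg)
    have d\<rho>: "m0 * \<delta> \<le> m * \<delta>" "m * \<delta> < \<rho>"
    proof -
      show "m0 * \<delta> \<le> m * \<delta>" using m \<delta> by (intro mult_right_mono) auto
      have "\<delta> < \<rho> / m" using \<delta>(2) by (simp add: d0_def)
      then show "m * \<delta> < \<rho>" using m by (simp add: pos_less_divide_eq mult.commute)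
    qed
    have "ennreal (S\<^sup>2) = (\<integral>\<^sup>+x. ennreal ((norm (indicat_real (layer \<delta>) x *\<^sub>R u x))\<^sup>2) \<partial>M)"
      unfolding S_def using l2_eq_nn[OF square_integrable_indicator(1)[OF sq(1)]] by simp
    also have "\<dots> = (\<integral>\<^sup>+x. ennreal ((norm (indicat_real (layer \<delta>) x *\<^sub>R u x))\<^sup>2) * indicator \<Omega> x \<partial>lborel)"
      unfolding M_def by (rule nn_integral_lebesgue_on[OF lebesgue\<Omega>])
    also have "\<dots> \<le> (\<integral>\<^sup>+x. ennreal ((u x)\<^sup>2) * indicator (\<Omega>0 \<inter> {x. infdist x (frontier \<Omega>0) < \<delta>}) x \<partial>lborel)"
      by (rule nn_integral_mono) (auto simp: indicator_def layer_def \<Omega>_def)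
    also have "\<dots> \<le> ennreal (K0 * \<delta>) * (\<integral>\<^sup>+x. ennreal ((u x)\<^sup>2) \<partial>\<sigma>)
        + ennreal (K0 * \<delta>\<^sup>2) * (\<integral>\<^sup>+x. ennreal ((norm (grad u x))\<^sup>2) * indicator (\<Omega>0 \<inter> {x. infdist x (frontier \<Omega>0) < m0 * \<delta>}) x \<partial>lborel)"
      unfolding \<sigma>_def using \<delta> u'(3) by (intro K0(4)) (auto simp: d0_def)
    also have "\<dots> \<le> ennreal (K0 * \<delta>) * ennreal (b\<^sup>2) + ennreal (K0 * \<delta>\<^sup>2) * ennreal (G\<^sup>2)"
    proof (intro add_mono mult_left_mono)
      show "(\<integral>\<^sup>+x. ennreal ((u x)\<^sup>2) \<partial>\<sigma>) \<le> ennreal (b\<^sup>2)"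
        using l2_eq_nn[OF u'(4)] by (simp add: b_def)
      have "(\<integral>\<^sup>+x. ennreal ((norm (grad u x))\<^sup>2) * indicator (\<Omega>0 \<inter> {x. infdist x (frontier \<Omega>0) < m0 * \<delta>}) x \<partial>lborel)
        \<le> (\<integral>\<^sup>+x. ennreal ((norm (indicat_real (layer (m * \<delta>)) x *\<^sub>R grad u x))\<^sup>2) * indicator \<Omega> x \<partial>lborel)"
      proof (rule nn_integral_mono)
        fix x
        have "x \<in> \<Omega> \<and> x \<in> layer (m * \<delta>)" if "x \<in> \<Omega>0" "infdist x (frontier \<Omega>0) < m0 * \<delta>"
          using that \<rho>(2) d\<rho> by (auto simp: layer_def)
        then show "ennreal ((norm (grad u x))\<^sup>2) * indicator (\<Omega>0 \<inter> {x. infdist x (frontier \<Omega>0) < m0 * \<delta>}) x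
          \<le> ennreal ((norm (indicat_real (layer (m * \<delta>)) x *\<^sub>R grad u x))\<^sup>2) * indicator \<Omega> x"
          by (auto simp: indicator_def)
      qed
      also have "\<dots> = (\<integral>\<^sup>+x. ennreal ((norm (indicat_real (layer (m * \<delta>)) x *\<^sub>R grad u x))\<^sup>2) \<partial>M)"
        unfolding M_def by (rule nn_integral_lebesgue_on[OF lebesgue\<Omega>, symmetric])
      also have "\<dots> = ennreal (G\<^sup>2)"
        unfolding G_def layer_energy_def by (rule l2_eq_nn[OF square_integrable_indicator(1)[OF sq(2)]])
      finally show "(\<integral>\<^sup>+x. ennreal ((norm (grad u x))\<^sup>2) * indicator (\<Omega>0 \<inter> {x. infdist x (frontier \<Omega>0) < m0 * \<delta>}) x \<partial>lborel)
        \<le> ennreal (G\<^sup>2)" .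
    qed auto
    also have "\<dots> = ennreal (K0 * \<delta> * b\<^sup>2 + K0 * \<delta>\<^sup>2 * G\<^sup>2)"
      using K0(1) \<delta>(1) by (simp add: ennreal_mult[symmetric] flip: ennreal_plus)
    finally have "S\<^sup>2 \<le> K0 * \<delta> * b\<^sup>2 + K0 * \<delta>\<^sup>2 * G\<^sup>2"
      using K0(1) \<delta>(1) by (subst (asm) ennreal_le_iff) auto
    also have "\<dots> \<le> (K * (sqrt \<delta> * b + \<delta> * G))\<^sup>2"
    proof -
      have e: "(K * (sqrt \<delta> * b + \<delta> * G))\<^sup>2 = K0 * \<delta> * b\<^sup>2 + K0 * \<delta>\<^sup>2 * G\<^sup>2 + 2 * K0 * (sqrt \<delta> * b) * (\<delta> * G)"
        using K0(1) \<delta>(1) by (simp add: K_def power_mult_distrib power2_sum algebra_simps)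
      have "0 \<le> 2 * K0 * (sqrt \<delta> * b) * (\<delta> * G)" using K0(1) \<delta>(1) nn by auto
      then show ?thesis unfolding e by linarith
    qed
    finally have "S \<le> K * (sqrt \<delta> * b + \<delta> * G)"
      by (rule power2_le_imp_le) (use \<open>K > 0\<close> \<delta> nn in auto)
    then show ?thesis by (simp add: S_def G_def b_def)
  qed
  ultimately show ?thesis using m(1) that[of K m d0] by blast
qed


text \<open>\<open>\<eta>\<close> is 1 at distance at least \<open>3 * \<delta>\<close> inside the
  outer boundary and 0 at distance below \<open>\<delta>\<close>, so on \<open>\<Omega>\<close> only
  the layer of width \<open>4 * \<delta>\<close> is altered. Setting \<open>v\<close> to zero on the
  hole keeps it smooth because \<open>u\<close> vanishes near \<open>frontier \<Theta>\<close>; the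
  support then lies in a compact part of \<open>\<Omega>\<close>.\<close>

lemma cut_off_boundary:
  assumes \<delta>: "\<delta> > 0" and u: "u \<in> V" and \<eta>: "cutoff C {x \<in> \<Omega>0. 2 * \<delta> \<le> infdist x (frontier \<Omega>0)} \<delta> \<eta>" and C: "C > 0"
  defines "v \<equiv> (\<lambda>x. if x \<in> \<Theta> then 0 else \<eta> x * u x)"
  shows "v \<in> test_functions \<Omega>"
    "\<And>x. x \<in> \<Omega> \<Longrightarrow> \<bar>v x - u x\<bar> \<le> \<bar>indicat_real (layer (4 * \<delta>)) x *\<^sub>R u x\<bar>"
    "\<And>x. x \<in> \<Omega> \<Longrightarrow> norm (grad v x - grad u x)
      \<le> norm (indicat_real (layer (4 * \<delta>)) x *\<^sub>R grad u x) + C / \<delta> * \<bar>indicat_real (layer (4 * \<delta>)) x *\<^sub>R u x\<bar>"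
proof -
  define A where "A = {x \<in> \<Omega>0. 2 * \<delta> \<le> infdist x (frontier \<Omega>0)}"
  note u' = VD[OF u]
  have h: "smooth \<eta>" "\<And>x. 0 \<le> \<eta> x" "\<And>x. \<eta> x \<le> 1" "\<And>x. ball x \<delta> \<subseteq> A \<Longrightarrow> \<eta> x = 1"
    "\<And>x. ball x \<delta> \<inter> A = {} \<Longrightarrow> \<eta> x = 0" "\<And>x. norm (grad \<eta> x) \<le> C / \<delta>"
    using \<eta> unfolding cutoff_def A_def by blast+
  \<comment> \<open>A ball is connected, so leaving \<open>\<Omega>0\<close> would force it to meet
    the frontier, which is too far away.\<close>
  have stay: "y \<in> \<Omega>0" if "x \<in> \<Omega>0" "\<delta> \<le> infdist x (frontier \<Omega>0)" "y \<in> ball x \<delta>" for x y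
  proof (rule ccontr)
    assume "y \<notin> \<Omega>0"
    have "ball x \<delta> \<inter> frontier \<Omega>0 \<noteq> {}"
    proof (rule connected_Int_frontier)
      show "connected (ball x \<delta>)" by (intro convex_connected convex_ball)
      have "x \<in> ball x \<delta> \<inter> \<Omega>0" using that(1) \<delta> by simp
      then show "ball x \<delta> \<inter> \<Omega>0 \<noteq> {}" by blast
      show "ball x \<delta> - \<Omega>0 \<noteq> {}" using that(3) \<open>y \<notin> \<Omega>0\<close> by blast
    qed
    then obtain z where "z \<in> frontier \<Omega>0" "dist x z < \<delta>" by auto
    then show False using infdist_le[of z "frontier \<Omega>0" x] that(2) by linarith
  qed
  have one: "\<eta> x = 1" if x: "x \<in> \<Omega>0" "3 * \<delta> \<le> infdist x (frontier \<Omega>0)" for x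
  proof (rule h(4), rule subsetI)
    fix y assume y: "y \<in> ball x \<delta>"
    have "y \<in> \<Omega>0" using stay[OF x(1) _ y] x(2) \<delta> by simp
    moreover have "infdist x (frontier \<Omega>0) \<le> infdist y (frontier \<Omega>0) + dist x y" by (rule infdist_triangle)
    ultimately show "y \<in> A" using x y by (simp add: A_def)
  qed
  define S where "S = closure \<Omega>0 \<inter> {x. \<delta> \<le> infdist x (frontier \<Omega>0)}"
  have supp: "x \<in> S" if "\<eta> x \<noteq> 0" for x
  proof -
    obtain y where y: "y \<in> \<Omega>0" "2 * \<delta> \<le> infdist y (frontier \<Omega>0)" "dist x y < \<delta>"
    proof -
      have "ball x \<delta> \<inter> A \<noteq> {}" using h(5)[of x] \<open>\<eta> x \<noteq> 0\<close> by blast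
      then show ?thesis using that by (auto simp: A_def)
    qed
    have "x \<in> \<Omega>0" using stay[OF y(1), of x] y \<delta> by (simp add: dist_commute)
    moreover have "infdist y (frontier \<Omega>0) \<le> infdist x (frontier \<Omega>0) + dist y x" by (rule infdist_triangle)
    ultimately show ?thesis using y closure_subset by (auto simp: S_def dist_commute)
  qed
  have SO: "S \<subseteq> \<Omega>0"
  proof
    fix x assume x: "x \<in> S"
    then have "x \<notin> frontier \<Omega>0" using \<delta> by (auto simp: S_def)
    then show "x \<in> \<Omega>0" using x open0 by (auto simp: S_def frontier_def interior_open)
  qed
  have "compact (closure \<Omega>0)" using bounded0 by simp
  moreover have "closed {x. \<delta> \<le> infdist x (frontier \<Omega>0)}" by (intro closed_Collect_le continuous_intros)
  ultimately have Sc: "compact S" unfolding S_def by (rule compact_Int_closed)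
  show vt: "v \<in> test_functions \<Omega>"
  proof (rule test_functionsI[where S="S \<inter> (spt u \<inter> - \<Theta>)"])
    show "smooth v"
    proof (rule smooth_local)
      fix x
      consider "x \<in> frontier \<Theta>" | "x \<in> \<Theta>" | "x \<notin> closure \<Theta>"
        using open\<Theta> by (auto simp: frontier_def interior_open)
      then show "\<exists>U g. open U \<and> x \<in> U \<and> smooth g \<and> (\<forall>y\<in>U. v y = g y)"
      proof cases
        case 1
        then have "x \<in> - spt u" using test_functions_offD(3)[OF u'(1)] by blast
        then show ?thesis using closed_spt[of u]
          by (intro exI[of _ "- spt u"] exI[of _ "\<lambda>_. 0"]) (auto simp: smooth_const v_def spt_notin open_Compl)
      next
        case 2
        then show ?thesis using open\<Theta> by (intro exI[of _ \<Theta>] exI[of _ "\<lambda>_. 0"]) (auto simp: smooth_const v_def)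
      next
        case 3
        then show ?thesis using closure_subset[of \<Theta>]
          by (intro exI[of _ "- closure \<Theta>"] exI[of _ "\<lambda>x. \<eta> x * u x"])
             (auto simp: smooth_mult[OF h(1) u'(3)] v_def)
      qed
    qed
    show "compact (S \<inter> (spt u \<inter> - \<Theta>))"
      using Sc open\<Theta> closed_spt[of u] by (intro compact_Int_closed closed_Int) auto
    show "S \<inter> (spt u \<inter> - \<Theta>) \<subseteq> \<Omega>"
      using SO test_functions_offD(3)[OF u'(1)] open\<Theta> by (auto simp: \<Omega>_def frontier_def interior_open)
    show "v x = 0" if "x \<notin> S \<inter> (spt u \<inter> - \<Theta>)" for x
      using that supp[of x] spt_notin[of x u] by (auto simp: v_def)
  qed
  have v\<Omega>: "v x = \<eta> x * u x" if "x \<in> \<Omega>" for x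
    using that closure_subset[of \<Theta>] by (auto simp: v_def \<Omega>_def)
  have in0: "x \<in> \<Omega>0" if "x \<in> \<Omega>" for x using that by (simp add: \<Omega>_def)
  fix x assume x: "x \<in> \<Omega>"
  show "\<bar>v x - u x\<bar> \<le> \<bar>indicat_real (layer (4 * \<delta>)) x *\<^sub>R u x\<bar>"
  proof (cases "x \<in> layer (4 * \<delta>)")
    case True
    have "v x - u x = (\<eta> x - 1) * u x" by (simp add: v\<Omega>[OF x] algebra_simps)
    then have "\<bar>v x - u x\<bar> = \<bar>\<eta> x - 1\<bar> * \<bar>u x\<bar>" by (simp add: abs_mult)
    also have "\<dots> \<le> 1 * \<bar>u x\<bar>" using h(2,3)[of x] by (intro mult_right_mono) auto
    finally show ?thesis using True by simp
  next
    case False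
    then have "\<eta> x = 1" using one[OF in0[OF x]] \<delta> by (simp add: layer_def)
    then show ?thesis by (simp add: v\<Omega>[OF x])
  qed
  have gv: "grad v x = \<eta> x *\<^sub>R grad u x + u x *\<^sub>R grad \<eta> x"
    using grad_cong_open[OF open\<Omega> x smooth_mult[OF h(1) u'(3)] v\<Omega>] by (simp add: grad_mult[OF h(1) u'(3)])
  show "norm (grad v x - grad u x)
    \<le> norm (indicat_real (layer (4 * \<delta>)) x *\<^sub>R grad u x) + C / \<delta> * \<bar>indicat_real (layer (4 * \<delta>)) x *\<^sub>R u x\<bar>"
  proof (cases "x \<in> layer (4 * \<delta>)")
    case True
    have "grad v x - grad u x = (\<eta> x - 1) *\<^sub>R grad u x + u x *\<^sub>R grad \<eta> x" by (simp add: gv algebra_simps)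
    then have "norm (grad v x - grad u x) \<le> \<bar>\<eta> x - 1\<bar> * norm (grad u x) + \<bar>u x\<bar> * norm (grad \<eta> x)"
      using norm_triangle_ineq[of "(\<eta> x - 1) *\<^sub>R grad u x" "u x *\<^sub>R grad \<eta> x"] by simp
    also have "\<dots> \<le> 1 * norm (grad u x) + \<bar>u x\<bar> * (C / \<delta>)"
      using h(2,3)[of x] h(6)[of x] by (intro add_mono mult_right_mono mult_left_mono) auto
    finally show ?thesis using True by (simp add: mult.commute)
  next
    case False
    \<comment> \<open>On this open set \<open>\<eta>\<close> is constant, hence its gradient
      vanishes; the layer of width \<open>4 * \<delta>\<close> instead of
      \<open>3 * \<delta>\<close> leaves room for an open neighbourhood.\<close>
    define U where "U = \<Omega>0 \<inter> {x. 3 * \<delta> < infdist x (frontier \<Omega>0)}"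
    have "open U" unfolding U_def by (intro open_Int open0 open_Collect_less continuous_intros)
    moreover have "x \<in> U" using False in0[OF x] \<delta> by (simp add: U_def layer_def)
    ultimately have "grad \<eta> x = grad (\<lambda>_. 1) x"
      by (rule grad_cong_open[OF _ _ smooth_const]) (use one in \<open>simp add: U_def\<close>)
    then have "grad \<eta> x = 0" by (simp add: grad_def)
    moreover have "\<eta> x = 1" using one[OF in0[OF x]] False \<delta> by (simp add: layer_def)
    ultimately have "grad v x - grad u x = 0" by (simp add: gv)
    then show ?thesis using C \<delta> by simp
  qed
qed

text \<open>The layer norm of \<open>u\<close> is of order
  \<open>sqrt \<delta> * b + \<delta> * G\<close>, and the gradient of the cutoff multiplies it by
  \<open>C / \<delta>\<close>. The two terms then behave differently: one vanishes with the boundary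
  values at fixed width, the other only if little gradient sits in the layer.\<close>

lemma interior_approximation:
  obtains K m \<delta>0 where "K > 0" "m > 0" "\<delta>0 > 0"
    "\<And>\<delta> u. 0 < \<delta> \<Longrightarrow> \<delta> < \<delta>0 \<Longrightarrow> u \<in> V \<Longrightarrow> \<exists>v. v \<in> test_functions \<Omega> \<and>
      l2 M (\<lambda>x. v x - u x) \<le> K * (sqrt \<delta> * l2 \<sigma> u + \<delta> * layer_energy (m * \<delta>) u) \<and>
      l2 M (\<lambda>x. grad v x - grad u x) \<le> K * (l2 \<sigma> u / sqrt \<delta> + layer_energy (m * \<delta>) u)"
proof -
  obtain K0 m0 \<delta>0 where K0: "K0 > 0" "m0 \<ge> 1" "\<delta>0 > 0"
    "\<And>\<delta> u. 0 < \<delta> \<Longrightarrow> \<delta> < \<delta>0 \<Longrightarrow> u \<in> V \<Longrightarrow>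
      l2 M (\<lambda>x. indicat_real (layer \<delta>) x *\<^sub>R u x) \<le> K0 * (sqrt \<delta> * l2 \<sigma> u + \<delta> * layer_energy (m0 * \<delta>) u)"
    using layer_estimate by blast
  obtain C :: real where C: "C > 0" "\<And>(A::'a set) \<delta>. A \<in> sets borel \<Longrightarrow> bounded A \<Longrightarrow> \<delta> > 0 \<Longrightarrow> \<exists>\<eta>. cutoff C A \<delta> \<eta>"
    by (rule cutoff_exists) blast
  \<comment> \<open>\<open>4 * K0\<close> serves the mass, \<open>1 + 4 * C * K0\<close> the
    gradient. The factors 4, here and in \<open>m\<close>, stem from using the layer estimate at
    width \<open>4 * \<delta>\<close>.\<close>
  define K where "K = 1 + 4 * K0 + 4 * C * K0"
  define m where "m = 4 * m0"
  have "K > 0" "m > 0" "\<delta>0 / 4 > 0" using K0 C(1) by (auto simp: K_def m_def intro!: add_pos_nonneg)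
  moreover have "\<exists>v. v \<in> test_functions \<Omega> \<and>
      l2 M (\<lambda>x. v x - u x) \<le> K * (sqrt \<delta> * l2 \<sigma> u + \<delta> * layer_energy (m * \<delta>) u) \<and>
      l2 M (\<lambda>x. grad v x - grad u x) \<le> K * (l2 \<sigma> u / sqrt \<delta> + layer_energy (m * \<delta>) u)"
    if \<delta>: "0 < \<delta>" "\<delta> < \<delta>0 / 4" and u: "u \<in> V" for \<delta> u
  proof -
    define A where "A = {x \<in> \<Omega>0. 2 * \<delta> \<le> infdist x (frontier \<Omega>0)}"
    have "closed {x. 2 * \<delta> \<le> infdist x (frontier \<Omega>0)}" by (intro closed_Collect_le continuous_intros)
    then have "\<Omega>0 \<inter> {x. 2 * \<delta> \<le> infdist x (frontier \<Omega>0)} \<in> sets borel"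
      using open0 by (intro sets.Int borel_open borel_closed)
    moreover have "A = \<Omega>0 \<inter> {x. 2 * \<delta> \<le> infdist x (frontier \<Omega>0)}" by (auto simp: A_def)
    ultimately have Ab: "A \<in> sets borel" by simp
    have "bounded A" by (rule bounded_subset[OF bounded0]) (auto simp: A_def)
    then obtain \<eta> where \<eta>: "cutoff C A \<delta> \<eta>" using C(2)[OF Ab _ \<delta>(1)] by blast
    define v where "v = (\<lambda>x. if x \<in> \<Theta> then 0 else \<eta> x * u x)"
    note cut = cut_off_boundary[OF \<delta>(1) u \<eta>[unfolded A_def] C(1), folded v_def]
    note u' = VD[OF u]
    have vU: "v \<in> test_functions UNIV" by (rule test_functions_mono[OF _ cut(1)]) simp
    note squ = square_integrable_M[OF u'(2)] and sqv = square_integrable_M[OF vU]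
    define S where "S = l2 M (\<lambda>x. indicat_real (layer (4 * \<delta>)) x *\<^sub>R u x)"
    define G where "G = layer_energy (m * \<delta>) u"
    define b where "b = l2 \<sigma> u"
    have nn: "G \<ge> 0" "b \<ge> 0" by (auto simp: G_def b_def layer_energy_def l2_nonneg)
    have S: "S \<le> K0 * (2 * sqrt \<delta> * b + 4 * \<delta> * G)"
      using K0(4)[of "4 * \<delta>" u] \<delta> u
      by (simp add: S_def G_def b_def m_def real_sqrt_mult mult_ac)
    have i: "square_integrable M (\<lambda>x. indicat_real (layer (4 * \<delta>)) x *\<^sub>R u x)"
      "square_integrable M (\<lambda>x. indicat_real (layer (4 * \<delta>)) x *\<^sub>R grad u x)"
      by (rule square_integrable_indicator(1)[OF squ(1)], rule square_integrable_indicator(1)[OF squ(2)])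
    have "l2 M (\<lambda>x. v x - u x) \<le> S"
      unfolding S_def
    proof (rule square_integrable_mono(2)[OF i(1)])
      show "(\<lambda>x. v x - u x) \<in> borel_measurable M"
        by (rule square_integrable_measurable[OF square_integrable_diff[OF sqv(1) squ(1)]])
      show "AE x in M. norm (v x - u x) \<le> norm (indicat_real (layer (4 * \<delta>)) x *\<^sub>R u x)"
        by (rule AE_M_I) (use cut(2) in \<open>simp add: v_def\<close>)
    qed
    also have "\<dots> \<le> K0 * (2 * sqrt \<delta> * b + 4 * \<delta> * G)" by (rule S)
    also have "\<dots> \<le> K * (sqrt \<delta> * b + \<delta> * G)"
    proof -
      have "K0 * (2 * sqrt \<delta> * b + 4 * \<delta> * G) \<le> K0 * (4 * (sqrt \<delta> * b + \<delta> * G))"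
        using K0(1) \<delta>(1) nn by (intro mult_left_mono) auto
      also have "\<dots> = (4 * K0) * (sqrt \<delta> * b + \<delta> * G)" by simp
      also have "\<dots> \<le> K * (sqrt \<delta> * b + \<delta> * G)"
        using K0(1) C(1) \<delta>(1) nn by (intro mult_right_mono) (auto simp: K_def)
      finally show ?thesis .
    qed
    finally have 1: "l2 M (\<lambda>x. v x - u x) \<le> K * (sqrt \<delta> * b + \<delta> * G)" .
    have G4: "l2 M (\<lambda>x. indicat_real (layer (4 * \<delta>)) x *\<^sub>R grad u x) \<le> G"
      unfolding G_def layer_energy_def
    proof (rule square_integrable_mono(2)[OF square_integrable_indicator(1)[OF squ(2)] square_integrable_measurable[OF i(2)]])
      have "4 * \<delta> \<le> m * \<delta>" using K0(2) \<delta>(1) by (simp add: m_def)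
      then have "layer (4 * \<delta>) \<subseteq> layer (m * \<delta>)" by (auto simp: layer_def)
      then show "AE x in M. norm (indicat_real (layer (4 * \<delta>)) x *\<^sub>R grad u x) \<le> norm (indicat_real (layer (m * \<delta>)) x *\<^sub>R grad u x)"
        by (intro AE_I2) (auto simp: indicator_def)
    qed
    have "l2 M (\<lambda>x. grad v x - grad u x)
      \<le> l2 M (\<lambda>x. norm (indicat_real (layer (4 * \<delta>)) x *\<^sub>R grad u x) + (C / \<delta>) *\<^sub>R norm (indicat_real (layer (4 * \<delta>)) x *\<^sub>R u x))"
    proof (rule square_integrable_mono(2))
      show "square_integrable M (\<lambda>x. norm (indicat_real (layer (4 * \<delta>)) x *\<^sub>R grad u x) + (C / \<delta>) *\<^sub>R norm (indicat_real (layer (4 * \<delta>)) x *\<^sub>R u x))"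
        by (intro square_integrable_add square_integrable_scale square_integrable_norm i)
      show "(\<lambda>x. grad v x - grad u x) \<in> borel_measurable M"
        by (rule square_integrable_measurable[OF square_integrable_diff[OF sqv(2) squ(2)]])
      show "AE x in M. norm (grad v x - grad u x)
        \<le> norm (norm (indicat_real (layer (4 * \<delta>)) x *\<^sub>R grad u x) + (C / \<delta>) *\<^sub>R norm (indicat_real (layer (4 * \<delta>)) x *\<^sub>R u x))"
      proof (rule AE_M_I)
        fix x assume "x \<in> \<Omega>"
        from cut(3)[OF this] show "norm (grad v x - grad u x)
          \<le> norm (norm (indicat_real (layer (4 * \<delta>)) x *\<^sub>R grad u x) + (C / \<delta>) *\<^sub>R norm (indicat_real (layer (4 * \<delta>)) x *\<^sub>R u x))"
          unfolding real_norm_def real_scaleR_def by (rule order_trans[OF _ abs_ge_self])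
      qed
    qed
    also have "\<dots> \<le> l2 M (\<lambda>x. norm (indicat_real (layer (4 * \<delta>)) x *\<^sub>R grad u x)) + l2 M (\<lambda>x. (C / \<delta>) *\<^sub>R norm (indicat_real (layer (4 * \<delta>)) x *\<^sub>R u x))"
      by (intro l2_triangle square_integrable_scale square_integrable_norm i)
    also have "\<dots> = l2 M (\<lambda>x. indicat_real (layer (4 * \<delta>)) x *\<^sub>R grad u x) + C / \<delta> * S"
      unfolding l2_scale l2_norm S_def using C(1) \<delta>(1) by simp
    also have "\<dots> \<le> G + C / \<delta> * (K0 * (2 * sqrt \<delta> * b + 4 * \<delta> * G))"
      using C(1) \<delta>(1) by (intro add_mono G4 mult_left_mono S) auto
    also have "\<dots> = G * (1 + 4 * C * K0) + 2 * C * K0 * (b / sqrt \<delta>)"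
    proof -
      have "sqrt \<delta> / \<delta> = 1 / sqrt \<delta>" using \<delta>(1) real_sqrt_mult_self[of \<delta>] by (simp add: field_simps)
      then have "C / \<delta> * (K0 * (2 * sqrt \<delta> * b + 4 * \<delta> * G)) = 2 * C * K0 * b * (1 / sqrt \<delta>) + 4 * C * K0 * G"
        using \<delta>(1) by (simp add: field_simps)
      then show ?thesis by (simp add: algebra_simps)
    qed
    also have "\<dots> \<le> G * K + K * (b / sqrt \<delta>)"
    proof (intro add_mono mult_left_mono mult_right_mono)
      have "0 \<le> C * K0" using C(1) K0(1) by simp
      then show "1 + 4 * C * K0 \<le> K" "2 * C * K0 \<le> K" using K0(1) by (auto simp: K_def)
    qed (use nn \<delta> in auto)
    finally have 2: "l2 M (\<lambda>x. grad v x - grad u x) \<le> K * (b / sqrt \<delta> + G)" by (simp add: algebra_simps)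
    show ?thesis using cut(1) 1 2 by (intro exI[of _ v]) (simp add: b_def G_def)
  qed
  ultimately show ?thesis using that[of K m "\<delta>0 / 4"] by blast
qed

end

context robin_domain
begin

section \<open>Compactness of Robin quasi-minimisers\<close>

lemma layer_energy_le: "u \<in> test_functions UNIV \<Longrightarrow> layer_energy d u \<le> l2 M (grad u)"
  unfolding layer_energy_def by (rule square_integrable_indicator(2)[OF square_integrable_M(2)])

text \<open>Carries smallness of the layer energy from one function to all functions with nearby
  gradients; this is how convergence of the gradients excludes concentration at the
  boundary.\<close>

lemma layer_energy_diff:
  assumes "u \<in> test_functions UNIV" "v \<in> test_functions UNIV"
  shows "layer_energy d u \<le> layer_energy d v + l2 M (\<lambda>x. grad u x - grad v x)"
proof -
  note sq = square_integrable_M[OF assms(1)] square_integrable_M[OF assms(2)]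
  note d = square_integrable_diff[OF sq(2) sq(4)]
  have "layer_energy d u = l2 M (\<lambda>x. indicat_real (layer d) x *\<^sub>R grad v x + indicat_real (layer d) x *\<^sub>R (grad u x - grad v x))"
    by (simp add: layer_energy_def scaleR_diff_right)
  also have "\<dots> \<le> layer_energy d v + l2 M (\<lambda>x. indicat_real (layer d) x *\<^sub>R (grad u x - grad v x))"
    unfolding layer_energy_def by (intro l2_triangle square_integrable_indicator sq d)
  also have "\<dots> \<le> layer_energy d v + l2 M (\<lambda>x. grad u x - grad v x)"
    by (intro add_left_mono square_integrable_indicator(2) d)
  finally show ?thesis .
qed

text \<open>Every point of \<open>\<Omega>\<close> has positive distance from the outer boundary and
  so leaves the layers eventually; dominated convergence does the rest.\<close>

lemma layer_energy_tendsto_0: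
  assumes u: "u \<in> test_functions UNIV" and d: "d \<longlonglongrightarrow> 0"
  shows "(\<lambda>j. layer_energy (d j) u) \<longlonglongrightarrow> 0"
proof -
  note sq = square_integrable_M(2)[OF u]
  have "(\<lambda>j. LINT x|M. (norm (indicat_real (layer (d j)) x *\<^sub>R grad u x))\<^sup>2) \<longlonglongrightarrow> (LINT x|M. 0)"
  proof (rule integral_dominated_convergence[where w="\<lambda>x. (norm (grad u x))\<^sup>2"])
    show "integrable M (\<lambda>x. (norm (grad u x))\<^sup>2)" using sq by (simp add: square_integrable_def)
    show "(\<lambda>x. (norm (indicat_real (layer (d j)) x *\<^sub>R grad u x))\<^sup>2) \<in> borel_measurable M" for j
      using square_integrable_measurable[OF square_integrable_indicator(1)[OF sq, of "d j"]] by measurable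
    show "AE x in M. norm ((norm (indicat_real (layer (d j)) x *\<^sub>R grad u x))\<^sup>2) \<le> (norm (grad u x))\<^sup>2" for j
      by (intro AE_I2) (auto simp: indicator_def)
    show "AE x in M. (\<lambda>j. (norm (indicat_real (layer (d j)) x *\<^sub>R grad u x))\<^sup>2) \<longlonglongrightarrow> 0"
    proof (rule AE_M_I)
      fix x assume "x \<in> \<Omega>"
      then have "x \<notin> frontier \<Omega>0" using open0 frontier_disjoint_eq[of \<Omega>0] by (auto simp: \<Omega>_def)
      then have "infdist x (frontier \<Omega>0) > 0"
        using infdist_pos_not_in_closed[OF frontier_closed frontier_nonempty] by simp
      then have "\<forall>\<^sub>F j in sequentially. d j < infdist x (frontier \<Omega>0)" by (rule order_tendstoD(2)[OF d])
      then have "\<forall>\<^sub>F j in sequentially. 0 = (norm (indicat_real (layer (d j)) x *\<^sub>R grad u x))\<^sup>2"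
        by eventually_elim (simp add: layer_def)
      then show "(\<lambda>j. (norm (indicat_real (layer (d j)) x *\<^sub>R grad u x))\<^sup>2) \<longlonglongrightarrow> 0"
        by (rule Lim_transform_eventually[OF tendsto_const])
    qed
  qed simp
  then have "(\<lambda>j. sqrt (LINT x|M. (norm (indicat_real (layer (d j)) x *\<^sub>R grad u x))\<^sup>2)) \<longlonglongrightarrow> sqrt (LINT x|M. 0)"
    by (rule tendsto_real_sqrt)
  then show ?thesis by (simp add: layer_energy_def l2_def)
qed

text \<open>The \<open>u k\<close> need not vanish at the boundary, so compactness is first obtained
  for their truncations \<open>v j k\<close> at width \<open>\<delta> j\<close>. These approximate
  \<open>u k\<close> in \<open>L2\<close> within \<open>E1 j\<close>, uniformly in \<open>k\<close>,
  and \<open>E1 j\<close> tends to zero with the width; a three-term estimate transfers the Cauchy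
  property.\<close>

lemma robin_compactness:
  assumes u: "\<And>k. u k \<in> V" and A: "\<And>k. l2 M (u k) \<le> A" "\<And>k. l2 M (grad (u k)) \<le> A" "\<And>k. l2 \<sigma> (u k) \<le> A"
  shows "\<exists>r::nat\<Rightarrow>nat. strict_mono r \<and> (\<forall>\<epsilon>>0. \<exists>N. \<forall>k\<ge>N. \<forall>l\<ge>N. l2 M (\<lambda>x. u (r k) x - u (r l) x) < \<epsilon>)"
proof -
  have A0: "0 \<le> A" using A(1)[of 0] l2_nonneg[of M "u 0"] by linarith
  obtain K m \<delta>0 where K: "K > 0" "m > 0" "\<delta>0 > 0"
    "\<And>\<delta> u. 0 < \<delta> \<Longrightarrow> \<delta> < \<delta>0 \<Longrightarrow> u \<in> V \<Longrightarrow> \<exists>v. v \<in> test_functions \<Omega> \<and>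
      l2 M (\<lambda>x. v x - u x) \<le> K * (sqrt \<delta> * l2 \<sigma> u + \<delta> * layer_energy (m * \<delta>) u) \<and>
      l2 M (\<lambda>x. grad v x - grad u x) \<le> K * (l2 \<sigma> u / sqrt \<delta> + layer_energy (m * \<delta>) u)"
    using interior_approximation by blast
  note uU = VD(2)[OF u]
  define \<delta> where "\<delta> j = \<delta>0 / 2 * inverse (real (Suc j))" for j
  have \<delta>: "0 < \<delta> j" "\<delta> j < \<delta>0" for j
  proof -
    show "0 < \<delta> j" using K(3) by (simp add: \<delta>_def)
    have "inverse (real (Suc j)) \<le> 1" by (simp add: inverse_le_1_iff)
    then have "\<delta>0 / 2 * inverse (real (Suc j)) \<le> \<delta>0 / 2 * 1" using K(3) by (intro mult_left_mono) auto
    then show "\<delta> j < \<delta>0" using K(3) by (simp only: \<delta>_def)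
  qed
  have \<delta>lim: "\<delta> \<longlonglongrightarrow> 0"
    using tendsto_mult_left[OF LIMSEQ_inverse_real_of_nat, of "\<delta>0 / 2"] unfolding \<delta>_def[abs_def] by simp
  \<comment> \<open>\<open>E1\<close> has to tend to zero, while the gradient error
    \<open>E2\<close> may grow as the width shrinks: for each fixed \<open>j\<close> any bound on
    the gradients is enough.\<close>
  define E1 where "E1 j = K * (sqrt (\<delta> j) * A + \<delta> j * A)" for j
  define E2 where "E2 j = K * (A / sqrt (\<delta> j) + A)" for j
  have E1lim: "E1 \<longlonglongrightarrow> 0"
  proof -
    have "E1 \<longlonglongrightarrow> K * (sqrt 0 * A + 0 * A)" unfolding E1_def by (intro tendsto_intros \<delta>lim)
    then show ?thesis by simp
  qed
  have ex: "\<exists>v. v \<in> test_functions \<Omega> \<and> l2 M (\<lambda>x. v x - u k x) \<le> E1 j \<and> l2 M (\<lambda>x. grad v x - grad (u k) x) \<le> E2 j" for j k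
  proof -
    obtain v where v: "v \<in> test_functions \<Omega>"
      "l2 M (\<lambda>x. v x - u k x) \<le> K * (sqrt (\<delta> j) * l2 \<sigma> (u k) + \<delta> j * layer_energy (m * \<delta> j) (u k))"
      "l2 M (\<lambda>x. grad v x - grad (u k) x) \<le> K * (l2 \<sigma> (u k) / sqrt (\<delta> j) + layer_energy (m * \<delta> j) (u k))"
      using K(4)[OF \<delta>(1)[of j] \<delta>(2)[of j] u[of k]] by blast
    have le: "layer_energy (m * \<delta> j) (u k) \<le> A" using layer_energy_le[OF uU] A(2) order_trans by blast
    have "K * (sqrt (\<delta> j) * l2 \<sigma> (u k) + \<delta> j * layer_energy (m * \<delta> j) (u k)) \<le> E1 j"
      unfolding E1_def using K(1) \<delta>(1)[of j] by (intro mult_left_mono add_mono A le) auto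
    moreover have "K * (l2 \<sigma> (u k) / sqrt (\<delta> j) + layer_energy (m * \<delta> j) (u k)) \<le> E2 j"
      unfolding E2_def using K(1) \<delta>(1)[of j] by (intro mult_left_mono add_mono divide_right_mono A le) auto
    ultimately show ?thesis using v order_trans by blast
  qed
  define v where "v j k = (SOME v. v \<in> test_functions \<Omega> \<and> l2 M (\<lambda>x. v x - u k x) \<le> E1 j \<and> l2 M (\<lambda>x. grad v x - grad (u k) x) \<le> E2 j)" for j k
  have v: "v j k \<in> test_functions \<Omega>" "l2 M (\<lambda>x. v j k x - u k x) \<le> E1 j" "l2 M (\<lambda>x. grad (v j k) x - grad (u k) x) \<le> E2 j" for j k
    using someI_ex[OF ex[of k j]] unfolding v_def by blast+
  have vU: "v j k \<in> test_functions UNIV" for j k by (rule test_functions_mono[OF _ v(1)]) simp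
  note squ = square_integrable_M[OF uU] and sqv = square_integrable_M[OF vU]
  have lv: "l2 M (v j k) = l2 lborel (v j k)" "l2 M (grad (v j k)) = l2 lborel (grad (v j k))" for j k
    unfolding M_def using l2_test_functions_lborel[OF v(1) lebesgue\<Omega>] by auto
  have b1: "l2 lborel (v j k) \<le> A + E1 j" for j k
    using l2_abs_diff[OF sqv(1)[of j k] squ(1)[of k]] v(2)[of j k] A(1)[of k] unfolding lv by linarith
  have b2: "l2 lborel (grad (v j k)) \<le> A + E2 j" for j k
    using l2_abs_diff[OF sqv(2)[of j k] squ(2)[of k]] v(3)[of j k] A(2)[of k] unfolding lv by linarith
  \<comment> \<open>Widths and cells are indexed together, so that a single subsequence makes the
    truncations Cauchy for every width.\<close>
  define f where "f n p = cell_integral (v (fst p) n) (snd p)" for n and p :: "nat \<times> real \<times> 'a"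
  have "countable (UNIV \<times> cell_index \<Omega> :: (nat \<times> real \<times> 'a) set)"
    using countable_cell_index[OF bounded\<Omega>] by (intro countable_SIGMA) auto
  then obtain r where r: "strict_mono (r::nat\<Rightarrow>nat)" "\<And>p. p \<in> UNIV \<times> cell_index \<Omega> \<Longrightarrow> convergent (\<lambda>n. f (r n) p)"
  proof (rule pointwise_bounded_convergent_subsequence[of _ f])
    fix p :: "nat \<times> real \<times> 'a" assume "p \<in> UNIV \<times> cell_index \<Omega>"
    then have pos: "fst (snd p) > 0" using cell_index_pos by auto
    have "\<bar>f n p\<bar> \<le> l2 lborel (indicat_real (lattice_cell (fst (snd p)) (snd (snd p)))) * (A + E1 (fst p))" for n
    proof -
      have "\<bar>f n p\<bar> \<le> l2 lborel (indicat_real (lattice_cell (fst (snd p)) (snd (snd p)))) * l2 lborel (v (fst p) n)"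
        unfolding f_def by (rule cell_integral_bound[OF pos square_integrable_lborel_test(1)[OF v(1)]])
      also have "\<dots> \<le> l2 lborel (indicat_real (lattice_cell (fst (snd p)) (snd (snd p)))) * (A + E1 (fst p))"
        by (intro mult_left_mono b1 l2_nonneg)
      finally show ?thesis .
    qed
    then show "\<exists>B. \<forall>n. \<bar>f n p\<bar> \<le> B" by blast
  qed blast
  have vc: "\<exists>N. \<forall>k\<ge>N. \<forall>l\<ge>N. l2 lborel (\<lambda>x. v j (r k) x - v j (r l) x) < \<epsilon>" if "\<epsilon> > 0" for j \<epsilon>
  proof (rule rellich_Cauchy[OF bounded\<Omega> v(1) b2 _ that])
    fix i assume "i \<in> cell_index \<Omega>"
    then show "convergent (\<lambda>k. cell_integral (v j (r k)) i)" using r(2)[of "(j, i)"] by (simp add: f_def)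
  qed
  have "\<exists>N. \<forall>k\<ge>N. \<forall>l\<ge>N. l2 M (\<lambda>x. u (r k) x - u (r l) x) < \<epsilon>" if \<epsilon>: "\<epsilon> > 0" for \<epsilon>
  proof -
    have "\<forall>\<^sub>F j in sequentially. E1 j < \<epsilon> / 3" using E1lim by (rule order_tendstoD(2)) (use \<epsilon> in simp)
    then obtain j where j: "E1 j < \<epsilon> / 3" by (auto simp: eventually_sequentially)
    obtain N where N: "\<forall>k\<ge>N. \<forall>l\<ge>N. l2 lborel (\<lambda>x. v j (r k) x - v j (r l) x) < \<epsilon> / 3"
      using vc[of "\<epsilon> / 3" j] \<epsilon> by auto
    have "l2 M (\<lambda>x. u (r k) x - u (r l) x) < \<epsilon>" if kl: "k \<ge> N" "l \<ge> N" for k l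
    proof -
      have "l2 M (\<lambda>x. u (r k) x - u (r l) x) \<le> l2 M (\<lambda>x. u (r k) x - v j (r k) x) + l2 M (\<lambda>x. v j (r k) x - u (r l) x)"
        by (rule l2_diff_triangle[OF squ(1) sqv(1) squ(1)])
      moreover have "l2 M (\<lambda>x. v j (r k) x - u (r l) x) \<le> l2 M (\<lambda>x. v j (r k) x - v j (r l) x) + l2 M (\<lambda>x. v j (r l) x - u (r l) x)"
        by (rule l2_diff_triangle[OF sqv(1) sqv(1) squ(1)])
      moreover have "l2 M (\<lambda>x. v j (r k) x - v j (r l) x) = l2 lborel (\<lambda>x. v j (r k) x - v j (r l) x)"
        unfolding M_def by (rule l2_test_functions_lborel(1)[OF test_functions_diff[OF v(1) v(1)] lebesgue\<Omega>])
      moreover have "l2 M (\<lambda>x. u (r k) x - v j (r k) x) = l2 M (\<lambda>x. v j (r k) x - u (r k) x)" by (rule l2_minus_commute)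
      ultimately show ?thesis using N kl v(2)[of j "r k"] v(2)[of j "r l"] j by force
    qed
    then show ?thesis by blast
  qed
  then show ?thesis using r(1) by blast
qed

text \<open>The parallelogram argument for forms that vary with \<open>k\<close>. The lower bound
  for \<open>w k + w l\<close> is taken at a fixed \<open>\<beta> = j\<close> with
  \<open>j \<le> k\<close> and \<open>j \<le> l\<close>, where both functions still satisfy the
  upper bound; boundary terms obey the parallelogram law as well. The price
  \<open>\<Lambda> - \<mu> j\<close> tends to zero.\<close>

lemma robin_gradient_Cauchy:
  assumes w: "\<And>k. w k \<in> V" "\<And>k. l2 M (w k) = 1"
    and en: "\<And>k j. j \<le> k \<Longrightarrow> (l2 M (grad (w k)))\<^sup>2 + real j * (l2 \<sigma> (w k))\<^sup>2 \<le> \<Lambda> + inverse (real (Suc k))"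
    and lim: "(\<lambda>j. eigenvalue_RD (real j) \<Omega>0 \<Theta>) \<longlonglongrightarrow> \<Lambda>" and le: "\<And>j. eigenvalue_RD (real j) \<Omega>0 \<Theta> \<le> \<Lambda>"
    and cau: "\<And>\<epsilon>. \<epsilon> > 0 \<Longrightarrow> \<exists>N. \<forall>k\<ge>N. \<forall>l\<ge>N. l2 M (\<lambda>x. w k x - w l x) < \<epsilon>"
    and \<epsilon>: "\<epsilon> > 0"
  shows "\<exists>N. \<forall>k\<ge>N. \<forall>l\<ge>N. l2 M (\<lambda>x. grad (w k) x - grad (w l) x) < \<epsilon>"
proof -
  note w' = VD[OF w(1)]
  note sq = square_integrable_M[OF w'(2)]
  define \<mu> where "\<mu> j = eigenvalue_RD (real j) \<Omega>0 \<Theta>" for j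
  have \<mu>0: "\<mu> j \<ge> 0" for j by (simp add: \<mu>_def eigenvalue_RD_nonneg)
  have \<Lambda>0: "\<Lambda> \<ge> 0" using le[of 0] \<mu>0[of 0] unfolding \<mu>_def by linarith
  have main: "(l2 M (\<lambda>x. grad (w k) x - grad (w l) x))\<^sup>2
    \<le> 4 * (\<Lambda> - \<mu> j + inverse (real (Suc j))) + \<Lambda> * (l2 M (\<lambda>x. w k x - w l x))\<^sup>2"
    if j: "j \<le> k" "j \<le> l" for j k l
  proof -
    have inv: "inverse (real (Suc k)) \<le> inverse (real (Suc j))" "inverse (real (Suc l)) \<le> inverse (real (Suc j))"
      using j by (auto intro!: le_imp_inverse_le)
    have "\<mu> j * (l2 M (\<lambda>x. w k x + w l x))\<^sup>2
      \<le> (l2 M (grad (\<lambda>x. w k x + w l x)))\<^sup>2 + real j * (l2 \<sigma> (\<lambda>x. w k x + w l x))\<^sup>2"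
      unfolding \<mu>_def by (rule eigenvalue_RD_le_smooth[OF _ V_add[OF w(1) w(1)]]) simp
    moreover have "grad (\<lambda>x. w k x + w l x) = (\<lambda>x. grad (w k) x + grad (w l) x)"
      by (rule ext) (rule grad_add[OF w'(3) w'(3)])
    ultimately have lower: "\<mu> j * (l2 M (\<lambda>x. w k x + w l x))\<^sup>2
      \<le> (l2 M (\<lambda>x. grad (w k) x + grad (w l) x))\<^sup>2 + real j * (l2 \<sigma> (\<lambda>x. w k x + w l x))\<^sup>2" by simp
    have pm: "(l2 M (\<lambda>x. w k x + w l x))\<^sup>2 = 4 - (l2 M (\<lambda>x. w k x - w l x))\<^sup>2"
      using l2_parallelogram[OF sq(1)[of k] sq(1)[of l]] w(2) by simp
    have pa: "(l2 M (\<lambda>x. grad (w k) x + grad (w l) x))\<^sup>2 + (l2 M (\<lambda>x. grad (w k) x - grad (w l) x))\<^sup>2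
      = 2 * (l2 M (grad (w k)))\<^sup>2 + 2 * (l2 M (grad (w l)))\<^sup>2"
      by (rule l2_parallelogram[OF sq(2)[of k] sq(2)[of l]])
    have "real j * ((l2 \<sigma> (\<lambda>x. w k x + w l x))\<^sup>2 + (l2 \<sigma> (\<lambda>x. w k x - w l x))\<^sup>2)
      = real j * (2 * (l2 \<sigma> (w k))\<^sup>2 + 2 * (l2 \<sigma> (w l))\<^sup>2)"
      by (simp only: l2_parallelogram[OF w'(4)[of k] w'(4)[of l]])
    then have pb: "real j * (l2 \<sigma> (\<lambda>x. w k x + w l x))\<^sup>2 + real j * (l2 \<sigma> (\<lambda>x. w k x - w l x))\<^sup>2
      = 2 * (real j * (l2 \<sigma> (w k))\<^sup>2) + 2 * (real j * (l2 \<sigma> (w l))\<^sup>2)"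
      by (simp add: algebra_simps)
    \<comment> \<open>With the squared norms abstracted to variables the claim is linear; the
      boundary term \<open>bd\<close> of the difference is nonnegative and is dropped.\<close>
    have arith: "ad \<le> 4 * (\<Lambda> - mu + i) + Lm"
      if "0 \<le> bd" "4 * mu - mum \<le> as + bs" "mum \<le> Lm" "as + ad = 2 * ak + 2 * al" "bs + bd = 2 * bk + 2 * bl"
        "ak + bk \<le> \<Lambda> + ik" "al + bl \<le> \<Lambda> + il" "ik \<le> i" "il \<le> i"
      for ad mu i Lm bd mum as bs ak al bk bl ik il :: real
      using that by argo
    have "0 \<le> real j * (l2 \<sigma> (\<lambda>x. w k x - w l x))\<^sup>2" by simp
    moreover have "4 * \<mu> j - \<mu> j * (l2 M (\<lambda>x. w k x - w l x))\<^sup>2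
      \<le> (l2 M (\<lambda>x. grad (w k) x + grad (w l) x))\<^sup>2 + real j * (l2 \<sigma> (\<lambda>x. w k x + w l x))\<^sup>2"
      using lower[unfolded pm] by (simp add: algebra_simps)
    moreover have "\<mu> j * (l2 M (\<lambda>x. w k x - w l x))\<^sup>2 \<le> \<Lambda> * (l2 M (\<lambda>x. w k x - w l x))\<^sup>2"
      using le[of j] unfolding \<mu>_def by (intro mult_right_mono) auto
    ultimately show ?thesis
      by (rule arith[OF _ _ _ pa pb en[OF j(1)] en[OF j(2)] inv])
  qed
  define \<eta> where "\<eta> = sqrt (\<epsilon>\<^sup>2 / (4 * (\<Lambda> + 1)))"
  have \<eta>: "\<eta> > 0" "\<eta>\<^sup>2 = \<epsilon>\<^sup>2 / (4 * (\<Lambda> + 1))" using \<epsilon> \<Lambda>0 by (auto simp: \<eta>_def)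
  have "(\<lambda>j. 4 * (\<Lambda> - \<mu> j + inverse (real (Suc j)))) \<longlonglongrightarrow> 4 * (\<Lambda> - \<Lambda> + 0)"
    unfolding \<mu>_def by (intro tendsto_intros lim LIMSEQ_inverse_real_of_nat)
  then have "\<forall>\<^sub>F j in sequentially. 4 * (\<Lambda> - \<mu> j + inverse (real (Suc j))) < \<epsilon>\<^sup>2 / 2"
    by (rule order_tendstoD(2)) (use \<epsilon> in simp)
  then obtain j where j: "4 * (\<Lambda> - \<mu> j + inverse (real (Suc j))) < \<epsilon>\<^sup>2 / 2"
    by (auto simp: eventually_sequentially)
  obtain N where N: "\<forall>k\<ge>N. \<forall>l\<ge>N. l2 M (\<lambda>x. w k x - w l x) < \<eta>" using cau[OF \<eta>(1)] by blast
  have "l2 M (\<lambda>x. grad (w k) x - grad (w l) x) < \<epsilon>" if kl: "k \<ge> max N j" "l \<ge> max N j" for k l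
  proof (rule power2_less_imp_less)
    have kl': "N \<le> k" "N \<le> l" "j \<le> k" "j \<le> l" using kl by auto
    have "l2 M (\<lambda>x. w k x - w l x) \<le> \<eta>" using N kl'(1,2) less_imp_le by blast
    then have "(l2 M (\<lambda>x. w k x - w l x))\<^sup>2 \<le> \<eta>\<^sup>2" by (intro power_mono l2_nonneg)
    then have "\<Lambda> * (l2 M (\<lambda>x. w k x - w l x))\<^sup>2 \<le> \<Lambda> * (\<epsilon>\<^sup>2 / (4 * (\<Lambda> + 1)))"
      unfolding \<eta>(2) using \<Lambda>0 by (rule mult_left_mono)
    also have "\<dots> \<le> \<epsilon>\<^sup>2 / 4" using \<Lambda>0 by (simp add: divide_simps) (simp add: algebra_simps)
    finally have "\<Lambda> * (l2 M (\<lambda>x. w k x - w l x))\<^sup>2 \<le> \<epsilon>\<^sup>2 / 4" .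
    moreover have "\<epsilon>\<^sup>2 > 0" using \<epsilon> by simp
    ultimately show "(l2 M (\<lambda>x. grad (w k) x - grad (w l) x))\<^sup>2 < \<epsilon>\<^sup>2"
      using main[OF kl'(3,4)] j by linarith
  qed (use \<epsilon> in simp)
  then show ?thesis by blast
qed

text \<open>The order of choices matters: after \<open>\<epsilon>\<close> comes \<open>N\<close>
  from the Cauchy property, then a width \<open>\<delta>\<close> for which the single function
  \<open>w N\<close> has small layer energy, and only then \<open>k \<ge> N\<close> with boundary
  values small relative to \<open>sqrt \<delta>\<close>. The truncation of this \<open>w k\<close>
  competes for the Dirichlet quotient. Each error is at most \<open>K\<close> times
  \<open>\<epsilon>\<close> from the boundary and \<open>2 * \<epsilon>\<close> from the
  layer.\<close>

lemma dirichlet_le_of_gradient_Cauchy: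
  assumes w: "\<And>k. w k \<in> V" "\<And>k. l2 M (w k) = 1"
    and en: "\<And>k. (l2 M (grad (w k)))\<^sup>2 \<le> \<Lambda> + inverse (real (Suc k))"
    and tr: "(\<lambda>k. l2 \<sigma> (w k)) \<longlonglongrightarrow> 0"
    and cau: "\<And>\<epsilon>. \<epsilon> > 0 \<Longrightarrow> \<exists>N. \<forall>k\<ge>N. \<forall>l\<ge>N. l2 M (\<lambda>x. grad (w k) x - grad (w l) x) < \<epsilon>"
    and \<Lambda>: "\<Lambda> \<ge> 0"
  shows "rayleigh_inf \<Omega> \<le> \<Lambda>"
proof -
  obtain K m \<delta>0 where K: "K > 0" "m > 0" "\<delta>0 > 0"
    "\<And>\<delta> u. 0 < \<delta> \<Longrightarrow> \<delta> < \<delta>0 \<Longrightarrow> u \<in> V \<Longrightarrow> \<exists>v. v \<in> test_functions \<Omega> \<and>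
      l2 M (\<lambda>x. v x - u x) \<le> K * (sqrt \<delta> * l2 \<sigma> u + \<delta> * layer_energy (m * \<delta>) u) \<and>
      l2 M (\<lambda>x. grad v x - grad u x) \<le> K * (l2 \<sigma> u / sqrt \<delta> + layer_energy (m * \<delta>) u)"
    using interior_approximation by blast
  note w' = VD[OF w(1)]
  note sq = square_integrable_M[OF w'(2)]
  define D where "D = rayleigh_inf \<Omega>"
  have D0: "D \<ge> 0" unfolding D_def by (rule rayleigh_inf_nonneg[OF open\<Omega> nonempty\<Omega>])
  have step: "sqrt D * (1 - K * (3 * \<epsilon>)) \<le> sqrt (\<Lambda> + \<epsilon>) + K * (3 * \<epsilon>)" if \<epsilon>: "\<epsilon> > 0" for \<epsilon>
  proof -
    obtain N where N: "\<forall>k\<ge>N. \<forall>l\<ge>N. l2 M (\<lambda>x. grad (w k) x - grad (w l) x) < \<epsilon>" using cau[OF \<epsilon>] by blast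
    \<comment> \<open>Widths at most 1 let the factors \<open>\<delta>\<close> and
      \<open>sqrt \<delta>\<close> in the mass estimate be dropped.\<close>
    define d where "d j = min 1 (\<delta>0 / 2) * inverse (real (Suc j))" for j
    have d: "0 < d j" "d j < \<delta>0" "d j \<le> 1" for j
    proof -
      show "0 < d j" using K(3) by (simp add: d_def)
      have "inverse (real (Suc j)) \<le> 1" by (simp add: inverse_le_1_iff)
      then have "min 1 (\<delta>0 / 2) * inverse (real (Suc j)) \<le> min 1 (\<delta>0 / 2) * 1"
        using K(3) by (intro mult_left_mono) auto
      then have "d j \<le> min 1 (\<delta>0 / 2)" by (simp only: d_def mult_1_right)
      then show "d j < \<delta>0" "d j \<le> 1" using K(3) by auto
    qed
    have "(\<lambda>j. m * d j) \<longlonglongrightarrow> m * (min 1 (\<delta>0 / 2) * 0)"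
      unfolding d_def by (intro tendsto_intros LIMSEQ_inverse_real_of_nat)
    then have "(\<lambda>j. layer_energy (m * d j) (w N)) \<longlonglongrightarrow> 0"
      by (intro layer_energy_tendsto_0 w') simp
    then have "\<forall>\<^sub>F j in sequentially. layer_energy (m * d j) (w N) < \<epsilon>" by (rule order_tendstoD(2)) (rule \<epsilon>)
    then obtain j where j: "layer_energy (m * d j) (w N) < \<epsilon>" by (auto simp: eventually_sequentially)
    define \<delta> where "\<delta> = d j"
    have \<delta>: "0 < \<delta>" "\<delta> < \<delta>0" "\<delta> \<le> 1" using d by (auto simp: \<delta>_def)
    have "(\<lambda>k. l2 \<sigma> (w k) / sqrt \<delta>) \<longlonglongrightarrow> 0 / sqrt \<delta>" using \<delta> by (intro tendsto_divide tr tendsto_const) auto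
    then have "\<forall>\<^sub>F k in sequentially. l2 \<sigma> (w k) / sqrt \<delta> < \<epsilon>" by (rule order_tendstoD(2)) (use \<epsilon> in simp)
    moreover have "\<forall>\<^sub>F k in sequentially. inverse (real (Suc k)) < \<epsilon>"
      using LIMSEQ_inverse_real_of_nat \<epsilon> by (rule order_tendstoD(2))
    moreover have "\<forall>\<^sub>F k in sequentially. N \<le> k" by (rule eventually_ge_at_top)
    ultimately have "\<forall>\<^sub>F k in sequentially. l2 \<sigma> (w k) / sqrt \<delta> < \<epsilon> \<and> inverse (real (Suc k)) < \<epsilon> \<and> N \<le> k"
      by eventually_elim blast
    then obtain k where k: "l2 \<sigma> (w k) / sqrt \<delta> < \<epsilon>" "inverse (real (Suc k)) < \<epsilon>" "N \<le> k"
      by (auto simp: eventually_sequentially)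
    define G where "G = layer_energy (m * \<delta>) (w k)"
    have "G \<le> layer_energy (m * \<delta>) (w N) + l2 M (\<lambda>x. grad (w k) x - grad (w N) x)"
      unfolding G_def by (rule layer_energy_diff[OF w'(2) w'(2)])
    moreover have "l2 M (\<lambda>x. grad (w k) x - grad (w N) x) < \<epsilon>" using N k(3) by blast
    ultimately have G: "G \<le> 2 * \<epsilon>" using j unfolding \<delta>_def by linarith
    have G0: "G \<ge> 0" by (simp add: G_def layer_energy_def l2_nonneg)
    define b where "b = l2 \<sigma> (w k)"
    have b0: "b \<ge> 0" by (simp add: b_def l2_nonneg)
    have s1: "0 < sqrt \<delta>" "sqrt \<delta> \<le> 1" using \<delta> by auto
    obtain v where v: "v \<in> test_functions \<Omega>"
      "l2 M (\<lambda>x. v x - w k x) \<le> K * (sqrt \<delta> * b + \<delta> * G)"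
      "l2 M (\<lambda>x. grad v x - grad (w k) x) \<le> K * (b / sqrt \<delta> + G)"
      using K(4)[OF \<delta>(1,2) w(1)[of k]] unfolding b_def G_def by blast
    have vU: "v \<in> test_functions UNIV" by (rule test_functions_mono[OF _ v(1)]) simp
    note sqv = square_integrable_M[OF vU]
    have bs: "b / sqrt \<delta> \<le> \<epsilon>" using k(1) by (simp add: b_def)
    have "b \<le> \<epsilon>"
    proof -
      have "b \<le> \<epsilon> * sqrt \<delta>" using bs s1(1) by (simp add: pos_divide_le_eq)
      also have "\<dots> \<le> \<epsilon> * 1" using s1 \<epsilon> by (intro mult_left_mono) auto
      finally show ?thesis by simp
    qed
    have "sqrt \<delta> * b \<le> 1 * b" using s1(2) b0 by (rule mult_right_mono)
    moreover have "\<delta> * G \<le> 1 * G" using \<delta>(3) G0 by (rule mult_right_mono)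
    ultimately have "sqrt \<delta> * b + \<delta> * G \<le> 3 * \<epsilon>" using \<open>b \<le> \<epsilon>\<close> G by linarith
    then have d1: "l2 M (\<lambda>x. v x - w k x) \<le> K * (3 * \<epsilon>)"
      using v(2) K(1) mult_left_mono[of "sqrt \<delta> * b + \<delta> * G" "3 * \<epsilon>" K] by linarith
    have d2: "l2 M (\<lambda>x. grad v x - grad (w k) x) \<le> K * (3 * \<epsilon>)"
      using v(3) K(1) bs G mult_left_mono[of "b / sqrt \<delta> + G" "3 * \<epsilon>" K] by linarith
    \<comment> \<open>Norms rather than squares keep the errors additive. The lower bound may be
      negative for large \<open>\<epsilon>\<close>, which the factor \<open>sqrt D\<close>
      tolerates, being nonnegative.\<close>
    have "l2 M v \<ge> 1 - K * (3 * \<epsilon>)"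
      using l2_abs_diff[OF sqv(1) sq(1)[of k]] d1 w(2)[of k] by linarith
    then have "sqrt D * (1 - K * (3 * \<epsilon>)) \<le> sqrt D * l2 M v" using D0 by (intro mult_left_mono) auto
    also have "\<dots> \<le> l2 M (grad v)"
    proof (rule power2_le_imp_le[OF _ l2_nonneg])
      have "D * (l2 lborel v)\<^sup>2 \<le> (l2 lborel (grad v))\<^sup>2" unfolding D_def by (rule rayleigh_inf_le[OF v(1)])
      then show "(sqrt D * l2 M v)\<^sup>2 \<le> (l2 M (grad v))\<^sup>2"
        unfolding M_def using l2_test_functions_lborel[OF v(1) lebesgue\<Omega>] D0 by (simp add: power_mult_distrib)
    qed
    also have "\<dots> \<le> l2 M (grad (w k)) + K * (3 * \<epsilon>)"
      using l2_abs_diff[OF sqv(2) sq(2)[of k]] d2 by linarith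
    also have "l2 M (grad (w k)) \<le> sqrt (\<Lambda> + \<epsilon>)"
      by (rule real_le_rsqrt) (use en[of k] k(2) in linarith)
    finally show ?thesis by simp
  qed
  define e where "e i = inverse (real (Suc i))" for i
  have e: "e \<longlonglongrightarrow> 0" unfolding e_def by (rule LIMSEQ_inverse_real_of_nat)
  have "(\<lambda>i. sqrt D * (1 - K * (3 * e i))) \<longlonglongrightarrow> sqrt D * (1 - K * (3 * 0))" by (intro tendsto_intros e)
  moreover have "(\<lambda>i. sqrt (\<Lambda> + e i) + K * (3 * e i)) \<longlonglongrightarrow> sqrt (\<Lambda> + 0) + K * (3 * 0)" by (intro tendsto_intros e)
  ultimately have "sqrt D * (1 - K * (3 * 0)) \<le> sqrt (\<Lambda> + 0) + K * (3 * 0)"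
    by (rule LIMSEQ_le) (use step in \<open>simp add: e_def\<close>)
  then show ?thesis by (simp add: D_def)
qed

section \<open>The limit of large Robin parameter\<close>

lemma dirichlet_le_limit:
  assumes lim: "(\<lambda>j. eigenvalue_RD (real j) \<Omega>0 \<Theta>) \<longlonglongrightarrow> \<Lambda>" and le: "\<And>j. eigenvalue_RD (real j) \<Omega>0 \<Theta> \<le> \<Lambda>"
  shows "rayleigh_inf \<Omega> \<le> \<Lambda>"
proof -
  have \<Lambda>0: "\<Lambda> \<ge> 0" using le[of 0] eigenvalue_RD_nonneg[of 0] by simp
  \<comment> \<open>\<open>Suc k\<close> instead of \<open>k\<close> keeps the parameter positive,
    so the energy bound controls the boundary values from the first index on.\<close>
  have "\<exists>u. u \<in> V \<and> l2 M u = 1 \<and> (l2 M (grad u))\<^sup>2 + real (Suc k) * (l2 \<sigma> u)\<^sup>2 \<le> \<Lambda> + inverse (real (Suc k))" for k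
  proof -
    have "real (Suc k) \<ge> 0" "inverse (real (Suc k)) > 0" by simp_all
    then obtain u where "u \<in> V" "l2 M u = 1"
      "(l2 M (grad u))\<^sup>2 + real (Suc k) * (l2 \<sigma> u)\<^sup>2 \<le> eigenvalue_RD (real (Suc k)) \<Omega>0 \<Theta> + inverse (real (Suc k))"
      using robin_minimizing by blast
    then show ?thesis using le[of "Suc k"] by (intro exI[of _ u]) linarith
  qed
  then have "\<forall>k. \<exists>u. u \<in> V \<and> l2 M u = 1 \<and> (l2 M (grad u))\<^sup>2 + real (Suc k) * (l2 \<sigma> u)\<^sup>2 \<le> \<Lambda> + inverse (real (Suc k))" ..
  from choice[OF this] obtain u where u: "\<And>k. u k \<in> V" "\<And>k. l2 M (u k) = 1"
    "\<And>k. (l2 M (grad (u k)))\<^sup>2 + real (Suc k) * (l2 \<sigma> (u k))\<^sup>2 \<le> \<Lambda> + inverse (real (Suc k))" by blast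
  \<comment> \<open>One bound for three norms: the mass norm is 1, the other two are at most
    \<open>sqrt (\<Lambda> + 1)\<close>.\<close>
  define A where "A = sqrt (\<Lambda> + 1) + 1"
  have inv1: "inverse (real (Suc k)) \<le> 1" for k by (simp add: inverse_le_1_iff)
  have E: "(l2 M (grad (u k)))\<^sup>2 + real (Suc k) * (l2 \<sigma> (u k))\<^sup>2 \<le> \<Lambda> + 1" for k
    using u(3)[of k] inv1[of k] by linarith
  have a: "(l2 M (grad (u k)))\<^sup>2 \<le> \<Lambda> + 1" for k
  proof -
    have "0 \<le> real (Suc k) * (l2 \<sigma> (u k))\<^sup>2" by simp
    then show ?thesis using E[of k] by linarith
  qed
  have b: "(l2 \<sigma> (u k))\<^sup>2 \<le> (\<Lambda> + 1) * inverse (real (Suc k))" for k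
  proof -
    have "0 \<le> (l2 M (grad (u k)))\<^sup>2" by simp
    then have "real (Suc k) * (l2 \<sigma> (u k))\<^sup>2 \<le> \<Lambda> + 1" using E[of k] by linarith
    then show ?thesis by (simp add: field_simps)
  qed
  have b': "(l2 \<sigma> (u k))\<^sup>2 \<le> \<Lambda> + 1" for k
  proof -
    have "(\<Lambda> + 1) * inverse (real (Suc k)) \<le> (\<Lambda> + 1) * 1" using \<Lambda>0 by (intro mult_left_mono inv1) simp
    from order_trans[OF b[of k] this] show ?thesis by simp
  qed
  have sA: "sqrt (\<Lambda> + 1) \<ge> 0" using \<Lambda>0 by simp
  obtain r :: "nat \<Rightarrow> nat" where r: "strict_mono r"
    "\<forall>\<epsilon>>0. \<exists>N. \<forall>k\<ge>N. \<forall>l\<ge>N. l2 M (\<lambda>x. u (r k) x - u (r l) x) < \<epsilon>"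
  proof -
    have "l2 M (u k) \<le> A" "l2 M (grad (u k)) \<le> A" "l2 \<sigma> (u k) \<le> A" for k
      using u(2)[of k] sA real_le_rsqrt[OF a[of k]] real_le_rsqrt[OF b'[of k]] unfolding A_def by linarith+
    then show ?thesis using robin_compactness[of u A] u(1) that by blast
  qed
  define w where "w k = u (r k)" for k
  have rk: "k \<le> r k" for k by (rule seq_suble[OF r(1)])
  have invr: "inverse (real (Suc (r k))) \<le> inverse (real (Suc k))" for k
    using rk[of k] by (intro le_imp_inverse_le) auto
  have w: "w k \<in> V" "l2 M (w k) = 1" for k by (simp_all add: w_def u)
  \<comment> \<open>Since \<open>j \<le> k \<le> r k\<close>, the bound at parameter
    \<open>Suc (r k)\<close> implies the one at \<open>j\<close>; the subsequence thus keeps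
    quasi-minimality for all smaller parameters.\<close>
  have en: "(l2 M (grad (w k)))\<^sup>2 + real j * (l2 \<sigma> (w k))\<^sup>2 \<le> \<Lambda> + inverse (real (Suc k))" if "j \<le> k" for j k
  proof -
    have "real j * (l2 \<sigma> (w k))\<^sup>2 \<le> real (Suc (r k)) * (l2 \<sigma> (w k))\<^sup>2"
      using that rk[of k] by (intro mult_right_mono) auto
    then show ?thesis using u(3)[of "r k"] invr[of k] unfolding w_def by linarith
  qed
  have tr: "(\<lambda>k. l2 \<sigma> (w k)) \<longlonglongrightarrow> 0"
  proof (rule tendsto_sandwich[OF _ _ tendsto_const])
    show "\<forall>\<^sub>F k in sequentially. 0 \<le> l2 \<sigma> (w k)" by (simp add: l2_nonneg)
    show "\<forall>\<^sub>F k in sequentially. l2 \<sigma> (w k) \<le> sqrt ((\<Lambda> + 1) * inverse (real (Suc k)))"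
    proof (intro always_eventually allI real_le_rsqrt)
      fix k
      have "(\<Lambda> + 1) * inverse (real (Suc (r k))) \<le> (\<Lambda> + 1) * inverse (real (Suc k))"
        using \<Lambda>0 by (intro mult_left_mono invr) auto
      then show "(l2 \<sigma> (w k))\<^sup>2 \<le> (\<Lambda> + 1) * inverse (real (Suc k))" using b[of "r k"] unfolding w_def by linarith
    qed
    have "(\<lambda>k. sqrt ((\<Lambda> + 1) * inverse (real (Suc k)))) \<longlonglongrightarrow> sqrt ((\<Lambda> + 1) * 0)"
      by (intro tendsto_intros LIMSEQ_inverse_real_of_nat)
    then show "(\<lambda>k. sqrt ((\<Lambda> + 1) * inverse (real (Suc k)))) \<longlonglongrightarrow> 0" by simp
  qed
  have cau: "\<exists>N. \<forall>k\<ge>N. \<forall>l\<ge>N. l2 M (\<lambda>x. w k x - w l x) < \<epsilon>" if "\<epsilon> > 0" for \<epsilon>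
    using r(2) that by (simp add: w_def)
  have gcau: "\<exists>N. \<forall>k\<ge>N. \<forall>l\<ge>N. l2 M (\<lambda>x. grad (w k) x - grad (w l) x) < \<epsilon>" if "\<epsilon> > 0" for \<epsilon>
    by (rule robin_gradient_Cauchy[OF w en lim le cau that])
  show ?thesis
    by (rule dirichlet_le_of_gradient_Cauchy[OF w _ tr gcau \<Lambda>0]) (use en[of 0] in simp)
qed

text \<open>Monotonicity in \<open>\<beta>\<close> reduces the limit over the reals to integers:
  from below by comparison with one integer, from above by the Dirichlet bound valid for every
  \<open>\<beta> \<ge> 0\<close>.\<close>

lemma eigenvalue_RD_tendsto:
  "((\<lambda>\<beta>. eigenvalue_RD \<beta> \<Omega>0 \<Theta>) \<longlongrightarrow> eigenvalue_DD \<Omega>) at_top"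
proof -
  define D where "D = rayleigh_inf \<Omega>"
  define \<mu> where "\<mu> j = eigenvalue_RD (real j) \<Omega>0 \<Theta>" for j
  have inc: "incseq \<mu>" unfolding \<mu>_def by (intro incseq_SucI eigenvalue_RD_mono) auto
  have bd: "\<mu> j \<le> D" for j unfolding \<mu>_def D_def by (rule eigenvalue_RD_le_Dirichlet) simp
  obtain L where L: "\<mu> \<longlonglongrightarrow> L" "\<And>j. \<mu> j \<le> L"
    using incseq_convergent[OF inc, of D] bd by blast
  have "D \<le> L" unfolding D_def using L unfolding \<mu>_def[abs_def] by (rule dirichlet_le_limit)
  have "((\<lambda>\<beta>. eigenvalue_RD \<beta> \<Omega>0 \<Theta>) \<longlongrightarrow> D) at_top"
  proof (rule order_tendstoI)
    fix a assume "a < D"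
    then have "\<forall>\<^sub>F j in sequentially. a < \<mu> j" using L(1) \<open>D \<le> L\<close> by (intro order_tendstoD(1)[of \<mu> L]) auto
    then obtain j where j: "a < \<mu> j" by (auto simp: eventually_sequentially)
    show "\<forall>\<^sub>F \<beta> in at_top. a < eigenvalue_RD \<beta> \<Omega>0 \<Theta>"
      using eventually_ge_at_top[of "real j"]
    proof eventually_elim
      case (elim \<beta>)
      then show ?case using j eigenvalue_RD_mono[of "real j" \<beta>] by (simp add: \<mu>_def)
    qed
  next
    fix a assume a: "D < a"
    show "\<forall>\<^sub>F \<beta> in at_top. eigenvalue_RD \<beta> \<Omega>0 \<Theta> < a"
      using eventually_ge_at_top[of "0::real"]
    proof eventually_elim
      case (elim \<beta>)
      then show ?case using a eigenvalue_RD_le_Dirichlet[of \<beta>] by (simp add: D_def)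
    qed
  qed
  then show ?thesis
    using eigenvalue_DD_eq_rayleigh_inf[OF open\<Omega> bounded\<Omega> nonempty\<Omega>] by (simp add: D_def)
qed

end

theorem mainTheorem4:
  fixes \<Omega>0 \<Theta> \<Omega> :: "(real ^ 'n) set"
  assumes "CARD('n) \<ge> 2"
    and "open \<Omega>0" "bounded \<Omega>0" "connected \<Omega>0" "\<Omega>0 \<noteq> {}"
    and "lipschitz_boundary \<Omega>0"
    and "open \<Theta>" "bounded \<Theta>" "connected \<Theta>"
    and "closure \<Theta> \<subseteq> \<Omega>0"
    and "\<Omega> = \<Omega>0 - closure \<Theta>"
  shows "((\<lambda>\<beta>. eigenvalue_RD \<beta> \<Omega>0 \<Theta>) \<longlongrightarrow> eigenvalue_DD \<Omega>) at_top"
proof -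
  interpret R: robin_domain \<Omega>0 \<Theta>
    using assms by unfold_locales simp_all
  show ?thesis using R.eigenvalue_RD_tendsto unfolding R.\<Omega>_def assms(11) .
qed

end
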